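(* Let $\alpha,\beta>0$, let $\psi\in W$ or $\psi\in L^1(\mathbb R)\cap\widehat W$, and assume that $\mathcal G(\psi,\alpha,\beta)=(T_{\alpha k}M_{\beta\ell}\psi)_{k,\ell\in\mathbb Z}$ is a (Gabor) frame for $L^2(\mathbb R)$. For $\lambda\in[0,\frac{2\pi}\alpha)$ and $\ell\in\mathbb Z$ let $h_{\lambda,\ell}\in AP_2(\mathbb R)$ be the element whose Fourier coefficient at $\mu=\lambda+\frac{2\pi}\alpha p$ is $\widehat\psi(\lambda+\frac{2\pi}\alpha p-\beta\ell)$ for each $p\in\mathbb Z$, and whose Fourier coefficients at all other $\mu\in\mathbb R$ are $0$. Then there exist constants $A,B>0$ such that: (a) for every $f\in AP_2(\mathbb R)$, $$A\|f\|_{AP}^2\le\sum_{\ell\in\mathbb Z}\ \sum_{\lambda\in[0,\frac{2\pi}\alpha)}\big|(f,h_{\lambda,\ell})_{AP_2}\big|^2\le B\|f\|_{AP}^2;$$ (b) in the case $\psi\in W$, for every $f\in S^2$, $$A\|f\|_{AP}^2\le\sum_{\ell\in\mathbb Z}\big\|\big(\langle f,T_{\alpha k}M_{\beta\ell}\psi\rangle\big)_{k\in\mathbb Z}\big\|_{AP(\mathbb Z)}^2\le B\|f\|_{AP}^2.$$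
   Context: $AP(\mathbb R)$ is the space of Bohr almost periodic functions: continuous $f:\mathbb R\to\mathbb C$ such that for every $\epsilon>0$ there is $L>0$ such that every interval of length greater than $L$ contains $\tau$ with $\sup_t|f(t+\tau)-f(t)|\le\epsilon$. It carries the inner product $(f,g)_{AP}=\lim_{T\to\infty}\frac1{2T}\int_{-T}^Tf(t)\overline{g(t)}\,dt$, with norm $\|\cdot\|_{AP}$. $AP_2(\mathbb R)$ is the Hilbert space completion of $(AP(\mathbb R),\|\cdot\|_{AP})$, with inner product denoted $(\cdot,\cdot)_{AP_2}$ and norm still $\|\cdot\|_{AP}$; the functions $e_\lambda(t)=e^{i\lambda t}$, $\lambda\in\mathbb R$, form an orthonormal basis of it, and the $\mu$-Fourier coefficient of $f\in AP_2(\mathbb R)$ is $(f,e_\mu)_{AP_2}$. The Stepanov class $S^2$ is the closure of the trigonometric polynomials (finite linear combinations of the $e_\lambda$) in the space $W(L^2,L^\infty)$ of measurable $f$ with $\|f\|_{W(L^2,L^\infty)}=\sup_{t\in\mathbb R}\big(\int_t^{t+1}|f(s)|^2ds\big)^{1/2}<\infty$; one has continuous inclusions $AP(\mathbb R)\subset S^2\subset AP_2(\mathbb R)$. $AP(\mathbb Z)$ is the space of almost periodic sequences: complex sequences $(a_n)_{n\in\mathbb Z}$ such that for every $\epsilon>0$ there is $N\in\mathbb N$ such that any $N$ consecutive integers contain an integer $p$ with $\sup_n|a_{n+p}-a_n|\le\epsilon$. It carries the inner product $(a,b)_{AP(\mathbb Z)}=\lim_{p\to\infty}\frac1{2p}\sum_{n=-p}^pa_n\overline{b_n}$,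 with norm $\|\cdot\|_{AP(\mathbb Z)}$. For $f\in S^2$ and $\varphi\in W$, $(\langle f,T_{\alpha k}\varphi\rangle)_k\in AP(\mathbb Z)$. $W$ is the Wiener space of $\psi\in L^\infty(\mathbb R)$ with $\|\psi\|_W=\sum_{k\in\mathbb Z}\operatorname{ess\,sup}_{x\in[0,1]}|\psi(x-k)|<\infty$ (so $W\subset L^1(\mathbb R)$). $\widehat W$ is the set of Fourier transforms of elements of $W$; thus $\psi\in L^1(\mathbb R)\cap\widehat W$ means $\psi\in L^1(\mathbb R)$ and $\widehat\psi\in W$. $\widehat\psi(\lambda)=\int_{\mathbb R}\psi(t)e^{-i\lambda t}\,dt$, $T_x\psi(t)=\psi(t-x)$, $M_\omega\psi(t)=e^{i\omega t}\psi(t)$, $\langle f,g\rangle=\int_{\mathbb R}f(t)\overline{g(t)}\,dt$. Under the hypotheses on $\psi$ one has $\sup_\lambda\sum_p|\widehat\psi(\lambda+\frac{2\pi}\alpha p)|^2<\infty$, so the $h_{\lambda,\ell}$ are well defined. In the paper property (a) is expressed by saying that $\mathcal G(\psi,\alpha,\beta)$ is an AP-frame for $AP_2(\mathbb R)$. *)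

theory Defs
  imports "HOL-Analysis.Analysis" "HOL-Probability.Essential_Supremum"
begin

section \<open>Function spaces on the real line\<close>

text \<open>Elements of Lebesgue spaces are represented by functions rather than by classes modulo
  null sets; the integrals and essential suprema involved do not see null sets.\<close>

definition L1_fun :: "(real \<Rightarrow> complex) set" where
  "L1_fun = {f. integrable lebesgue f}"

definition L2_fun :: "(real \<Rightarrow> complex) set" where
  "L2_fun = {f. f \<in> borel_measurable lebesgue \<and> integrable lebesgue (\<lambda>t. (cmod (f t))\<^sup>2)}"

definition L2_nrm :: "(real \<Rightarrow> complex) \<Rightarrow> real" where
  "L2_nrm f = sqrt (LINT t|lebesgue. (cmod (f t))\<^sup>2)"

definition pairing :: "(real \<Rightarrow> complex) \<Rightarrow> (real \<Rightarrow> complex) \<Rightarrow> complex" where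
  "pairing f g = (LINT t|lebesgue. f t * cnj (g t))"

definition translate :: "real \<Rightarrow> (real \<Rightarrow> complex) \<Rightarrow> real \<Rightarrow> complex" where
  "translate x \<psi> = (\<lambda>t. \<psi> (t - x))"

definition modulate :: "real \<Rightarrow> (real \<Rightarrow> complex) \<Rightarrow> real \<Rightarrow> complex" where
  "modulate \<omega> \<psi> = (\<lambda>t. cis (\<omega> * t) * \<psi> t)"

definition fourier :: "(real \<Rightarrow> complex) \<Rightarrow> real \<Rightarrow> complex" where
  "fourier \<psi> \<xi> = (LINT t|lebesgue. \<psi> t * cis (- (\<xi> * t)))"

definition wiener_nrm :: "(real \<Rightarrow> complex) \<Rightarrow> ennreal" where
  "wiener_nrm \<psi> = (\<Sum>\<^sub>\<infinity>k\<in>(UNIV :: int set).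
     esssup (restrict_space lebesgue {0..1}) (\<lambda>x. ennreal (cmod (\<psi> (x - of_int k)))))"

definition wiener_space :: "(real \<Rightarrow> complex) set" where
  "wiener_space = {\<psi>. \<psi> \<in> borel_measurable lebesgue \<and>
     esssup lebesgue (\<lambda>x. ennreal (cmod (\<psi> x))) < \<infinity> \<and> wiener_nrm \<psi> < \<infinity>}"

text \<open>Frame sums have nonnegative terms and are taken in \<^typ>\<open>ennreal\<close>, where every such sum
  exists; the upper frame bound then expresses convergence.\<close>

definition L2_frame :: "('i \<Rightarrow> real \<Rightarrow> complex) \<Rightarrow> bool" where
  "L2_frame g \<longleftrightarrow> (\<forall>i. g i \<in> L2_fun) \<and>
     (\<exists>A>0. \<exists>B>0. \<forall>f\<in>L2_fun.
        ennreal (A * (L2_nrm f)\<^sup>2) \<le> (\<Sum>\<^sub>\<infinity>i\<in>UNIV. ennreal ((cmod (pairing f (g i)))\<^sup>2)) \<and>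
        (\<Sum>\<^sub>\<infinity>i\<in>UNIV. ennreal ((cmod (pairing f (g i)))\<^sup>2)) \<le> ennreal (B * (L2_nrm f)\<^sup>2))"

definition gabor :: "(real \<Rightarrow> complex) \<Rightarrow> real \<Rightarrow> real \<Rightarrow> int \<times> int \<Rightarrow> real \<Rightarrow> complex" where
  "gabor \<psi> \<alpha> \<beta> = (\<lambda>(k, l). translate (\<alpha> * of_int k) (modulate (\<beta> * of_int l) \<psi>))"


section \<open>Bohr almost periodic functions\<close>

definition AP :: "(real \<Rightarrow> complex) set" where
  "AP = {f. continuous_on UNIV f \<and>
     (\<forall>\<epsilon>>0. \<exists>L>0. \<forall>a b. b - a > L \<longrightarrow> (\<exists>\<tau>\<in>{a<..<b}. \<forall>t. cmod (f (t + \<tau>) - f t) \<le> \<epsilon>))}"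

definition AP_inner :: "(real \<Rightarrow> complex) \<Rightarrow> (real \<Rightarrow> complex) \<Rightarrow> complex" where
  "AP_inner f g =
     Lim at_top (\<lambda>T::real. (LINT t:{-T..T}|lebesgue. f t * cnj (g t)) / of_real (2 * T))"

definition AP_nrm :: "(real \<Rightarrow> complex) \<Rightarrow> real" where
  "AP_nrm f = sqrt (Re (AP_inner f f))"

definition e_fun :: "real \<Rightarrow> real \<Rightarrow> complex" where
  "e_fun \<xi> = (\<lambda>t. cis (\<xi> * t))"


section \<open>The completion of the almost periodic functions\<close>

text \<open>The completion is the set of classes of Cauchy sequences modulo null sequences.\<close>

definition AP_Cauchy :: "(nat \<Rightarrow> real \<Rightarrow> complex) set" where
  "AP_Cauchy = {u. (\<forall>n. u n \<in> AP) \<and>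
     (\<forall>\<epsilon>>0. \<exists>N. \<forall>m\<ge>N. \<forall>n\<ge>N. AP_nrm (\<lambda>t. u m t - u n t) < \<epsilon>)}"

definition AP_null_rel :: "((nat \<Rightarrow> real \<Rightarrow> complex) \<times> (nat \<Rightarrow> real \<Rightarrow> complex)) set" where
  "AP_null_rel = {(u, v). u \<in> AP_Cauchy \<and> v \<in> AP_Cauchy \<and>
     (\<lambda>n. AP_nrm (\<lambda>t. u n t - v n t)) \<longlonglongrightarrow> 0}"

type_synonym ap2 = "(nat \<Rightarrow> real \<Rightarrow> complex) set"

definition AP2 :: "ap2 set" where
  "AP2 = AP_Cauchy // AP_null_rel"

definition AP2_inner :: "ap2 \<Rightarrow> ap2 \<Rightarrow> complex" where
  "AP2_inner F G = (THE z. \<forall>u\<in>F. \<forall>v\<in>G. (\<lambda>n. AP_inner (u n) (v n)) \<longlonglongrightarrow> z)"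

definition AP2_nrm :: "ap2 \<Rightarrow> real" where
  "AP2_nrm F = sqrt (Re (AP2_inner F F))"

definition AP2_of_AP :: "(real \<Rightarrow> complex) \<Rightarrow> ap2" where
  "AP2_of_AP f = AP_null_rel `` {\<lambda>_. f}"

definition AP2_coeff :: "ap2 \<Rightarrow> real \<Rightarrow> complex" where
  "AP2_coeff F \<mu> = AP2_inner F (AP2_of_AP (e_fun \<mu>))"

definition AP2_with_coeffs :: "(real \<Rightarrow> complex) \<Rightarrow> ap2" where
  "AP2_with_coeffs c = (THE F. F \<in> AP2 \<and> (\<forall>\<mu>. AP2_coeff F \<mu> = c \<mu>))"

definition gabor_AP :: "(real \<Rightarrow> complex) \<Rightarrow> real \<Rightarrow> real \<Rightarrow> real \<Rightarrow> int \<Rightarrow> ap2" where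
  "gabor_AP \<psi> \<alpha> \<beta> \<xi> l = AP2_with_coeffs
     (\<lambda>\<mu>. if \<exists>p::int. \<mu> = \<xi> + 2 * pi / \<alpha> * of_int p then fourier \<psi> (\<mu> - \<beta> * of_int l) else 0)"


section \<open>The Stepanov class\<close>

definition amalgam :: "(real \<Rightarrow> complex) set" where
  "amalgam = {f. f \<in> borel_measurable lebesgue \<and>
     (\<forall>t. set_integrable lebesgue {t..t+1} (\<lambda>s. (cmod (f s))\<^sup>2)) \<and>
     bdd_above (range (\<lambda>t. sqrt (LINT s:{t..t+1}|lebesgue. (cmod (f s))\<^sup>2)))}"

definition amalgam_nrm :: "(real \<Rightarrow> complex) \<Rightarrow> real" where
  "amalgam_nrm f = (SUP t. sqrt (LINT s:{t..t+1}|lebesgue. (cmod (f s))\<^sup>2))"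

definition trig_poly :: "(real \<Rightarrow> complex) set" where
  "trig_poly = {p. \<exists>M c. finite M \<and> p = (\<lambda>t. \<Sum>\<mu>\<in>M. c \<mu> * e_fun \<mu> t)}"

definition S2 :: "(real \<Rightarrow> complex) set" where
  "S2 = {f \<in> amalgam. \<forall>\<epsilon>>0. \<exists>p\<in>trig_poly. amalgam_nrm (\<lambda>t. f t - p t) < \<epsilon>}"

text \<open>The inclusion of the Stepanov class into the completion is the continuous extension of
  \<^const>\<open>AP2_of_AP\<close>: \<open>f\<close> is identified with the one class containing every sequence in \<^const>\<open>AP\<close>
  that converges to \<open>f\<close> in the amalgam norm.\<close>

definition AP2_of_S2 :: "(real \<Rightarrow> complex) \<Rightarrow> ap2" where
  "AP2_of_S2 f = (THE F. F \<in> AP2 \<and>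
     (\<forall>u. (\<forall>n. u n \<in> AP) \<and> (\<lambda>n. amalgam_nrm (\<lambda>t. f t - u n t)) \<longlonglongrightarrow> 0 \<longrightarrow> u \<in> F))"


section \<open>Almost periodic sequences\<close>

definition AP_seq :: "(int \<Rightarrow> complex) set" where
  "AP_seq = {a. \<forall>\<epsilon>>0. \<exists>N::nat. \<forall>m::int. \<exists>p\<in>{m..<m + int N}. \<forall>n. cmod (a (n + p) - a n) \<le> \<epsilon>}"

text \<open>This inner product is meaningful for elements of \<^const>\<open>AP_seq\<close>, where the limit exists.\<close>

definition AP_seq_inner :: "(int \<Rightarrow> complex) \<Rightarrow> (int \<Rightarrow> complex) \<Rightarrow> complex" where
  "AP_seq_inner a b = lim (\<lambda>p::nat. (\<Sum>n=-int p..int p. a n * cnj (b n)) / of_nat (2 * p))"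

definition AP_seq_nrm :: "(int \<Rightarrow> complex) \<Rightarrow> real" where
  "AP_seq_nrm a = sqrt (Re (AP_seq_inner a a))"

end

theory Submission
  imports Defs "HOL-Probability.Sinc_Integral" "HOL-Real_Asymp.Real_Asymp"
begin

text \<open>
  Almost periodic sequences, and hence \<open>AP\<close> functions, are uniform limits of trigonometric
  polynomials: averaging over differences of almost periods is a convolution on a large cyclic group,
  whose Fourier multiplier is small except at boundedly many frequencies, and compactness of the
  remaining parameters yields one polynomial on all of \<open>\<int>\<close>. So it suffices to prove both frame
  inequalities for trigonometric polynomials \<open>p\<close>, with constants independent of \<open>p\<close>.

  To this end the \<open>L\<^sup>2\<close> frame inequality is applied to \<open>p(t) w(\<epsilon> t)\<close>, where \<open>w\<close> is the Fourier
  transform of a bump supported in \<open>[0, 1]\<close>. For small \<open>\<epsilon>\<close> the bumps at different frequencies of \<open>p\<close>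
  are disjoint modulo \<open>T = 2 \<pi> / \<alpha>\<close> unless the frequencies are congruent modulo \<open>T\<close>.
  Parseval's identity on the circle therefore turns the sum over \<open>k\<close> of the squared Gabor
  coefficients into a sum over residue classes modulo \<open>T\<close>, one for each fibre of coefficients of \<open>p\<close>,
  and after rescaling the limit \<open>\<epsilon> \<rightarrow> 0\<close> gives the sum of \<open>\<bar>(p, h\<^sub>\<lambda>\<^sub>,\<^sub>l)\<bar>\<^sup>2\<close>. Exchanging this limit with
  the sum over \<open>l\<close> is where \<open>\<psi>\<close> or its Fourier transform being in the Wiener space enters: it makes
  the translates of the transform of \<open>\<psi>\<close> by multiples of \<open>\<beta>\<close> continuous in \<open>\<ell>\<^sup>2\<close>. For a sequence
  \<open>\<Sum>\<^sub>r D\<^sub>r e\<^bsup>i r \<alpha> k\<^esup>\<close> with distinct \<open>r\<close> in \<open>[0, T)\<close>, the \<open>AP(\<int>)\<close> norm squared is \<open>\<Sum>\<^sub>r \<bar>D\<^sub>r\<bar>\<^sup>2\<close>, which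
  links (b) to (a).
\<close>

section \<open>Approximation of almost periodic sequences\<close>

text \<open>A nonzero p is not square integrable, and the window that repairs this smears each
  frequency \<mu> over [\<mu>, \<mu> + \<epsilon>]. The bump sits on [0, 1] rather than around 0 so
  that a residue r in [0, T) is only moved upwards and stays below T once \<epsilon> is small; a
  symmetric bump would wrap around at r = 0. The two bounds behave differently as \<epsilon> tends
  to 0: for the upper one it suffices to treat finitely many l at a time, whereas for the lower one
  mass could escape to large l, and the l2 continuity, uniform over all finite sets of l, excludes
  this. The upper bound has a second use: tested on coefficients copied from the transform of \<psi>
  it shows that the coefficients of \<open>gabor_AP\<close> are square summable, so that this
  element exists. Since only the existence of constants is claimed, triangle inequalities in l2 are
  replaced by |a|^2 \<le> 2 |b|^2 + 2 |a - b|^2. This loses factors of 2 in the passages to limits,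
  which explains the final constants.\<close>

lemma sum_roots_of_unity:
  fixes y :: int and P :: nat
  assumes "P > 0"
  shows "(\<Sum>k<P. cis (2 * pi * real k * of_int y / real P)) = (if int P dvd y then of_nat P else 0)"
proof -
  define z where "z = cis (2 * pi * of_int y / real P)"
  have zk: "cis (2 * pi * real k * of_int y / real P) = z ^ k" for k
    unfolding z_def Complex.DeMoivre by (simp add: mult_ac)
  have zP: "z ^ P = 1"
  proof -
    have "2 * pi * real P * of_int y / real P = 2 * pi * of_int y" using assms by simp
    then show ?thesis using zk[of P] by (simp add: cis_multiple_2pi)
  qed
  show ?thesis
  proof (cases "int P dvd y")
    case True
    then obtain q where q: "y = int P * q" by auto
    have "2 * pi * of_int y / real P = 2 * pi * of_int q"
      using assms by (simp add: q field_simps)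
    hence "z = 1" unfolding z_def by (simp add: cis_multiple_2pi)
    then show ?thesis using True by (simp add: zk)
  next
    case False
    have "z \<noteq> 1"
    proof
      assume "z = 1"
      then obtain q :: int where "2 * pi * of_int y / real P = of_int q * 2 * pi"
        unfolding z_def by (auto simp: complex_eq_iff cos_one_2pi_int)
      hence "real_of_int y = of_int (int P * q)"
        using assms by (simp add: field_simps)
      hence "y = int P * q" by linarith
      with False show False by simp
    qed
    then show ?thesis using False zP by (simp add: zk geometric_sum)
  qed
qed

text \<open>Orthogonality of the characters of the cyclic group of order P. Asking only for pairwise
  incongruent indices lets the same identity serve a full period \<open>Y\<close> and the sparse set
  \<open>S\<close> of almost periods.\<close>

lemma dft_parseval:
  fixes b :: "int \<Rightarrow> complex" and P :: nat
  assumes P: "P > 0" and Y: "finite Y"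
    and inj: "\<And>y z. y \<in> Y \<Longrightarrow> z \<in> Y \<Longrightarrow> int P dvd y - z \<Longrightarrow> y = z"
  shows "(\<Sum>k<P. (cmod (\<Sum>y\<in>Y. b y * cis (2 * pi * real k * of_int y / real P)))\<^sup>2)
           = real P * (\<Sum>y\<in>Y. (cmod (b y))\<^sup>2)"
proof -
  define e where "e = (\<lambda>k (y::int). cis (2 * pi * real k * of_int y / real P))"
  have e: "e k y * cnj (e k z) = e k (y - z)" for k y z
    by (simp add: e_def cis_cnj cis_mult diff_divide_distrib algebra_simps)
  have "complex_of_real (\<Sum>k<P. (cmod (\<Sum>y\<in>Y. b y * e k y))\<^sup>2)
      = (\<Sum>k<P. (\<Sum>y\<in>Y. b y * e k y) * cnj (\<Sum>z\<in>Y. b z * e k z))"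
    by (simp only: of_real_sum complex_norm_square)
  also have "\<dots> = (\<Sum>k<P. \<Sum>y\<in>Y. \<Sum>z\<in>Y. b y * cnj (b z) * e k (y - z))"
    by (simp add: sum_product e[symmetric] mult_ac)
  also have "\<dots> = (\<Sum>y\<in>Y. \<Sum>z\<in>Y. \<Sum>k<P. b y * cnj (b z) * e k (y - z))"
    by (subst sum.swap, rule sum.cong[OF refl], subst sum.swap, rule refl)
  also have "\<dots> = (\<Sum>y\<in>Y. \<Sum>z\<in>Y. b y * cnj (b z) * (if y = z then of_nat P else 0))"
  proof (intro sum.cong refl)
    fix y z assume "y \<in> Y" "z \<in> Y"
    then have "(int P dvd y - z) = (y = z)" using inj by auto
    then show "(\<Sum>k<P. b y * cnj (b z) * e k (y - z)) = b y * cnj (b z) * (if y = z then of_nat P else 0)"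
      by (simp only: sum_distrib_left[symmetric] sum_roots_of_unity[OF P] e_def)
  qed
  also have "\<dots> = (\<Sum>y\<in>Y. of_nat P * of_real ((cmod (b y))\<^sup>2))"
    by (intro sum.cong refl) (simp add: Y if_distrib[where f="(*) _"] sum.delta' sum.delta complex_norm_square mult_ac cong: if_cong del: of_real_power)
  also have "\<dots> = complex_of_real (real P * (\<Sum>y\<in>Y. (cmod (b y))\<^sup>2))"
    by (simp add: sum_distrib_left)
  finally show ?thesis by (simp only: of_real_eq_iff e_def)
qed

lemma sum_mult_le_sqrt:
  fixes a b :: "'a \<Rightarrow> real"
  assumes "(\<Sum>i\<in>I. (a i)\<^sup>2) \<le> A\<^sup>2" "(\<Sum>i\<in>I. (b i)\<^sup>2) \<le> B\<^sup>2" "0 \<le> A" "0 \<le> B"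
  shows "(\<Sum>i\<in>I. a i * b i) \<le> A * B"
proof -
  have "(\<Sum>i\<in>I. a i * b i)\<^sup>2 \<le> (\<Sum>i\<in>I. (a i)\<^sup>2) * (\<Sum>i\<in>I. (b i)\<^sup>2)"
    by (rule Cauchy_Schwarz_ineq_sum)
  also have "\<dots> \<le> A\<^sup>2 * B\<^sup>2"
    using assms by (intro mult_mono sum_nonneg) auto
  finally show ?thesis
    by (metis assms(3,4) abs_le_square_iff abs_of_nonneg mult_nonneg_nonneg power_mult_distrib abs_le_iff)
qed

lemma cmod_sum_cis_le:
  assumes "finite S" "S \<noteq> {}"
  shows "cmod ((\<Sum>s\<in>S. cis (f s)) / of_nat (card S)) \<le> 1"
proof -
  have "cmod (\<Sum>s\<in>S. cis (f s)) \<le> (\<Sum>s\<in>S. 1)"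
    by (rule sum_norm_le) simp
  moreover have "card S > 0" using assms by (simp add: card_gt_0_iff)
  ultimately show ?thesis by (simp add: norm_divide)
qed

text \<open>The averages of \<open>a\<close> over differences of almost periods form a convolution on a cyclic group
  whose multiplier \<open>(cmod (g k))\<^sup>2\<close> exceeds \<open>\<delta>\<^sup>2\<close> only at boundedly many frequencies.\<close>

lemma bohr_int_local:
  fixes a :: "int \<Rightarrow> complex" and m N :: nat
  assumes K: "\<And>n. cmod (a n) \<le> K" and mN: "m > 0" "N > 0" and "\<delta> > 0"
    and S: "\<And>p n. p \<in> S \<Longrightarrow> cmod (a (n + p) - a n) \<le> \<epsilon>" "S \<subseteq> {0..<int (m * N)}" "card S \<ge> m"
    and r: "4 * real N / \<delta>\<^sup>2 \<le> real r"
  shows "\<exists>c \<theta>. (\<forall>j<r. cmod (c j) \<le> K \<and> \<bar>\<theta> j\<bar> \<le> 2 * pi) \<and>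
     (\<forall>x. \<bar>x\<bar> \<le> int (m * N) \<longrightarrow> cmod (a x - (\<Sum>j<r. c j * cis (\<theta> j * of_int x))) \<le> 2 * \<epsilon> + \<delta> * K * sqrt (4 * real N))"
proof -
  define T where "T = m * N"
  \<comment> \<open>The order is 4 T because x + s - t with |x| \<le> T and s, t in [0, T) lies in
    [-2T, 2T): where the approximation is claimed, the cyclic convolution has no wraparound.\<close>
  define P where "P = 4 * T"
  have T0: "T > 0" using mN by (simp add: T_def)
  have P0: "P > 0" using T0 by (simp add: P_def)
  have K0: "K \<ge> 0" using K[of 0] norm_ge_zero order_trans by blast
  define e where "e = (\<lambda>(k::nat) (y::int). cis (2 * pi * real k * of_int y / real P))"
  have e_mult: "e k y * e k z = e k (y + z)" for k y z
    by (simp add: e_def cis_mult distrib_left add_divide_distrib)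
  have e_cnj: "cnj (e k y) = e k (- y)" for k y
    by (simp add: e_def cis_cnj)
  have e_norm: "cmod (e k y) = 1" for k y by (simp add: e_def)
  define Y where "Y = {- int (2 * T)..<int (2 * T)}"
  have finY: "finite Y" and cardY: "card Y = P" by (auto simp: Y_def P_def)
  have injY: "y = z" if "y \<in> Y" "z \<in> Y" "int P dvd y - z" for y z
  proof -
    have "\<bar>y - z\<bar> < int P" using that by (auto simp: Y_def P_def)
    moreover have "\<bar>int P\<bar> \<le> \<bar>y - z\<bar>" if "y \<noteq> z"
      using dvd_imp_le_int[OF _ \<open>int P dvd y - z\<close>] that by simp
    ultimately show ?thesis by force
  qed
  have finS: "finite S" using S(2) finite_subset by blast
  have cS: "card S > 0" using S(3) mN by simp
  have Sne: "S \<noteq> {}" using cS by auto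
  have SY: "S \<subseteq> Y" using S(2) by (auto simp: Y_def T_def)
  define Fh where "Fh = (\<lambda>k. (\<Sum>y\<in>Y. a y * e k (- y)) / of_nat P)"
  define g where "g = (\<lambda>k. (\<Sum>s\<in>S. e k s) / of_nat (card S))"
  have inv: "(\<Sum>k<P. Fh k * e k x) = a x" if "x \<in> Y" for x
  proof -
    have "(\<Sum>k<P. Fh k * e k x) = (\<Sum>k<P. \<Sum>y\<in>Y. a y * e k (x - y)) / of_nat P"
      by (simp add: Fh_def sum_divide_distrib[symmetric] sum_distrib_right mult.assoc e_mult)
    also have "(\<Sum>k<P. \<Sum>y\<in>Y. a y * e k (x - y)) = (\<Sum>y\<in>Y. a y * (\<Sum>k<P. e k (x - y)))"
      by (subst sum.swap) (simp add: sum_distrib_left)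
    also have "\<dots> = (\<Sum>y\<in>Y. a y * (if x = y then of_nat P else 0))"
    proof (intro sum.cong refl)
      fix y assume "y \<in> Y"
      then have "(int P dvd x - y) = (x = y)" using injY that by auto
      then show "a y * (\<Sum>k<P. e k (x - y)) = a y * (if x = y then of_nat P else 0)"
        by (simp only: e_def sum_roots_of_unity[OF P0])
    qed
    also have "\<dots> = a x * of_nat P"
      using that by (simp add: finY if_distrib[where f="(*) _"] sum.delta' sum.delta cong: if_cong)
    finally show ?thesis using P0 by simp
  qed
  have parsF: "(\<Sum>k<P. (cmod (Fh k))\<^sup>2) \<le> K\<^sup>2"
  proof -
    have "cmod (Fh k) = cmod (\<Sum>y\<in>Y. cnj (a y) * e k y) / real P" for k
    proof -
      have "cnj (\<Sum>y\<in>Y. cnj (a y) * e k y) = (\<Sum>y\<in>Y. a y * e k (- y))"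
        by (simp add: e_cnj)
      then show ?thesis unfolding Fh_def norm_divide by (metis complex_mod_cnj norm_of_nat)
    qed
    then have "(\<Sum>k<P. (cmod (Fh k))\<^sup>2) = (\<Sum>k<P. (cmod (\<Sum>y\<in>Y. cnj (a y) * e k y))\<^sup>2) / (real P)\<^sup>2"
      by (simp add: power_divide sum_divide_distrib[symmetric])
    also have "\<dots> = (real P * (\<Sum>y\<in>Y. (cmod (cnj (a y)))\<^sup>2)) / (real P)\<^sup>2"
      unfolding e_def by (subst dft_parseval[OF P0 finY injY]) auto
    also have "\<dots> \<le> (real P * (\<Sum>y\<in>Y. K\<^sup>2)) / (real P)\<^sup>2"
      by (intro divide_right_mono mult_left_mono sum_mono power_mono) (auto simp: K)
    also have "\<dots> = K\<^sup>2" using P0 by (simp add: cardY power2_eq_square)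
    finally show ?thesis .
  qed
  \<comment> \<open>\<open>S\<close> has at least m elements among 4 m N residues, so the bound P /
    card S \<le> 4 N does not depend on m. Hence neither does the bound on the number of frequencies
    with a large multiplier.\<close>
  have parsg: "(\<Sum>k<P. (cmod (g k))\<^sup>2) \<le> 4 * real N"
  proof -
    have "(\<Sum>k<P. (cmod (g k))\<^sup>2) = (\<Sum>k<P. (cmod (\<Sum>s\<in>S. 1 * e k s))\<^sup>2) / (real (card S))\<^sup>2"
      by (simp add: g_def norm_divide power_divide sum_divide_distrib[symmetric])
    also have "\<dots> = (real P * (\<Sum>s\<in>S. (cmod 1)\<^sup>2)) / (real (card S))\<^sup>2"
      unfolding e_def using injY SY by (subst dft_parseval[OF P0 finS]) (auto simp del: norm_one)
    also have "\<dots> = real P / real (card S)" using cS by (simp add: power2_eq_square)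
    also have "\<dots> \<le> real P / real m" using S(3) mN by (intro divide_left_mono) auto
    also have "\<dots> = 4 * real N" using mN by (simp add: P_def T_def)
    finally show ?thesis .
  qed
  have g1: "cmod (g k) \<le> 1" for k
    unfolding g_def e_def by (rule cmod_sum_cis_le[OF finS Sne])
  have avg: "(\<Sum>s\<in>S. \<Sum>t\<in>S. a (x + s - t)) = (of_nat (card S))\<^sup>2 * (\<Sum>k<P. Fh k * of_real ((cmod (g k))\<^sup>2) * e k x)"
    if "\<bar>x\<bar> \<le> int T" for x
  proof -
    have "(\<Sum>s\<in>S. \<Sum>t\<in>S. a (x + s - t)) = (\<Sum>s\<in>S. \<Sum>t\<in>S. \<Sum>k<P. Fh k * e k (x + s - t))"
    proof (intro sum.cong refl inv[symmetric])
      fix s t assume "s \<in> S" "t \<in> S"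
      then have "s \<in> {0..<int T}" "t \<in> {0..<int T}" using S(2) T_def by auto
      then show "x + s - t \<in> Y" using that by (auto simp: Y_def)
    qed
    also have "\<dots> = (\<Sum>k<P. \<Sum>s\<in>S. \<Sum>t\<in>S. Fh k * e k (x + s - t))"
      by (rule trans[OF sum.cong[OF refl sum.swap] sum.swap])
    also have "\<dots> = (\<Sum>k<P. Fh k * e k x * ((\<Sum>s\<in>S. e k s) * cnj (\<Sum>t\<in>S. e k t)))"
    proof (intro sum.cong refl)
      fix k
      have "e k (x + s - t) = e k x * (e k s * cnj (e k t))" for s t
        by (simp add: e_cnj e_mult add_diff_eq)
      then show "(\<Sum>s\<in>S. \<Sum>t\<in>S. Fh k * e k (x + s - t)) = Fh k * e k x * ((\<Sum>s\<in>S. e k s) * cnj (\<Sum>t\<in>S. e k t))"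
        by (simp only: cnj_sum sum_product) (simp add: sum_distrib_left mult.assoc)
    qed
    also have "\<dots> = (\<Sum>k<P. (of_nat (card S))\<^sup>2 * (Fh k * of_real ((cmod (g k))\<^sup>2) * e k x))"
    proof (intro sum.cong refl)
      fix k
      have "(\<Sum>s\<in>S. e k s) = of_nat (card S) * g k" using cS by (simp add: g_def)
      then have "(\<Sum>s\<in>S. e k s) * cnj (\<Sum>t\<in>S. e k t) = (of_nat (card S))\<^sup>2 * of_real ((cmod (g k))\<^sup>2)"
        by (simp add: power2_eq_square[of "of_nat (card S)"] complex_norm_square[symmetric] mult_ac del: of_real_power cnj_sum)
      then show "Fh k * e k x * ((\<Sum>s\<in>S. e k s) * cnj (\<Sum>t\<in>S. e k t)) = (of_nat (card S))\<^sup>2 * (Fh k * of_real ((cmod (g k))\<^sup>2) * e k x)"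
        by (simp only: mult_ac)
    qed
    finally show ?thesis by (simp add: sum_distrib_left)
  qed
  \<comment> \<open>Seen from x - t, both a x and a (x + s - t) are translates by an almost period,
    namely by t and by s; each differs from a (x - t) by at most \<epsilon>.\<close>
  have close: "cmod (a x - (\<Sum>k<P. Fh k * of_real ((cmod (g k))\<^sup>2) * e k x)) \<le> 2 * \<epsilon>" (is "cmod (a x - ?R) \<le> _")
    if "\<bar>x\<bar> \<le> int T" for x
  proof -
    have "(of_nat (card S))\<^sup>2 * (a x - ?R) = (\<Sum>s\<in>S. \<Sum>t\<in>S. a x - a (x + s - t))"
      using avg[OF that] by (simp add: sum_subtractf power2_eq_square algebra_simps)
    also have "cmod \<dots> \<le> (\<Sum>s\<in>S. \<Sum>t\<in>S. 2 * \<epsilon>)"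
    proof (intro sum_norm_le)
      fix s t assume st: "s \<in> S" "t \<in> S"
      have "a x - a (x + s - t) = (a ((x - t) + t) - a (x - t)) - (a ((x - t) + s) - a (x - t))"
        by (simp add: algebra_simps)
      also have "cmod \<dots> \<le> \<epsilon> + \<epsilon>"
        by (intro order_trans[OF norm_triangle_ineq4] add_mono S(1) st)
      finally show "cmod (a x - a (x + s - t)) \<le> 2 * \<epsilon>" by simp
    qed
    finally have "(real (card S))\<^sup>2 * cmod (a x - ?R) \<le> (real (card S))\<^sup>2 * (2 * \<epsilon>)"
      by (simp add: norm_mult norm_power power2_eq_square)
    then show ?thesis using cS by simp
  qed
  \<comment> \<open>Chebyshev's inequality applied to \<open>parsg\<close> bounds the number of
    these frequencies by 4 N / \<delta>^2.\<close>
  define B where "B = {k \<in> {..<P}. cmod (g k) \<ge> \<delta>}"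
  have finB: "finite B" by (simp add: B_def)
  have "\<delta>\<^sup>2 * real (card B) = (\<Sum>k\<in>B. \<delta>\<^sup>2)" by simp
  also have "\<dots> \<le> (\<Sum>k\<in>B. (cmod (g k))\<^sup>2)"
    using \<open>\<delta> > 0\<close> by (intro sum_mono power_mono) (auto simp: B_def)
  also have "\<dots> \<le> (\<Sum>k<P. (cmod (g k))\<^sup>2)"
    by (intro sum_mono2) (auto simp: B_def)
  finally have "\<delta>\<^sup>2 * real (card B) \<le> 4 * real N" using parsg by simp
  then have "real (card B) \<le> 4 * real N / \<delta>\<^sup>2"
    using \<open>\<delta> > 0\<close> by (simp add: field_simps)
  then have cB: "card B \<le> r" using r by linarith
  obtain \<phi> where \<phi>: "bij_betw \<phi> {..<card B} B"
    using ex_bij_betw_nat_finite[OF finB] by (auto simp: atLeast0LessThan)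
  \<comment> \<open>Coefficients are padded with zeros to exactly r terms, so that the number of
    parameters is the same for every m and compactness applies to them later.\<close>
  define c where "c = (\<lambda>j. if j < card B then Fh (\<phi> j) * of_real ((cmod (g (\<phi> j)))\<^sup>2) else 0)"
  define \<theta> where "\<theta> = (\<lambda>j. if j < card B then 2 * pi * real (\<phi> j) / real P else 0)"
  have sumc: "(\<Sum>j<r. c j * cis (\<theta> j * of_int x)) = (\<Sum>k\<in>B. Fh k * of_real ((cmod (g k))\<^sup>2) * e k x)" for x
  proof -
    have "(\<Sum>j<r. c j * cis (\<theta> j * of_int x)) = (\<Sum>j<card B. c j * cis (\<theta> j * of_int x))"
      using cB by (intro sum.mono_neutral_right) (auto simp: c_def)
    also have "\<dots> = (\<Sum>j<card B. (\<lambda>k. Fh k * of_real ((cmod (g k))\<^sup>2) * e k x) (\<phi> j))"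
      by (intro sum.cong refl) (simp add: c_def \<theta>_def e_def)
    also have "\<dots> = (\<Sum>k\<in>B. Fh k * of_real ((cmod (g k))\<^sup>2) * e k x)"
      by (rule sum.reindex_bij_betw[OF \<phi>])
    finally show ?thesis .
  qed
  have cb: "cmod (c j) \<le> K" for j
  proof (cases "j < card B")
    case True
    then have "\<phi> j \<in> {..<P}" using \<phi> by (auto simp: bij_betw_def B_def)
    then have "(cmod (Fh (\<phi> j)))\<^sup>2 \<le> K\<^sup>2"
      using parsF by (meson finite_lessThan order_trans member_le_sum zero_le_power2)
    then have "cmod (Fh (\<phi> j)) \<le> K" using K0 by (simp add: power2_le_iff_abs_le)
    moreover have "(cmod (g (\<phi> j)))\<^sup>2 \<le> 1" using g1 by (simp add: power_le_one)
    ultimately have "cmod (Fh (\<phi> j)) * (cmod (g (\<phi> j)))\<^sup>2 \<le> K * 1"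
      using K0 by (intro mult_mono) auto
    then show ?thesis using True by (simp add: c_def norm_mult norm_power)
  qed (simp add: c_def K0)
  have tb: "\<bar>\<theta> j\<bar> \<le> 2 * pi" for j
  proof (cases "j < card B")
    case True
    then have "\<phi> j < P" using \<phi> by (auto simp: bij_betw_def B_def)
    then show ?thesis using P0 by (simp add: \<theta>_def field_simps)
  qed (simp add: \<theta>_def)
  \<comment> \<open>On the discarded frequencies one factor |g k| is at most \<delta>;
    Cauchy-Schwarz pairs the other one with |Fh k|, using \<open>parsF\<close> and
    \<open>parsg\<close>.\<close>
  have "cmod (a x - (\<Sum>j<r. c j * cis (\<theta> j * of_int x))) \<le> 2 * \<epsilon> + \<delta> * K * sqrt (4 * real N)"
    if "\<bar>x\<bar> \<le> int T" for x
  proof -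
    let ?t = "\<lambda>k. Fh k * of_real ((cmod (g k))\<^sup>2) * e k x"
    have "(\<Sum>k<P. ?t k) = (\<Sum>k\<in>B. ?t k) + (\<Sum>k\<in>{..<P} - B. ?t k)"
      by (subst add.commute, rule sum.subset_diff) (auto simp: B_def)
    then have "a x - (\<Sum>k\<in>B. ?t k) = (a x - (\<Sum>k<P. ?t k)) + (\<Sum>k\<in>{..<P} - B. ?t k)"
      by simp
    also have "cmod \<dots> \<le> 2 * \<epsilon> + (\<Sum>k\<in>{..<P} - B. \<delta> * (cmod (Fh k) * cmod (g k)))"
    proof (intro order_trans[OF norm_triangle_ineq] add_mono close[OF that] sum_norm_le)
      fix k assume "k \<in> {..<P} - B"
      then have "cmod (g k) \<le> \<delta>" by (auto simp: B_def)
      then have "cmod (g k) * (cmod (Fh k) * cmod (g k)) \<le> \<delta> * (cmod (Fh k) * cmod (g k))"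
        by (intro mult_right_mono) auto
      then show "cmod (?t k) \<le> \<delta> * (cmod (Fh k) * cmod (g k))"
        by (simp add: norm_mult norm_power e_norm power2_eq_square mult_ac)
    qed
    also have "(\<Sum>k\<in>{..<P} - B. \<delta> * (cmod (Fh k) * cmod (g k))) \<le> (\<Sum>k<P. \<delta> * (cmod (Fh k) * cmod (g k)))"
      using \<open>\<delta> > 0\<close> by (intro sum_mono2) auto
    also have "\<dots> = \<delta> * (\<Sum>k<P. cmod (Fh k) * cmod (g k))" by (simp add: sum_distrib_left)
    also have "\<dots> \<le> \<delta> * (K * sqrt (4 * real N))"
      using \<open>\<delta> > 0\<close> K0 parsF parsg by (intro mult_left_mono sum_mult_le_sqrt) auto
    finally show ?thesis by (simp add: sumc mult.assoc)
  qed
  with cb tb show ?thesis unfolding T_def by blast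
qed

lemma convergent_subseq_finitely_many:
  fixes c :: "nat \<Rightarrow> nat \<Rightarrow> 'a::heine_borel"
  assumes "\<And>j. j < r \<Longrightarrow> bounded (range (\<lambda>n. c n j))"
  shows "\<exists>\<phi>::nat \<Rightarrow> nat. strict_mono \<phi> \<and> (\<forall>j<r. convergent (\<lambda>n. c (\<phi> n) j))"
  using assms
proof (induction r)
  case 0
  show ?case by (intro exI[of _ id]) (auto simp: strict_mono_def)
next
  case (Suc r)
  then obtain \<phi> where \<phi>: "strict_mono \<phi>" "\<forall>j<r. convergent (\<lambda>n. c (\<phi> n) j)" by auto
  have "bounded (range (\<lambda>n. c (\<phi> n) r))"
    using Suc.prems[of r] by (auto intro: bounded_subset)
  then obtain l s where s: "strict_mono s" "((\<lambda>n. c (\<phi> n) r) \<circ> s) \<longlonglongrightarrow> l"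
    using bounded_imp_convergent_subsequence[of "\<lambda>n. c (\<phi> n) r"] by auto
  have "convergent (\<lambda>n. c ((\<phi> \<circ> s) n) j)" if "j < Suc r" for j
  proof (cases "j = r")
    case True
    with s(2) show ?thesis by (auto simp: convergent_def o_def)
  next
    case False
    with that \<phi>(2) have "convergent (\<lambda>n. c (\<phi> n) j)" by auto
    from convergent_subseq_convergent[OF this s(1)] show ?thesis by (simp add: o_def)
  qed
  with strict_mono_o[OF \<phi>(1) s(1)] show ?case by blast
qed

text \<open>The number r of frequencies does not depend on the window [-m, m], the coefficients are
  bounded by K and the frequencies by 2 \<pi>. The limit of a subsequence of these parameters works
  at each fixed x, since x lies in all large windows.\<close>

lemma bohr_int:
  fixes a :: "int \<Rightarrow> complex" and N :: nat
  assumes K: "\<And>n. cmod (a n) \<le> K" and \<epsilon>: "\<epsilon> > 0"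
    and ap: "\<And>m. \<exists>p\<in>{m..<m + int N}. \<forall>n. cmod (a (n + p) - a n) \<le> \<epsilon>"
  shows "\<exists>r c \<theta>. \<forall>x. cmod (a x - (\<Sum>j<(r::nat). c j * cis (\<theta> j * of_int x))) \<le> 3 * \<epsilon>"
proof -
  have N: "N > 0" using ap[of 0] by (cases "N = 0") auto
  have K0: "K \<ge> 0" using K[of 0] norm_ge_zero order_trans by blast
  \<comment> \<open>Chosen so that the error \<delta> K sqrt (4 N) of the discarded frequencies is
    at most \<epsilon>; K + 1 in place of K keeps the denominator positive.\<close>
  define \<delta> where "\<delta> = \<epsilon> / ((K + 1) * sqrt (4 * real N))"
  have \<delta>: "\<delta> > 0" using \<epsilon> K0 N by (simp add: \<delta>_def)
  have \<delta>K: "\<delta> * K * sqrt (4 * real N) \<le> \<epsilon>"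
  proof -
    have "\<delta> * K * sqrt (4 * real N) = \<epsilon> * (K / (K + 1))" using N by (simp add: \<delta>_def)
    also have "\<dots> \<le> \<epsilon> * 1" using \<epsilon> K0 by (intro mult_left_mono) auto
    finally show ?thesis by simp
  qed
  define r where "r = nat \<lceil>4 * real N / \<delta>\<^sup>2\<rceil>"
  have r: "4 * real N / \<delta>\<^sup>2 \<le> real r" unfolding r_def by linarith
  define Q where "Q = (\<lambda>m c \<theta>. (\<forall>j<r. cmod (c j) \<le> K \<and> \<bar>\<theta> j\<bar> \<le> 2 * pi) \<and>
     (\<forall>x. \<bar>x\<bar> \<le> int m \<longrightarrow> cmod (a x - (\<Sum>j<r. c j * cis (\<theta> j * of_int x))) \<le> 3 * \<epsilon>))"
  have ex: "\<exists>c \<theta>. Q m c \<theta>" for m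
  proof -
    \<comment> \<open>One almost period from each block of N consecutive integers; the block index
      is recovered by division by N, which makes \<open>q\<close> injective. \<open>Suc m\<close>
      blocks are used below because the local statement asks for a positive number of them.\<close>
    obtain q where q: "\<And>i::nat. q i \<in> {int (i * N)..<int (i * N) + int N}"
      "\<And>i n. cmod (a (n + q i) - a n) \<le> \<epsilon>"
    proof -
      have "\<forall>i::nat. \<exists>p. p \<in> {int (i * N)..<int (i * N) + int N} \<and> (\<forall>n. cmod (a (n + p) - a n) \<le> \<epsilon>)"
        using ap by blast
      then show ?thesis using that by (auto dest!: choice)
    qed
    have qdiv: "q i div int N = int i" for i
    proof -
      have "q i = int i * int N + (q i - int i * int N)" by simp
      moreover have "0 \<le> q i - int i * int N" "q i - int i * int N < int N" using q(1)[of i] by auto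
      ultimately show ?thesis by (metis add.commute div_mult_self1 div_pos_pos_trivial add_0 less_irrefl N of_nat_0_less_iff)
    qed
    have inj: "inj q" by (rule injI) (metis qdiv of_nat_eq_iff)
    define S where "S = q ` {..<Suc m}"
    have "card S \<ge> Suc m" using inj by (simp add: S_def card_image inj_on_subset)
    moreover have "S \<subseteq> {0..<int (Suc m * N)}"
    proof
      fix p assume "p \<in> S"
      then obtain i where i: "i < Suc m" "p = q i" by (auto simp: S_def)
      have "p < int ((i + 1) * N)" using q(1)[of i] i by simp
      also have "\<dots> \<le> int (Suc m * N)" using i by (intro of_nat_mono mult_right_mono) auto
      finally show "p \<in> {0..<int (Suc m * N)}" using q(1)[of i] i by (auto intro: order_trans[rotated])
    qed
    ultimately obtain c \<theta> where *: "\<forall>j<r. cmod (c j) \<le> K \<and> \<bar>\<theta> j\<bar> \<le> 2 * pi"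
      "\<forall>x. \<bar>x\<bar> \<le> int (Suc m * N) \<longrightarrow> cmod (a x - (\<Sum>j<r. c j * cis (\<theta> j * of_int x))) \<le> 2 * \<epsilon> + \<delta> * K * sqrt (4 * real N)"
      using bohr_int_local[where a = a and K = K and m = "Suc m" and N = N and S = S and \<epsilon> = \<epsilon> and r = r and \<delta> = \<delta>] K N \<delta> q(2) r unfolding S_def by blast
    have "int m \<le> int (Suc m * N)" using N by (intro of_nat_mono) (cases N, auto)
    have "Q m c \<theta>"
      unfolding Q_def
    proof (intro conjI *(1) allI impI)
      fix x assume "\<bar>x\<bar> \<le> int m"
      then have "\<bar>x\<bar> \<le> int (Suc m * N)" using \<open>int m \<le> int (Suc m * N)\<close> by linarith
      from *(2)[rule_format, OF this] \<delta>K
      show "cmod (a x - (\<Sum>j<r. c j * cis (\<theta> j * of_int x))) \<le> 3 * \<epsilon>" by linarith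
    qed
    then show ?thesis by blast
  qed
  then have "\<exists>c \<theta>. \<forall>m. Q m (c m) (\<theta> m)" by metis
  then obtain c \<theta> where c: "\<And>m j. j < r \<Longrightarrow> cmod (c m j) \<le> K" "\<And>m j. j < r \<Longrightarrow> \<bar>\<theta> m j\<bar> \<le> 2 * pi"
    and cl: "\<And>m x. \<bar>x\<bar> \<le> int m \<Longrightarrow> cmod (a x - (\<Sum>j<r. c m j * cis (\<theta> m j * of_int x))) \<le> 3 * \<epsilon>"
    unfolding Q_def by blast
  have "\<exists>\<phi>::nat \<Rightarrow> nat. strict_mono \<phi> \<and> (\<forall>j<r. convergent (\<lambda>n. (c (\<phi> n) j, \<theta> (\<phi> n) j)))"
  proof (rule convergent_subseq_finitely_many[where c = "\<lambda>n j. (c n j, \<theta> n j)"])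
    fix j assume "j < r"
    have "range (\<lambda>n. (c n j, \<theta> n j)) \<subseteq> cball 0 K \<times> cball 0 (2 * pi)"
      using c \<open>j < r\<close> by auto
    then show "bounded (range (\<lambda>n. (c n j, \<theta> n j)))"
      by (rule bounded_subset[OF bounded_Times[OF bounded_cball bounded_cball]])
  qed
  then obtain \<phi> where \<phi>: "strict_mono \<phi>" "\<forall>j<r. convergent (\<lambda>n. (c (\<phi> n) j, \<theta> (\<phi> n) j))" by auto
  then obtain l where l: "\<And>j. j < r \<Longrightarrow> (\<lambda>n. (c (\<phi> n) j, \<theta> (\<phi> n) j)) \<longlonglongrightarrow> l j"
    unfolding convergent_def by metis
  have "cmod (a x - (\<Sum>j<r. fst (l j) * cis (snd (l j) * of_int x))) \<le> 3 * \<epsilon>" for x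
  proof (rule tendsto_upperbound)
    show "(\<lambda>n. cmod (a x - (\<Sum>j<r. c (\<phi> n) j * cis (\<theta> (\<phi> n) j * of_int x)))) \<longlonglongrightarrow>
        cmod (a x - (\<Sum>j<r. fst (l j) * cis (snd (l j) * of_int x)))"
    proof (intro tendsto_intros)
      fix j assume "j \<in> {..<r}"
      then have "j < r" by simp
      from tendsto_fst[OF l[OF this]] show "(\<lambda>n. c (\<phi> n) j) \<longlonglongrightarrow> fst (l j)" by simp
      from tendsto_snd[OF l[OF \<open>j < r\<close>]] show "(\<lambda>n. \<theta> (\<phi> n) j) \<longlonglongrightarrow> snd (l j)" by simp
    qed
    show "\<forall>\<^sub>F n in sequentially. cmod (a x - (\<Sum>j<r. c (\<phi> n) j * cis (\<theta> (\<phi> n) j * of_int x))) \<le> 3 * \<epsilon>"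
    proof (rule eventually_sequentiallyI[of "nat \<bar>x\<bar>"])
      fix n assume "nat \<bar>x\<bar> \<le> n"
      moreover have "n \<le> \<phi> n" using seq_suble[OF \<phi>(1)] .
      ultimately have "\<bar>x\<bar> \<le> int (\<phi> n)" by linarith
      then show "cmod (a x - (\<Sum>j<r. c (\<phi> n) j * cis (\<theta> (\<phi> n) j * of_int x))) \<le> 3 * \<epsilon>" by (rule cl)
    qed
  qed auto
  then show ?thesis
    by (intro exI[of _ r] exI[of _ "\<lambda>j. fst (l j)"] exI[of _ "\<lambda>j. snd (l j)"]) simp
qed

section \<open>Trigonometric polynomials and uniform approximation of periodic functions\<close>

definition trig_poly_in :: "real set \<Rightarrow> (real \<Rightarrow> complex) set" where
  "trig_poly_in \<Lambda> = {p. \<exists>M c. finite M \<and> M \<subseteq> \<Lambda> \<and> p = (\<lambda>t. \<Sum>\<mu>\<in>M. c \<mu> * e_fun \<mu> t)}"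

lemma trig_poly_eq: "trig_poly = trig_poly_in UNIV"
  by (simp add: trig_poly_def trig_poly_in_def)

lemma trig_poly_in_mono: "p \<in> trig_poly_in \<Lambda> \<Longrightarrow> \<Lambda> \<subseteq> \<Lambda>' \<Longrightarrow> p \<in> trig_poly_in \<Lambda>'"
  unfolding trig_poly_in_def by blast

lemma trig_poly_in_monom: "\<mu> \<in> \<Lambda> \<Longrightarrow> (\<lambda>t. c * e_fun \<mu> t) \<in> trig_poly_in \<Lambda>"
  unfolding trig_poly_in_def by (intro CollectI exI[of _ "{\<mu>}"] exI[of _ "\<lambda>_. c"]) auto

lemma trig_poly_in_add:
  assumes "p \<in> trig_poly_in \<Lambda>" "q \<in> trig_poly_in \<Lambda>"
  shows "(\<lambda>t. p t + q t) \<in> trig_poly_in \<Lambda>"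
proof -
  obtain M c where M: "finite M" "M \<subseteq> \<Lambda>" "p = (\<lambda>t. \<Sum>\<mu>\<in>M. c \<mu> * e_fun \<mu> t)"
    using assms(1) unfolding trig_poly_in_def by blast
  obtain N d where N: "finite N" "N \<subseteq> \<Lambda>" "q = (\<lambda>t. \<Sum>\<mu>\<in>N. d \<mu> * e_fun \<mu> t)"
    using assms(2) unfolding trig_poly_in_def by blast
  let ?c = "\<lambda>\<mu>. if \<mu> \<in> M then c \<mu> else 0" and ?d = "\<lambda>\<mu>. if \<mu> \<in> N then d \<mu> else 0"
  have "p = (\<lambda>t. \<Sum>\<mu>\<in>M \<union> N. ?c \<mu> * e_fun \<mu> t)"
    unfolding M(3) using M(1) N(1) by (intro ext sum.mono_neutral_cong_left) auto
  moreover have "q = (\<lambda>t. \<Sum>\<mu>\<in>M \<union> N. ?d \<mu> * e_fun \<mu> t)"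
    unfolding N(3) using M(1) N(1) by (intro ext sum.mono_neutral_cong_left) auto
  ultimately have "(\<lambda>t. p t + q t) = (\<lambda>t. \<Sum>\<mu>\<in>M \<union> N. (?c \<mu> + ?d \<mu>) * e_fun \<mu> t)"
    by (simp only: sum.distrib distrib_right)
  then show ?thesis unfolding trig_poly_in_def using M N
    by (intro CollectI exI[of _ "M \<union> N"] exI[of _ "\<lambda>\<mu>. ?c \<mu> + ?d \<mu>"]) simp
qed

lemma trig_poly_in_zero: "(\<lambda>t. 0) \<in> trig_poly_in \<Lambda>"
  unfolding trig_poly_in_def by (intro CollectI exI[of _ "{}"]) auto

lemma trig_poly_in_sum:
  assumes "\<And>i. i \<in> I \<Longrightarrow> p i \<in> trig_poly_in \<Lambda>"
  shows "(\<lambda>t. \<Sum>i\<in>I. p i t) \<in> trig_poly_in \<Lambda>"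
  using assms by (induction I rule: infinite_finite_induct) (auto intro: trig_poly_in_add trig_poly_in_zero)

lemma trig_poly_in_mult:
  assumes add: "\<And>x y. x \<in> \<Lambda> \<Longrightarrow> y \<in> \<Lambda> \<Longrightarrow> x + y \<in> \<Lambda>"
    and "p \<in> trig_poly_in \<Lambda>" "q \<in> trig_poly_in \<Lambda>"
  shows "(\<lambda>t. p t * q t) \<in> trig_poly_in \<Lambda>"
proof -
  obtain M c where M: "finite M" "M \<subseteq> \<Lambda>" "p = (\<lambda>t. \<Sum>\<mu>\<in>M. c \<mu> * e_fun \<mu> t)"
    using assms(2) unfolding trig_poly_in_def by blast
  obtain N d where N: "finite N" "N \<subseteq> \<Lambda>" "q = (\<lambda>t. \<Sum>\<mu>\<in>N. d \<mu> * e_fun \<mu> t)"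
    using assms(3) unfolding trig_poly_in_def by blast
  have "(\<lambda>t. p t * q t) = (\<lambda>t. \<Sum>\<mu>\<in>M. \<Sum>\<nu>\<in>N. (c \<mu> * d \<nu>) * e_fun (\<mu> + \<nu>) t)"
  proof -
    have "e_fun (\<mu> + \<nu>) t = e_fun \<mu> t * e_fun \<nu> t" for \<mu> \<nu> t
      by (simp add: e_fun_def cis_mult distrib_right)
    then show ?thesis unfolding M N by (simp add: sum_product mult_ac)
  qed
  also have "\<dots> \<in> trig_poly_in \<Lambda>"
    by (intro trig_poly_in_sum trig_poly_in_monom add) (use M N in auto)
  finally show ?thesis .
qed

lemma trig_poly_in_const: "0 \<in> \<Lambda> \<Longrightarrow> (\<lambda>t. c) \<in> trig_poly_in \<Lambda>"
  using trig_poly_in_monom[of 0 \<Lambda> c] by (simp add: e_fun_def)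

lemma trig_poly_in_scale:
  assumes "p \<in> trig_poly_in \<Lambda>"
  shows "(\<lambda>t. c * p t) \<in> trig_poly_in \<Lambda>"
proof -
  obtain M d where M: "finite M" "M \<subseteq> \<Lambda>" "p = (\<lambda>t. \<Sum>\<mu>\<in>M. d \<mu> * e_fun \<mu> t)"
    using assms unfolding trig_poly_in_def by blast
  have "(\<lambda>t. c * p t) = (\<lambda>t. \<Sum>\<mu>\<in>M. (c * d \<mu>) * e_fun \<mu> t)"
    unfolding M by (simp add: sum_distrib_left mult.assoc)
  with M show ?thesis unfolding trig_poly_in_def by auto
qed

lemma trig_poly_in_diff:
  assumes "p \<in> trig_poly_in \<Lambda>" "q \<in> trig_poly_in \<Lambda>"
  shows "(\<lambda>t. p t - q t) \<in> trig_poly_in \<Lambda>"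
  using trig_poly_in_add[OF assms(1) trig_poly_in_scale[OF assms(2), of "-1"]] by simp

lemma trig_poly_dilate:
  assumes "p \<in> trig_poly"
  shows "(\<lambda>t. p (t / h)) \<in> trig_poly"
proof -
  obtain M c where M: "p = (\<lambda>t. \<Sum>\<mu>\<in>M. c \<mu> * e_fun \<mu> t)"
    using assms unfolding trig_poly_def by blast
  have "(\<lambda>t. p (t / h)) = (\<lambda>t. \<Sum>\<mu>\<in>M. c \<mu> * e_fun (\<mu> / h) t)"
    unfolding M by (simp add: e_fun_def)
  also have "\<dots> \<in> trig_poly"
    unfolding trig_poly_eq by (intro trig_poly_in_sum trig_poly_in_monom) auto
  finally show ?thesis .
qed

lemma Re_cis_trig_poly_in:
  assumes "\<omega> \<in> \<Lambda>" "- \<omega> \<in> \<Lambda>"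
  shows "(\<lambda>t. of_real (Re (cis (\<omega> * t)))) \<in> trig_poly_in \<Lambda>" "(\<lambda>t. of_real (Im (cis (\<omega> * t)))) \<in> trig_poly_in \<Lambda>"
proof -
  have "(\<lambda>t. of_real (Re (cis (\<omega> * t)))) = (\<lambda>t. (1/2) * e_fun \<omega> t + (1/2) * e_fun (- \<omega>) t)"
    by (auto simp: e_fun_def complex_eq_iff)
  also have "\<dots> \<in> trig_poly_in \<Lambda>" by (intro trig_poly_in_add trig_poly_in_monom assms)
  finally show "(\<lambda>t. of_real (Re (cis (\<omega> * t)))) \<in> trig_poly_in \<Lambda>" .
  have "(\<lambda>t. of_real (Im (cis (\<omega> * t)))) = (\<lambda>t. (- \<i>/2) * e_fun \<omega> t + (\<i>/2) * e_fun (- \<omega>) t)"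
    by (auto simp: e_fun_def complex_eq_iff)
  also have "\<dots> \<in> trig_poly_in \<Lambda>" by (intro trig_poly_in_add trig_poly_in_monom assms)
  finally show "(\<lambda>t. of_real (Im (cis (\<omega> * t)))) \<in> trig_poly_in \<Lambda>" .
qed

text \<open>On the circle the real-linear functions of the plane are combinations of cos and sin,
  and \<open>trig_poly_in \<Lambda>\<close> is closed under products when \<Lambda> is closed under
  addition. This turns Stone-Weierstrass polynomials into trigonometric ones.\<close>

lemma real_polynomial_function_cis:
  fixes g :: "complex \<Rightarrow> real"
  assumes "real_polynomial_function g" and \<Lambda>: "0 \<in> \<Lambda>" "\<omega> \<in> \<Lambda>" "- \<omega> \<in> \<Lambda>" "\<And>x y. x \<in> \<Lambda> \<Longrightarrow> y \<in> \<Lambda> \<Longrightarrow> x + y \<in> \<Lambda>"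
  shows "(\<lambda>t. complex_of_real (g (cis (\<omega> * t)))) \<in> trig_poly_in \<Lambda>"
  using assms(1)
proof (induction rule: real_polynomial_function.induct)
  case (linear f)
  have "f z = Re z * f 1 + Im z * f \<i>" for z
  proof -
    have "z = Re z *\<^sub>R 1 + Im z *\<^sub>R \<i>" by (simp add: complex_eq_iff)
    then have "f z = f (Re z *\<^sub>R 1 + Im z *\<^sub>R \<i>)" by simp
    then show ?thesis
      by (simp only: bounded_linear.linear[OF linear] linear_add linear_scale real_scaleR_def)
  qed
  then have *: "f (cis (\<omega> * t)) = f 1 * Re (cis (\<omega> * t)) + f \<i> * Im (cis (\<omega> * t))" for t
    by (metis mult.commute)
  have "(\<lambda>t. complex_of_real (f (cis (\<omega> * t)))) =
     (\<lambda>t. of_real (f 1) * of_real (Re (cis (\<omega> * t))) + of_real (f \<i>) * of_real (Im (cis (\<omega> * t))))"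
    by (simp only: * of_real_add of_real_mult)
  also have "\<dots> \<in> trig_poly_in \<Lambda>"
    by (intro trig_poly_in_add trig_poly_in_scale Re_cis_trig_poly_in \<Lambda>)
  finally show ?case .
next
  case (const c)
  show ?case by (intro trig_poly_in_const \<Lambda>)
next
  case (add f g)
  from trig_poly_in_add[OF add.IH] show ?case by simp
next
  case (mult f g)
  from trig_poly_in_mult[OF \<Lambda>(4) mult.IH] show ?case by simp
qed

text \<open>The frequencies of period T. Keeping track of the frequency set in
  \<open>trig_poly_in\<close> preserves this periodicity through sums and products.\<close>

definition harmonics :: "real \<Rightarrow> real set" where
  "harmonics T = {2 * pi * of_int k / T | k::int. True}"

lemma harmonics_closed: "0 \<in> harmonics T" "2 * pi / T \<in> harmonics T" "- (2 * pi / T) \<in> harmonics T"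
  "x \<in> harmonics T \<Longrightarrow> y \<in> harmonics T \<Longrightarrow> x + y \<in> harmonics T"
proof -
  show "0 \<in> harmonics T" "2 * pi / T \<in> harmonics T" "- (2 * pi / T) \<in> harmonics T"
    unfolding harmonics_def by (auto intro: exI[of _ 0] exI[of _ 1] exI[of _ "-1"])
  assume "x \<in> harmonics T" "y \<in> harmonics T"
  then obtain k l :: int where "x = 2 * pi * of_int k / T" "y = 2 * pi * of_int l / T"
    unfolding harmonics_def by auto
  then have "x + y = 2 * pi * of_int (k + l) / T" by (simp add: distrib_left add_divide_distrib)
  then show "x + y \<in> harmonics T" unfolding harmonics_def by blast
qed

lemma trig_poly_periodic:
  assumes "p \<in> trig_poly_in (harmonics T)" "T \<noteq> 0"
  shows "p (t + T * of_int n) = p t"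
proof -
  obtain M c where M: "M \<subseteq> harmonics T" "p = (\<lambda>t. \<Sum>\<mu>\<in>M. c \<mu> * e_fun \<mu> t)"
    using assms(1) unfolding trig_poly_in_def by blast
  have "e_fun \<mu> (t + T * of_int n) = e_fun \<mu> t" if \<mu>: "\<mu> \<in> M" for \<mu>
  proof -
    obtain k :: int where k: "\<mu> = 2 * pi * of_int k / T" using \<mu> M(1) unfolding harmonics_def by blast
    have "\<mu> * (t + T * of_int n) = \<mu> * t + 2 * pi * of_int (k * n)"
      using assms(2) by (simp add: k field_simps)
    then show ?thesis by (simp add: e_fun_def cis_mult[symmetric] cis_multiple_2pi del: of_int_mult)
  qed
  then show ?thesis unfolding M by simp
qed

lemma periodic_approximation:
  fixes u :: "real \<Rightarrow> complex"
  assumes T: "T > 0" and u: "continuous_on {0..T} u" "u 0 = u T" and e: "e > 0"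
  shows "\<exists>p\<in>trig_poly_in (harmonics T). \<forall>t\<in>{0..T}. cmod (u t - p t) \<le> e"
proof -
  define v where "v = (\<lambda>s. u (T * s))"
  have "(\<lambda>s. T * s) ` {0..1} \<subseteq> {0..T}" using T by (auto simp: mult_left_le)
  then have "path v" unfolding path_def v_def
    by (rule continuous_on_compose2[OF u(1) continuous_on_mult_left[OF continuous_on_id]])
  moreover have "pathfinish v = pathstart v" by (simp add: pathfinish_def pathstart_def v_def u(2))
  \<comment> \<open>The trivial homotopy of the loop \<open>v\<close> with itself is used only for a
    consequence: continuity of the induced map on the circle, also across the branch cut of
    \<open>Arg2pi\<close>.\<close>
  ultimately have "homotopic_loops UNIV v v" by (simp add: homotopic_loops_refl)
  from homotopic_with_imp_continuous[OF homotopic_loops_imp_homotopic_circlemaps[OF this]]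
  have "continuous_on (sphere 0 1) (v \<circ> (\<lambda>z. Arg2pi z / (2 * pi)))" by simp
  from Stone_Weierstrass_polynomial_function[OF compact_sphere this e]
  obtain g where g: "polynomial_function g"
    "\<forall>z\<in>sphere 0 1. norm ((v \<circ> (\<lambda>z. Arg2pi z / (2 * pi))) z - g z) < e"
    by blast
  define p where "p = (\<lambda>t. g (cis (2 * pi / T * t)))"
  have re: "real_polynomial_function (Re \<circ> g)" "real_polynomial_function (Im \<circ> g)"
    using g(1) bounded_linear_Re bounded_linear_Im unfolding polynomial_function_def by blast+
  note h = harmonics_closed[where T = T]
  have "p = (\<lambda>t. of_real ((Re \<circ> g) (cis (2 * pi / T * t))) + \<i> * of_real ((Im \<circ> g) (cis (2 * pi / T * t))))"
    by (auto simp: p_def complex_eq_iff)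
  also have "\<dots> \<in> trig_poly_in (harmonics T)"
    by (intro trig_poly_in_add trig_poly_in_scale real_polynomial_function_cis re h)
  finally have p: "p \<in> trig_poly_in (harmonics T)" .
  \<comment> \<open>The endpoint T is excluded because \<open>Arg2pi\<close> takes values in [0, 2
    \<pi>); it is recovered below from periodicity and u 0 = u T.\<close>
  have less: "cmod (u t - p t) \<le> e" if "0 \<le> t" "t < T" for t
  proof -
    have "Arg2pi (cis (2 * pi / T * t)) = 2 * pi / T * t"
      using that T by (intro Arg2pi_unique[of 1]) (auto simp: cis_conv_exp field_simps)
    then have "u t = (v \<circ> (\<lambda>z. Arg2pi z / (2 * pi))) (cis (2 * pi / T * t))"
      using T by (simp add: v_def)
    then show ?thesis using g(2)[rule_format, of "cis (2 * pi / T * t)"] by (simp add: p_def)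
  qed
  have "cmod (u t - p t) \<le> e" if "t \<in> {0..T}" for t
  proof (cases "t = T")
    case True
    have "p T = p 0" using trig_poly_periodic[OF p, of 0 1] T by simp
    with True less[of 0] T u(2) show ?thesis by simp
  qed (use that less in auto)
  with p show ?thesis by blast
qed

section \<open>Bohr's approximation theorem for almost periodic functions\<close>

lemma AP_almost_period_into:
  assumes "f \<in> AP" "\<epsilon> > 0"
  shows "\<exists>L>0. \<forall>t. \<exists>\<tau>. t + \<tau> \<in> {0<..<L} \<and> (\<forall>s. cmod (f (s + \<tau>) - f s) \<le> \<epsilon>)"
proof -
  obtain L where L: "L > 0" "\<And>a b. b - a > L \<Longrightarrow> \<exists>\<tau>\<in>{a<..<b}. \<forall>t. cmod (f (t + \<tau>) - f t) \<le> \<epsilon>"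
    using assms unfolding AP_def by blast
  have "\<exists>\<tau>. t + \<tau> \<in> {0<..<L + 1} \<and> (\<forall>s. cmod (f (s + \<tau>) - f s) \<le> \<epsilon>)" for t
  proof -
    obtain \<tau> where "\<tau> \<in> {-t<..<-t + (L + 1)}" "\<forall>s. cmod (f (s + \<tau>) - f s) \<le> \<epsilon>"
      using L(2)[where a = "-t" and b = "-t + (L + 1)"] by auto
    then show ?thesis by (intro exI[of _ \<tau>]) auto
  qed
  then show ?thesis using L(1) by (intro exI[of _ "L + 1"]) auto
qed

lemma AP_continuous: "f \<in> AP \<Longrightarrow> continuous_on S f"
  unfolding AP_def using continuous_on_subset by blast

lemma AP_bounded:
  assumes "f \<in> AP"
  obtains K where "\<And>t. cmod (f t) \<le> K"
proof -
  obtain L where L: "L > 0" "\<And>t. \<exists>\<tau>. t + \<tau> \<in> {0<..<L} \<and> (\<forall>s. cmod (f (s + \<tau>) - f s) \<le> 1)"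
    using AP_almost_period_into[OF assms, of 1] by auto
  have "bounded (f ` {0..L})"
    by (intro compact_imp_bounded compact_continuous_image AP_continuous[OF assms]) auto
  then obtain K where "\<forall>z\<in>f ` {0..L}. cmod z \<le> K"
    unfolding bounded_iff by blast
  then have K: "cmod (f t) \<le> K" if "t \<in> {0..L}" for t using that by blast
  have "cmod (f t) \<le> K + 1" for t
  proof -
    obtain \<tau> where \<tau>: "t + \<tau> \<in> {0<..<L}" "cmod (f (t + \<tau>) - f t) \<le> 1" using L(2) by blast
    then have "cmod (f (t + \<tau>)) \<le> K" by (intro K) auto
    with \<tau>(2) show ?thesis
      using norm_triangle_ineq4[of "f (t + \<tau>)" "f (t + \<tau>) - f t"] by simp
  qed
  then show ?thesis using that by blast
qed

text \<open>An almost period moves x into a fixed compact interval, where uniform continuity is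
  available; the margin 1 keeps the translate of y inside as well, given |x - y| \<le> 1.\<close>

lemma AP_uniformly_continuous:
  assumes f: "f \<in> AP" and \<epsilon>: "\<epsilon> > 0"
  shows "\<exists>\<delta>>0. \<forall>x y. \<bar>x - y\<bar> \<le> \<delta> \<longrightarrow> cmod (f x - f y) \<le> \<epsilon>"
proof -
  obtain L where L: "L > 0" "\<And>t. \<exists>\<tau>. t + \<tau> \<in> {0<..<L} \<and> (\<forall>s. cmod (f (s + \<tau>) - f s) \<le> \<epsilon> / 3)"
    using AP_almost_period_into[OF f, of "\<epsilon> / 3"] \<epsilon> by auto
  have "uniformly_continuous_on {-1..L+1} f"
    by (intro compact_uniformly_continuous AP_continuous[OF f]) auto
  then obtain d where d: "d > 0" "\<And>x y. x \<in> {-1..L+1} \<Longrightarrow> y \<in> {-1..L+1} \<Longrightarrow> \<bar>x - y\<bar> < d \<Longrightarrow> cmod (f x - f y) < \<epsilon> / 3"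
    using \<epsilon> unfolding uniformly_continuous_on_def dist_norm by (metis divide_pos_pos norm_minus_commute real_norm_def zero_less_numeral)
  have "cmod (f x - f y) \<le> \<epsilon>" if "\<bar>x - y\<bar> \<le> min 1 (d / 2)" for x y
  proof -
    obtain \<tau> where \<tau>: "x + \<tau> \<in> {0<..<L}" "\<And>s. cmod (f (s + \<tau>) - f s) \<le> \<epsilon> / 3" using L(2) by blast
    have "cmod (f (x + \<tau>) - f (y + \<tau>)) < \<epsilon> / 3"
      using \<tau>(1) that d(1) by (intro d(2)) auto
    moreover have "f x - f y = (f (x + \<tau>) - f (y + \<tau>)) - (f (x + \<tau>) - f x) + (f (y + \<tau>) - f y)" by simp
    ultimately show ?thesis
      using \<tau>(2)[of x] \<tau>(2)[of y] norm_triangle_ineq4[of "f (x + \<tau>) - f (y + \<tau>)" "f (x + \<tau>) - f x"]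
        norm_triangle_ineq[of "(f (x + \<tau>) - f (y + \<tau>)) - (f (x + \<tau>) - f x)" "f (y + \<tau>) - f y"] by simp
  qed
  then show ?thesis using d(1) by (intro exI[of _ "min 1 (d / 2)"]) auto
qed

text \<open>Rounding a real almost period down to a multiple of h costs another \<epsilon> by
  uniform continuity and leaves an almost period of the sampled sequence; relative density survives
  the rounding.\<close>

lemma AP_grid_almost_periods:
  assumes f: "f \<in> AP" and \<epsilon>: "\<epsilon> > 0" and h: "h > 0" "\<And>x y. \<bar>x - y\<bar> \<le> h \<Longrightarrow> cmod (f x - f y) \<le> \<epsilon>"
  shows "\<exists>N::nat. \<forall>m::int. \<exists>p\<in>{m..<m + int N}. \<forall>n::int. cmod (f (h * of_int (n + p)) - f (h * of_int n)) \<le> 2 * \<epsilon>"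
proof -
  obtain L where L: "L > 0" "\<And>a b. b - a > L \<Longrightarrow> \<exists>\<tau>\<in>{a<..<b}. \<forall>t. cmod (f (t + \<tau>) - f t) \<le> \<epsilon>"
    using f \<epsilon> unfolding AP_def by blast
  \<comment> \<open>N grid steps are longer than L, so that every run of N indices catches an almost
    period.\<close>
  define N where "N = nat \<lceil>L / h\<rceil> + 1"
  have "real N > L / h" unfolding N_def by linarith
  then have N: "h * real N > L" using h(1) by (simp add: field_simps)
  have "\<exists>p\<in>{m..<m + int N}. \<forall>n::int. cmod (f (h * of_int (n + p)) - f (h * of_int n)) \<le> 2 * \<epsilon>" for m :: int
  proof -
    obtain \<tau> where \<tau>: "\<tau> \<in> {h * of_int m<..<h * of_int m + h * real N}" "\<And>t. cmod (f (t + \<tau>) - f t) \<le> \<epsilon>"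
      using L(2)[where a = "h * of_int m" and b = "h * of_int m + h * real N"] N by auto
    define p where "p = \<lfloor>\<tau> / h\<rfloor>"
    have "of_int m < \<tau> / h" "\<tau> / h < of_int (m + int N)"
      using \<tau>(1) h(1) by (auto simp: field_simps)
    then have pm: "p \<in> {m..<m + int N}" unfolding p_def by (auto simp: le_floor_iff floor_less_iff)
    have "of_int p \<le> \<tau> / h" "\<tau> / h < of_int p + 1" unfolding p_def by linarith+
    then have "h * of_int p \<le> \<tau>" "\<tau> < h * of_int p + h" using h(1) by (auto simp: field_simps)
    then have ph: "\<bar>h * of_int p - \<tau>\<bar> \<le> h" by simp
    have "cmod (f (h * of_int (n + p)) - f (h * of_int n)) \<le> 2 * \<epsilon>" for n :: int
    proof -
      have "f (h * of_int (n + p)) - f (h * of_int n) =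
         (f (h * of_int (n + p)) - f (h * of_int n + \<tau>)) + (f (h * of_int n + \<tau>) - f (h * of_int n))" by simp
      also have "cmod \<dots> \<le> \<epsilon> + \<epsilon>"
        using ph by (intro order_trans[OF norm_triangle_ineq] add_mono \<tau>(2) h(2)) (simp add: distrib_left)
      finally show ?thesis by simp
    qed
    with pm show ?thesis by blast
  qed
  then show ?thesis by blast
qed

lemma linear_interpolation_approx:
  fixes f b0 b1 :: complex and s :: real
  assumes "0 \<le> s" "s \<le> 1" "cmod (f - b0) \<le> e" "cmod (f - b1) \<le> e"
  shows "cmod (f - (of_real (1 - s) * b0 + of_real s * b1)) \<le> e"
proof -
  have "f - (of_real (1 - s) * b0 + of_real s * b1) = of_real (1 - s) * (f - b0) + of_real s * (f - b1)"
    by (simp add: algebra_simps)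
  also have "cmod \<dots> \<le> (1 - s) * e + s * e"
    using assms by (intro order_trans[OF norm_triangle_ineq] add_mono) (auto simp: norm_mult simp del: of_real_diff intro!: mult_left_mono)
  finally show ?thesis by (simp add: algebra_simps)
qed

text \<open>f is sampled on a grid of mesh h, the samples are approximated by a combination of
  characters of the integers, and this combination is interpolated linearly. The linear
  interpolation of cis (\<theta> n) equals cis (\<theta> y) times a function of period 1 in y, so
  only periodic functions remain to be approximated.\<close>

theorem Bohr_approximation:
  assumes f: "f \<in> AP" and \<epsilon>: "\<epsilon> > 0"
  shows "\<exists>p\<in>trig_poly. \<forall>t. cmod (f t - p t) \<le> \<epsilon>"
proof -
  \<comment> \<open>Error budget: e for moving to the grid, 6 e for the samples and e for the
    periodic factors.\<close>
  define e where "e = \<epsilon> / 8"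
  have e: "e > 0" using \<epsilon> by (simp add: e_def)
  obtain h where h: "h > 0" "\<And>x y. \<bar>x - y\<bar> \<le> h \<Longrightarrow> cmod (f x - f y) \<le> e"
    using AP_uniformly_continuous[OF f e] by blast
  obtain K where K: "\<And>t. cmod (f t) \<le> K" using AP_bounded[OF f] by blast
  obtain N :: nat where N: "\<And>m::int. \<exists>p\<in>{m..<m + int N}. \<forall>n::int. cmod (f (h * of_int (n + p)) - f (h * of_int n)) \<le> 2 * e"
    using AP_grid_almost_periods[OF f e h] by blast
  obtain r :: nat and c \<theta> where r: "\<And>n::int. cmod (f (h * of_int n) - (\<Sum>j<r. c j * cis (\<theta> j * of_int n))) \<le> 3 * (2 * e)"
    using bohr_int[where a = "\<lambda>n. f (h * of_int n)" and \<epsilon> = "2 * e" and K = K and N = N] e K N by auto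
  define b where "b = (\<lambda>n::int. \<Sum>j<r. c j * cis (\<theta> j * of_int n))"
  \<comment> \<open>The linear interpolation of the character of frequency \<open>\<theta> j\<close>
    between two grid points, divided by the character itself. It equals 1 at both ends of [0, 1], as
    \<open>periodic_approximation\<close> requires.\<close>
  define U where "U = (\<lambda>j s. of_real (1 - s) * cis (- (\<theta> j * s)) + of_real s * cis (\<theta> j * (1 - s)))"
  define C where "C = (\<Sum>j<r. cmod (c j))"
  have C: "C \<ge> 0" by (auto simp: C_def intro: sum_nonneg)
  have "\<exists>q\<in>trig_poly_in (harmonics 1). \<forall>s\<in>{0..1}. cmod (U j s - q s) \<le> e / (C + 1)" for j
    using C e by (intro periodic_approximation) (auto simp: U_def cis_conv_exp intro!: continuous_intros)
  then obtain q where q: "\<And>j. q j \<in> trig_poly_in (harmonics 1)"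
      "\<And>j s. 0 \<le> s \<Longrightarrow> s \<le> 1 \<Longrightarrow> cmod (U j s - q j s) \<le> e / (C + 1)"
    by (metis atLeastAtMost_iff)
  define p where "p = (\<lambda>y. \<Sum>j<r. c j * (e_fun (\<theta> j) y * q j y))"
  have e_poly: "e_fun \<mu> \<in> trig_poly_in UNIV" for \<mu>
    using trig_poly_in_monom[of \<mu> UNIV 1] by simp
  have "p \<in> trig_poly"
    unfolding p_def trig_poly_eq
    by (intro trig_poly_in_sum trig_poly_in_scale trig_poly_in_mult e_poly trig_poly_in_mono[OF q(1)]) auto
  then have "(\<lambda>x. p (x / h)) \<in> trig_poly" by (rule trig_poly_dilate)
  moreover have "cmod (f x - p (x / h)) \<le> \<epsilon>" for x
  proof -
    define y where "y = x / h"
    define n where "n = \<lfloor>y\<rfloor>"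
    define s where "s = y - of_int n"
    have s: "0 \<le> s" "s \<le> 1" unfolding s_def n_def by linarith+
    have x: "x = h * of_int n + h * s" using h(1) by (simp add: s_def y_def field_simps)
    have hs: "0 \<le> h * s" "h * s \<le> h" using s h(1) by (auto intro: mult_left_le)
    have near: "cmod (f x - b k) \<le> 7 * e" if "\<bar>x - h * of_int k\<bar> \<le> h" for k :: int
    proof -
      have "f x - b k = (f x - f (h * of_int k)) + (f (h * of_int k) - b k)" by simp
      also have "cmod \<dots> \<le> e + 3 * (2 * e)"
        unfolding b_def by (intro order_trans[OF norm_triangle_ineq] add_mono h(2) r that)
      finally show ?thesis by simp
    qed
    have 1: "cmod (f x - (of_real (1 - s) * b n + of_real s * b (n + 1))) \<le> 7 * e"
      by (intro linear_interpolation_approx s near) (use x hs in \<open>auto simp: distrib_left\<close>)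
    have "e_fun (\<theta> j) y * U j s = of_real (1 - s) * cis (\<theta> j * of_int n) + of_real s * cis (\<theta> j * of_int (n + 1))" for j
    proof -
      have "e_fun (\<theta> j) y * cis (- (\<theta> j * s)) = cis (\<theta> j * of_int n)"
        "e_fun (\<theta> j) y * cis (\<theta> j * (1 - s)) = cis (\<theta> j * of_int (n + 1))"
        by (simp_all add: e_fun_def cis_mult s_def algebra_simps)
      then show ?thesis unfolding U_def by (simp only: distrib_left mult.left_commute[of "e_fun (\<theta> j) y"])
    qed
    then have "c j * (e_fun (\<theta> j) y * U j s) =
        of_real (1 - s) * (c j * cis (\<theta> j * of_int n)) + of_real s * (c j * cis (\<theta> j * of_int (n + 1)))" for j
      by (simp only: distrib_left mult.left_commute[of "c j"])
    then have 2: "of_real (1 - s) * b n + of_real s * b (n + 1) = (\<Sum>j<r. c j * (e_fun (\<theta> j) y * U j s))"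
      by (simp only: b_def sum_distrib_left sum.distrib)
    have qy: "q j y = q j s" for j
      using trig_poly_periodic[OF q(1)[of j], where t = s and n = n] by (simp add: s_def)
    have "(\<Sum>j<r. c j * (e_fun (\<theta> j) y * U j s)) - p y = (\<Sum>j<r. c j * (e_fun (\<theta> j) y * (U j s - q j s)))"
      by (simp add: p_def qy sum_subtractf[symmetric] algebra_simps)
    also have "cmod \<dots> \<le> (\<Sum>j<r. cmod (c j) * (e / (C + 1)))"
      by (intro sum_norm_le) (simp only: norm_mult e_fun_def norm_cis mult_1, intro mult_left_mono q(2) s norm_ge_zero)
    also have "\<dots> = e * (C / (C + 1))" by (simp only: sum_distrib_right[symmetric]) (simp add: C_def)
    also have "\<dots> \<le> e * 1" using C e by (intro mult_left_mono) auto
    finally have 3: "cmod ((of_real (1 - s) * b n + of_real s * b (n + 1)) - p y) \<le> e" by (simp only: 2 mult_1_right)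
    have "cmod (f x - p y) \<le> 7 * e + e"
      using norm_triangle_ineq[of "f x - (of_real (1 - s) * b n + of_real s * b (n + 1))" "(of_real (1 - s) * b n + of_real s * b (n + 1)) - p y"] 1 3 by simp
    then show ?thesis by (simp add: e_def y_def)
  qed
  ultimately show ?thesis by (intro bexI[of _ "\<lambda>x. p (x / h)"]) auto
qed

section \<open>Uniform limits of trigonometric polynomials\<close>

lemma convergent_of_approximations:
  fixes \<phi> :: "'a \<Rightarrow> complex"
  assumes F: "F \<noteq> bot" and "\<And>\<epsilon>. \<epsilon> > 0 \<Longrightarrow> \<exists>z. \<forall>\<^sub>F x in F. cmod (\<phi> x - z) \<le> \<epsilon>"
  shows "\<exists>L. (\<phi> \<longlongrightarrow> L) F"
proof -
  have "cauchy_filter (filtermap \<phi> F)"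
    unfolding cauchy_filter_metric_filtermap
  proof (intro allI impI)
    fix e :: real assume "e > 0"
    then obtain z where z: "\<forall>\<^sub>F x in F. cmod (\<phi> x - z) \<le> e / 3" using assms(2)[of "e / 3"] by auto
    have "dist (\<phi> x) (\<phi> y) < e" if "cmod (\<phi> x - z) \<le> e / 3" "cmod (\<phi> y - z) \<le> e / 3" for x y
      using norm_triangle_ineq4[of "\<phi> x - z" "\<phi> y - z"] that \<open>e > 0\<close> by (simp add: dist_norm)
    with z show "\<exists>P. eventually P F \<and> (\<forall>x y. P x \<and> P y \<longrightarrow> dist (\<phi> x) (\<phi> y) < e)"
      by (intro exI[of _ "\<lambda>x. cmod (\<phi> x - z) \<le> e / 3"]) auto
  qed
  moreover have "filtermap \<phi> F \<noteq> bot" using F by (simp add: filtermap_bot_iff)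
  moreover have "complete (UNIV :: complex set)"
    by (meson Cauchy_convergent UNIV_I complete_def convergent_def)
  ultimately obtain L where "filtermap \<phi> F \<le> nhds L"
    unfolding complete_uniform by (metis principal_eq_bot_iff top_greatest principal_UNIV)
  then show ?thesis unfolding filterlim_def by blast
qed

text \<open>The uniform closure of the trigonometric polynomials, used in place of \<open>AP\<close>
  for algebra: closure under sums and products is immediate here, whereas in \<open>AP\<close> it
  would require common almost periods.\<close>

definition UAP :: "(real \<Rightarrow> complex) set" where
  "UAP = {f. \<forall>\<epsilon>>0. \<exists>p\<in>trig_poly. \<forall>t. cmod (f t - p t) \<le> \<epsilon>}"

lemma UAP_approx: "f \<in> UAP \<Longrightarrow> \<epsilon> > 0 \<Longrightarrow> \<exists>p\<in>trig_poly. \<forall>t. cmod (f t - p t) \<le> \<epsilon>"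
  unfolding UAP_def by blast

lemma AP_subset_UAP: "AP \<subseteq> UAP"
  using Bohr_approximation unfolding UAP_def by blast

lemma trig_poly_UAP: "p \<in> trig_poly \<Longrightarrow> p \<in> UAP"
  unfolding UAP_def by (auto intro!: bexI[of _ p])

lemma e_fun_trig_poly: "e_fun \<mu> \<in> trig_poly"
  using trig_poly_in_monom[of \<mu> UNIV 1] by (simp add: trig_poly_eq)

lemma trig_poly_add: "p \<in> trig_poly \<Longrightarrow> q \<in> trig_poly \<Longrightarrow> (\<lambda>t. p t + q t) \<in> trig_poly"
  and trig_poly_diff: "p \<in> trig_poly \<Longrightarrow> q \<in> trig_poly \<Longrightarrow> (\<lambda>t. p t - q t) \<in> trig_poly"
  and trig_poly_mult: "p \<in> trig_poly \<Longrightarrow> q \<in> trig_poly \<Longrightarrow> (\<lambda>t. p t * q t) \<in> trig_poly"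
  unfolding trig_poly_eq by (simp_all add: trig_poly_in_add trig_poly_in_diff trig_poly_in_mult)

lemma trig_poly_cnj:
  assumes "p \<in> trig_poly"
  shows "(\<lambda>t. cnj (p t)) \<in> trig_poly"
proof -
  obtain M c where M: "p = (\<lambda>t. \<Sum>\<mu>\<in>M. c \<mu> * e_fun \<mu> t)"
    using assms unfolding trig_poly_def by blast
  have "(\<lambda>t. cnj (p t)) = (\<lambda>t. \<Sum>\<mu>\<in>M. cnj (c \<mu>) * e_fun (- \<mu>) t)"
    unfolding M by (simp add: e_fun_def cis_cnj)
  also have "\<dots> \<in> trig_poly"
    unfolding trig_poly_eq by (intro trig_poly_in_sum trig_poly_in_monom) auto
  finally show ?thesis .
qed

lemma trig_poly_continuous: "p \<in> trig_poly \<Longrightarrow> continuous_on S p"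
  unfolding trig_poly_def e_fun_def cis_conv_exp by (auto intro!: continuous_intros)

lemma trig_poly_bounded:
  assumes "p \<in> trig_poly" obtains K where "\<And>t. cmod (p t) \<le> K"
proof -
  obtain M c where M: "p = (\<lambda>t. \<Sum>\<mu>\<in>M. c \<mu> * e_fun \<mu> t)"
    using assms unfolding trig_poly_def by blast
  have "cmod (p t) \<le> (\<Sum>\<mu>\<in>M. cmod (c \<mu>))" for t
    unfolding M by (intro sum_norm_le) (simp add: norm_mult e_fun_def)
  then show ?thesis using that by blast
qed

lemma UAP_bounded:
  assumes "f \<in> UAP" obtains K where "\<And>t. cmod (f t) \<le> K" "K > 0"
proof -
  obtain p where p: "p \<in> trig_poly" "\<And>t. cmod (f t - p t) \<le> 1" using UAP_approx[OF assms, of 1] by auto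
  obtain K where K: "\<And>t. cmod (p t) \<le> K" using trig_poly_bounded[OF p(1)] by blast
  have "cmod (f t) \<le> K + 1" for t
    using norm_triangle_ineq[of "f t - p t" "p t"] p(2)[of t] K[of t] by simp
  moreover have "K + 1 > 0" using K[of 0] norm_ge_zero[of "p 0"] by linarith
  ultimately show ?thesis using that by blast
qed

lemma UAP_continuous:
  assumes "f \<in> UAP" shows "continuous_on S f"
proof -
  have "\<forall>n::nat. \<exists>p. p \<in> trig_poly \<and> (\<forall>t. cmod (f t - p t) \<le> inverse (real (Suc n)))"
    using UAP_approx[OF assms] by (metis inverse_positive_iff_positive of_nat_0_less_iff zero_less_Suc)
  then obtain p where p: "\<And>n. p n \<in> trig_poly" "\<And>n t. cmod (f t - p n t) \<le> inverse (real (Suc n))"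
    using choice by metis
  have "uniform_limit S p f sequentially"
  proof (rule uniform_limitI)
    fix e :: real assume "e > 0"
    then have "\<forall>\<^sub>F n in sequentially. inverse (real (Suc n)) < e"
      using LIMSEQ_inverse_real_of_nat by (rule order_tendstoD(2)[rotated])
    then show "\<forall>\<^sub>F n in sequentially. \<forall>x\<in>S. dist (p n x) (f x) < e"
      by eventually_elim (metis p(2) dist_norm norm_minus_commute le_less_trans)
  qed
  then show ?thesis
    by (rule uniform_limit_theorem[rotated]) (auto intro!: always_eventually trig_poly_continuous p)
qed

lemma UAP_add:
  assumes "f \<in> UAP" "g \<in> UAP" shows "(\<lambda>t. f t + g t) \<in> UAP"
  unfolding UAP_def
proof (intro CollectI allI impI)
  fix e :: real assume e: "e > 0"
  obtain p where p: "p \<in> trig_poly" "\<And>t. cmod (f t - p t) \<le> e / 2" using UAP_approx[OF assms(1), of "e / 2"] e by auto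
  obtain q where q: "q \<in> trig_poly" "\<And>t. cmod (g t - q t) \<le> e / 2" using UAP_approx[OF assms(2), of "e / 2"] e by auto
  have "cmod ((f t + g t) - (p t + q t)) \<le> e" for t
    using norm_triangle_ineq[of "f t - p t" "g t - q t"] p(2)[of t] q(2)[of t] by (simp add: algebra_simps)
  then show "\<exists>p\<in>trig_poly. \<forall>t. cmod (f t + g t - p t) \<le> e"
    using trig_poly_add[OF p(1) q(1)] by (intro bexI[of _ "\<lambda>t. p t + q t"]) auto
qed

lemma UAP_cnj:
  assumes "f \<in> UAP" shows "(\<lambda>t. cnj (f t)) \<in> UAP"
  unfolding UAP_def
proof (intro CollectI allI impI)
  fix e :: real assume e: "e > 0"
  obtain p where p: "p \<in> trig_poly" "\<And>t. cmod (f t - p t) \<le> e" using UAP_approx[OF assms e] by auto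
  have "cmod (cnj (f t) - cnj (p t)) \<le> e" for t
    using p(2)[of t] by (metis complex_cnj_diff complex_mod_cnj)
  then show "\<exists>p\<in>trig_poly. \<forall>t. cmod (cnj (f t) - p t) \<le> e"
    using trig_poly_cnj[OF p(1)] by (intro bexI[of _ "\<lambda>t. cnj (p t)"]) auto
qed

lemma UAP_mult:
  assumes f: "f \<in> UAP" and g: "g \<in> UAP" shows "(\<lambda>t. f t * g t) \<in> UAP"
  unfolding UAP_def
proof (intro CollectI allI impI)
  fix e :: real assume e: "e > 0"
  obtain K where K: "\<And>t. cmod (f t) \<le> K" "K > 0" using UAP_bounded[OF f] by blast
  \<comment> \<open>The approximant q of g comes first, since its bound J fixes the tolerance for
    p.\<close>
  obtain q where q: "q \<in> trig_poly" "\<And>t. cmod (g t - q t) \<le> e / (2 * K)"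
    using UAP_approx[OF g, of "e / (2 * K)"] e K by auto
  obtain J where J: "\<And>t. cmod (q t) \<le> J" "J > 0" using UAP_bounded[OF trig_poly_UAP[OF q(1)]] by blast
  obtain p where p: "p \<in> trig_poly" "\<And>t. cmod (f t - p t) \<le> e / (2 * J)"
    using UAP_approx[OF f, of "e / (2 * J)"] e J by auto
  have "cmod (f t * g t - p t * q t) \<le> e" for t
  proof -
    have "f t * g t - p t * q t = f t * (g t - q t) + (f t - p t) * q t" by (simp add: algebra_simps)
    also have "cmod \<dots> \<le> K * (e / (2 * K)) + (e / (2 * J)) * J"
      by (rule order_trans[OF norm_triangle_ineq])
        (unfold norm_mult, use K J e in \<open>intro add_mono mult_mono K(1) J(1) p(2) q(2) norm_ge_zero, auto\<close>)
    also have "\<dots> = e" using K J by simp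
    finally show ?thesis .
  qed
  then show "\<exists>p\<in>trig_poly. \<forall>t. cmod (f t * g t - p t) \<le> e"
    using trig_poly_mult[OF p(1) q(1)] by (intro bexI[of _ "\<lambda>t. p t * q t"]) auto
qed

lemma UAP_scale: "f \<in> UAP \<Longrightarrow> (\<lambda>t. c * f t) \<in> UAP"
  using UAP_mult[of "\<lambda>_. c" f] trig_poly_UAP[of "\<lambda>_. c"] trig_poly_in_const[of UNIV c] by (simp add: trig_poly_eq)

lemma UAP_diff: "f \<in> UAP \<Longrightarrow> g \<in> UAP \<Longrightarrow> (\<lambda>t. f t - g t) \<in> UAP"
  using UAP_add[OF _ UAP_scale[of g "-1"], of f] by simp

lemma UAP_inner: "f \<in> UAP \<Longrightarrow> g \<in> UAP \<Longrightarrow> (\<lambda>t. f t * cnj (g t)) \<in> UAP"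
  by (intro UAP_mult UAP_cnj)

section \<open>Mean values\<close>

definition avg :: "(real \<Rightarrow> complex) \<Rightarrow> real \<Rightarrow> complex" where
  "avg f T = (LINT t:{-T..T}|lebesgue. f t) / of_real (2 * T)"

definition mean :: "(real \<Rightarrow> complex) \<Rightarrow> complex" where
  "mean f = Lim at_top (avg f)"

lemma AP_inner_eq_mean: "AP_inner f g = mean (\<lambda>t. f t * cnj (g t))"
  unfolding AP_inner_def mean_def avg_def ..

lemma avg_integral:
  assumes "\<And>S. continuous_on S f"
  shows "avg f T = integral {-T..T} f / of_real (2 * T)"
  unfolding avg_def
  using set_lebesgue_integral_eq_integral(2)[OF absolutely_integrable_continuous_real[OF assms, of "-T" T]] by simp

lemma avg_add:
  assumes f: "\<And>S. continuous_on S f" and g: "\<And>S. continuous_on S g"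
  shows "avg (\<lambda>t. f t + g t) T = avg f T + avg g T"
proof -
  have "integral {-T..T} (\<lambda>t. f t + g t) = integral {-T..T} f + integral {-T..T} g"
    by (intro integral_add integrable_continuous_real f g)
  then show ?thesis
    by (subst (1 2 3) avg_integral) (auto intro!: continuous_intros f g simp: add_divide_distrib)
qed

lemma avg_scale:
  assumes f: "\<And>S. continuous_on S f"
  shows "avg (\<lambda>t. c * f t) T = c * avg f T"
  by (subst (1 2) avg_integral) (auto intro!: continuous_intros f)

lemma avg_bound:
  assumes f: "\<And>S. continuous_on S f" and K: "\<And>t. cmod (f t) \<le> K" and T: "T > 0"
  shows "cmod (avg f T) \<le> K"
proof -
  have "norm (integral {-T..T} f) \<le> K * (T - (-T))"
    by (rule integral_bound) (use T K f in auto)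
  then show ?thesis using T by (subst avg_integral[OF f]) (simp add: norm_divide field_simps)
qed

lemma avg_e_fun: "(avg (e_fun \<mu>) \<longlongrightarrow> (if \<mu> = 0 then 1 else 0)) at_top"
proof (cases "\<mu> = 0")
  case True
  have "\<forall>\<^sub>F T in at_top. 1 = avg (e_fun \<mu>) T"
    using eventually_gt_at_top[of 0]
  proof eventually_elim
    case (elim T)
    then show ?case
      by (subst avg_integral[OF trig_poly_continuous[OF e_fun_trig_poly]]) (simp add: True e_fun_def scaleR_conv_of_real)
  qed
  with True show ?thesis by (simp add: tendsto_eventually eventually_mono[OF _ sym])
next
  case False
  have "cmod (avg (e_fun \<mu>) T) \<le> 1 / \<bar>\<mu>\<bar> * inverse T" if T: "T > 0" for T
  proof -
    have "((\<lambda>t. cis (\<mu> * t)) has_integral cis (\<mu> * T) / (\<i> * \<mu>) - cis (\<mu> * (-T)) / (\<i> * \<mu>)) {-T..T}"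
      using T False
      by (intro fundamental_theorem_of_calculus)
         (auto simp: cis_conv_exp mult_ac intro!: derivative_eq_intros has_vector_derivative_real_field simp flip: has_real_derivative_iff_has_vector_derivative)
    then have "integral {-T..T} (e_fun \<mu>) = (cis (\<mu> * T) - cis (- (\<mu> * T))) / (\<i> * \<mu>)"
      by (simp add: e_fun_def integral_unique diff_divide_distrib)
    moreover have "cmod (cis (\<mu> * T) - cis (- (\<mu> * T))) \<le> 2"
      using norm_triangle_ineq4[of "cis (\<mu> * T)" "cis (- (\<mu> * T))"] by simp
    ultimately have "cmod (integral {-T..T} (e_fun \<mu>)) \<le> 2 / \<bar>\<mu>\<bar>"
      by (simp add: norm_divide norm_mult divide_right_mono)
    then show ?thesis
      using T False by (subst avg_integral[OF trig_poly_continuous[OF e_fun_trig_poly]]) (simp add: norm_divide norm_mult field_simps)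
  qed
  then have "\<forall>\<^sub>F T in at_top. norm (avg (e_fun \<mu>) T) \<le> 1 / \<bar>\<mu>\<bar> * inverse T"
    by (rule eventually_mono[OF eventually_gt_at_top])
  moreover have "((\<lambda>T::real. 1 / \<bar>\<mu>\<bar> * inverse T) \<longlongrightarrow> 1 / \<bar>\<mu>\<bar> * 0) at_top"
    by (intro tendsto_mult tendsto_const tendsto_inverse_0_at_top filterlim_ident)
  ultimately show ?thesis using False by (simp add: Lim_null_comparison)
qed

lemma avg_trig_poly_converges:
  assumes "p \<in> trig_poly" shows "\<exists>L. (avg p \<longlongrightarrow> L) at_top"
proof -
  obtain M c where M: "finite M" "p = (\<lambda>t. \<Sum>\<mu>\<in>M. c \<mu> * e_fun \<mu> t)"
    using assms unfolding trig_poly_def by blast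
  have cont: "continuous_on S (\<lambda>t. \<Sum>\<mu>\<in>N. c \<mu> * e_fun \<mu> t)" for S N
    unfolding e_fun_def cis_conv_exp by (intro continuous_intros)
  have "avg (\<lambda>t. \<Sum>\<mu>\<in>M. c \<mu> * e_fun \<mu> t) T = (\<Sum>\<mu>\<in>M. c \<mu> * avg (e_fun \<mu>) T)" for T
    using M(1)
  proof (induction M)
    case empty
    show ?case by (simp add: avg_def)
  next
    case (insert x F)
    have "avg (\<lambda>t. c x * e_fun x t + (\<Sum>\<mu>\<in>F. c \<mu> * e_fun \<mu> t)) T = avg (\<lambda>t. c x * e_fun x t) T + avg (\<lambda>t. \<Sum>\<mu>\<in>F. c \<mu> * e_fun \<mu> t) T"
      by (intro avg_add cont continuous_on_mult continuous_on_const trig_poly_continuous e_fun_trig_poly)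
    then show ?case using insert
      by (simp add: avg_scale[OF trig_poly_continuous[OF e_fun_trig_poly]])
  qed
  then have "avg p = (\<lambda>T. \<Sum>\<mu>\<in>M. c \<mu> * avg (e_fun \<mu>) T)" by (simp add: M fun_eq_iff)
  then have "(avg p \<longlongrightarrow> (\<Sum>\<mu>\<in>M. c \<mu> * (if \<mu> = 0 then 1 else 0))) at_top"
    by (simp only:) (intro tendsto_sum tendsto_mult tendsto_const avg_e_fun)
  then show ?thesis by blast
qed

text \<open>The mean exists for polynomials by \<open>avg_e_fun\<close>, and the averages of f and
  of a uniform approximant differ by at most the uniform distance; the Cauchy criterion does the
  rest.\<close>

lemma tendsto_mean:
  assumes f: "f \<in> UAP" shows "(avg f \<longlongrightarrow> mean f) at_top"
proof -
  have "\<exists>L. (avg f \<longlongrightarrow> L) at_top"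
  proof (rule convergent_of_approximations)
    fix e :: real assume e: "e > 0"
    obtain p where p: "p \<in> trig_poly" "\<And>t. cmod (f t - p t) \<le> e / 2" using UAP_approx[OF f, of "e / 2"] e by auto
    obtain L where L: "(avg p \<longlongrightarrow> L) at_top" using avg_trig_poly_converges[OF p(1)] by blast
    note cont = UAP_continuous[OF UAP_diff[OF f trig_poly_UAP[OF p(1)]]] trig_poly_continuous[OF p(1)]
    have "\<forall>\<^sub>F T in at_top. dist (avg p T) L < e / 2" using tendstoD[OF L, of "e / 2"] e by simp
    then have "\<forall>\<^sub>F T in at_top. cmod (avg f T - L) \<le> e"
      using eventually_gt_at_top[of 0]
    proof eventually_elim
      case (elim T)
      have "avg f T = avg (\<lambda>t. (f t - p t) + p t) T" by simp
      also have "\<dots> = avg (\<lambda>t. f t - p t) T + avg p T"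
        by (intro avg_add cont)
      finally have *: "avg f T - L = avg (\<lambda>t. f t - p t) T + (avg p T - L)" by simp
      then show ?case
        using norm_triangle_ineq[of "avg (\<lambda>t. f t - p t) T" "avg p T - L"] avg_bound[OF cont(1) p(2) elim(2)] elim(1)
        unfolding * dist_norm by linarith
    qed
    then show "\<exists>z. \<forall>\<^sub>F x in at_top. cmod (avg f x - z) \<le> e" by blast
  qed simp
  then obtain L where L: "(avg f \<longlongrightarrow> L) at_top" by blast
  have "mean f = L" unfolding mean_def by (rule tendsto_Lim[OF _ L]) simp
  with L show ?thesis by simp
qed

lemma mean_eqI: "(avg f \<longlongrightarrow> L) at_top \<Longrightarrow> mean f = L"
  unfolding mean_def by (intro tendsto_Lim) simp_all

lemma mean_add: "f \<in> UAP \<Longrightarrow> g \<in> UAP \<Longrightarrow> mean (\<lambda>t. f t + g t) = mean f + mean g"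
  by (rule mean_eqI, subst ext[OF avg_add[OF UAP_continuous UAP_continuous]], assumption+) (simp add: tendsto_add tendsto_mean)

lemma mean_scale: "f \<in> UAP \<Longrightarrow> mean (\<lambda>t. c * f t) = c * mean f"
  by (rule mean_eqI, subst ext[OF avg_scale[OF UAP_continuous]], assumption+) (simp add: tendsto_mult tendsto_mean)

lemma mean_e_fun: "mean (e_fun \<mu>) = (if \<mu> = 0 then 1 else 0)"
  by (rule mean_eqI[OF avg_e_fun])

lemma mean_bound:
  assumes f: "f \<in> UAP" and "\<And>t. cmod (f t) \<le> K" shows "cmod (mean f) \<le> K"
proof (rule tendsto_upperbound[OF tendsto_norm[OF tendsto_mean[OF f]]])
  show "\<forall>\<^sub>F T in at_top. cmod (avg f T) \<le> K"
    using eventually_gt_at_top[of 0] by eventually_elim (intro avg_bound UAP_continuous assms)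
qed simp

lemma avg_cnj:
  assumes f: "\<And>S. continuous_on S f"
  shows "avg (\<lambda>t. cnj (f t)) T = cnj (avg f T)"
  by (subst (1 2) avg_integral) (auto intro!: continuous_intros f simp: integral_cnj)

lemma mean_cnj: "f \<in> UAP \<Longrightarrow> mean (\<lambda>t. cnj (f t)) = cnj (mean f)"
  by (rule mean_eqI, subst ext[OF avg_cnj[OF UAP_continuous]], assumption+) (simp add: tendsto_cnj tendsto_mean)

lemma mean_nonneg:
  assumes f: "f \<in> UAP" and "\<And>t. f t = of_real (g t)" "\<And>t. g t \<ge> 0"
  shows "Re (mean f) \<ge> 0"
proof (rule tendsto_lowerbound[OF tendsto_Re[OF tendsto_mean[OF f]]])
  show "\<forall>\<^sub>F T in at_top. Re (avg f T) \<ge> 0"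
    using eventually_gt_at_top[of 0]
  proof eventually_elim
    case (elim T)
    have "Re (integral {-T..T} f) = integral {-T..T} (\<lambda>t. Re (f t))"
      using integral_linear[OF integrable_continuous_real[OF UAP_continuous[OF f]] bounded_linear_Re, of "-T" T]
      by (simp add: o_def)
    also have "\<dots> \<ge> 0" by (intro integral_nonneg integrable_continuous_real continuous_on_Re UAP_continuous f) (simp add: assms)
    finally show ?case using elim by (subst avg_integral[OF UAP_continuous[OF f]]) (simp add: Re_divide_of_real)
  qed
qed simp

section \<open>Inner product and seminorm given by the mean value\<close>

lemma AP_inner_cnj: "f \<in> UAP \<Longrightarrow> g \<in> UAP \<Longrightarrow> AP_inner g f = cnj (AP_inner f g)"
  unfolding AP_inner_eq_mean by (subst mean_cnj[symmetric]) (auto intro: UAP_inner simp: mult.commute)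

lemma AP_inner_add_left:
  "f \<in> UAP \<Longrightarrow> g \<in> UAP \<Longrightarrow> h \<in> UAP \<Longrightarrow> AP_inner (\<lambda>t. f t + g t) h = AP_inner f h + AP_inner g h"
  unfolding AP_inner_eq_mean distrib_right by (intro mean_add UAP_inner)

lemma AP_inner_scale_left: "f \<in> UAP \<Longrightarrow> h \<in> UAP \<Longrightarrow> AP_inner (\<lambda>t. c * f t) h = c * AP_inner f h"
  unfolding AP_inner_eq_mean mult.assoc by (intro mean_scale UAP_inner)

lemma AP_inner_diff_left:
  assumes "f \<in> UAP" "g \<in> UAP" "h \<in> UAP"
  shows "AP_inner (\<lambda>t. f t - g t) h = AP_inner f h - AP_inner g h"
  using AP_inner_add_left[OF assms(1) UAP_scale[OF assms(2), of "-1"] assms(3)] AP_inner_scale_left[OF assms(2,3), of "-1"]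
  by simp

lemma AP_inner_diff_right:
  assumes "f \<in> UAP" "g \<in> UAP" "h \<in> UAP"
  shows "AP_inner h (\<lambda>t. f t - g t) = AP_inner h f - AP_inner h g"
  using assms by (simp add: AP_inner_cnj[of _ h] AP_inner_cnj[of h, symmetric] AP_inner_diff_left UAP_diff
     AP_inner_cnj[OF UAP_diff[OF assms(1,2)] assms(3)])

lemma AP_inner_scale_right:
  assumes "f \<in> UAP" "h \<in> UAP"
  shows "AP_inner h (\<lambda>t. c * f t) = cnj c * AP_inner h f"
  unfolding AP_inner_cnj[OF UAP_scale[OF assms(1)] assms(2)] AP_inner_scale_left[OF assms]
    AP_inner_cnj[OF assms] by simp

lemma AP_inner_self:
  assumes "f \<in> UAP"
  shows "AP_inner f f = of_real ((AP_nrm f)\<^sup>2)" and AP_nrm_nonneg: "AP_nrm f \<ge> 0"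
proof -
  have "Re (AP_inner f f) \<ge> 0"
    unfolding AP_inner_eq_mean
    by (rule mean_nonneg[where g = "\<lambda>t. (cmod (f t))\<^sup>2"])
       (use assms in \<open>auto intro: UAP_inner simp: complex_norm_square simp del: of_real_power\<close>)
  moreover have "Im (AP_inner f f) = 0"
    using AP_inner_cnj[OF assms assms] by (simp add: complex_eq_iff)
  ultimately show "AP_inner f f = of_real ((AP_nrm f)\<^sup>2)" "AP_nrm f \<ge> 0"
    unfolding AP_nrm_def by (simp_all add: complex_eq_iff)
qed

lemma AP_nrm_square: "f \<in> UAP \<Longrightarrow> (AP_nrm f)\<^sup>2 = Re (AP_inner f f)"
  by (simp add: AP_inner_self)

lemma AP_nrm_diff_square:
  assumes f: "f \<in> UAP" and g: "g \<in> UAP"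
  shows "(AP_nrm (\<lambda>t. f t - z * g t))\<^sup>2 = (AP_nrm f)\<^sup>2 - 2 * Re (cnj z * AP_inner f g) + (cmod z)\<^sup>2 * (AP_nrm g)\<^sup>2"
proof -
  note zg = UAP_scale[OF g, of z]
  have "AP_inner (\<lambda>t. f t - z * g t) (\<lambda>t. f t - z * g t)
     = AP_inner f f - cnj z * AP_inner f g - z * AP_inner g f + z * cnj z * AP_inner g g"
    by (simp add: AP_inner_diff_left AP_inner_diff_right UAP_diff f g zg AP_inner_scale_left AP_inner_scale_right algebra_simps)
  also have "\<dots> = AP_inner f f - (cnj z * AP_inner f g + cnj (cnj z * AP_inner f g)) + of_real ((cmod z)\<^sup>2) * AP_inner g g"
    by (simp add: AP_inner_cnj[OF f g] complex_norm_square del: of_real_power)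
  finally show ?thesis
    by (simp add: AP_nrm_square f g zg UAP_diff)
qed

lemma AP_Cauchy_Schwarz:
  assumes f: "f \<in> UAP" and g: "g \<in> UAP"
  shows "cmod (AP_inner f g) \<le> AP_nrm f * AP_nrm g"
proof -
  define a b c where "a = (AP_nrm f)\<^sup>2" "b = (AP_nrm g)\<^sup>2" "c = AP_inner f g"
  \<comment> \<open>The square of the seminorm of f - t c g, with c the inner product of f and g:
    this factor makes the mixed term real and leaves a real quadratic in t.\<close>
  have pos: "0 \<le> a - 2 * t * (cmod c)\<^sup>2 + t\<^sup>2 * (cmod c)\<^sup>2 * b" for t
  proof -
    have "0 \<le> (AP_nrm (\<lambda>s. f s - (of_real t * c) * g s))\<^sup>2" by simp
    also have "\<dots> = a - 2 * Re (of_real t * (c * cnj c)) + t\<^sup>2 * (cmod c)\<^sup>2 * b"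
      unfolding AP_nrm_diff_square[OF f g] a_b_c_def by (simp add: norm_mult power_mult_distrib mult_ac)
    also have "\<dots> = a - 2 * t * (cmod c)\<^sup>2 + t\<^sup>2 * (cmod c)\<^sup>2 * b"
      by (simp add: complex_norm_square[symmetric] del: of_real_power)
    finally show ?thesis .
  qed
  have "(cmod c)\<^sup>2 \<le> a * b"
  proof (cases "b = 0")
    case True
    have "c = 0"
    proof (rule ccontr)
      assume "c \<noteq> 0"
      \<comment> \<open>With b = 0 the quadratic is linear in t, and this t gives it the value
        -1.\<close>
      then have "2 * ((a + 1) / (2 * (cmod c)\<^sup>2)) * (cmod c)\<^sup>2 = a + 1" by simp
      with pos[of "(a + 1) / (2 * (cmod c)\<^sup>2)"] True show False by simp
    qed
    then show ?thesis by (simp add: a_b_c_def)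
  next
    case False
    then have "b > 0" by (simp add: a_b_c_def)
    with pos[of "1 / b"] show ?thesis by (simp add: field_simps power2_eq_square)
  qed
  also have "a * b = (AP_nrm f * AP_nrm g)\<^sup>2" by (simp add: a_b_c_def power_mult_distrib)
  finally show ?thesis
    using f g by (simp add: a_b_c_def power2_le_iff_abs_le AP_nrm_nonneg)
qed

lemma AP_nrm_scale:
  assumes "f \<in> UAP" shows "AP_nrm (\<lambda>t. c * f t) = cmod c * AP_nrm f"
proof -
  have "(AP_nrm (\<lambda>t. c * f t))\<^sup>2 = (cmod c * AP_nrm f)\<^sup>2"
    using assms unfolding AP_nrm_square[OF UAP_scale[OF assms]]
    by (simp add: AP_inner_scale_left AP_inner_scale_right UAP_scale AP_inner_self mult.assoc[symmetric]
        complex_norm_square[symmetric] power_mult_distrib del: of_real_power of_real_mult flip: of_real_mult)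
  then show ?thesis using assms by (simp add: power2_eq_iff_nonneg AP_nrm_nonneg UAP_scale)
qed

lemma AP_nrm_triangle_diff:
  assumes f: "f \<in> UAP" and g: "g \<in> UAP"
  shows "AP_nrm (\<lambda>t. f t - g t) \<le> AP_nrm f + AP_nrm g"
proof -
  have "(AP_nrm (\<lambda>t. f t - g t))\<^sup>2 = (AP_nrm f)\<^sup>2 - 2 * Re (AP_inner f g) + (AP_nrm g)\<^sup>2"
    using AP_nrm_diff_square[OF f g, of 1] by simp
  also have "\<dots> \<le> (AP_nrm f)\<^sup>2 + 2 * (AP_nrm f * AP_nrm g) + (AP_nrm g)\<^sup>2"
    using AP_Cauchy_Schwarz[OF f g] abs_Re_le_cmod[of "AP_inner f g"] by linarith
  also have "\<dots> = (AP_nrm f + AP_nrm g)\<^sup>2" by (simp add: power2_eq_square algebra_simps)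
  finally show ?thesis
    using f g by (simp add: power2_le_iff_abs_le AP_nrm_nonneg)
qed

lemma AP_nrm_minus_commute:
  assumes f: "f \<in> UAP" and g: "g \<in> UAP"
  shows "AP_nrm (\<lambda>t. f t - g t) = AP_nrm (\<lambda>t. g t - f t)"
  using AP_nrm_scale[OF UAP_diff[OF f g], of "-1"] by simp

lemma AP_nrm_triangle3:
  assumes f: "f \<in> UAP" and g: "g \<in> UAP" and h: "h \<in> UAP"
  shows "AP_nrm (\<lambda>t. f t - h t) \<le> AP_nrm (\<lambda>t. f t - g t) + AP_nrm (\<lambda>t. g t - h t)"
  using AP_nrm_triangle_diff[OF UAP_diff[OF f g] UAP_diff[OF h g]] AP_nrm_minus_commute[OF g h] by simp

lemma AP_nrm_diff_abs:
  assumes f: "f \<in> UAP" and g: "g \<in> UAP"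
  shows "\<bar>AP_nrm f - AP_nrm g\<bar> \<le> AP_nrm (\<lambda>t. f t - g t)"
proof -
  have 0: "(\<lambda>t. 0) \<in> UAP" using UAP_scale[OF f, of 0] by simp
  show ?thesis
    using AP_nrm_triangle3[OF f g 0] AP_nrm_triangle3[OF g f 0] AP_nrm_minus_commute[OF f g] by simp
qed

lemma AP_nrm_le_bound:
  assumes f: "f \<in> UAP" and K: "\<And>t. cmod (f t) \<le> K"
  shows "AP_nrm f \<le> K"
proof -
  have K0: "K \<ge> 0" using K[of 0] norm_ge_zero order_trans by blast
  have "cmod (AP_inner f f) \<le> K\<^sup>2"
    unfolding AP_inner_eq_mean
    by (rule mean_bound[OF UAP_inner[OF f f]]) (auto simp: norm_mult power2_eq_square intro!: mult_mono K K0)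
  then have "(AP_nrm f)\<^sup>2 \<le> K\<^sup>2" using f by (simp add: AP_inner_self del: of_real_power)
  then show ?thesis using K0 f by (simp add: power2_le_iff_abs_le AP_nrm_nonneg)
qed

lemma mean_zero: "mean (\<lambda>t. 0) = 0"
  by (rule mean_eqI) (simp add: avg_def[abs_def])

lemma mean_sum:
  assumes "\<And>i. i \<in> I \<Longrightarrow> f i \<in> UAP"
  shows "mean (\<lambda>t. \<Sum>i\<in>I. f i t) = (\<Sum>i\<in>I. mean (f i)) \<and> (\<lambda>t. \<Sum>i\<in>I. f i t) \<in> UAP"
  using assms
proof (induction I rule: infinite_finite_induct)
  case (insert x F)
  then have "f x \<in> UAP" "(\<lambda>t. \<Sum>i\<in>F. f i t) \<in> UAP" by auto
  then show ?case using insert by (simp add: mean_add UAP_add)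
qed (auto simp: trig_poly_UAP trig_poly_eq trig_poly_in_zero mean_zero)

text \<open>A polynomial is coded by its coefficient function, with the support as index set.
  Coefficients are then unique, and \<open>fiber\<close> and all norms can be written in terms of
  \<open>c\<close>.\<close>

definition tp :: "(real \<Rightarrow> complex) \<Rightarrow> real \<Rightarrow> complex" where
  "tp c = (\<lambda>t. \<Sum>\<mu> | c \<mu> \<noteq> 0. c \<mu> * e_fun \<mu> t)"

abbreviation finsupp :: "(real \<Rightarrow> complex) \<Rightarrow> bool" where
  "finsupp c \<equiv> finite {\<mu>. c \<mu> \<noteq> 0}"

lemma tp_eq_sum:
  assumes "finite M" "{\<mu>. c \<mu> \<noteq> 0} \<subseteq> M"
  shows "tp c = (\<lambda>t. \<Sum>\<mu>\<in>M. c \<mu> * e_fun \<mu> t)"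
  unfolding tp_def using assms by (intro ext sum.mono_neutral_left) auto

lemma finsupp_diff: "finsupp c \<Longrightarrow> finsupp d \<Longrightarrow> finsupp (\<lambda>\<mu>. c \<mu> - d \<mu>)"
  by (rule finite_subset[of _ "{\<mu>. c \<mu> \<noteq> 0} \<union> {\<mu>. d \<mu> \<noteq> 0}"]) auto

lemma tp_diff:
  assumes "finsupp c" "finsupp d"
  shows "tp (\<lambda>\<mu>. c \<mu> - d \<mu>) = (\<lambda>t. tp c t - tp d t)"
proof -
  let ?M = "{\<mu>. c \<mu> \<noteq> 0} \<union> {\<mu>. d \<mu> \<noteq> 0}"
  have M: "finite ?M" using assms by simp
  show ?thesis
    by (subst (1 2 3) tp_eq_sum[OF M]) (auto simp: sum_subtractf left_diff_distrib)
qed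

lemma trig_poly_iff_tp: "p \<in> trig_poly \<longleftrightarrow> (\<exists>c. finsupp c \<and> p = tp c)"
proof
  assume "p \<in> trig_poly"
  then obtain M c where M: "finite M" "p = (\<lambda>t. \<Sum>\<mu>\<in>M. c \<mu> * e_fun \<mu> t)"
    unfolding trig_poly_def by blast
  let ?c = "\<lambda>\<mu>. if \<mu> \<in> M then c \<mu> else 0"
  have "tp ?c = p" using M by (subst tp_eq_sum[of M]) (auto intro!: ext sum.cong)
  moreover have "finsupp ?c" by (rule finite_subset[OF _ M(1)]) auto
  ultimately show "\<exists>c. finsupp c \<and> p = tp c" by (intro exI[of _ ?c]) auto
qed (auto simp: trig_poly_def tp_def)

lemma tp_trig_poly: "finsupp c \<Longrightarrow> tp c \<in> trig_poly"
  using trig_poly_iff_tp by blast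

lemma tp_UAP: "finsupp c \<Longrightarrow> tp c \<in> UAP"
  by (intro trig_poly_UAP tp_trig_poly)

lemma e_fun_UAP: "e_fun \<mu> \<in> UAP"
  by (intro trig_poly_UAP e_fun_trig_poly)

lemma AP_inner_tp_right:
  assumes f: "f \<in> UAP" and M: "finite M" "{\<mu>. d \<mu> \<noteq> 0} \<subseteq> M"
  shows "AP_inner f (tp d) = (\<Sum>\<mu>\<in>M. cnj (d \<mu>) * AP_inner f (e_fun \<mu>))"
proof -
  have "AP_inner f (tp d) = mean (\<lambda>t. \<Sum>\<mu>\<in>M. cnj (d \<mu>) * (f t * cnj (e_fun \<mu> t)))"
    unfolding AP_inner_eq_mean tp_eq_sum[OF M] by (simp add: sum_distrib_left mult_ac)
  also have "\<dots> = (\<Sum>\<mu>\<in>M. mean (\<lambda>t. cnj (d \<mu>) * (f t * cnj (e_fun \<mu> t))))"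
    by (rule mean_sum[THEN conjunct1]) (intro UAP_scale UAP_inner f e_fun_UAP)
  also have "\<dots> = (\<Sum>\<mu>\<in>M. cnj (d \<mu>) * AP_inner f (e_fun \<mu>))"
    unfolding AP_inner_eq_mean by (intro sum.cong refl mean_scale UAP_inner f e_fun_UAP)
  finally show ?thesis .
qed

lemma AP_inner_e_fun: "AP_inner (e_fun \<mu>) (e_fun \<nu>) = (if \<mu> = \<nu> then 1 else 0)"
proof -
  have "(\<lambda>t. e_fun \<mu> t * cnj (e_fun \<nu> t)) = e_fun (\<mu> - \<nu>)"
    by (simp add: e_fun_def cis_cnj cis_mult algebra_simps)
  then show ?thesis unfolding AP_inner_eq_mean by (simp add: mean_e_fun)
qed

lemma AP_inner_tp_e_fun:
  assumes "finsupp c" shows "AP_inner (tp c) (e_fun \<mu>) = c \<mu>"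
proof -
  have "AP_inner (e_fun \<mu>) (tp c) = (\<Sum>\<nu> | c \<nu> \<noteq> 0. cnj (c \<nu>) * (if \<mu> = \<nu> then 1 else 0))"
    by (subst AP_inner_tp_right[OF e_fun_UAP assms]) (auto simp: AP_inner_e_fun)
  also have "\<dots> = cnj (c \<mu>)" using assms by (simp add: if_distrib cong: if_cong)
  finally show ?thesis using AP_inner_cnj[OF e_fun_UAP tp_UAP[OF assms], of \<mu>] by simp
qed

lemma AP_inner_tp:
  assumes "finsupp c" "finite M" "{\<mu>. d \<mu> \<noteq> 0} \<subseteq> M"
  shows "AP_inner (tp c) (tp d) = (\<Sum>\<mu>\<in>M. c \<mu> * cnj (d \<mu>))"
  by (subst AP_inner_tp_right[OF tp_UAP assms(2,3)]) (auto simp: assms(1) AP_inner_tp_e_fun mult.commute)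

lemma AP_nrm_tp:
  assumes "finite M" "{\<mu>. c \<mu> \<noteq> 0} \<subseteq> M"
  shows "(AP_nrm (tp c))\<^sup>2 = (\<Sum>\<mu>\<in>M. (cmod (c \<mu>))\<^sup>2)"
proof -
  have c: "finsupp c" using assms finite_subset by blast
  have "AP_inner (tp c) (tp c) = of_real (\<Sum>\<mu>\<in>M. (cmod (c \<mu>))\<^sup>2)"
    by (subst AP_inner_tp[OF c assms]) (simp add: complex_norm_square del: of_real_power)
  then show ?thesis by (simp add: AP_nrm_square tp_UAP c del: of_real_sum)
qed

lemma cmod_cis_diff_le: "cmod (cis x - cis y) \<le> \<bar>x - y\<bar>"
proof -
  have "cis x - cis y = cis y * (exp (\<i> * of_real (x - y)) - 1)"
    by (simp add: cis_conv_exp right_diff_distrib exp_add[symmetric] algebra_simps)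
  then have "cmod (cis x - cis y) = 2 * \<bar>sin ((x - y) / 2)\<bar>"
    by (simp only: norm_mult norm_cis mult_1 dist_exp_i_1)
  then show ?thesis using abs_sin_x_le_abs_x[of "(x - y) / 2"] by simp
qed

text \<open>Pigeonhole: two times at which all frequencies fall into the same cells of a grid of mesh
  \<open>1/n\<close> on the torus differ by an almost period.\<close>

lemma simultaneous_almost_periods:
  assumes M: "finite M" and \<epsilon>: "\<epsilon> > 0"
  shows "\<exists>L>0. \<forall>a b. b - a > L \<longrightarrow> (\<exists>\<tau>\<in>{a<..<b}. \<forall>\<mu>\<in>M. cmod (cis (\<mu> * \<tau>) - 1) \<le> \<epsilon>)"
proof -
  define n where "n = nat \<lceil>2 * pi / \<epsilon>\<rceil> + 1"
  have "real n > 2 * pi / \<epsilon>" unfolding n_def by linarith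
  moreover have "n > 0" by (simp add: n_def)
  ultimately have n: "2 * pi / real n \<le> \<epsilon>" "n > 0"
    using \<epsilon> by (auto simp: field_simps)
  define \<kappa> where "\<kappa> = (\<lambda>t::real. restrict (\<lambda>\<mu>. \<lfloor>real n * frac (\<mu> * t / (2 * pi))\<rfloor>) M)"
  have close: "cmod (cis (\<mu> * (s - t)) - 1) \<le> \<epsilon>" if st: "\<kappa> s = \<kappa> t" "\<mu> \<in> M" for s t \<mu>
  proof -
    have "\<kappa> s \<mu> = \<kappa> t \<mu>" using st by simp
    then have "\<lfloor>real n * frac (\<mu> * s / (2 * pi))\<rfloor> = \<lfloor>real n * frac (\<mu> * t / (2 * pi))\<rfloor>"
      using st by (simp add: \<kappa>_def)
    then have "\<bar>real n * frac (\<mu> * s / (2 * pi)) - real n * frac (\<mu> * t / (2 * pi))\<bar> \<le> 1" by linarith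
    then have "real n * \<bar>frac (\<mu> * s / (2 * pi)) - frac (\<mu> * t / (2 * pi))\<bar> \<le> 1"
      using n(2) by (simp add: right_diff_distrib[symmetric] abs_mult)
    then have fr: "\<bar>frac (\<mu> * s / (2 * pi)) - frac (\<mu> * t / (2 * pi))\<bar> \<le> 1 / real n"
      using n(2) by (simp add: field_simps)
    have cis_frac: "cis (\<mu> * x) = cis (2 * pi * frac (\<mu> * x / (2 * pi)))" for x
    proof -
      have "\<mu> * x = 2 * pi * frac (\<mu> * x / (2 * pi)) + 2 * pi * of_int \<lfloor>\<mu> * x / (2 * pi)\<rfloor>"
        by (simp add: frac_def algebra_simps)
      then have "cis (\<mu> * x) = cis (2 * pi * frac (\<mu> * x / (2 * pi))) * cis (2 * pi * of_int \<lfloor>\<mu> * x / (2 * pi)\<rfloor>)"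
        by (metis cis_mult)
      then show ?thesis by (simp add: cis_multiple_2pi)
    qed
    have "cis (\<mu> * (s - t)) - 1 = cis (- (\<mu> * t)) * (cis (\<mu> * s) - cis (\<mu> * t))"
      by (simp add: right_diff_distrib cis_mult)
    then have "cmod (cis (\<mu> * (s - t)) - 1) = cmod (cis (\<mu> * s) - cis (\<mu> * t))"
      by (simp add: norm_mult)
    also have "\<dots> \<le> \<bar>2 * pi * frac (\<mu> * s / (2 * pi)) - 2 * pi * frac (\<mu> * t / (2 * pi))\<bar>"
      unfolding cis_frac[of s] cis_frac[of t] by (rule cmod_cis_diff_le)
    also have "\<dots> = 2 * pi * \<bar>frac (\<mu> * s / (2 * pi)) - frac (\<mu> * t / (2 * pi))\<bar>"
      by (simp only: right_diff_distrib[symmetric] abs_mult) simp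
    also have "\<dots> \<le> 2 * pi * (1 / real n)" by (intro mult_left_mono fr) simp
    finally show ?thesis using n by simp
  qed
  have "range \<kappa> \<subseteq> (\<Pi>\<^sub>E \<mu>\<in>M. {0..int n})"
  proof
    fix k assume "k \<in> range \<kappa>"
    then obtain t where k: "k = \<kappa> t" by blast
    have "0 \<le> \<lfloor>real n * frac (\<mu> * t / (2 * pi))\<rfloor>" "\<lfloor>real n * frac (\<mu> * t / (2 * pi))\<rfloor> \<le> int n" for \<mu>
    proof -
      have "0 \<le> frac (\<mu> * t / (2 * pi))" "frac (\<mu> * t / (2 * pi)) \<le> 1"
        using frac_lt_1[of "\<mu> * t / (2 * pi)"] by (auto simp: frac_ge_0)
      then have "0 \<le> real n * frac (\<mu> * t / (2 * pi))" "real n * frac (\<mu> * t / (2 * pi)) \<le> real n"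
        by (auto intro: mult_left_le)
      then show "0 \<le> \<lfloor>real n * frac (\<mu> * t / (2 * pi))\<rfloor>" "\<lfloor>real n * frac (\<mu> * t / (2 * pi))\<rfloor> \<le> int n"
        by linarith+
    qed
    then show "k \<in> (\<Pi>\<^sub>E \<mu>\<in>M. {0..int n})" unfolding k \<kappa>_def by auto
  qed
  then have "finite (range \<kappa>)" by (rule finite_subset) (simp add: finite_PiE M)
  then obtain X where X: "finite X" "range \<kappa> = \<kappa> ` X"
    using finite_subset_image[of "range \<kappa>" \<kappa> UNIV] by auto
  \<comment> \<open>Every time shares its cells with one of the finitely many times in
    \<open>X\<close>, all of absolute value at most R. Subtracting that time from the midpoint of
    (a, b) gives an almost period, which lies in the interval once b - a > 2 R + 1.\<close>
  define R where "R = (\<Sum>t\<in>X. \<bar>t\<bar>)"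
  have R: "\<bar>t\<bar> \<le> R" if "t \<in> X" for t
    unfolding R_def using that X by (intro member_le_sum) auto
  have "\<exists>\<tau>\<in>{a<..<b}. \<forall>\<mu>\<in>M. cmod (cis (\<mu> * \<tau>) - 1) \<le> \<epsilon>" if ab: "b - a > 2 * R + 1" for a b
  proof -
    obtain t where t: "t \<in> X" "\<kappa> ((a + b) / 2) = \<kappa> t" using X by (metis imageE rangeI)
    have "(a + b) / 2 - t \<in> {a<..<b}" using R[OF t(1)] ab by (auto simp: field_simps abs_le_iff)
    then show ?thesis using close[OF t(2)] by blast
  qed
  moreover have "R \<ge> 0" unfolding R_def by (rule sum_nonneg) simp
  ultimately show ?thesis by (intro exI[of _ "2 * R + 1"]) auto
qed

text \<open>This allows polynomials as members of the Cauchy sequences that make up the completion.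
  Almost periods common to all frequencies are taken with tolerance \<epsilon> / (C + 1), where C is
  the sum of the moduli of the coefficients.\<close>

lemma trig_poly_AP: "p \<in> trig_poly \<Longrightarrow> p \<in> AP"
proof -
  assume p: "p \<in> trig_poly"
  then obtain M c where M: "finite M" "p = (\<lambda>t. \<Sum>\<mu>\<in>M. c \<mu> * e_fun \<mu> t)"
    unfolding trig_poly_def by blast
  define C where "C = (\<Sum>\<mu>\<in>M. cmod (c \<mu>))"
  have C: "C \<ge> 0" unfolding C_def by (rule sum_nonneg) simp
  show "p \<in> AP"
    unfolding AP_def
  proof (intro CollectI conjI trig_poly_continuous[OF p] allI impI)
    fix \<epsilon> :: real assume \<epsilon>: "\<epsilon> > 0"
    have "\<epsilon> / (C + 1) > 0" using \<epsilon> C by simp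
    from simultaneous_almost_periods[OF M(1) this]
    obtain L where L: "L > 0" "\<And>a b. b - a > L \<Longrightarrow> \<exists>\<tau>\<in>{a<..<b}. \<forall>\<mu>\<in>M. cmod (cis (\<mu> * \<tau>) - 1) \<le> \<epsilon> / (C + 1)"
      by blast
    have "cmod (p (t + \<tau>) - p t) \<le> \<epsilon>" if "\<forall>\<mu>\<in>M. cmod (cis (\<mu> * \<tau>) - 1) \<le> \<epsilon> / (C + 1)" for \<tau> t
    proof -
      have "p (t + \<tau>) - p t = (\<Sum>\<mu>\<in>M. c \<mu> * (cis (\<mu> * t) * (cis (\<mu> * \<tau>) - 1)))"
        unfolding M sum_subtractf[symmetric] by (intro sum.cong refl) (simp add: e_fun_def right_diff_distrib distrib_left cis_mult)
      also have "cmod \<dots> \<le> (\<Sum>\<mu>\<in>M. cmod (c \<mu>) * (\<epsilon> / (C + 1)))"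
        using that by (intro sum_norm_le) (simp only: norm_mult norm_cis mult_1, intro mult_left_mono, auto)
      also have "\<dots> = \<epsilon> * (C / (C + 1))" by (simp only: sum_distrib_right[symmetric]) (simp add: C_def)
      also have "\<dots> \<le> \<epsilon> * 1" using \<epsilon> C by (intro mult_left_mono) auto
      finally show ?thesis by simp
    qed
    then show "\<exists>L>0. \<forall>a b. L < b - a \<longrightarrow> (\<exists>\<tau>\<in>{a<..<b}. \<forall>t. cmod (p (t + \<tau>) - p t) \<le> \<epsilon>)"
      using L by (intro exI[of _ L]) blast
  qed
qed

section \<open>Sums of extended nonnegative reals and perturbation of square sums\<close>

lemma infsum_ennreal_le_iff:
  fixes f :: "'i \<Rightarrow> ennreal"
  shows "infsum f A \<le> c \<longleftrightarrow> (\<forall>F. finite F \<longrightarrow> F \<subseteq> A \<longrightarrow> sum f F \<le> c)"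
  by (subst nonneg_infsum_complete) (auto simp: SUP_le_iff)

lemma sum_le_infsum_ennreal:
  fixes f :: "'i \<Rightarrow> ennreal"
  shows "finite F \<Longrightarrow> F \<subseteq> A \<Longrightarrow> sum f F \<le> infsum f A"
  using infsum_ennreal_le_iff[of f A "infsum f A"] by blast

lemma infsum_mono_ennreal:
  fixes f g :: "'i \<Rightarrow> ennreal"
  shows "(\<And>i. i \<in> A \<Longrightarrow> f i \<le> g i) \<Longrightarrow> infsum f A \<le> infsum g A"
  by (rule infsum_mono) (simp_all add: nonneg_summable_on_complete)

lemma infsum_le_ennreal_real:
  fixes a :: "'i \<Rightarrow> real"
  assumes "\<And>i. a i \<ge> 0" "c \<ge> 0"
  shows "(\<Sum>\<^sub>\<infinity>i\<in>A. ennreal (a i)) \<le> ennreal c \<longleftrightarrow> (\<forall>F. finite F \<longrightarrow> F \<subseteq> A \<longrightarrow> sum a F \<le> c)"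
  unfolding infsum_ennreal_le_iff using assms
  by (simp add: sum_ennreal ennreal_le_iff)

text \<open>Tonelli for sums: a finite set of pairs lies in the product of its two projections, and
  conversely finitely many rows add up to the sum over a part of the product.\<close>

lemma infsum_ennreal_Sigma:
  fixes f :: "'i \<Rightarrow> 'j \<Rightarrow> ennreal"
  shows "(\<Sum>\<^sub>\<infinity>(i, j)\<in>A \<times> B. f i j) = (\<Sum>\<^sub>\<infinity>i\<in>A. \<Sum>\<^sub>\<infinity>j\<in>B. f i j)"
proof (rule antisym)
  show "(\<Sum>\<^sub>\<infinity>(i, j)\<in>A \<times> B. f i j) \<le> (\<Sum>\<^sub>\<infinity>i\<in>A. \<Sum>\<^sub>\<infinity>j\<in>B. f i j)"
    unfolding infsum_ennreal_le_iff[of _ "A \<times> B"]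
  proof (intro allI impI)
    fix F assume F: "finite F" "F \<subseteq> A \<times> B"
    have "(\<Sum>(i, j)\<in>F. f i j) \<le> (\<Sum>(i, j)\<in>fst ` F \<times> snd ` F. f i j)"
      using F by (intro sum_mono2) (auto intro: rev_image_eqI)
    also have "\<dots> = (\<Sum>i\<in>fst ` F. \<Sum>j\<in>snd ` F. f i j)"
      by (simp add: sum.cartesian_product)
    also have "\<dots> \<le> (\<Sum>i\<in>fst ` F. \<Sum>\<^sub>\<infinity>j\<in>B. f i j)"
      using F by (intro sum_mono sum_le_infsum_ennreal) auto
    also have "\<dots> \<le> (\<Sum>\<^sub>\<infinity>i\<in>A. \<Sum>\<^sub>\<infinity>j\<in>B. f i j)"
      using F by (intro sum_le_infsum_ennreal) auto
    finally show "(\<Sum>(i, j)\<in>F. f i j) \<le> (\<Sum>\<^sub>\<infinity>i\<in>A. \<Sum>\<^sub>\<infinity>j\<in>B. f i j)" .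
  qed
  show "(\<Sum>\<^sub>\<infinity>i\<in>A. \<Sum>\<^sub>\<infinity>j\<in>B. f i j) \<le> (\<Sum>\<^sub>\<infinity>(i, j)\<in>A \<times> B. f i j)"
    unfolding infsum_ennreal_le_iff[of _ A]
  proof (intro allI impI)
    fix F assume F: "finite F" "F \<subseteq> A"
    have "(\<Sum>i\<in>F. \<Sum>\<^sub>\<infinity>j\<in>B. f i j) = (\<Sum>\<^sub>\<infinity>(i, j)\<in>F \<times> B. f i j)"
      using F(1)
    proof induction
      case (insert x F)
      have "(\<Sum>\<^sub>\<infinity>(i, j)\<in>{x} \<times> B. f i j) = (\<Sum>\<^sub>\<infinity>j\<in>B. f x j)"
      proof -
        have "bij_betw (Pair x) B ({x} \<times> B)" by (auto simp: bij_betw_def inj_on_def)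
        from infsum_reindex_bij_betw[OF this, of "\<lambda>(i, j). f i j"] show ?thesis by simp
      qed
      moreover have "insert x F \<times> B = {x} \<times> B \<union> F \<times> B" by auto
      moreover have "(\<Sum>\<^sub>\<infinity>(i, j)\<in>{x} \<times> B \<union> F \<times> B. f i j) = (\<Sum>\<^sub>\<infinity>(i, j)\<in>{x} \<times> B. f i j) + (\<Sum>\<^sub>\<infinity>(i, j)\<in>F \<times> B. f i j)"
        using insert.hyps by (intro infsum_Un_disjoint) (auto simp: nonneg_summable_on_complete)
      ultimately show ?case using insert by simp
    qed simp
    also have "\<dots> \<le> (\<Sum>\<^sub>\<infinity>(i, j)\<in>A \<times> B. f i j)"
      using F by (intro infsum_mono_neutral) (auto simp: nonneg_summable_on_complete)
    finally show "(\<Sum>i\<in>F. \<Sum>\<^sub>\<infinity>j\<in>B. f i j) \<le> (\<Sum>\<^sub>\<infinity>(i, j)\<in>A \<times> B. f i j)" .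
  qed
qed

lemma infsum_ennreal_swap:
  fixes f :: "'i \<Rightarrow> 'j \<Rightarrow> ennreal"
  shows "(\<Sum>\<^sub>\<infinity>(i, j)\<in>A \<times> B. f i j) = (\<Sum>\<^sub>\<infinity>j\<in>B. \<Sum>\<^sub>\<infinity>i\<in>A. f i j)"
  unfolding infsum_ennreal_Sigma[of "\<lambda>j i. f i j" B A, symmetric]
proof -
  have "bij_betw (\<lambda>(j, i). (i, j)) (B \<times> A) (A \<times> B)"
    by (rule bij_betwI[where g = "\<lambda>(i, j). (j, i)"]) auto
  from infsum_reindex_bij_betw[OF this, of "\<lambda>(i, j). f i j"]
  show "(\<Sum>\<^sub>\<infinity>(i, j)\<in>A \<times> B. f i j) = (\<Sum>\<^sub>\<infinity>(j, i)\<in>B \<times> A. f i j)"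
    by (simp add: split_def)
qed

lemma cmod_square_le_double: "(cmod a)\<^sup>2 \<le> 2 * (cmod b)\<^sup>2 + 2 * (cmod (a - b))\<^sup>2"
proof -
  have "(cmod a)\<^sup>2 \<le> (cmod b + cmod (a - b))\<^sup>2"
    using norm_triangle_ineq[of b "a - b"] by (intro power_mono) auto
  also have "\<dots> \<le> 2 * (cmod b)\<^sup>2 + 2 * (cmod (a - b))\<^sup>2"
    using zero_le_power2[of "cmod b - cmod (a - b)"] by (simp add: power2_eq_square algebra_simps)
  finally show ?thesis .
qed

text \<open>Takes the place of the triangle inequality in l2, at the price of a factor 2; closeness
  is expressed by finite partial sums. The empty sum shows \<eta> \<ge> 0.\<close>

lemma infsum_square_perturb:
  fixes a b :: "'i \<Rightarrow> complex"
  assumes "\<And>F. finite F \<Longrightarrow> F \<subseteq> A \<Longrightarrow> (\<Sum>i\<in>F. (cmod (a i - b i))\<^sup>2) \<le> \<eta>"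
  shows "(\<Sum>\<^sub>\<infinity>i\<in>A. ennreal ((cmod (a i))\<^sup>2)) \<le> 2 * (\<Sum>\<^sub>\<infinity>i\<in>A. ennreal ((cmod (b i))\<^sup>2)) + ennreal (2 * \<eta>)"
  unfolding infsum_ennreal_le_iff[of "\<lambda>i. ennreal ((cmod (a i))\<^sup>2)"]
proof (intro allI impI)
  fix F assume F: "finite F" "F \<subseteq> A"
  have "(\<Sum>i\<in>F. ennreal ((cmod (a i))\<^sup>2)) = ennreal (\<Sum>i\<in>F. (cmod (a i))\<^sup>2)" by (simp add: sum_ennreal)
  also have "(\<Sum>i\<in>F. (cmod (a i))\<^sup>2) \<le> (\<Sum>i\<in>F. 2 * (cmod (b i))\<^sup>2 + 2 * (cmod (a i - b i))\<^sup>2)"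
    by (intro sum_mono cmod_square_le_double)
  also have "\<dots> = 2 * (\<Sum>i\<in>F. (cmod (b i))\<^sup>2) + 2 * (\<Sum>i\<in>F. (cmod (a i - b i))\<^sup>2)"
    by (simp add: sum.distrib sum_distrib_left)
  also have "\<dots> \<le> 2 * (\<Sum>i\<in>F. (cmod (b i))\<^sup>2) + 2 * \<eta>" using assms[OF F] by simp
  also have "ennreal \<dots> \<le> ennreal (2 * (\<Sum>i\<in>F. (cmod (b i))\<^sup>2)) + ennreal (2 * \<eta>)"
    using assms[of "{}"] by (simp add: ennreal_plus sum_nonneg)
  also have "ennreal (2 * (\<Sum>i\<in>F. (cmod (b i))\<^sup>2)) = 2 * (\<Sum>i\<in>F. ennreal ((cmod (b i))\<^sup>2))"
    by (simp add: sum_ennreal ennreal_mult sum_nonneg)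
  also have "\<dots> \<le> 2 * (\<Sum>\<^sub>\<infinity>i\<in>A. ennreal ((cmod (b i))\<^sup>2))"
    by (intro mult_left_mono sum_le_infsum_ennreal F) simp
  finally show "(\<Sum>i\<in>F. ennreal ((cmod (a i))\<^sup>2)) \<le> 2 * (\<Sum>\<^sub>\<infinity>i\<in>A. ennreal ((cmod (b i))\<^sup>2)) + ennreal (2 * \<eta>)"
    by (simp add: add_right_mono ennreal_leI)
qed

lemma sum_square_diff_limit:
  fixes \<theta> :: "nat \<Rightarrow> 'i \<Rightarrow> complex"
  assumes "\<And>i. i \<in> F \<Longrightarrow> (\<lambda>n. \<theta> n i) \<longlonglongrightarrow> \<theta>' i" and "\<And>m. m \<ge> N \<Longrightarrow> (\<Sum>i\<in>F. (cmod (b i - \<theta> m i))\<^sup>2) \<le> \<eta>"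
  shows "(\<Sum>i\<in>F. (cmod (b i - \<theta>' i))\<^sup>2) \<le> \<eta>"
proof (rule tendsto_upperbound)
  show "(\<lambda>m. \<Sum>i\<in>F. (cmod (b i - \<theta> m i))\<^sup>2) \<longlonglongrightarrow> (\<Sum>i\<in>F. (cmod (b i - \<theta>' i))\<^sup>2)"
    by (intro tendsto_intros assms)
qed (use assms(2) in \<open>auto simp: eventually_sequentially\<close>)

section \<open>The completion\<close>

lemma AP_CauchyD: "u \<in> AP_Cauchy \<Longrightarrow> u n \<in> UAP"
  unfolding AP_Cauchy_def using AP_subset_UAP by auto

lemma AP_Cauchy_diff_le:
  assumes u: "u \<in> AP_Cauchy" and e: "e > 0"
  obtains N where "\<And>m n. m \<ge> N \<Longrightarrow> n \<ge> N \<Longrightarrow> AP_nrm (\<lambda>t. u m t - u n t) \<le> e"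
proof -
  obtain N where "\<forall>m\<ge>N. \<forall>n\<ge>N. AP_nrm (\<lambda>t. u m t - u n t) < e"
    using u e unfolding AP_Cauchy_def by blast
  then show ?thesis by (intro that[of N]) (auto intro: less_imp_le)
qed

lemma AP_nrm_Cauchy_converges:
  assumes u: "u \<in> AP_Cauchy" shows "convergent (\<lambda>n. AP_nrm (u n))"
proof (rule Cauchy_convergent, rule metric_CauchyI)
  fix e :: real assume e: "e > 0"
  obtain N where N: "\<And>m n. m \<ge> N \<Longrightarrow> n \<ge> N \<Longrightarrow> AP_nrm (\<lambda>t. u m t - u n t) \<le> e / 2"
    using AP_Cauchy_diff_le[OF u, of "e / 2"] e by auto
  show "\<exists>M. \<forall>m\<ge>M. \<forall>n\<ge>M. dist (AP_nrm (u m)) (AP_nrm (u n)) < e"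
  proof (intro exI allI impI)
    fix m n assume "m \<ge> N" "n \<ge> N"
    then show "dist (AP_nrm (u m)) (AP_nrm (u n)) < e"
      using AP_nrm_diff_abs[OF AP_CauchyD[OF u, of m] AP_CauchyD[OF u, of n]] N[of m n] e by (simp add: dist_real_def)
  qed
qed

lemma AP_nrm_Cauchy_bounded:
  assumes u: "u \<in> AP_Cauchy" obtains K where "\<And>n. AP_nrm (u n) \<le> K" "K > 0"
proof -
  obtain K where K: "K > 0" "\<And>n. norm (AP_nrm (u n)) \<le> K"
    using convergent_imp_Bseq[OF AP_nrm_Cauchy_converges[OF u]] by (auto elim: BseqE)
  show ?thesis by (rule that[OF _ K(1)]) (use K(2) in \<open>auto simp: abs_le_iff\<close>)
qed

lemma AP_inner_diff_bound:
  assumes "f \<in> UAP" "g \<in> UAP" "f' \<in> UAP" "g' \<in> UAP"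
  shows "cmod (AP_inner f g - AP_inner f' g') \<le> AP_nrm (\<lambda>t. f t - f' t) * AP_nrm g + AP_nrm f' * AP_nrm (\<lambda>t. g t - g' t)"
proof -
  have "AP_inner f g - AP_inner f' g' = AP_inner (\<lambda>t. f t - f' t) g + AP_inner f' (\<lambda>t. g t - g' t)"
    by (simp add: AP_inner_diff_left AP_inner_diff_right assms)
  also have "cmod \<dots> \<le> AP_nrm (\<lambda>t. f t - f' t) * AP_nrm g + AP_nrm f' * AP_nrm (\<lambda>t. g t - g' t)"
    by (intro order_trans[OF norm_triangle_ineq] add_mono AP_Cauchy_Schwarz UAP_diff assms)
  finally show ?thesis .
qed

lemma AP_inner_Cauchy_converges:
  assumes u: "u \<in> AP_Cauchy" and v: "v \<in> AP_Cauchy"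
  shows "convergent (\<lambda>n. AP_inner (u n) (v n))"
proof (rule Cauchy_convergent, rule metric_CauchyI)
  fix e :: real assume e: "e > 0"
  obtain K where K: "\<And>n. AP_nrm (u n) \<le> K" "K > 0" using AP_nrm_Cauchy_bounded[OF u] by blast
  obtain J where J: "\<And>n. AP_nrm (v n) \<le> J" "J > 0" using AP_nrm_Cauchy_bounded[OF v] by blast
  obtain N where N: "\<And>m n. m \<ge> N \<Longrightarrow> n \<ge> N \<Longrightarrow> AP_nrm (\<lambda>t. u m t - u n t) \<le> e / (3 * J)"
    using AP_Cauchy_diff_le[OF u, of "e / (3 * J)"] e J by auto
  obtain N' where N': "\<And>m n. m \<ge> N' \<Longrightarrow> n \<ge> N' \<Longrightarrow> AP_nrm (\<lambda>t. v m t - v n t) \<le> e / (3 * K)"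
    using AP_Cauchy_diff_le[OF v, of "e / (3 * K)"] e K by auto
  show "\<exists>M. \<forall>m\<ge>M. \<forall>n\<ge>M. dist (AP_inner (u m) (v m)) (AP_inner (u n) (v n)) < e"
  proof (intro exI allI impI)
    fix m n assume mn: "m \<ge> max N N'" "n \<ge> max N N'"
    note U = AP_CauchyD[OF u] AP_CauchyD[OF v]
    have "cmod (AP_inner (u m) (v m) - AP_inner (u n) (v n)) \<le>
      AP_nrm (\<lambda>t. u m t - u n t) * AP_nrm (v m) + AP_nrm (u n) * AP_nrm (\<lambda>t. v m t - v n t)"
      by (intro AP_inner_diff_bound U)
    also have "\<dots> \<le> (e / (3 * J)) * J + K * (e / (3 * K))"
      using mn e J K by (intro add_mono mult_mono N N' J(1) K(1) AP_nrm_nonneg UAP_diff U) auto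
    also have "\<dots> < e" using J K e by simp
    finally show "dist (AP_inner (u m) (v m)) (AP_inner (u n) (v n)) < e" by (simp add: dist_norm)
  qed
qed

lemma AP_nrm_diff_tendsto0_trans:
  assumes "\<And>n. u n \<in> UAP" "\<And>n. v n \<in> UAP" "\<And>n. w n \<in> UAP"
    and "(\<lambda>n. AP_nrm (\<lambda>t. u n t - v n t)) \<longlonglongrightarrow> 0" "(\<lambda>n. AP_nrm (\<lambda>t. v n t - w n t)) \<longlonglongrightarrow> 0"
  shows "(\<lambda>n. AP_nrm (\<lambda>t. u n t - w n t)) \<longlonglongrightarrow> 0"
proof (rule Lim_null_comparison)
  show "\<forall>\<^sub>F n in sequentially. norm (AP_nrm (\<lambda>t. u n t - w n t)) \<le> AP_nrm (\<lambda>t. u n t - v n t) + AP_nrm (\<lambda>t. v n t - w n t)"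
    using assms(1-3) by (auto intro!: always_eventually AP_nrm_triangle3 simp: AP_nrm_nonneg UAP_diff)
  show "(\<lambda>n. AP_nrm (\<lambda>t. u n t - v n t) + AP_nrm (\<lambda>t. v n t - w n t)) \<longlonglongrightarrow> 0"
    using tendsto_add[OF assms(4,5)] by simp
qed

lemma AP_nrm_zero: "AP_nrm (\<lambda>t. 0) = 0"
  by (simp add: AP_nrm_def AP_inner_eq_mean mean_zero)

lemma equiv_AP_null_rel: "equiv AP_Cauchy AP_null_rel"
proof (rule equivI)
  show "AP_null_rel \<subseteq> AP_Cauchy \<times> AP_Cauchy" unfolding AP_null_rel_def by auto
  show "refl_on AP_Cauchy AP_null_rel"
    by (rule refl_onI) (auto simp: AP_null_rel_def AP_nrm_zero)
  show "sym AP_null_rel"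
  proof (rule symI)
    fix u v assume "(u, v) \<in> AP_null_rel"
    then show "(v, u) \<in> AP_null_rel"
      unfolding AP_null_rel_def using AP_nrm_minus_commute[OF AP_CauchyD AP_CauchyD] by auto
  qed
  show "trans AP_null_rel"
  proof (rule transI)
    fix u v w assume *: "(u, v) \<in> AP_null_rel" "(v, w) \<in> AP_null_rel"
    have "(\<lambda>n. AP_nrm (\<lambda>t. u n t - w n t)) \<longlonglongrightarrow> 0"
      by (rule AP_nrm_diff_tendsto0_trans[where v = v]) (use * in \<open>auto simp: AP_null_rel_def dest: AP_CauchyD\<close>)
    with * show "(u, w) \<in> AP_null_rel" unfolding AP_null_rel_def by auto
  qed
qed

abbreviation AP_class :: "(nat \<Rightarrow> real \<Rightarrow> complex) \<Rightarrow> ap2" where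
  "AP_class u \<equiv> AP_null_rel `` {u}"

lemma AP_class_AP2: "u \<in> AP_Cauchy \<Longrightarrow> AP_class u \<in> AP2"
  unfolding AP2_def by (rule quotientI)

lemma AP_class_self: "u \<in> AP_Cauchy \<Longrightarrow> u \<in> AP_class u"
  using equiv_class_self[OF equiv_AP_null_rel] .

lemma AP2_eq_class: "F \<in> AP2 \<Longrightarrow> u \<in> F \<Longrightarrow> F = AP_class u \<and> u \<in> AP_Cauchy"
proof -
  assume "F \<in> AP2" and u: "u \<in> F"
  then obtain w where w: "F = AP_class w" unfolding AP2_def by (auto elim: quotientE)
  with u have "(w, u) \<in> AP_null_rel" by simp
  then show ?thesis
    unfolding w using equiv_class_eq[OF equiv_AP_null_rel, of w u] by (auto simp: AP_null_rel_def)
qed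

text \<open>\<open>AP2_inner\<close> is a definite description over all pairs of representatives, so
  the limit has to be independent of them. Null sequences change the inner products by a null
  sequence because Cauchy sequences are bounded in norm.\<close>

lemma AP2_inner_class:
  assumes u: "u \<in> AP_Cauchy" and v: "v \<in> AP_Cauchy"
  shows "(\<lambda>n. AP_inner (u n) (v n)) \<longlonglongrightarrow> AP2_inner (AP_class u) (AP_class v)"
proof -
  obtain z where z: "(\<lambda>n. AP_inner (u n) (v n)) \<longlonglongrightarrow> z"
    using AP_inner_Cauchy_converges[OF u v] unfolding convergent_def by blast
  have all: "(\<lambda>n. AP_inner (u' n) (v' n)) \<longlonglongrightarrow> z" if "u' \<in> AP_class u" "v' \<in> AP_class v" for u' v'
  proof -
    have u': "u' \<in> AP_Cauchy" "(\<lambda>n. AP_nrm (\<lambda>t. u n t - u' n t)) \<longlonglongrightarrow> 0"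
      and v': "v' \<in> AP_Cauchy" "(\<lambda>n. AP_nrm (\<lambda>t. v n t - v' n t)) \<longlonglongrightarrow> 0"
      using that by (auto simp: AP_null_rel_def)
    obtain K where K: "\<And>n. AP_nrm (u' n) \<le> K" "K > 0" using AP_nrm_Cauchy_bounded[OF u'(1)] by blast
    obtain J where J: "\<And>n. AP_nrm (v n) \<le> J" "J > 0" using AP_nrm_Cauchy_bounded[OF v] by blast
    note U = AP_CauchyD[OF u] AP_CauchyD[OF v] AP_CauchyD[OF u'(1)] AP_CauchyD[OF v'(1)]
    have "(\<lambda>n. AP_inner (u n) (v n) - AP_inner (u' n) (v' n)) \<longlonglongrightarrow> 0"
    proof (rule Lim_null_comparison)
      have "cmod (AP_inner (u n) (v n) - AP_inner (u' n) (v' n)) \<le>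
         AP_nrm (\<lambda>t. u n t - u' n t) * J + K * AP_nrm (\<lambda>t. v n t - v' n t)" for n
        by (rule order_trans[OF AP_inner_diff_bound[OF U]])
           (intro add_mono mult_mono order_refl J(1) K(1) AP_nrm_nonneg UAP_diff U less_imp_le[OF K(2)])
      then show "\<forall>\<^sub>F n in sequentially. norm (AP_inner (u n) (v n) - AP_inner (u' n) (v' n)) \<le>
         AP_nrm (\<lambda>t. u n t - u' n t) * J + K * AP_nrm (\<lambda>t. v n t - v' n t)" by simp
      show "(\<lambda>n. AP_nrm (\<lambda>t. u n t - u' n t) * J + K * AP_nrm (\<lambda>t. v n t - v' n t)) \<longlonglongrightarrow> 0"
        using tendsto_add[OF tendsto_mult_right[OF u'(2), of J] tendsto_mult_left[OF v'(2), of K]] by simp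
    qed
    from tendsto_diff[OF z this] show ?thesis by simp
  qed
  have "AP2_inner (AP_class u) (AP_class v) = z"
    unfolding AP2_inner_def
  proof (rule the_equality)
    show "\<forall>u'\<in>AP_class u. \<forall>v'\<in>AP_class v. (\<lambda>n. AP_inner (u' n) (v' n)) \<longlonglongrightarrow> z" using all by blast
    fix z' assume "\<forall>u'\<in>AP_class u. \<forall>v'\<in>AP_class v. (\<lambda>n. AP_inner (u' n) (v' n)) \<longlonglongrightarrow> z'"
    then have "(\<lambda>n. AP_inner (u n) (v n)) \<longlonglongrightarrow> z'" using AP_class_self u v by blast
    with z show "z' = z" using LIMSEQ_unique by blast
  qed
  with z show ?thesis by simp
qed

lemma AP2_nrm_class:
  assumes u: "u \<in> AP_Cauchy"
  shows "(\<lambda>n. AP_nrm (u n)) \<longlonglongrightarrow> AP2_nrm (AP_class u)"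
  using tendsto_real_sqrt[OF tendsto_Re[OF AP2_inner_class[OF u u]]]
  unfolding AP2_nrm_def AP_nrm_def .

text \<open>Each term is replaced by a polynomial within 1 / (n + 1) uniformly, hence also in
  \<open>AP_nrm\<close>. From here on an element of the completion is handled through finitely
  supported coefficient functions.\<close>

lemma AP2_trig_poly_rep:
  assumes "F \<in> AP2"
  obtains c where "\<And>n. finsupp (c n)" "(\<lambda>n. tp (c n)) \<in> AP_Cauchy" "F = AP_class (\<lambda>n. tp (c n))"
proof -
  obtain u where u: "u \<in> AP_Cauchy" "F = AP_class u"
    using assms unfolding AP2_def by (auto elim: quotientE)
  have "\<exists>c. finsupp c \<and> (\<forall>t. cmod (u n t - tp c t) \<le> inverse (real (Suc n)))" for n
  proof -
    obtain p where "p \<in> trig_poly" "\<forall>t. cmod (u n t - p t) \<le> inverse (real (Suc n))"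
      using UAP_approx[OF AP_CauchyD[OF u(1)], of "inverse (real (Suc n))" n] by auto
    then show ?thesis by (auto simp: trig_poly_iff_tp)
  qed
  then have "\<exists>c. \<forall>n. finsupp (c n) \<and> (\<forall>t. cmod (u n t - tp (c n) t) \<le> inverse (real (Suc n)))"
    by (intro choice allI)
  then obtain c where c: "\<And>n. finsupp (c n)" "\<And>n t. cmod (u n t - tp (c n) t) \<le> inverse (real (Suc n))"
    by blast
  note U = AP_CauchyD[OF u(1)] tp_UAP[OF c(1)]
  have le: "AP_nrm (\<lambda>t. u n t - tp (c n) t) \<le> inverse (real (Suc n))" for n
    by (intro AP_nrm_le_bound UAP_diff U c)
  have null: "(\<lambda>n. AP_nrm (\<lambda>t. u n t - tp (c n) t)) \<longlonglongrightarrow> 0"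
    by (rule Lim_null_comparison[OF _ LIMSEQ_inverse_real_of_nat])
       (use le in \<open>auto intro!: always_eventually simp: AP_nrm_nonneg UAP_diff U simp del: of_nat_Suc\<close>)
  have "(\<lambda>n. tp (c n)) \<in> AP_Cauchy"
    unfolding AP_Cauchy_def
  proof (intro CollectI conjI allI impI)
    show "tp (c n) \<in> AP" for n by (intro trig_poly_AP tp_trig_poly c)
    fix e :: real assume e: "e > 0"
    obtain N where N: "\<And>m n. m \<ge> N \<Longrightarrow> n \<ge> N \<Longrightarrow> AP_nrm (\<lambda>t. u m t - u n t) \<le> e / 4"
      using AP_Cauchy_diff_le[OF u(1), of "e / 4"] e by auto
    obtain N' where N': "\<And>n. n \<ge> N' \<Longrightarrow> AP_nrm (\<lambda>t. u n t - tp (c n) t) < e / 4"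
      using order_tendstoD(2)[OF null, of "e / 4"] e by (auto simp: eventually_sequentially)
    show "\<exists>N. \<forall>m\<ge>N. \<forall>n\<ge>N. AP_nrm (\<lambda>t. tp (c m) t - tp (c n) t) < e"
    proof (intro exI allI impI)
      fix m n assume "m \<ge> max N N'" "n \<ge> max N N'"
      then show "AP_nrm (\<lambda>t. tp (c m) t - tp (c n) t) < e"
        using N[of m n] N'[of m] N'[of n] e AP_nrm_triangle3[OF U(2)[of m] U(1)[of m] U(2)[of n]]
          AP_nrm_triangle3[OF U(1)[of m] U(1)[of n] U(2)[of n]] AP_nrm_minus_commute[OF U(1)[of m] U(2)[of m]]
        by simp
    qed
  qed
  moreover from this have "F = AP_class (\<lambda>n. tp (c n))"
    unfolding u(2) by (intro equiv_class_eq[OF equiv_AP_null_rel]) (use null u in \<open>auto simp: AP_null_rel_def\<close>)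
  ultimately show ?thesis using that c(1) by blast
qed

lemma const_AP_Cauchy: "f \<in> AP \<Longrightarrow> (\<lambda>_. f) \<in> AP_Cauchy"
  unfolding AP_Cauchy_def by (auto simp: AP_nrm_zero)

lemma AP2_coeff_class:
  assumes u: "u \<in> AP_Cauchy"
  shows "(\<lambda>n. AP_inner (u n) (e_fun \<mu>)) \<longlonglongrightarrow> AP2_coeff (AP_class u) \<mu>"
  unfolding AP2_coeff_def AP2_of_AP_def
  using AP2_inner_class[OF u const_AP_Cauchy[OF trig_poly_AP[OF e_fun_trig_poly]]] .

text \<open>Completeness of the exponentials: for large \<open>m\<close> the square \<open>(AP_nrm (w n))\<^sup>2\<close> is close to
  \<open>AP_inner (w n) (w m)\<close>, which only involves finitely many Fourier coefficients of \<open>w n\<close>.\<close>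

lemma AP2_coeff_inject:
  assumes F: "F \<in> AP2" and G: "G \<in> AP2" and eq: "\<And>\<mu>. AP2_coeff F \<mu> = AP2_coeff G \<mu>"
  shows "F = G"
proof -
  obtain c where c: "\<And>n. finsupp (c n)" "(\<lambda>n. tp (c n)) \<in> AP_Cauchy" "F = AP_class (\<lambda>n. tp (c n))"
    using AP2_trig_poly_rep[OF F] by blast
  obtain d where d: "\<And>n. finsupp (d n)" "(\<lambda>n. tp (d n)) \<in> AP_Cauchy" "G = AP_class (\<lambda>n. tp (d n))"
    using AP2_trig_poly_rep[OF G] by blast
  define b where "b = (\<lambda>n \<mu>. c n \<mu> - d n \<mu>)"
  have b: "finsupp (b n)" for n unfolding b_def by (intro finsupp_diff c d)
  have tpb: "tp (b n) = (\<lambda>t. tp (c n) t - tp (d n) t)" for n unfolding b_def by (rule tp_diff[OF c(1) d(1)])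
  have b0: "(\<lambda>n. b n \<mu>) \<longlonglongrightarrow> 0" for \<mu>
    using tendsto_diff[OF AP2_coeff_class[OF c(2), of \<mu>] AP2_coeff_class[OF d(2), of \<mu>]] eq[of \<mu>]
    by (simp add: AP_inner_tp_e_fun c d b_def)
  obtain K where K: "\<And>n. AP_nrm (tp (c n)) \<le> K" "K > 0" using AP_nrm_Cauchy_bounded[OF c(2)] by blast
  obtain J where J: "\<And>n. AP_nrm (tp (d n)) \<le> J" "J > 0" using AP_nrm_Cauchy_bounded[OF d(2)] by blast
  define L where "L = K + J"
  have L: "L > 0" using K J by (simp add: L_def)
  have bK: "AP_nrm (tp (b n)) \<le> L" for n
    using AP_nrm_triangle_diff[OF tp_UAP[OF c(1)[of n]] tp_UAP[OF d(1)[of n]]] K(1)[of n] J(1)[of n] by (simp add: tpb L_def)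
  have "(\<lambda>n. (AP_nrm (tp (b n)))\<^sup>2) \<longlonglongrightarrow> 0"
  proof (rule LIMSEQ_I)
    fix e :: real assume e: "e > 0"
    \<comment> \<open>The estimate below is L (2 e') + e / 4, which this choice turns into 3 e /
      4.\<close>
    define e' where "e' = e / 4 / L"
    have e': "e' > 0" using e L by (simp add: e'_def)
    obtain N where N: "\<And>m n. m \<ge> N \<Longrightarrow> n \<ge> N \<Longrightarrow> AP_nrm (\<lambda>t. tp (c m) t - tp (c n) t) \<le> e'"
      using AP_Cauchy_diff_le[OF c(2) e'] by blast
    obtain N' where N': "\<And>m n. m \<ge> N' \<Longrightarrow> n \<ge> N' \<Longrightarrow> AP_nrm (\<lambda>t. tp (d m) t - tp (d n) t) \<le> e'"
      using AP_Cauchy_diff_le[OF d(2) e'] by blast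
    define m where "m = max N N'"
    have "(\<lambda>n. AP_inner (tp (b n)) (tp (b m))) \<longlonglongrightarrow> (\<Sum>\<mu> | b m \<mu> \<noteq> 0. 0 * cnj (b m \<mu>))"
      by (subst AP_inner_tp[OF b b order_refl]) (intro tendsto_sum tendsto_mult b0 tendsto_const)
    then have "(\<lambda>n. AP_inner (tp (b n)) (tp (b m))) \<longlonglongrightarrow> 0" by simp
    then obtain N'' where N'': "\<And>n. n \<ge> N'' \<Longrightarrow> cmod (AP_inner (tp (b n)) (tp (b m))) < e / 4"
      using LIMSEQ_D[of _ 0 "e / 4"] e by auto
    have "norm ((AP_nrm (tp (b n)))\<^sup>2 - 0) < e" if n: "n \<ge> max m N''" for n
    proof -
      note U = tp_UAP[OF b, of n] tp_UAP[OF b, of m]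
      have "AP_nrm (\<lambda>t. tp (b n) t - tp (b m) t) = AP_nrm (\<lambda>t. (tp (c n) t - tp (c m) t) - (tp (d n) t - tp (d m) t))"
        by (simp add: tpb algebra_simps)
      also have "\<dots> \<le> AP_nrm (\<lambda>t. tp (c n) t - tp (c m) t) + AP_nrm (\<lambda>t. tp (d n) t - tp (d m) t)"
        by (intro AP_nrm_triangle_diff UAP_diff tp_UAP c d)
      also have "\<dots> \<le> e' + e'" using n by (intro add_mono N N') (auto simp: m_def)
      finally have diff: "AP_nrm (\<lambda>t. tp (b n) t - tp (b m) t) \<le> 2 * e'" by simp
      have "(AP_nrm (tp (b n)))\<^sup>2 = cmod (AP_inner (tp (b n)) (tp (b n)))"
        by (simp add: AP_inner_self U norm_power)
      also have "AP_inner (tp (b n)) (tp (b n)) = AP_inner (tp (b n)) (\<lambda>t. tp (b n) t - tp (b m) t) + AP_inner (tp (b n)) (tp (b m))"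
        by (simp add: AP_inner_diff_right U)
      also have "cmod \<dots> \<le> AP_nrm (tp (b n)) * AP_nrm (\<lambda>t. tp (b n) t - tp (b m) t) + e / 4"
        using N''[of n] n by (intro order_trans[OF norm_triangle_ineq] add_mono AP_Cauchy_Schwarz UAP_diff U) auto
      also have "\<dots> \<le> L * (2 * e') + e / 4"
        using L by (intro add_right_mono mult_mono bK diff AP_nrm_nonneg UAP_diff U) auto
      also have "\<dots> = 2 * (L * e') + e / 4" by simp
      also have "L * e' = e / 4" using L by (simp add: e'_def)
      also have "2 * (e / 4) + e / 4 < e" using e by simp
      finally show ?thesis by simp
    qed
    then show "\<exists>no. \<forall>n\<ge>no. norm ((AP_nrm (tp (b n)))\<^sup>2 - 0) < e" by blast
  qed
  from tendsto_real_sqrt[OF this] have "(\<lambda>n. AP_nrm (tp (b n))) \<longlonglongrightarrow> 0"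
    by (simp add: AP_nrm_nonneg tp_UAP b)
  then show ?thesis
    unfolding c(3) d(3)
    by (intro equiv_class_eq[OF equiv_AP_null_rel]) (use c d in \<open>auto simp: AP_null_rel_def tpb\<close>)
qed

text \<open>Riesz-Fischer: the squared distance of two truncations is a difference of partial sums
  of |a|^2, which increase and are bounded. Uniqueness, needed for the definite description, is
  \<open>AP2_coeff_inject\<close>. The sets \<open>M n\<close> are left open so that a coset can
  later be exhausted by finite pieces.\<close>

lemma AP2_with_coeffs_class:
  fixes a :: "real \<Rightarrow> complex"
  assumes M: "\<And>n::nat. finite (M n)" "\<And>m n. m \<le> n \<Longrightarrow> M m \<subseteq> M n" "{\<mu>. a \<mu> \<noteq> 0} \<subseteq> (\<Union>n. M n)"
    and B: "\<And>n. (\<Sum>\<mu>\<in>M n. (cmod (a \<mu>))\<^sup>2) \<le> B"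
  defines "v \<equiv> \<lambda>n. tp (\<lambda>\<mu>. if \<mu> \<in> M n then a \<mu> else 0)"
  shows "v \<in> AP_Cauchy" "AP2_with_coeffs a = AP_class v"
proof -
  define an where "an = (\<lambda>n \<mu>. if \<mu> \<in> M n then a \<mu> else 0)"
  have v: "v n = tp (an n)" for n by (simp add: v_def an_def)
  have supp: "{\<mu>. an n \<mu> \<noteq> 0} \<subseteq> M n" for n by (auto simp: an_def)
  have fs: "finsupp (an n)" for n using supp M(1) finite_subset by blast
  define S where "S = (\<lambda>n. \<Sum>\<mu>\<in>M n. (cmod (a \<mu>))\<^sup>2)"
  have "incseq S" unfolding S_def incseq_def by (auto intro!: sum_mono2 M)
  then have "convergent S"
    using B by (intro Bseq_mono_convergent) (auto simp: incseq_def S_def sum_nonneg intro!: BseqI'[of _ B])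
  then have "Cauchy S" by (rule convergent_Cauchy)
  have sq: "(AP_nrm (\<lambda>t. v m t - v n t))\<^sup>2 = \<bar>S m - S n\<bar>" for m n
  proof -
    have le: "(AP_nrm (\<lambda>t. v m t - v n t))\<^sup>2 = S n - S m" if mn: "m \<le> n" for m n
    proof -
      have "(AP_nrm (\<lambda>t. v m t - v n t))\<^sup>2 = (\<Sum>\<mu>\<in>M n. (cmod (an m \<mu> - an n \<mu>))\<^sup>2)"
        unfolding v tp_diff[OF fs fs, symmetric]
        using M(2)[OF mn] by (intro AP_nrm_tp M) (auto simp: an_def)
      also have "\<dots> = (\<Sum>\<mu>\<in>M n - M m. (cmod (a \<mu>))\<^sup>2)"
        using M(2)[OF mn] M(1) by (intro sum.mono_neutral_cong_right) (auto simp: an_def)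
      also have "\<dots> = S n - S m"
        unfolding S_def using M(2)[OF mn] M(1) by (simp add: sum_diff)
      finally show ?thesis .
    qed
    have mono: "S m \<le> S n" if "m \<le> n" for m n using \<open>incseq S\<close> that by (simp add: incseqD)
    show ?thesis
    proof (cases "m \<le> n")
      case True
      then show ?thesis using le[OF True] mono[OF True] by simp
    next
      case False
      then have "n \<le> m" by simp
      then show ?thesis using le[of n m] mono[of n m] AP_nrm_minus_commute[of "v m" "v n"]
        by (simp add: v tp_UAP fs)
    qed
  qed
  show vC: "v \<in> AP_Cauchy"
    unfolding AP_Cauchy_def
  proof (intro CollectI conjI allI impI)
    show "v n \<in> AP" for n unfolding v by (intro trig_poly_AP tp_trig_poly fs)
    fix e :: real assume e: "e > 0"
    then obtain N where N: "\<And>m n. m \<ge> N \<Longrightarrow> n \<ge> N \<Longrightarrow> \<bar>S m - S n\<bar> < e\<^sup>2"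
      using metric_CauchyD[OF \<open>Cauchy S\<close>, of "e\<^sup>2"] unfolding dist_real_def by auto
    have "AP_nrm (\<lambda>t. v m t - v n t) < e" if "m \<ge> N" "n \<ge> N" for m n
      using N[OF that] e by (intro power2_less_imp_less[of _ e]) (auto simp: sq)
    then show "\<exists>N. \<forall>m\<ge>N. \<forall>n\<ge>N. AP_nrm (\<lambda>t. v m t - v n t) < e" by blast
  qed
  have co: "AP2_coeff (AP_class v) \<mu> = a \<mu>" for \<mu>
  proof -
    obtain n0 where n0: "a \<mu> \<noteq> 0 \<Longrightarrow> \<mu> \<in> M n0" using M(3) by blast
    have "\<forall>\<^sub>F n in sequentially. an n \<mu> = a \<mu>"
      using n0 M(2) unfolding eventually_sequentially an_def by (intro exI[of _ n0]) auto
    then have "(\<lambda>n. an n \<mu>) \<longlonglongrightarrow> a \<mu>" by (rule tendsto_eventually)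
    moreover have "(\<lambda>n. an n \<mu>) \<longlonglongrightarrow> AP2_coeff (AP_class v) \<mu>"
      using AP2_coeff_class[OF vC, of \<mu>] by (simp add: v AP_inner_tp_e_fun fs)
    ultimately show ?thesis using LIMSEQ_unique by blast
  qed
  show "AP2_with_coeffs a = AP_class v"
    unfolding AP2_with_coeffs_def
  proof (rule the_equality)
    show "AP_class v \<in> AP2 \<and> (\<forall>\<mu>. AP2_coeff (AP_class v) \<mu> = a \<mu>)"
      using co AP_class_AP2[OF vC] by simp
    fix F assume "F \<in> AP2 \<and> (\<forall>\<mu>. AP2_coeff F \<mu> = a \<mu>)"
    then show "F = AP_class v"
      using AP2_coeff_inject[OF _ AP_class_AP2[OF vC], of F] co by simp
  qed
qed

text \<open>The diagonal sequence \<open>AP_inner (tp (c n)) (v n)\<close> that defines the inner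
  product is compared with its limit in the second index alone; the norms of \<open>tp (c n)\<close>
  are bounded, so the error is small for all large n. The result involves the full coefficients
  \<open>a\<close> and no truncation.\<close>

lemma AP2_inner_with_coeffs:
  fixes a :: "real \<Rightarrow> complex"
  assumes M: "\<And>n::nat. finite (M n)" "\<And>m n. m \<le> n \<Longrightarrow> M m \<subseteq> M n" "{\<mu>. a \<mu> \<noteq> 0} \<subseteq> (\<Union>n. M n)"
    and B: "\<And>n. (\<Sum>\<mu>\<in>M n. (cmod (a \<mu>))\<^sup>2) \<le> B"
    and c: "\<And>n. finsupp (c n)" "(\<lambda>n. tp (c n)) \<in> AP_Cauchy"
  shows "(\<lambda>n. \<Sum>\<mu> | c n \<mu> \<noteq> 0. c n \<mu> * cnj (a \<mu>)) \<longlonglongrightarrow> AP2_inner (AP_class (\<lambda>n. tp (c n))) (AP2_with_coeffs a)"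
proof -
  define an where "an = (\<lambda>n \<mu>. if \<mu> \<in> M n then a \<mu> else 0)"
  define v where "v = (\<lambda>n. tp (an n))"
  have v: "v \<in> AP_Cauchy" "AP2_with_coeffs a = AP_class v"
    using AP2_with_coeffs_class[OF M B] unfolding v_def an_def by auto
  have fs: "finsupp (an n)" for n
    by (rule finite_subset[OF _ M(1)[of n]]) (auto simp: an_def)
  define s where "s = (\<lambda>n. \<Sum>\<mu> | c n \<mu> \<noteq> 0. c n \<mu> * cnj (a \<mu>))"
  have inner_lim: "(\<lambda>m. AP_inner (tp (c n)) (v m)) \<longlonglongrightarrow> s n" for n
  proof -
    have ev: "(\<lambda>m. an m \<mu>) \<longlonglongrightarrow> a \<mu>" for \<mu>
    proof -
      obtain n0 where n0: "a \<mu> \<noteq> 0 \<Longrightarrow> \<mu> \<in> M n0" using M(3) by blast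
      have "\<forall>\<^sub>F n in sequentially. an n \<mu> = a \<mu>"
        using n0 M(2) unfolding eventually_sequentially an_def by (intro exI[of _ n0]) auto
      then show ?thesis by (rule tendsto_eventually)
    qed
    have "AP_inner (tp (c n)) (v m) = (\<Sum>\<mu> | c n \<mu> \<noteq> 0. c n \<mu> * cnj (an m \<mu>))" for m
    proof -
      have "AP_inner (tp (c n)) (v m) = (\<Sum>\<mu>\<in>{\<mu>. c n \<mu> \<noteq> 0} \<union> {\<mu>. an m \<mu> \<noteq> 0}. c n \<mu> * cnj (an m \<mu>))"
        unfolding v_def using c(1) fs by (intro AP_inner_tp) auto
      also have "\<dots> = (\<Sum>\<mu> | c n \<mu> \<noteq> 0. c n \<mu> * cnj (an m \<mu>))"
        using c(1) fs by (intro sum.mono_neutral_right) auto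
      finally show ?thesis .
    qed
    moreover have "(\<lambda>m. \<Sum>\<mu> | c n \<mu> \<noteq> 0. c n \<mu> * cnj (an m \<mu>)) \<longlonglongrightarrow> s n"
      unfolding s_def by (intro tendsto_sum tendsto_mult tendsto_cnj tendsto_const ev)
    ultimately show ?thesis by simp
  qed
  obtain K where K: "\<And>n. AP_nrm (tp (c n)) \<le> K" "K > 0" using AP_nrm_Cauchy_bounded[OF c(2)] by blast
  note U = tp_UAP[OF c(1)] AP_CauchyD[OF v(1)]
  have "(\<lambda>n. AP_inner (tp (c n)) (v n) - s n) \<longlonglongrightarrow> 0"
  proof (rule LIMSEQ_I)
    fix e :: real assume e: "e > 0"
    obtain N where N: "\<And>m n. m \<ge> N \<Longrightarrow> n \<ge> N \<Longrightarrow> AP_nrm (\<lambda>t. v m t - v n t) \<le> e / (2 * K)"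
      using AP_Cauchy_diff_le[OF v(1), of "e / (2 * K)"] e K by auto
    have "cmod (AP_inner (tp (c n)) (v n) - s n) \<le> e / 2" if n: "n \<ge> N" for n
    proof (rule tendsto_upperbound[OF tendsto_norm[OF tendsto_diff[OF tendsto_const inner_lim]]])
      have "cmod (AP_inner (tp (c n)) (v n) - AP_inner (tp (c n)) (v m)) \<le> e / 2" if m: "m \<ge> N" for m
      proof -
        have "cmod (AP_inner (tp (c n)) (v n) - AP_inner (tp (c n)) (v m)) \<le> AP_nrm (tp (c n)) * AP_nrm (\<lambda>t. v n t - v m t)"
          using AP_Cauchy_Schwarz[OF U(1) UAP_diff[OF U(2) U(2)]] by (simp add: AP_inner_diff_right U)
        also have "\<dots> \<le> K * (e / (2 * K))"
          using K n m by (intro mult_mono K N AP_nrm_nonneg UAP_diff U) auto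
        also have "\<dots> = e / 2" using K by simp
        finally show ?thesis .
      qed
      then show "\<forall>\<^sub>F m in sequentially. cmod (AP_inner (tp (c n)) (v n) - AP_inner (tp (c n)) (v m)) \<le> e / 2"
        by (auto simp: eventually_sequentially)
    qed simp
    moreover have "e / 2 < e" using e by simp
    ultimately have "\<forall>n\<ge>N. norm (AP_inner (tp (c n)) (v n) - s n - 0) < e"
      unfolding diff_zero by (blast intro: le_less_trans)
    then show "\<exists>no. \<forall>n\<ge>no. norm (AP_inner (tp (c n)) (v n) - s n - 0) < e" by blast
  qed
  from tendsto_diff[OF AP2_inner_class[OF c(2) v(1)] this]
  have "s \<longlonglongrightarrow> AP2_inner (AP_class (\<lambda>n. tp (c n))) (AP_class v)" by simp
  then show ?thesis unfolding v(2) s_def .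
qed

section \<open>Parseval's identity on the circle\<close>

lemma integral_e_fun_periods:
  assumes "\<mu> \<noteq> 0" "cis (\<mu> * (b - a)) = 1" "a \<le> b"
  shows "integral {a..b} (e_fun \<mu>) = 0"
proof -
  have "((\<lambda>t. cis (\<mu> * t)) has_integral cis (\<mu> * b) / (\<i> * \<mu>) - cis (\<mu> * a) / (\<i> * \<mu>)) {a..b}"
    using assms
    by (intro fundamental_theorem_of_calculus)
       (auto simp: cis_conv_exp mult_ac intro!: derivative_eq_intros has_vector_derivative_real_field simp flip: has_real_derivative_iff_has_vector_derivative)
  moreover have "cis (\<mu> * b) = cis (\<mu> * a) * cis (\<mu> * (b - a))" by (simp add: cis_mult algebra_simps)
  ultimately show ?thesis using assms(2) by (simp add: e_fun_def integral_unique)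
qed

lemma continuous_on_e_fun [continuous_intros]: "continuous_on S (e_fun \<mu>)"
  by (intro trig_poly_continuous e_fun_trig_poly)

text \<open>Completing the square. It has three uses: c \<mu> = \<gamma> \<mu> / (b - a) gives
  Bessel's inequality, dropping the last term gives the reverse estimate from an approximant, and G
  = 0 gives the mean square of a polynomial over whole periods.\<close>

lemma integral_sum_square_expand:
  fixes G :: "real \<Rightarrow> complex"
  assumes G: "continuous_on {a..b} G" and M: "finite M" and ab: "a < b"
    and per: "\<And>\<mu> \<nu>. \<mu> \<in> M \<Longrightarrow> \<nu> \<in> M \<Longrightarrow> cis ((\<mu> - \<nu>) * (b - a)) = 1"
  defines "\<gamma> \<equiv> \<lambda>\<mu>. integral {a..b} (\<lambda>t. G t * cnj (e_fun \<mu> t))"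
  shows "integral {a..b} (\<lambda>t. (cmod (G t - (\<Sum>\<mu>\<in>M. c \<mu> * e_fun \<mu> t)))\<^sup>2)
    = integral {a..b} (\<lambda>t. (cmod (G t))\<^sup>2) - (\<Sum>\<mu>\<in>M. (cmod (\<gamma> \<mu>))\<^sup>2) / (b - a)
       + (b - a) * (\<Sum>\<mu>\<in>M. (cmod (c \<mu> - \<gamma> \<mu> / of_real (b - a)))\<^sup>2)"
proof -
  define T where "T = b - a"
  have T: "T > 0" using ab by (simp add: T_def)
  define q where "q = (\<lambda>t. \<Sum>\<mu>\<in>M. c \<mu> * e_fun \<mu> t)"
  have q: "continuous_on {a..b} q" unfolding q_def by (intro continuous_intros)
  have int: "f integrable_on {a..b}" if "continuous_on {a..b} f" for f :: "real \<Rightarrow> complex"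
    using that by (rule integrable_continuous_real)
  have Gq: "integral {a..b} (\<lambda>t. G t * cnj (q t)) = (\<Sum>\<mu>\<in>M. cnj (c \<mu>) * \<gamma> \<mu>)"
  proof -
    have "integral {a..b} (\<lambda>t. G t * cnj (q t)) = integral {a..b} (\<lambda>t. \<Sum>\<mu>\<in>M. cnj (c \<mu>) * (G t * cnj (e_fun \<mu> t)))"
      by (simp add: q_def sum_distrib_left mult_ac)
    also have "\<dots> = (\<Sum>\<mu>\<in>M. integral {a..b} (\<lambda>t. cnj (c \<mu>) * (G t * cnj (e_fun \<mu> t))))"
      by (intro integral_sum M int continuous_intros G)
    finally show ?thesis by (simp add: \<gamma>_def)
  qed
  have qq: "integral {a..b} (\<lambda>t. q t * cnj (q t)) = of_real T * (\<Sum>\<mu>\<in>M. c \<mu> * cnj (c \<mu>))"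
  proof -
    have "(\<lambda>t. q t * cnj (q t)) = (\<lambda>t. \<Sum>\<mu>\<in>M. \<Sum>\<nu>\<in>M. (c \<mu> * cnj (c \<nu>)) * e_fun (\<mu> - \<nu>) t)"
    proof -
      have "e_fun (\<mu> - \<nu>) t = e_fun \<mu> t * cnj (e_fun \<nu> t)" for \<mu> \<nu> t
        by (simp add: e_fun_def cis_cnj cis_mult left_diff_distrib)
      then show ?thesis unfolding q_def by (simp add: sum_product mult_ac)
    qed
    then have "integral {a..b} (\<lambda>t. q t * cnj (q t)) = (\<Sum>\<mu>\<in>M. \<Sum>\<nu>\<in>M. (c \<mu> * cnj (c \<nu>)) * integral {a..b} (e_fun (\<mu> - \<nu>)))"
      by (simp add: integral_sum M int continuous_intros)
    also have "\<dots> = (\<Sum>\<mu>\<in>M. \<Sum>\<nu>\<in>M. (c \<mu> * cnj (c \<nu>)) * (if \<mu> = \<nu> then of_real T else 0))"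
    proof (intro sum.cong refl)
      fix \<mu> \<nu> assume mn: "\<mu> \<in> M" "\<nu> \<in> M"
      have "integral {a..b} (e_fun (\<mu> - \<nu>)) = (if \<mu> = \<nu> then of_real T else 0)"
        using integral_e_fun_periods[of "\<mu> - \<nu>" b a] per[OF mn] ab by (auto simp: e_fun_def T_def scaleR_conv_of_real)
      then show "(c \<mu> * cnj (c \<nu>)) * integral {a..b} (e_fun (\<mu> - \<nu>)) = (c \<mu> * cnj (c \<nu>)) * (if \<mu> = \<nu> then of_real T else 0)" by simp
    qed
    also have "\<dots> = of_real T * (\<Sum>\<mu>\<in>M. c \<mu> * cnj (c \<mu>))"
      using M by (simp add: if_distrib[where f="(*) _"] sum_distrib_left mult_ac cong: if_cong)
    finally show ?thesis .
  qed
  have sq_int: "of_real (integral {a..b} (\<lambda>t. (cmod (f t))\<^sup>2)) = integral {a..b} (\<lambda>t. f t * cnj (f t))"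
    if "continuous_on {a..b} f" for f :: "real \<Rightarrow> complex"
  proof -
    have "((\<lambda>t. (cmod (f t))\<^sup>2) has_integral integral {a..b} (\<lambda>t. (cmod (f t))\<^sup>2)) {a..b}"
      by (intro integrable_integral integrable_continuous_real continuous_intros that)
    from has_integral_of_real[OF this, where 'b = complex] show ?thesis
      by (simp add: integral_unique complex_norm_square del: of_real_power)
  qed
  have cqG: "integral {a..b} (\<lambda>t. q t * cnj (G t)) = cnj (\<Sum>\<mu>\<in>M. cnj (c \<mu>) * \<gamma> \<mu>)"
  proof -
    have "integral {a..b} (\<lambda>t. q t * cnj (G t)) = integral {a..b} (\<lambda>t. cnj (G t * cnj (q t)))"
      by (simp add: mult.commute)
    also have "\<dots> = cnj (integral {a..b} (\<lambda>t. G t * cnj (q t)))" by (rule integral_cnj[symmetric])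
    finally show ?thesis by (simp only: Gq)
  qed
  have "of_real (integral {a..b} (\<lambda>t. (cmod (G t - q t))\<^sup>2)) =
      integral {a..b} (\<lambda>t. (G t * cnj (G t) - G t * cnj (q t)) - (q t * cnj (G t) - q t * cnj (q t)))"
    by (subst sq_int) (auto intro!: continuous_intros G q simp: algebra_simps)
  also have "\<dots> = (integral {a..b} (\<lambda>t. G t * cnj (G t)) - integral {a..b} (\<lambda>t. G t * cnj (q t)))
     - (integral {a..b} (\<lambda>t. q t * cnj (G t)) - integral {a..b} (\<lambda>t. q t * cnj (q t)))"
    by (simp add: integral_diff int continuous_intros G q)
  also have "\<dots> = of_real (integral {a..b} (\<lambda>t. (cmod (G t))\<^sup>2)) - (\<Sum>\<mu>\<in>M. cnj (c \<mu>) * \<gamma> \<mu>)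
     - cnj (\<Sum>\<mu>\<in>M. cnj (c \<mu>) * \<gamma> \<mu>) + of_real T * (\<Sum>\<mu>\<in>M. c \<mu> * cnj (c \<mu>))"
    by (simp add: Gq qq cqG sq_int[OF G] del: cnj_sum)
  also have "\<dots> = of_real (integral {a..b} (\<lambda>t. (cmod (G t))\<^sup>2)) - of_real ((\<Sum>\<mu>\<in>M. (cmod (\<gamma> \<mu>))\<^sup>2) / T)
       + of_real (T * (\<Sum>\<mu>\<in>M. (cmod (c \<mu> - \<gamma> \<mu> / of_real T))\<^sup>2))"
  proof -
    have "of_real T * ((c \<mu> - \<gamma> \<mu> / of_real T) * cnj (c \<mu> - \<gamma> \<mu> / of_real T))
       = of_real T * (c \<mu> * cnj (c \<mu>)) - cnj (c \<mu>) * \<gamma> \<mu> - cnj (cnj (c \<mu>) * \<gamma> \<mu>) + \<gamma> \<mu> * cnj (\<gamma> \<mu>) / of_real T" for \<mu>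
      using T by (simp add: field_simps)
    then have "of_real (T * (\<Sum>\<mu>\<in>M. (cmod (c \<mu> - \<gamma> \<mu> / of_real T))\<^sup>2)) =
      (\<Sum>\<mu>\<in>M. of_real T * (c \<mu> * cnj (c \<mu>)) - cnj (c \<mu>) * \<gamma> \<mu> - cnj (cnj (c \<mu>) * \<gamma> \<mu>) + \<gamma> \<mu> * cnj (\<gamma> \<mu>) / of_real T)"
      by (simp only: of_real_mult of_real_sum complex_norm_square sum_distrib_left)
    also have "\<dots> = of_real T * (\<Sum>\<mu>\<in>M. c \<mu> * cnj (c \<mu>)) - (\<Sum>\<mu>\<in>M. cnj (c \<mu>) * \<gamma> \<mu>) - cnj (\<Sum>\<mu>\<in>M. cnj (c \<mu>) * \<gamma> \<mu>)
       + of_real ((\<Sum>\<mu>\<in>M. (cmod (\<gamma> \<mu>))\<^sup>2) / T)"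
      by (simp only: sum.distrib sum_subtractf sum_distrib_left[symmetric] sum_divide_distrib[symmetric] cnj_sum of_real_divide of_real_sum complex_norm_square)
    finally show ?thesis by simp
  qed
  finally show ?thesis
    unfolding q_def T_def by (simp only: of_real_eq_iff flip: of_real_add of_real_diff)
qed

text \<open>Bessel's inequality for every finite set of harmonics gives one direction. For the
  other, equal end values admit \<open>periodic_approximation\<close>, and polynomials exhaust the
  energy of G.\<close>

lemma circle_parseval:
  fixes G :: "real \<Rightarrow> complex"
  assumes T: "T > 0" and G: "continuous_on {0..T} G" "G 0 = G T"
  shows "(\<Sum>\<^sub>\<infinity>k\<in>(UNIV::int set). ennreal ((cmod (integral {0..T} (\<lambda>t. G t * cis (2 * pi / T * of_int k * t))))\<^sup>2))
     = ennreal (T * integral {0..T} (\<lambda>t. (cmod (G t))\<^sup>2))"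
proof -
  define \<gamma> where "\<gamma> = (\<lambda>\<mu>. integral {0..T} (\<lambda>t. G t * cnj (e_fun \<mu> t)))"
  \<comment> \<open>The minus sign appears because G is integrated against cis with a positive sign,
    that is, paired with the exponential of the opposite frequency.\<close>
  define h where "h = (\<lambda>k::int. - (2 * pi / T * of_int k))"
  have inj: "inj h" using T by (auto simp: h_def inj_on_def)
  have rng: "range h = harmonics T"
  proof
    show "range h \<subseteq> harmonics T"
      unfolding h_def harmonics_def by (auto intro: exI[of _ "- _"])
    show "harmonics T \<subseteq> range h"
    proof
      fix x assume "x \<in> harmonics T"
      then obtain k :: int where "x = 2 * pi * of_int k / T" unfolding harmonics_def by blast
      then have "x = h (- k)" by (simp add: h_def)
      then show "x \<in> range h" by blast
    qed
  qed
  define I where "I = integral {0..T} (\<lambda>t. (cmod (G t))\<^sup>2)"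
  have I0: "I \<ge> 0" unfolding I_def by (intro integral_nonneg integrable_continuous_real continuous_intros G) auto
  have per: "cis ((\<mu> - \<nu>) * (T - 0)) = 1" if "\<mu> \<in> harmonics T" "\<nu> \<in> harmonics T" for \<mu> \<nu>
  proof -
    obtain k l :: int where "\<mu> = 2 * pi * of_int k / T" "\<nu> = 2 * pi * of_int l / T"
      using \<open>\<mu> \<in> harmonics T\<close> \<open>\<nu> \<in> harmonics T\<close> unfolding harmonics_def by blast
    then have "(\<mu> - \<nu>) * (T - 0) = 2 * pi * of_int (k - l)" using T by (simp add: field_simps)
    then show ?thesis by (simp add: cis_multiple_2pi del: of_int_diff)
  qed
  have id: "integral {0..T} (\<lambda>t. (cmod (G t - (\<Sum>\<mu>\<in>M. c \<mu> * e_fun \<mu> t)))\<^sup>2)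
    = I - (\<Sum>\<mu>\<in>M. (cmod (\<gamma> \<mu>))\<^sup>2) / T + T * (\<Sum>\<mu>\<in>M. (cmod (c \<mu> - \<gamma> \<mu> / of_real T))\<^sup>2)"
    if "finite M" "M \<subseteq> harmonics T" for M c
    using integral_sum_square_expand[OF G(1) that(1) T, of c] per that(2) unfolding \<gamma>_def I_def by auto
  have "(\<Sum>\<^sub>\<infinity>k\<in>(UNIV::int set). ennreal ((cmod (integral {0..T} (\<lambda>t. G t * cis (2 * pi / T * of_int k * t))))\<^sup>2))
     = (\<Sum>\<^sub>\<infinity>k\<in>(UNIV::int set). ennreal ((cmod (\<gamma> (h k)))\<^sup>2))"
    by (simp add: \<gamma>_def h_def e_fun_def cis_cnj)
  also have "\<dots> = (\<Sum>\<^sub>\<infinity>\<mu>\<in>harmonics T. ennreal ((cmod (\<gamma> \<mu>))\<^sup>2))"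
    using infsum_reindex[of h UNIV "\<lambda>\<mu>. ennreal ((cmod (\<gamma> \<mu>))\<^sup>2)"] inj rng by (simp add: o_def)
  also have "\<dots> = ennreal (T * I)"
  proof (rule antisym)
    show "(\<Sum>\<^sub>\<infinity>\<mu>\<in>harmonics T. ennreal ((cmod (\<gamma> \<mu>))\<^sup>2)) \<le> ennreal (T * I)"
    proof (subst infsum_le_ennreal_real, simp, use T I0 in simp, intro allI impI)
      fix M assume M: "finite M" "M \<subseteq> harmonics T"
      have "0 \<le> integral {0..T} (\<lambda>t. (cmod (G t - (\<Sum>\<mu>\<in>M. (\<gamma> \<mu> / of_real T) * e_fun \<mu> t)))\<^sup>2)"
        by (intro integral_nonneg integrable_continuous_real continuous_intros G) auto
      then show "(\<Sum>\<mu>\<in>M. (cmod (\<gamma> \<mu>))\<^sup>2) \<le> T * I"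
        using T unfolding id[OF M] by (simp add: field_simps)
    qed
    have ge: "ennreal (T * I) \<le> (\<Sum>\<^sub>\<infinity>\<mu>\<in>harmonics T. ennreal ((cmod (\<gamma> \<mu>))\<^sup>2)) + ennreal e" if e: "e > 0" for e
    proof -
      \<comment> \<open>A uniform error \<eta> contributes T times T \<eta>^2, that is (T \<eta>)^2,
        to the defect in Parseval's identity; this choice makes it e.\<close>
      define \<eta> where "\<eta> = sqrt e / T"
      have \<eta>: "\<eta> > 0" using e T by (simp add: \<eta>_def)
      obtain q where q: "q \<in> trig_poly_in (harmonics T)" "\<forall>t\<in>{0..T}. cmod (G t - q t) \<le> \<eta>"
        using periodic_approximation[OF T G \<eta>] by blast
      obtain M c where M: "finite M" "M \<subseteq> harmonics T" "q = (\<lambda>t. \<Sum>\<mu>\<in>M. c \<mu> * e_fun \<mu> t)"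
        using q(1) unfolding trig_poly_in_def by blast
      have "I - (\<Sum>\<mu>\<in>M. (cmod (\<gamma> \<mu>))\<^sup>2) / T \<le> integral {0..T} (\<lambda>t. (cmod (G t - (\<Sum>\<mu>\<in>M. c \<mu> * e_fun \<mu> t)))\<^sup>2)"
        unfolding id[OF M(1,2)] using T by (simp add: sum_nonneg)
      also have "\<dots> \<le> integral {0..T} (\<lambda>t. \<eta>\<^sup>2)"
        using q(2) unfolding M(3)
        by (intro integral_le integrable_continuous_real continuous_intros G power_mono) auto
      also have "\<dots> = T * \<eta>\<^sup>2" using T by simp
      finally have "T * I - (\<Sum>\<mu>\<in>M. (cmod (\<gamma> \<mu>))\<^sup>2) \<le> (T * \<eta>)\<^sup>2"
        using T by (simp add: field_simps power2_eq_square)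
      also have "(T * \<eta>)\<^sup>2 = e" using T e by (simp add: \<eta>_def)
      finally have "ennreal (T * I) \<le> ennreal ((\<Sum>\<mu>\<in>M. (cmod (\<gamma> \<mu>))\<^sup>2) + e)" by (intro ennreal_leI) simp
      also have "\<dots> = (\<Sum>\<mu>\<in>M. ennreal ((cmod (\<gamma> \<mu>))\<^sup>2)) + ennreal e"
        using e by (simp add: ennreal_plus sum_nonneg sum_ennreal)
      also have "\<dots> \<le> (\<Sum>\<^sub>\<infinity>\<mu>\<in>harmonics T. ennreal ((cmod (\<gamma> \<mu>))\<^sup>2)) + ennreal e"
        by (intro add_right_mono sum_le_infsum_ennreal M)
      finally show ?thesis .
    qed
    show "ennreal (T * I) \<le> (\<Sum>\<^sub>\<infinity>\<mu>\<in>harmonics T. ennreal ((cmod (\<gamma> \<mu>))\<^sup>2))"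
      by (rule ennreal_le_epsilon) (rule ge)
  qed
  finally show ?thesis unfolding I_def .
qed

section \<open>The Wiener space\<close>

text \<open>The term with index k of \<open>wiener_nrm\<close>. Because of the argument x - k it
  controls \<psi> on [-k, 1 - k], so the cell [j, j + 1] carries the index - j below.\<close>

definition cell_bound :: "(real \<Rightarrow> complex) \<Rightarrow> int \<Rightarrow> ennreal" where
  "cell_bound \<psi> k = esssup (restrict_space lebesgue {0..1}) (\<lambda>x. ennreal (cmod (\<psi> (x - of_int k))))"

text \<open>Translation carries the exceptional null set from [0, 1] to the cell.\<close>

lemma AE_cell_bound: "AE t in lebesgue. t \<in> {- of_int k..1 - of_int k} \<longrightarrow> ennreal (cmod (\<psi> t)) \<le> cell_bound \<psi> k"
proof -
  have "AE x in restrict_space lebesgue {0..1}. ennreal (cmod (\<psi> (x - of_int k))) \<le> cell_bound \<psi> k"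
    unfolding cell_bound_def by (rule esssup_AE)
  then have "AE x in lebesgue. x \<in> {0..1::real} \<longrightarrow> ennreal (cmod (\<psi> (x - of_int k))) \<le> cell_bound \<psi> k"
    by (subst (asm) AE_restrict_space_iff) auto
  then obtain N where N: "{x. \<not> (x \<in> {0..1::real} \<longrightarrow> ennreal (cmod (\<psi> (x - of_int k))) \<le> cell_bound \<psi> k)} \<subseteq> N" "negligible N"
    by (auto simp: negligible_iff_null_sets eventually_ae_filter)
  have "negligible ((+) (- of_int k) ` N)" by (rule negligible_translation[OF N(2)])
  moreover have "{t. \<not> (t \<in> {- of_int k..1 - of_int k} \<longrightarrow> ennreal (cmod (\<psi> t)) \<le> cell_bound \<psi> k)} \<subseteq> (+) (- of_int k) ` N"
  proof
    fix t assume "t \<in> {t. \<not> (t \<in> {- of_int k..1 - of_int k} \<longrightarrow> ennreal (cmod (\<psi> t)) \<le> cell_bound \<psi> k)}"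
    then have "t + of_int k \<in> N" using N(1) by auto
    then show "t \<in> (+) (- of_int k) ` N" by (intro image_eqI[of _ _ "t + of_int k"]) auto
  qed
  ultimately show ?thesis
    by (auto simp: negligible_iff_null_sets eventually_ae_filter)
qed

text \<open>Hoelder's inequality cell by cell: the suprema of \<psi> are summable and the integrals
  of w over unit cells are bounded. It is applied with w = 1, with the squared modulus of a
  polynomial and with the modulus of a translated \<open>amalgam\<close> function.\<close>

lemma wiener_integral_bound:
  assumes \<psi>: "\<psi> \<in> wiener_space" and w: "w \<in> borel_measurable lebesgue"
    and C: "\<And>j::int. (\<integral>\<^sup>+t. w t * indicator {of_int j..of_int j + 1} t \<partial>lebesgue) \<le> C"
  shows "(\<integral>\<^sup>+t. ennreal (cmod (\<psi> t)) * w t \<partial>lebesgue) \<le> wiener_nrm \<psi> * C"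
proof -
  have m: "\<psi> \<in> borel_measurable lebesgue" using \<psi> unfolding wiener_space_def by simp
  define f where "f = (\<lambda>t. ennreal (cmod (\<psi> t)) * w t)"
  have f [measurable]: "f \<in> borel_measurable lebesgue"
    unfolding f_def using m w by measurable
  have cell: "(\<integral>\<^sup>+t. f t * indicator {of_int j..of_int j + 1} t \<partial>lebesgue) \<le> cell_bound \<psi> (- j) * C" for j :: int
  proof -
    have "(\<integral>\<^sup>+t. f t * indicator {of_int j..of_int j + 1} t \<partial>lebesgue)
        \<le> (\<integral>\<^sup>+t. cell_bound \<psi> (- j) * (w t * indicator {of_int j..of_int j + 1} t) \<partial>lebesgue)"
      using AE_cell_bound[of "- j" \<psi>]
      by (intro nn_integral_mono_AE, elim eventually_mono) (auto simp: f_def indicator_def intro: mult_right_mono)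
    also have "\<dots> = cell_bound \<psi> (- j) * (\<integral>\<^sup>+t. w t * indicator {of_int j..of_int j + 1} t \<partial>lebesgue)"
      by (intro nn_integral_cmult borel_measurable_times_ennreal w borel_measurable_indicator) simp
    also have "\<dots> \<le> cell_bound \<psi> (- j) * C" by (intro mult_left_mono C) simp
    finally show ?thesis .
  qed
  have "(\<integral>\<^sup>+t. f t \<partial>lebesgue) = (\<integral>\<^sup>+t. (SUP n::nat. f t * indicator {- real n..<real n} t) \<partial>lebesgue)"
  proof (intro nn_integral_cong)
    fix t
    obtain n :: nat where n: "\<bar>t\<bar> < real n" using reals_Archimedean2 by blast
    show "f t = (SUP n::nat. f t * indicator {- real n..<real n} t)"
    proof (rule antisym)
      show "f t \<le> (SUP n::nat. f t * indicator {- real n..<real n} t)"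
        using n by (intro SUP_upper2[of n]) (auto simp: indicator_def abs_less_iff)
      show "(SUP n::nat. f t * indicator {- real n..<real n} t) \<le> f t"
        by (intro SUP_least) (auto simp: indicator_def)
    qed
  qed
  also have "\<dots> = (SUP n::nat. \<integral>\<^sup>+t. f t * indicator {- real n..<real n} t \<partial>lebesgue)"
    by (intro nn_integral_monotone_convergence_SUP borel_measurable_times_ennreal f borel_measurable_indicator)
      (auto simp: incseq_def le_fun_def indicator_def)
  also have "\<dots> \<le> wiener_nrm \<psi> * C"
  proof (rule SUP_least)
    fix n :: nat
    have "(\<integral>\<^sup>+t. f t * indicator {- real n..<real n} t \<partial>lebesgue)
       \<le> (\<integral>\<^sup>+t. (\<Sum>j\<in>{- int n..<int n}. f t * indicator {of_int j..of_int j + 1} t) \<partial>lebesgue)"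
    proof (intro nn_integral_mono)
      fix t
      show "f t * indicator {- real n..<real n} t \<le> (\<Sum>j\<in>{- int n..<int n}. f t * indicator {of_int j..of_int j + 1} t)"
      proof (cases "t \<in> {- real n..<real n}")
        case True
        then have "\<lfloor>t\<rfloor> \<in> {- int n..<int n}" by (auto simp: le_floor_iff floor_less_iff)
        moreover have "t \<in> {of_int \<lfloor>t\<rfloor>..of_int \<lfloor>t\<rfloor> + 1}" by (auto intro: less_imp_le)
        ultimately show ?thesis
          using member_le_sum[of "\<lfloor>t\<rfloor>" "{- int n..<int n}" "\<lambda>j. f t * indicator {of_int j..of_int j + 1} t"] True by simp
      qed simp
    qed
    also have "\<dots> = (\<Sum>j\<in>{- int n..<int n}. \<integral>\<^sup>+t. f t * indicator {of_int j..of_int j + 1} t \<partial>lebesgue)"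
      by (intro nn_integral_sum borel_measurable_times_ennreal f borel_measurable_indicator) simp
    also have "\<dots> \<le> (\<Sum>j\<in>{- int n..<int n}. cell_bound \<psi> (- j) * C)" by (intro sum_mono cell)
    also have "\<dots> = (\<Sum>k\<in>uminus ` {- int n..<int n}. cell_bound \<psi> k) * C"
      by (subst sum.reindex) (simp_all only: inj_on_def sum_distrib_right o_def neg_equal_iff_equal, simp_all)
    also have "\<dots> \<le> wiener_nrm \<psi> * C"
      unfolding wiener_nrm_def cell_bound_def[symmetric] by (intro mult_right_mono sum_le_infsum_ennreal) auto
    finally show "(\<integral>\<^sup>+t. f t * indicator {- real n..<real n} t \<partial>lebesgue) \<le> wiener_nrm \<psi> * C" .
  qed
  finally show ?thesis unfolding f_def .
qed

lemma wiener_space_subset_L1: "wiener_space \<subseteq> L1_fun"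
proof
  fix \<psi> assume \<psi>: "\<psi> \<in> wiener_space"
  have "(\<integral>\<^sup>+t. ennreal (cmod (\<psi> t)) * 1 \<partial>lebesgue) \<le> wiener_nrm \<psi> * 1"
    by (rule wiener_integral_bound[OF \<psi>]) (simp_all add: nn_integral_indicator)
  also have "\<dots> < \<infinity>" using \<psi> unfolding wiener_space_def by simp
  finally show "\<psi> \<in> L1_fun"
    using \<psi> unfolding wiener_space_def L1_fun_def by (simp add: integrable_iff_bounded)
qed

section \<open>Square-summable translates of the Fourier transform\<close>

lemma borel_measurable_lebesgue_continuous:
  "continuous_on UNIV f \<Longrightarrow> f \<in> borel_measurable lebesgue" for f :: "real \<Rightarrow> 'a::topological_space"
  by (intro measurable_completion) (simp add: borel_measurable_continuous_onI)

lemma borel_measurable_cis: "(\<lambda>t. cis (x * t)) \<in> borel_measurable lebesgue"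
  by (intro borel_measurable_lebesgue_continuous) (auto simp: cis_conv_exp intro!: continuous_intros)

lemma norm_measurable: "f \<in> borel_measurable M \<Longrightarrow> (\<lambda>t. norm (f t)) \<in> borel_measurable M"
  for f :: "'a \<Rightarrow> complex"
  by measurable

lemma L1_measurable: "\<psi> \<in> L1_fun \<Longrightarrow> \<psi> \<in> borel_measurable lebesgue"
  unfolding L1_fun_def by (auto dest: borel_measurable_integrable)

lemma L1_mult_bounded:
  fixes g :: "real \<Rightarrow> complex"
  assumes \<psi>: "\<psi> \<in> L1_fun" and g: "g \<in> borel_measurable lebesgue" "\<And>t. cmod (g t) \<le> K"
  shows "integrable lebesgue (\<lambda>t. \<psi> t * g t)"
proof (rule Bochner_Integration.integrable_bound[where f = "\<lambda>t. K * cmod (\<psi> t)"])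
  show "integrable lebesgue (\<lambda>t. K * cmod (\<psi> t))" using \<psi> unfolding L1_fun_def by simp
  show "(\<lambda>t. \<psi> t * g t) \<in> borel_measurable lebesgue"
    by (intro borel_measurable_times L1_measurable \<psi> g)
  have "cmod (g t) * cmod (\<psi> t) \<le> \<bar>K\<bar> * cmod (\<psi> t)" for t
    using g(2)[of t] by (intro mult_right_mono) auto
  then show "AE t in lebesgue. norm (\<psi> t * g t) \<le> norm (K * cmod (\<psi> t))"
    by (simp add: norm_mult abs_mult mult.commute)
qed

lemma L1_norm_mult_bounded:
  fixes g :: "real \<Rightarrow> real"
  assumes \<psi>: "\<psi> \<in> L1_fun" and g: "g \<in> borel_measurable lebesgue" "\<And>t. \<bar>g t\<bar> \<le> K"
  shows "integrable lebesgue (\<lambda>t. cmod (\<psi> t) * g t)"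
proof (rule Bochner_Integration.integrable_bound[where f = "\<lambda>t. K * cmod (\<psi> t)"])
  show "integrable lebesgue (\<lambda>t. K * cmod (\<psi> t))" using \<psi> unfolding L1_fun_def by simp
  show "(\<lambda>t. cmod (\<psi> t) * g t) \<in> borel_measurable lebesgue"
    by (intro borel_measurable_times norm_measurable L1_measurable \<psi> g)
  have "\<bar>g t\<bar> * cmod (\<psi> t) \<le> \<bar>K\<bar> * cmod (\<psi> t)" for t
    using g(2)[of t] by (intro mult_right_mono) auto
  then show "AE t in lebesgue. norm (cmod (\<psi> t) * g t) \<le> norm (K * cmod (\<psi> t))"
    by (simp add: abs_mult mult.commute)
qed

lemma cmod_cis_minus_1_le: "cmod (cis x - 1) \<le> 2"
  using norm_triangle_ineq4[of "cis x" 1] by simp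

text \<open>Dominated convergence with majorant 2 |\<psi>|. This estimate yields both the continuity
  of the Fourier transform and the l2 continuity for \<psi> in the Wiener space.\<close>

lemma L1_small_modulation:
  assumes \<psi>: "\<psi> \<in> L1_fun" and \<eta>: "\<eta> > 0"
  shows "\<exists>\<delta>>0. \<forall>x. \<bar>x\<bar> \<le> \<delta> \<longrightarrow> (LINT t|lebesgue. cmod (\<psi> t) * cmod (cis (x * t) - 1)) \<le> \<eta>"
proof -
  define I where "I = (\<lambda>x. LINT t|lebesgue. cmod (\<psi> t) * cmod (cis (x * t) - 1))"
  have "(I \<longlongrightarrow> 0) (at 0)"
    unfolding tendsto_at_iff_sequentially
  proof (intro allI impI)
    fix X :: "nat \<Rightarrow> real" assume X: "X \<longlonglongrightarrow> 0"
    have "(\<lambda>n. I (X n)) \<longlonglongrightarrow> integral\<^sup>L (lebesgue :: real measure) (\<lambda>t. 0 :: real)"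
      unfolding I_def
    proof (rule integral_dominated_convergence[where w = "\<lambda>t. 2 * cmod (\<psi> t)"])
      show "integrable lebesgue (\<lambda>t. 2 * cmod (\<psi> t))" using \<psi> unfolding L1_fun_def by simp
      show "(\<lambda>t. cmod (\<psi> t) * cmod (cis (X n * t) - 1)) \<in> borel_measurable lebesgue" for n
        by (intro borel_measurable_times norm_measurable borel_measurable_diff borel_measurable_const
            L1_measurable \<psi> borel_measurable_cis)
      have "(\<lambda>n. cmod (\<psi> t) * cmod (cis (X n * t) - 1)) \<longlonglongrightarrow> 0" for t
      proof -
        have "(\<lambda>n. cmod (\<psi> t) * cmod (exp (\<i> * of_real (X n * t)) - 1)) \<longlonglongrightarrow> cmod (\<psi> t) * cmod (exp (\<i> * of_real (0 * t)) - 1)"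
          by (intro tendsto_intros X)
        then show ?thesis by (simp add: cis_conv_exp)
      qed
      then show "AE t in lebesgue. (\<lambda>n. cmod (\<psi> t) * cmod (cis (X n * t) - 1)) \<longlonglongrightarrow> 0" by simp
      have "cmod (\<psi> t) * cmod (cis (X n * t) - 1) \<le> cmod (\<psi> t) * 2" for n t
        by (intro mult_left_mono cmod_cis_minus_1_le) simp
      then show "AE t in lebesgue. norm (cmod (\<psi> t) * cmod (cis (X n * t) - 1)) \<le> 2 * cmod (\<psi> t)" for n
        by (simp add: abs_mult mult.commute)
    qed simp
    then show "(I \<circ> X) \<longlonglongrightarrow> 0" by (simp add: o_def)
  qed
  then have "\<forall>\<^sub>F x in at 0. I x < \<eta>" using \<eta> by (rule order_tendstoD)
  then obtain d where d: "d > 0" "\<And>x. x \<noteq> 0 \<Longrightarrow> \<bar>x\<bar> < d \<Longrightarrow> I x < \<eta>"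
    unfolding eventually_at by (auto simp: dist_real_def)
  have "I 0 = 0" unfolding I_def by simp
  then have "I x \<le> \<eta>" if "\<bar>x\<bar> \<le> d / 2" for x
    using d(2)[of x] that d(1) \<eta> by (cases "x = 0") auto
  then show ?thesis unfolding I_def using d(1) by (intro exI[of _ "d / 2"]) auto
qed

lemma fourier_diff:
  assumes \<psi>: "\<psi> \<in> L1_fun"
  shows "fourier \<psi> (\<xi> + x) - fourier \<psi> \<xi> = (LINT t|lebesgue. \<psi> t * (cis (- \<xi> * t) * (cis (- x * t) - 1)))"
proof -
  have i: "integrable lebesgue (\<lambda>t. \<psi> t * cis (- (\<xi> * t)))" for \<xi>
    using L1_mult_bounded[OF \<psi> borel_measurable_cis[of "- \<xi>"], of 1] by simp
  have "fourier \<psi> (\<xi> + x) - fourier \<psi> \<xi> = (LINT t|lebesgue. \<psi> t * cis (- ((\<xi> + x) * t)) - \<psi> t * cis (- (\<xi> * t)))"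
    unfolding fourier_def by (rule Bochner_Integration.integral_diff[OF i i, symmetric])
  also have "\<dots> = (LINT t|lebesgue. \<psi> t * (cis (- \<xi> * t) * (cis (- x * t) - 1)))"
    by (intro Bochner_Integration.integral_cong refl) (simp add: right_diff_distrib cis_mult algebra_simps)
  finally show ?thesis .
qed

lemma fourier_diff_le:
  assumes \<psi>: "\<psi> \<in> L1_fun"
  shows "cmod (fourier \<psi> (\<xi> + x) - fourier \<psi> \<xi>) \<le> (LINT t|lebesgue. cmod (\<psi> t) * cmod (cis (- x * t) - 1))"
  unfolding fourier_diff[OF \<psi>]
  by (rule order_trans[OF integral_norm_bound]) (simp add: norm_mult)

lemma continuous_on_fourier:
  assumes \<psi>: "\<psi> \<in> L1_fun" shows "continuous_on S (fourier \<psi>)"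
proof (rule continuous_on_subset[OF _ subset_UNIV], unfold continuous_on_iff, intro ballI allI impI)
  fix \<xi> e :: real assume e: "e > 0"
  then obtain d where d: "d > 0" "\<And>x. \<bar>x\<bar> \<le> d \<Longrightarrow> (LINT t|lebesgue. cmod (\<psi> t) * cmod (cis (x * t) - 1)) \<le> e / 2"
    using L1_small_modulation[OF \<psi>, of "e / 2"] by auto
  have "cmod (fourier \<psi> \<xi>' - fourier \<psi> \<xi>) < e" if "\<bar>\<xi>' - \<xi>\<bar> < d" for \<xi>'
    using fourier_diff_le[OF \<psi>, of \<xi> "\<xi>' - \<xi>"] d(2)[of "- (\<xi>' - \<xi>)"] that e
    by (simp del: minus_diff_eq)
  then show "\<exists>d>0. \<forall>x'\<in>UNIV. dist x' \<xi> < d \<longrightarrow> dist (fourier \<psi> x') (fourier \<psi> \<xi>) < e"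
    using d(1) by (auto simp: dist_norm)
qed

text \<open>Bessel's inequality by duality: the sum of squares is \<open>\<integral> \<psi> u p\<close> for a trigonometric polynomial
  \<open>p\<close> of period \<open>2 \<pi> / \<beta>\<close>, and \<open>\<integral> \<bar>\<psi>\<bar> \<bar>p\<bar>\<^sup>2\<close> is controlled by the local averages of \<open>\<bar>p\<bar>\<^sup>2\<close>.\<close>

lemma wiener_bessel:
  fixes \<beta> :: real
  assumes \<psi>: "\<psi> \<in> wiener_space" and \<beta>: "\<beta> > 0" and L: "finite L"
    and u: "u \<in> borel_measurable lebesgue" "\<And>t. cmod (u t) \<le> K"
  defines "d \<equiv> \<lambda>\<mu>. LINT t|lebesgue. \<psi> t * (u t * cis (\<mu> * t))"
  shows "(\<Sum>l\<in>L. (cmod (d (\<beta> * of_int l)))\<^sup>2)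
     \<le> (enn2real (wiener_nrm \<psi>) + 1) * (1 + 2 * pi / \<beta>) * (LINT t|lebesgue. cmod (\<psi> t) * (cmod (u t))\<^sup>2)"
proof -
  have \<psi>1: "\<psi> \<in> L1_fun" using \<psi> wiener_space_subset_L1 by blast
  define P where "P = 2 * pi / \<beta>"
  have P: "P > 0" using \<beta> by (simp add: P_def)
  define M where "M = (\<lambda>l. \<beta> * of_int l) ` L"
  have M: "finite M" using L by (simp add: M_def)
  define D where "D = (\<Sum>\<mu>\<in>M. (cmod (d \<mu>))\<^sup>2)"
  have D0: "D \<ge> 0" unfolding D_def by (rule sum_nonneg) simp
  have D: "(\<Sum>l\<in>L. (cmod (d (\<beta> * of_int l)))\<^sup>2) = D"
    unfolding D_def M_def using \<beta> by (subst sum.reindex) (auto simp: inj_on_def)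
  define p where "p = (\<lambda>t. \<Sum>\<mu>\<in>M. cnj (d \<mu>) * e_fun \<mu> t)"
  have pT: "p \<in> trig_poly" unfolding p_def trig_poly_def using M by auto
  have p: "continuous_on S p" for S by (rule trig_poly_continuous[OF pT])
  obtain J where J: "\<And>t. cmod (p t) \<le> J" using trig_poly_bounded[OF pT] by blast
  have J0: "J \<ge> 0" using J[of 0] norm_ge_zero order_trans by blast
  have K0: "K \<ge> 0" using u(2)[of 0] norm_ge_zero order_trans by blast
  have pm: "p \<in> borel_measurable lebesgue" by (intro borel_measurable_lebesgue_continuous p)
  \<comment> \<open>A unit cell need not contain a whole number of periods P. It is enlarged to N
    periods, of total length between 1 and 1 + P, on which the exponentials are orthogonal.\<close>
  define N where "N = nat \<lceil>1 / P\<rceil>"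
  have N: "1 \<le> real N * P" "real N * P \<le> 1 + P"
  proof -
    have "1 / P \<le> real N" "real N \<le> 1 / P + 1" unfolding N_def using P of_int_ceiling_le_add_one[of "1 / P"] by (auto simp: real_nat_ceiling_ge)
    then show "1 \<le> real N * P" "real N * P \<le> 1 + P" using P by (auto simp: field_simps)
  qed
  have cell: "(\<integral>\<^sup>+t. ennreal ((cmod (p t))\<^sup>2) * indicator {of_int j..of_int j + 1} t \<partial>lebesgue) \<le> ennreal ((1 + P) * D)" for j :: int
  proof -
    let ?a = "real_of_int j"
    have per: "cis ((\<mu> - \<nu>) * ((?a + real N * P) - ?a)) = 1" if mn: "\<mu> \<in> M" "\<nu> \<in> M" for \<mu> \<nu>
    proof -
      obtain l m :: int where lm: "\<mu> = \<beta> * of_int l" "\<nu> = \<beta> * of_int m" using mn unfolding M_def by blast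
      have "(\<mu> - \<nu>) * ((?a + real N * P) - ?a) = 2 * pi * of_int ((l - m) * int N)"
        using \<beta> by (simp add: lm P_def field_simps)
      then show ?thesis by (simp add: cis_multiple_2pi del: of_int_mult of_int_diff)
    qed
    have "?a < ?a + real N * P" using N(1) by simp
    from integral_sum_square_expand[OF continuous_on_const M this per, of 0 "\<lambda>\<mu>. cnj (d \<mu>)"]
    have full: "integral {?a..?a + real N * P} (\<lambda>t. (cmod (p t))\<^sup>2) = real N * P * D"
      by (simp add: p_def D_def)
    have "integral {?a..?a + 1} (\<lambda>t. (cmod (p t))\<^sup>2) \<le> integral {?a..?a + real N * P} (\<lambda>t. (cmod (p t))\<^sup>2)"
      using N(1) by (intro integral_subset_le integrable_continuous_real continuous_intros p) auto
    also have "\<dots> \<le> (1 + P) * D" unfolding full using N(2) D0 by (rule mult_right_mono)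
    finally have le: "integral {?a..?a + 1} (\<lambda>t. (cmod (p t))\<^sup>2) \<le> (1 + P) * D" .
    have "((\<lambda>t. (cmod (p t))\<^sup>2) has_integral integral {?a..?a + 1} (\<lambda>t. (cmod (p t))\<^sup>2)) {?a..?a + 1}"
      by (intro integrable_integral integrable_continuous_real continuous_intros p)
    from nn_integral_has_integral_lebesgue'[OF _ this]
    have "(\<integral>\<^sup>+t. ennreal ((cmod (p t))\<^sup>2) * indicator {?a..?a + 1} t \<partial>lebesgue) = ennreal (integral {?a..?a + 1} (\<lambda>t. (cmod (p t))\<^sup>2))"
      by (simp add: nn_integral_completion)
    with le show ?thesis by (simp add: ennreal_leI)
  qed
  define w where "w = enn2real (wiener_nrm \<psi>)"
  have w: "wiener_nrm \<psi> = ennreal w" "w \<ge> 0"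
    using \<psi> unfolding w_def wiener_space_def by simp_all
  define A where "A = (LINT t|lebesgue. cmod (\<psi> t) * (cmod (u t))\<^sup>2)"
  define B where "B = (LINT t|lebesgue. cmod (\<psi> t) * (cmod (p t))\<^sup>2)"
  have iu: "integrable lebesgue (\<lambda>t. cmod (\<psi> t) * (cmod (u t))\<^sup>2)"
    by (rule L1_norm_mult_bounded[OF \<psi>1, where K = "K\<^sup>2"])
       (use u in \<open>auto intro!: borel_measurable_power norm_measurable power_mono\<close>)
  have ip: "integrable lebesgue (\<lambda>t. cmod (\<psi> t) * (cmod (p t))\<^sup>2)"
    by (rule L1_norm_mult_bounded[OF \<psi>1, where K = "J\<^sup>2"])
       (use pm J in \<open>auto intro!: borel_measurable_power norm_measurable power_mono\<close>)
  have B: "B \<le> w * ((1 + P) * D)"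
  proof -
    have "ennreal B = (\<integral>\<^sup>+t. ennreal (cmod (\<psi> t) * (cmod (p t))\<^sup>2) \<partial>lebesgue)"
      unfolding B_def by (rule nn_integral_eq_integral[OF ip, symmetric]) simp
    also have "\<dots> = (\<integral>\<^sup>+t. ennreal (cmod (\<psi> t)) * ennreal ((cmod (p t))\<^sup>2) \<partial>lebesgue)"
      by (simp add: ennreal_mult)
    also have "\<dots> \<le> wiener_nrm \<psi> * ennreal ((1 + P) * D)"
      by (rule wiener_integral_bound[OF \<psi> _ cell])
         (intro measurable_compose[OF _ measurable_ennreal] borel_measurable_power norm_measurable pm)
    also have "\<dots> = ennreal (w * ((1 + P) * D))" using w D0 P by (simp add: ennreal_mult)
    finally show ?thesis using w D0 P by (simp add: ennreal_le_iff)
  qed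
  \<comment> \<open>w + 1 instead of w makes \<kappa> positive; the weighted inequality below
    divides by it.\<close>
  define \<kappa> where "\<kappa> = (w + 1) * (1 + P)"
  have \<kappa>: "\<kappa> > 0" using w P by (simp add: \<kappa>_def)
  have B': "B \<le> \<kappa> * D" 
  proof -
    have "w * ((1 + P) * D) \<le> (w + 1) * ((1 + P) * D)" using D0 P by (intro mult_right_mono) auto
    with B show ?thesis unfolding \<kappa>_def mult.assoc by linarith
  qed
  have iup: "integrable lebesgue (\<lambda>t. \<psi> t * (u t * p t))"
    by (rule L1_mult_bounded[OF \<psi>1, where K = "K * J"])
       (auto intro!: borel_measurable_times u pm mult_mono J K0 simp: norm_mult)
  have "of_real D = (LINT t|lebesgue. \<psi> t * (u t * p t))"
  proof -
    have "of_real D = (\<Sum>\<mu>\<in>M. cnj (d \<mu>) * d \<mu>)"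
      by (simp add: D_def complex_norm_square mult.commute del: of_real_power)
    also have "\<dots> = (\<Sum>\<mu>\<in>M. (LINT t|lebesgue. cnj (d \<mu>) * (\<psi> t * (u t * cis (\<mu> * t)))))"
      by (simp add: d_def)
    also have "\<dots> = (LINT t|lebesgue. (\<Sum>\<mu>\<in>M. cnj (d \<mu>) * (\<psi> t * (u t * cis (\<mu> * t)))))"
    proof (rule Bochner_Integration.integral_sum[symmetric])
      fix \<mu>
      have "integrable lebesgue (\<lambda>t. \<psi> t * (u t * cis (\<mu> * t)))"
        by (rule L1_mult_bounded[OF \<psi>1, where K = K]) (auto intro!: borel_measurable_times u borel_measurable_cis simp: norm_mult)
      then show "integrable lebesgue (\<lambda>t. cnj (d \<mu>) * (\<psi> t * (u t * cis (\<mu> * t))))" by simp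
    qed
    also have "\<dots> = (LINT t|lebesgue. \<psi> t * (u t * p t))"
      by (simp add: p_def e_fun_def sum_distrib_left mult_ac)
    finally show ?thesis .
  qed
  then have "D = cmod (LINT t|lebesgue. \<psi> t * (u t * p t))" using D0 by (metis abs_of_nonneg norm_of_real)
  also have "\<dots> \<le> (LINT t|lebesgue. cmod (\<psi> t * (u t * p t)))" by (rule integral_norm_bound)
  also have "\<dots> \<le> (LINT t|lebesgue. \<kappa> / 2 * (cmod (\<psi> t) * (cmod (u t))\<^sup>2) + 1 / (2 * \<kappa>) * (cmod (\<psi> t) * (cmod (p t))\<^sup>2))"
  proof (intro integral_mono integrable_norm iup Bochner_Integration.integrable_add integrable_mult_right iu ip)
    fix t
    \<comment> \<open>The weights are chosen so that the integral of the term with p is at most D /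
      2 by \<open>B'\<close> and can be absorbed on the left.\<close>
    have "0 \<le> (\<kappa> * cmod (u t) - cmod (p t))\<^sup>2" by simp
    then have "cmod (u t) * cmod (p t) \<le> \<kappa> / 2 * (cmod (u t))\<^sup>2 + 1 / (2 * \<kappa>) * (cmod (p t))\<^sup>2"
      using \<kappa> by (simp add: field_simps power2_eq_square)
    from mult_left_mono[OF this norm_ge_zero[of "\<psi> t"]]
    show "cmod (\<psi> t * (u t * p t)) \<le> \<kappa> / 2 * (cmod (\<psi> t) * (cmod (u t))\<^sup>2) + 1 / (2 * \<kappa>) * (cmod (\<psi> t) * (cmod (p t))\<^sup>2)"
      by (simp add: norm_mult algebra_simps)
  qed
  also have "\<dots> = \<kappa> / 2 * A + 1 / (2 * \<kappa>) * B"
    unfolding A_def B_def using iu ip by simp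
  also have "\<dots> \<le> \<kappa> / 2 * A + 1 / (2 * \<kappa>) * (\<kappa> * D)"
    using \<kappa> B' by (intro add_left_mono mult_left_mono) auto
  also have "\<dots> = \<kappa> / 2 * A + D / 2" using \<kappa> by simp
  finally have "D \<le> \<kappa> * A" by simp
  then show ?thesis unfolding D \<kappa>_def A_def w_def P_def .
qed

text \<open>Continuity from the right, in l2 over l, of the samples at \<mu> + x - \<beta> l. Only x
  \<ge> 0 occurs, as frequencies are displaced by \<epsilon> s with s in [0, 1]. The condition
  speaks of differences and does not assert that the samples themselves are square summable.\<close>

definition fourier_l2_continuous :: "(real \<Rightarrow> complex) \<Rightarrow> real \<Rightarrow> bool" where
  "fourier_l2_continuous \<psi> \<beta> \<longleftrightarrow> (\<forall>\<mu>. \<forall>\<eta>>0. \<exists>\<delta>>0. \<forall>x. 0 \<le> x \<longrightarrow> x \<le> \<delta> \<longrightarrow> (\<forall>L::int set. finite L \<longrightarrow>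
     (\<Sum>l\<in>L. (cmod (fourier \<psi> (\<mu> + x - \<beta> * of_int l) - fourier \<psi> (\<mu> - \<beta> * of_int l)))\<^sup>2) \<le> \<eta>))"

text \<open>The difference at l is the integral of \<psi> u against cis (\<beta> l t), with u = cis
  (- \<mu> t) (cis (- x t) - 1). Bessel's inequality bounds the square sum by a multiple of
  \<integral> |\<psi>| |u|^2, and |u| \<le> 2 reduces this to
  \<open>L1_small_modulation\<close>.\<close>

lemma fourier_l2_continuous_wiener:
  assumes \<psi>: "\<psi> \<in> wiener_space" and \<beta>: "\<beta> > 0"
  shows "fourier_l2_continuous \<psi> \<beta>"
  unfolding fourier_l2_continuous_def
proof (intro allI impI)
  fix \<mu> \<eta> :: real assume \<eta>: "\<eta> > 0"
  have \<psi>1: "\<psi> \<in> L1_fun" using \<psi> wiener_space_subset_L1 by blast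
  define \<kappa> where "\<kappa> = (enn2real (wiener_nrm \<psi>) + 1) * (1 + 2 * pi / \<beta>)"
  have \<kappa>: "\<kappa> > 0" using \<beta> unfolding \<kappa>_def by (intro mult_pos_pos add_nonneg_pos add_pos_nonneg) auto
  obtain \<delta> where \<delta>: "\<delta> > 0" "\<And>x. \<bar>x\<bar> \<le> \<delta> \<Longrightarrow> (LINT t|lebesgue. cmod (\<psi> t) * cmod (cis (x * t) - 1)) \<le> \<eta> / (2 * \<kappa>)"
    using L1_small_modulation[OF \<psi>1, of "\<eta> / (2 * \<kappa>)"] \<eta> \<kappa> by auto
  have "(\<Sum>l\<in>L. (cmod (fourier \<psi> (\<mu> + x - \<beta> * of_int l) - fourier \<psi> (\<mu> - \<beta> * of_int l)))\<^sup>2) \<le> \<eta>"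
    if x: "0 \<le> x" "x \<le> \<delta>" and L: "finite L" for x and L :: "int set"
  proof -
    define u where "u = (\<lambda>t. cis (- \<mu> * t) * (cis (- x * t) - 1))"
    have um: "u \<in> borel_measurable lebesgue"
      unfolding u_def by (intro borel_measurable_times borel_measurable_diff borel_measurable_const borel_measurable_cis)
    have u2: "cmod (u t) \<le> 2" for t unfolding u_def norm_mult norm_cis mult_1 by (rule cmod_cis_minus_1_le)
    have eq: "fourier \<psi> (\<mu> + x - \<beta> * of_int l) - fourier \<psi> (\<mu> - \<beta> * of_int l) = (LINT t|lebesgue. \<psi> t * (u t * cis ((\<beta> * of_int l) * t)))" for l
    proof -
      have "fourier \<psi> ((\<mu> - \<beta> * of_int l) + x) - fourier \<psi> (\<mu> - \<beta> * of_int l) = (LINT t|lebesgue. \<psi> t * (u t * cis ((\<beta> * of_int l) * t)))"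
        unfolding fourier_diff[OF \<psi>1]
      proof (intro Bochner_Integration.integral_cong refl)
        fix t
        have "cis (- (\<mu> - \<beta> * of_int l) * t) = cis (- \<mu> * t) * cis ((\<beta> * of_int l) * t)"
          by (simp add: cis_mult algebra_simps)
        then show "\<psi> t * (cis (- (\<mu> - \<beta> * of_int l) * t) * (cis (- x * t) - 1)) = \<psi> t * (u t * cis ((\<beta> * of_int l) * t))"
          by (simp only: u_def mult_ac)
      qed
      then show ?thesis by (simp add: algebra_simps)
    qed
    have "(\<Sum>l\<in>L. (cmod (fourier \<psi> (\<mu> + x - \<beta> * of_int l) - fourier \<psi> (\<mu> - \<beta> * of_int l)))\<^sup>2)
        \<le> \<kappa> * (LINT t|lebesgue. cmod (\<psi> t) * (cmod (u t))\<^sup>2)"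
      unfolding eq \<kappa>_def by (rule wiener_bessel[OF \<psi> \<beta> L um u2])
    also have "(LINT t|lebesgue. cmod (\<psi> t) * (cmod (u t))\<^sup>2) \<le> (LINT t|lebesgue. 2 * (cmod (\<psi> t) * cmod (cis (- x * t) - 1)))"
    proof (rule integral_mono)
      show "integrable lebesgue (\<lambda>t. cmod (\<psi> t) * (cmod (u t))\<^sup>2)"
        using power_mono[OF u2 norm_ge_zero, of _ 2]
        by (intro L1_norm_mult_bounded[OF \<psi>1, where K = 4] borel_measurable_power norm_measurable um) simp
      have "integrable lebesgue (\<lambda>t. cmod (\<psi> t) * cmod (cis (- x * t) - 1))"
        by (intro L1_norm_mult_bounded[OF \<psi>1, where K = 2] norm_measurable borel_measurable_diff
            borel_measurable_cis borel_measurable_const) (simp only: abs_norm_cancel cmod_cis_minus_1_le)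
      then show "integrable lebesgue (\<lambda>t. 2 * (cmod (\<psi> t) * cmod (cis (- x * t) - 1)))" by simp
      fix t
      have "cmod (u t) * cmod (u t) \<le> 2 * cmod (cis (- x * t) - 1)"
        using u2[of t] by (intro mult_mono) (auto simp: u_def norm_mult)
      from mult_left_mono[OF this norm_ge_zero[of "\<psi> t"]]
      show "cmod (\<psi> t) * (cmod (u t))\<^sup>2 \<le> 2 * (cmod (\<psi> t) * cmod (cis (- x * t) - 1))"
        by (simp add: power2_eq_square mult_ac)
    qed
    also have "\<dots> \<le> 2 * (\<eta> / (2 * \<kappa>))" using \<delta>(2)[of "- x"] x by simp
    finally show ?thesis using \<kappa> by (simp add: mult_left_mono)
  qed
  then show "\<exists>\<delta>>0. \<forall>x. 0 \<le> x \<longrightarrow> x \<le> \<delta> \<longrightarrow> (\<forall>L::int set. finite L \<longrightarrow>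
     (\<Sum>l\<in>L. (cmod (fourier \<psi> (\<mu> + x - \<beta> * of_int l) - fourier \<psi> (\<mu> - \<beta> * of_int l)))\<^sup>2) \<le> \<eta>)"
    using \<delta>(1) by blast
qed

text \<open>A value above the essential supremum would persist on an interval of positive length.
  This pointwise bound permits sampling the transform at the single points \<mu> - \<beta>
  l.\<close>

lemma continuous_le_cell_bound:
  assumes F: "continuous_on UNIV F" and z: "z \<in> {of_int j..of_int j + 1}"
  shows "ennreal (cmod (F z)) \<le> cell_bound F (- j)"
proof (rule ccontr)
  assume "\<not> ennreal (cmod (F z)) \<le> cell_bound F (- j)"
  then have less: "cell_bound F (- j) < ennreal (cmod (F z))" by simp
  then have fin: "cell_bound F (- j) < top" by (rule less_trans) simp
  define s where "s = enn2real (cell_bound F (- j))"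
  have s: "cell_bound F (- j) = ennreal s" "s \<ge> 0" using fin by (simp_all add: s_def)
  have "s < cmod (F z)" using less s by (simp add: ennreal_less_iff)
  moreover have "continuous_on UNIV (\<lambda>z. cmod (F z))" by (intro continuous_intros F)
  ultimately obtain d where d: "d > 0" "\<And>y. \<bar>y - z\<bar> < d \<Longrightarrow> \<bar>cmod (F y) - cmod (F z)\<bar> < cmod (F z) - s"
    unfolding continuous_on_iff by (auto simp: dist_real_def) (metis diff_gt_0_iff_gt)
  define a b where "a = max (of_int j) (z - d)" "b = min (of_int j + 1) (z + d)"
  have ab: "a < b" using z d(1) by (auto simp: a_b_def)
  have "AE t in lebesgue. t \<notin> {a<..<b}"
    using AE_cell_bound[of "- j" F]
  proof (rule eventually_mono)
    fix t assume *: "t \<in> {- of_int (- j)..1 - of_int (- j)} \<longrightarrow> ennreal (cmod (F t)) \<le> cell_bound F (- j)"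
    show "t \<notin> {a<..<b}"
    proof
      assume t: "t \<in> {a<..<b}"
      then have "\<bar>t - z\<bar> < d" by (auto simp: a_b_def)
      then have "cmod (F t) > s" using d(2)[of t] by linarith
      moreover have "cmod (F t) \<le> s" using * t s by (auto simp: a_b_def ennreal_le_iff)
      ultimately show False by simp
    qed
  qed
  then have "{a<..<b} \<in> null_sets lebesgue"
    by (subst (asm) AE_iff_null_sets[symmetric]) auto
  then have "emeasure lebesgue {a<..<b} = 0" by (rule null_setsD1)
  then show False using ab by simp
qed

text \<open>Points with spacing \<beta> meet each unit cell at most \<lceil>1 / \<beta>\<rceil> + 1
  times, so sampling multiplies a sum over cells by at most this factor.\<close>

lemma separated_cell_sum:
  fixes s :: "int \<Rightarrow> real" and \<beta> \<mu> :: real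
  assumes \<beta>: "\<beta> > 0" and s: "\<And>j. s j \<ge> 0" "\<And>J. finite J \<Longrightarrow> sum s J \<le> w" and L: "finite (L :: int set)"
  shows "(\<Sum>l\<in>L. s \<lfloor>\<mu> - \<beta> * of_int l\<rfloor>) \<le> (of_int \<lceil>1 / \<beta>\<rceil> + 1) * w"
proof -
  define \<kappa> where "\<kappa> = (\<lambda>l::int. \<lfloor>\<mu> - \<beta> * of_int l\<rfloor>)"
  define m where "m = nat (\<lceil>1 / \<beta>\<rceil> + 1)"
  have "1 / \<beta> > 0" using \<beta> by simp
  then have c0: "\<lceil>1 / \<beta>\<rceil> \<ge> 0" by linarith
  have m: "real m = of_int \<lceil>1 / \<beta>\<rceil> + 1" using c0 by (simp add: m_def)
  have card: "card {l \<in> L. \<kappa> l = j} \<le> m" for j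
  proof (cases "{l \<in> L. \<kappa> l = j} = {}")
    case False
    define S where "S = {l \<in> L. \<kappa> l = j}"
    have S: "finite S" "S \<noteq> {}" using L False by (auto simp: S_def)
    \<comment> \<open>Counted from the smallest index whose point lies in the cell: two such indices
      differ by less than 1 / \<beta>.\<close>
    have "S \<subseteq> {Min S..Min S + \<lceil>1 / \<beta>\<rceil>}"
    proof
      fix l assume l: "l \<in> S"
      have "Min S \<in> S" using S by (rule Min_in)
      with l have "\<lfloor>\<mu> - \<beta> * of_int l\<rfloor> = \<lfloor>\<mu> - \<beta> * of_int (Min S)\<rfloor>" by (simp add: S_def \<kappa>_def)
      then have "\<beta> * of_int l - \<beta> * of_int (Min S) < 1" by linarith
      then have "of_int l - of_int (Min S) < 1 / \<beta>" using \<beta> by (simp add: field_simps)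
      then have "l - Min S \<le> \<lceil>1 / \<beta>\<rceil>" by linarith
      then show "l \<in> {Min S..Min S + \<lceil>1 / \<beta>\<rceil>}" using Min_le[OF S(1) l] by auto
    qed
    then have "card S \<le> card {Min S..Min S + \<lceil>1 / \<beta>\<rceil>}" by (intro card_mono) auto
    also have "\<dots> = m" by (simp add: m_def)
    finally show ?thesis by (simp add: S_def)
  qed (simp only: card.empty)
  have "(\<Sum>l\<in>L. s (\<kappa> l)) = (\<Sum>j\<in>\<kappa> ` L. \<Sum>l | l \<in> L \<and> \<kappa> l = j. s (\<kappa> l))"
    by (rule sum.image_gen[OF L])
  also have "\<dots> = (\<Sum>j\<in>\<kappa> ` L. real (card {l \<in> L. \<kappa> l = j}) * s j)"
    by (intro sum.cong refl) simp
  also have "\<dots> \<le> (\<Sum>j\<in>\<kappa> ` L. real m * s j)"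
    using card by (intro sum_mono mult_right_mono s) auto
  also have "\<dots> = real m * sum s (\<kappa> ` L)" by (simp add: sum_distrib_left)
  also have "\<dots> \<le> real m * w" using L by (intro mult_left_mono s) auto
  finally show ?thesis by (simp add: m \<kappa>_def)
qed

text \<open>\<open>L0\<close> attains the supremum of the finite sums up to e, which leaves at most
  e for any finite set disjoint from it.\<close>

lemma bounded_sums_small_tail:
  fixes b :: "'i \<Rightarrow> real"
  assumes b: "\<And>i. b i \<ge> 0" "\<And>L. finite L \<Longrightarrow> sum b L \<le> X" and e: "e > 0"
  obtains L0 where "finite L0" "\<And>L. finite L \<Longrightarrow> sum b (L - L0) \<le> e"
proof -
  define S where "S = (SUP L\<in>{L. finite L}. sum b L)"
  have bdd: "bdd_above (sum b ` {L. finite L})" by (intro bdd_aboveI2[of _ _ X]) (simp add: b(2))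
  have "S - e < S" using e by simp
  then obtain L0 where L0: "finite L0" "S - e < sum b L0"
    unfolding S_def using less_cSUP_iff[OF _ bdd, of "S - e"] by (auto simp: S_def)
  have "sum b (L - L0) \<le> e" if L: "finite L" for L
  proof -
    have "sum b (L - L0) + sum b L0 = sum b (L \<union> L0)"
      using sum.subset_diff[of L0 "L \<union> L0" b] L L0(1) by (simp add: Un_Diff)
    also have "\<dots> \<le> S" unfolding S_def using L L0(1) by (intro cSUP_upper[OF _ bdd]) auto
    finally show ?thesis using L0(2) by simp
  qed
  with L0(1) show ?thesis using that by blast
qed

text \<open>The samples are dominated by the summable cell bounds. Off a finite set
  \<open>L0\<close> of indices the bounds themselves are small, and on \<open>L0\<close> the
  continuity of the transform suffices.\<close>

lemma fourier_l2_continuous_fourier_wiener: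
  assumes \<psi>: "\<psi> \<in> L1_fun" and F: "fourier \<psi> \<in> wiener_space" and \<beta>: "\<beta> > 0"
  shows "fourier_l2_continuous \<psi> \<beta>"
  unfolding fourier_l2_continuous_def
proof (intro allI impI)
  fix \<mu> \<eta> :: real assume \<eta>: "\<eta> > 0"
  let ?F = "fourier \<psi>"
  have cont: "continuous_on S ?F" for S by (rule continuous_on_fourier[OF \<psi>])
  define w where "w = enn2real (wiener_nrm ?F)"
  have w: "wiener_nrm ?F = ennreal w" "w \<ge> 0"
    using F unfolding w_def wiener_space_def by simp_all
  have cb: "cell_bound ?F k < top" for k
  proof -
    have "cell_bound ?F k \<le> wiener_nrm ?F"
      using sum_le_infsum_ennreal[of "{k}" UNIV "cell_bound ?F"] unfolding wiener_nrm_def cell_bound_def by simp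
    also have "\<dots> < top" using w by simp
    finally show ?thesis .
  qed
  define s where "s = (\<lambda>j. enn2real (cell_bound ?F (- j)))"
  have s0: "s j \<ge> 0" for j by (simp add: s_def)
  have s_eq: "ennreal (s j) = cell_bound ?F (- j)" for j using cb by (simp add: s_def)
  have s_le: "cmod (?F z) \<le> s \<lfloor>z\<rfloor>" for z
    using continuous_le_cell_bound[OF cont, of z "\<lfloor>z\<rfloor>"] unfolding s_eq[symmetric]
    by (simp add: s0 ennreal_le_iff less_imp_le)
  have s_sum: "sum s J \<le> w" if "finite J" for J
  proof -
    have "ennreal (sum s J) = (\<Sum>j\<in>J. cell_bound ?F (- j))" by (simp add: s_eq s0 flip: sum_ennreal)
    also have "\<dots> = (\<Sum>k\<in>uminus ` J. cell_bound ?F k)" by (subst sum.reindex) (auto simp: inj_on_def)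
    also have "\<dots> \<le> wiener_nrm ?F"
      unfolding wiener_nrm_def cell_bound_def[symmetric] using that by (intro sum_le_infsum_ennreal) auto
    finally show ?thesis using w by (simp add: ennreal_le_iff)
  qed
  \<comment> \<open>A displacement 0 \<le> x \<le> 1 can carry a sample point into the next
    cell.\<close>
  define s' where "s' = (\<lambda>j. s (j + 1))"
  have s'_sum: "sum s' J \<le> w" if "finite J" for J
  proof -
    have "sum s' J = sum s ((\<lambda>j. j + 1) ` J)" unfolding s'_def by (subst sum.reindex) (auto simp: inj_on_def)
    then show ?thesis using s_sum that by simp
  qed
  have sw: "s j \<le> w" for j using s_sum[of "{j}"] by simp
  define m where "m = of_int \<lceil>1 / \<beta>\<rceil> + (1::real)"
  define b where "b = (\<lambda>l::int. 2 * (s \<lfloor>\<mu> - \<beta> * of_int l\<rfloor> + s' \<lfloor>\<mu> - \<beta> * of_int l\<rfloor>))"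
  have b0: "b l \<ge> 0" for l using s0 by (simp add: b_def s'_def)
  have bw: "b l \<le> 4 * w" for l using sw[of "\<lfloor>\<mu> - \<beta> * of_int l\<rfloor>"] sw[of "\<lfloor>\<mu> - \<beta> * of_int l\<rfloor> + 1"] by (simp add: b_def s'_def)
  have bsum: "sum b L \<le> 4 * (m * w)" if "finite L" for L
    using separated_cell_sum[OF \<beta> s0 s_sum that, of \<mu>] separated_cell_sum[OF \<beta> _ s'_sum that, of \<mu>] s0
    by (simp add: b_def m_def sum.distrib sum_distrib_left[symmetric] s'_def)
  \<comment> \<open>The tail is estimated by |D|^2 \<le> 4 w b, so a sum of b below this number
    contributes at most \<eta> / 2; the summand 1 keeps the denominator positive when w = 0.\<close>
  have eps: "\<eta> / (2 * (4 * w + 1)) > 0" using \<eta> w by simp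
  obtain L0 where L0: "finite L0" "\<And>L. finite L \<Longrightarrow> sum b (L - L0) \<le> \<eta> / (2 * (4 * w + 1))"
    using bounded_sums_small_tail[OF b0 bsum eps] by blast
  define D where "D = (\<lambda>x l. ?F (\<mu> + x - \<beta> * of_int l) - ?F (\<mu> - \<beta> * of_int l))"
  have "continuous_on UNIV (\<lambda>x. \<Sum>l\<in>L0. (cmod (D x l))\<^sup>2)"
    unfolding D_def by (intro continuous_intros continuous_on_compose2[OF cont]) auto
  moreover have "(\<Sum>l\<in>L0. (cmod (D 0 l))\<^sup>2) = 0" by (simp add: D_def)
  ultimately obtain d where d: "d > 0" "\<And>x. \<bar>x\<bar> < d \<Longrightarrow> \<bar>\<Sum>l\<in>L0. (cmod (D x l))\<^sup>2\<bar> < \<eta> / 2"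
    using \<eta> unfolding continuous_on_iff dist_real_def by (metis UNIV_I diff_zero half_gt_zero)
  have "(\<Sum>l\<in>L. (cmod (D x l))\<^sup>2) \<le> \<eta>" if x: "0 \<le> x" "x \<le> min 1 (d / 2)" and L: "finite L" for x and L :: "int set"
  proof -
    have Db: "cmod (D x l) \<le> b l" for l
    proof -
      define y where "y = \<mu> - \<beta> * of_int l"
      have "\<lfloor>y + x\<rfloor> = \<lfloor>y\<rfloor> \<or> \<lfloor>y + x\<rfloor> = \<lfloor>y\<rfloor> + 1" using x by linarith
      then have "cmod (?F (y + x)) \<le> s \<lfloor>y\<rfloor> + s' \<lfloor>y\<rfloor>"
        using s_le[of "y + x"] s0[of "\<lfloor>y\<rfloor>"] s0[of "\<lfloor>y\<rfloor> + 1"] by (auto simp: s'_def)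
      moreover have "cmod (?F y) \<le> s \<lfloor>y\<rfloor> + s' \<lfloor>y\<rfloor>" using s_le[of y] s0[of "\<lfloor>y\<rfloor> + 1"] by (simp add: s'_def)
      moreover have "D x l = ?F (y + x) - ?F y" by (simp add: D_def y_def algebra_simps)
      ultimately show ?thesis
        using norm_triangle_ineq4[of "?F (y + x)" "?F y"] by (simp add: b_def y_def)
    qed
    have "(\<Sum>l\<in>L. (cmod (D x l))\<^sup>2) \<le> (\<Sum>l\<in>L0 \<union> (L - L0). (cmod (D x l))\<^sup>2)"
      using L L0(1) by (intro sum_mono2) auto
    also have "\<dots> = (\<Sum>l\<in>L0. (cmod (D x l))\<^sup>2) + (\<Sum>l\<in>L - L0. (cmod (D x l))\<^sup>2)"
      using L L0(1) by (intro sum.union_disjoint) auto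
    also have "(\<Sum>l\<in>L0. (cmod (D x l))\<^sup>2) \<le> \<eta> / 2" using d(2)[of x] x d(1) by simp
    also have "(\<Sum>l\<in>L - L0. (cmod (D x l))\<^sup>2) \<le> (\<Sum>l\<in>L - L0. (4 * w) * b l)"
    proof (intro sum_mono)
      fix l
      show "(cmod (D x l))\<^sup>2 \<le> (4 * w) * b l"
        unfolding power2_eq_square using Db[of l] bw[of l] b0[of l] by (intro mult_mono) auto
    qed
    also have "\<dots> = 4 * w * sum b (L - L0)" by (simp add: sum_distrib_left)
    also have "\<dots> \<le> (4 * w + 1) * (\<eta> / (2 * (4 * w + 1)))"
      using w L0(2)[OF L] b0 by (intro mult_mono) (auto intro: sum_nonneg)
    also have "\<dots> = \<eta> / 2"
    proof -
      have "V * (\<eta> / (2 * V)) = \<eta> / 2" if "V > 0" for V :: real using that by simp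
      from this[of "4 * w + 1"] show ?thesis using w by linarith
    qed
    finally show ?thesis by simp
  qed
  then show "\<exists>\<delta>>0. \<forall>x. 0 \<le> x \<longrightarrow> x \<le> \<delta> \<longrightarrow> (\<forall>L::int set. finite L \<longrightarrow>
     (\<Sum>l\<in>L. (cmod (?F (\<mu> + x - \<beta> * of_int l) - ?F (\<mu> - \<beta> * of_int l)))\<^sup>2) \<le> \<eta>)"
    unfolding D_def using d(1) by (intro exI[of _ "min 1 (d / 2)"]) auto
qed

section \<open>A slowly varying window\<close>

text \<open>It vanishes continuously at both ends of its support, which makes \<open>window\<close>
  decay quadratically, and it is a polynomial on [0, 1], so that \<open>window\<close> has a closed
  form.\<close>

definition bump :: "real \<Rightarrow> real" where
  "bump s = max 0 (s * (1 - s))"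

definition window :: "real \<Rightarrow> complex" where
  "window x = integral {0..1} (\<lambda>s. of_real (bump s) * cis (x * s))"

lemma continuous_on_bump [continuous_intros]:
  "continuous_on S f \<Longrightarrow> continuous_on S (\<lambda>x. bump (f x))"
  unfolding bump_def by (intro continuous_intros)

lemma bump_nonneg: "0 \<le> bump s" by (simp add: bump_def)

lemma bump_zero: "s \<le> 0 \<or> 1 \<le> s \<Longrightarrow> bump s = 0"
  using mult_le_0_iff[of s "1 - s"] unfolding bump_def by (auto intro: max_absorb1)

lemma bump_eq: "0 \<le> s \<Longrightarrow> s \<le> 1 \<Longrightarrow> bump s = s * (1 - s)"
  by (simp add: bump_def)

lemma bump_le_1: "bump s \<le> 1"
proof (cases "0 \<le> s \<and> s \<le> 1")
  case True
  then have "s * (1 - s) \<le> 1 * 1" by (intro mult_mono) auto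
  then show ?thesis by (simp add: bump_def)
qed (auto simp: bump_zero)

lemma window_integrand_continuous: "continuous_on S (\<lambda>s. of_real (bump s) * cis (x * s))"
  unfolding cis_conv_exp by (intro continuous_intros)

lemma window_le_1: "cmod (window x) \<le> 1"
proof -
  have "norm (integral {0..1} (\<lambda>s. of_real (bump s) * cis (x * s))) \<le> 1 * (1 - 0)"
    by (rule integral_bound) (auto intro!: window_integrand_continuous simp: norm_mult bump_nonneg bump_le_1)
  then show ?thesis by (simp add: window_def)
qed

lemma window_explicit:
  assumes "x \<noteq> 0"
  defines "a \<equiv> \<i> * complex_of_real x"
  shows "window x = exp a * (1 / a^2 - 2 / a^3) + (1 / a^2 + 2 / a^3)"
proof -
  have a: "a \<noteq> 0" using assms by simp
  \<comment> \<open>The antiderivative of exp (a z) (z - z^2) found by repeated integration by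
    parts.\<close>
  define G where "G = (\<lambda>z. exp (a * z) * ((z - z^2) / a - (1 - 2 * z) / a^2 - 2 / a^3))"
  have d: "(G has_field_derivative exp (a * z) * (z - z^2)) (at z)" for z
    unfolding G_def
    by (rule derivative_eq_intros refl | use a in \<open>simp add: field_simps eval_nat_numeral\<close>)+
  have "((\<lambda>s. exp (a * of_real s) * (of_real s - (of_real s)^2)) has_integral (G (of_real 1) - G (of_real 0))) {0..1}"
    by (rule fundamental_theorem_of_calculus) (auto intro!: has_vector_derivative_real_field d)
  then have "((\<lambda>s. of_real (bump s) * cis (x * s)) has_integral (G (of_real 1) - G (of_real 0))) {0..1}"
    by (rule has_integral_eq[rotated]) (auto simp: bump_eq a_def cis_conv_exp power2_eq_square algebra_simps)
  then show ?thesis by (simp add: window_def integral_unique G_def algebra_simps)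
qed

text \<open>There is no term of order 1 / x because \<open>bump\<close> vanishes at 0 and 1. For |x|
  \<le> 1 the trivial bound 1 takes over; 12 is twice the constant 6 obtained for |x| > 1, as 1 +
  x^2 \<le> 2 x^2 there.\<close>

lemma window_decay: "cmod (window x) \<le> 12 / (1 + x\<^sup>2)"
proof (cases "\<bar>x\<bar> \<le> 1")
  case True
  then have "x\<^sup>2 \<le> 1" by (simp add: abs_square_le_1)
  then have "1 \<le> 12 / (1 + x\<^sup>2)" by (simp add: field_simps add_pos_nonneg)
  then show ?thesis using window_le_1[of x] by linarith
next
  case False
  define a where "a = \<i> * complex_of_real x"
  have x: "\<bar>x\<bar> > 1" "x \<noteq> 0" using False by auto
  have x2: "x\<^sup>2 > 1" using one_less_power[OF x(1), of 2] by simp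
  have na: "cmod (1 / a^2) = 1 / x\<^sup>2" "cmod (2 / a^3) \<le> 2 / x\<^sup>2"
  proof -
    show "cmod (1 / a^2) = 1 / x\<^sup>2" by (simp add: a_def norm_divide norm_power norm_mult)
    have "x\<^sup>2 * 1 \<le> x\<^sup>2 * \<bar>x\<bar>" using x by (intro mult_left_mono) auto
    then have "x\<^sup>2 \<le> \<bar>x\<bar>^3" by (simp add: eval_nat_numeral)
    then show "cmod (2 / a^3) \<le> 2 / x\<^sup>2"
      using x by (simp add: a_def norm_divide norm_power norm_mult frac_le)
  qed
  have "cmod (window x) \<le> cmod (exp a * (1 / a^2 - 2 / a^3)) + cmod (1 / a^2 + 2 / a^3)"
    unfolding window_explicit[OF x(2)] a_def[symmetric] by (rule norm_triangle_ineq)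
  also have "cmod (exp a * (1 / a^2 - 2 / a^3)) = cmod (1 / a^2 - 2 / a^3)"
    by (simp add: norm_mult a_def)
  also have "\<dots> + cmod (1 / a^2 + 2 / a^3) \<le> (1 / x\<^sup>2 + 2 / x\<^sup>2) + (1 / x\<^sup>2 + 2 / x\<^sup>2)"
    using na norm_triangle_ineq4[of "1 / a^2" "2 / a^3"] norm_triangle_ineq[of "1 / a^2" "2 / a^3"] by linarith
  also have "\<dots> = 6 / x\<^sup>2" by (simp add: add_divide_distrib[symmetric])
  also have "\<dots> \<le> 12 / (1 + x\<^sup>2)" using x2 x(2) by (simp add: field_simps)
  finally show ?thesis .
qed

lemma integrable_bump_cis: "(\<lambda>s. of_real (bump s) * cis (x * s)) integrable_on {0..1}"
  by (intro integrable_continuous_real window_integrand_continuous)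

lemma window_lipschitz: "cmod (window x - window y) \<le> \<bar>x - y\<bar>"
proof -
  have "window x - window y = integral {0..1} (\<lambda>s. of_real (bump s) * cis (x * s) - of_real (bump s) * cis (y * s))"
    unfolding window_def by (intro integral_diff[symmetric] integrable_bump_cis)
  also have "norm \<dots> \<le> \<bar>x - y\<bar> * (1 - 0)"
  proof (rule integral_bound)
    show "continuous_on {0..1} (\<lambda>s. of_real (bump s) * cis (x * s) - of_real (bump s) * cis (y * s))"
      by (intro continuous_on_diff window_integrand_continuous)
    fix s :: real assume s: "s \<in> {0..1}"
    have "cmod (of_real (bump s) * cis (x * s) - of_real (bump s) * cis (y * s)) = bump s * cmod (cis (x * s) - cis (y * s))"
      by (simp add: right_diff_distrib[symmetric] norm_mult bump_nonneg del: right_diff_distrib)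
    also have "\<dots> \<le> 1 * \<bar>x * s - y * s\<bar>" by (intro mult_mono bump_le_1 cmod_cis_diff_le) auto
    also have "\<dots> = \<bar>x - y\<bar> * s" using s by (simp add: left_diff_distrib[symmetric] abs_mult)
    also have "\<dots> \<le> \<bar>x - y\<bar> * 1" using s by (intro mult_left_mono) auto
    finally show "cmod (of_real (bump s) * cis (x * s) - of_real (bump s) * cis (y * s)) \<le> \<bar>x - y\<bar>" by simp
  qed simp
  finally show ?thesis by simp
qed

lemma continuous_on_window [continuous_intros]:
  assumes "continuous_on S f" shows "continuous_on S (\<lambda>x. window (f x))"
proof (rule continuous_on_compose2[OF _ assms subset_UNIV])
  show "continuous_on UNIV window"
    unfolding continuous_on_iff
  proof (intro ballI allI impI)
    fix x e :: real assume "e > 0"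
    then show "\<exists>d>0. \<forall>y\<in>UNIV. dist y x < d \<longrightarrow> dist (window y) (window x) < e"
      using window_lipschitz by (intro exI[of _ e]) (auto simp: dist_norm intro: le_less_trans)
  qed
qed

lemma window_0: "window 0 = 1 / 6"
proof -
  have "((\<lambda>s::real. complex_of_real (s * (1 - s))) has_integral of_real (1/2 - 1/3)) {0..1}"
  proof (rule has_integral_of_real)
    have "((\<lambda>s::real. s * (1 - s)) has_integral (1^2/2 - 1^3/3) - (0^2/2 - 0^3/3)) {0..1}"
      by (rule fundamental_theorem_of_calculus)
         (auto intro!: derivative_eq_intros simp: algebra_simps eval_nat_numeral simp flip: has_real_derivative_iff_has_vector_derivative)
    then show "((\<lambda>s::real. s * (1 - s)) has_integral 1/2 - 1/3) {0..1}" by simp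
  qed
  then have "((\<lambda>s. of_real (bump s) * cis (0 * s)) has_integral of_real (1/2 - 1/3)) {0..1}"
    by (rule has_integral_eq[rotated]) (auto simp: bump_eq)
  then show ?thesis by (simp add: window_def integral_unique)
qed

definition window_sq :: "real \<Rightarrow> real" where "window_sq x = (cmod (window x))\<^sup>2"

lemma integrable_inverse_square: "integrable lebesgue (\<lambda>x::real. inverse (1 + x\<^sup>2))"
  using integrable_inverse_1_plus_square
  by (subst integrable_completion) (auto simp: set_integrable_def einterval_def)

lemma window_sq_le: "window_sq x \<le> 144 * inverse (1 + x\<^sup>2)"
proof -
  have "window_sq x \<le> (12 / (1 + x\<^sup>2))\<^sup>2" unfolding window_sq_def by (intro power_mono window_decay) auto
  also have "\<dots> = 144 * (inverse (1 + x\<^sup>2) * inverse (1 + x\<^sup>2))" by (simp add: power_divide power2_eq_square field_simps)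
  also have "\<dots> \<le> 144 * (inverse (1 + x\<^sup>2) * 1)"
    by (intro mult_left_mono) (auto simp: inverse_le_1_iff add_pos_nonneg)
  finally show ?thesis by simp
qed

lemma window_sq_nonneg: "0 \<le> window_sq x" by (simp add: window_sq_def)

lemma continuous_on_window_sq [continuous_intros]: "continuous_on S f \<Longrightarrow> continuous_on S (\<lambda>x. window_sq (f x))"
  unfolding window_sq_def by (intro continuous_intros)

lemma integrable_dominated_by_inverse_square:
  fixes f :: "real \<Rightarrow> 'a::{banach, second_countable_topology}"
  assumes "continuous_on UNIV f" "\<And>x. norm (f x) \<le> C * inverse (1 + x\<^sup>2)"
  shows "integrable lebesgue f"
proof (rule Bochner_Integration.integrable_bound)
  show "integrable lebesgue (\<lambda>x::real. C * inverse (1 + x\<^sup>2))" using integrable_inverse_square by simp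
  show "f \<in> borel_measurable lebesgue" by (rule borel_measurable_lebesgue_continuous[OF assms(1)])
  show "AE x in lebesgue. norm (f x) \<le> norm (C * inverse (1 + x\<^sup>2))"
    using assms(2) by (intro always_eventually allI) (metis abs_ge_self order_trans real_norm_def)
qed

lemma integrable_window_sq: "integrable lebesgue window_sq"
  by (rule integrable_dominated_by_inverse_square[where C = 144])
     (auto intro!: continuous_on_window_sq continuous_on_id simp: window_sq_le abs_of_nonneg[OF window_sq_nonneg])

definition window_energy :: real where "window_energy = integral\<^sup>L lebesgue window_sq"

lemma window_energy_pos: "window_energy > 0"
proof -
  \<comment> \<open>The value 1 / 6 at 0 and the Lipschitz constant 1 keep the modulus of the window
    above 1 / 12 on [0, 1 / 12].\<close>
  have low: "(1 / 144) * indicator {0..1/12} x \<le> window_sq x" for x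
  proof (cases "x \<in> {0..1/12}")
    case True
    have "cmod (window 0) - cmod (window x) \<le> cmod (window 0 - window x)" by (rule norm_triangle_ineq2)
    also have "\<dots> \<le> 1 / 12" using window_lipschitz[of 0 x] True by simp
    finally have "1 / 12 \<le> cmod (window x)" by (simp add: window_0 norm_divide)
    then have "(1 / 12)\<^sup>2 \<le> window_sq x" unfolding window_sq_def by (intro power_mono) auto
    then show ?thesis using True by (simp add: power2_eq_square)
  qed (simp add: window_sq_nonneg)
  have "0 < (1 / 144) * measure lebesgue {0..1/12::real}" by simp
  also have "\<dots> = (LINT x|lebesgue. (1 / 144) * indicator {0..1/12::real} x)" by simp
  also have "\<dots> \<le> window_energy"
    unfolding window_energy_def
    by (intro integral_mono integrable_window_sq low integrable_mult_right) auto
  finally show ?thesis .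
qed

lemma lborel_integral_affine_lebesgue:
  fixes f :: "real \<Rightarrow> 'a::{banach, second_countable_topology}"
  assumes f: "continuous_on UNIV f" and c: "c \<noteq> 0"
  shows "(LINT x|lebesgue. f x) = \<bar>c\<bar> *\<^sub>R (LINT x|lebesgue. f (t + c * x))"
proof -
  have m: "f \<in> borel_measurable lborel" "(\<lambda>x. f (t + c * x)) \<in> borel_measurable lborel"
    using f by (auto intro!: borel_measurable_continuous_onI continuous_on_compose2[OF f] continuous_intros)
  show ?thesis
    unfolding integral_completion[OF m(1)] integral_completion[OF m(2)] by (rule lborel_integral_real_affine[OF c])
qed

text \<open>A shift of x by \<pi> / s changes the sign of cis (s x). Averaging both forms of the
  integral leaves the difference of \<open>window_sq\<close> at x and at x - \<pi> / s, which tends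
  to 0 under an integrable majorant.\<close>

lemma window_riemann_lebesgue:
  assumes X: "filterlim (\<lambda>n. \<bar>X n\<bar>) at_top sequentially"
  shows "(\<lambda>n. LINT x|lebesgue. of_real (window_sq x) * cis (X n * x)) \<longlonglongrightarrow> 0"
proof -
  define I where "I = (\<lambda>s. LINT x|lebesgue. of_real (window_sq x) * cis (s * x))"
  have cont: "continuous_on UNIV (\<lambda>x. of_real (window_sq (x - d)) * cis (s * x))" for s d
    unfolding cis_conv_exp by (intro continuous_intros)
  \<comment> \<open>For |d| \<le> 1 one has 1 + x^2 \<le> 3 (1 + (x - d)^2), which turns the
    constant 144 of \<open>window_sq_le\<close> into 432. The majorant 576 used below is their
    sum.\<close>
  have dom: "window_sq (x - d) \<le> 432 * inverse (1 + x\<^sup>2)" if "\<bar>d\<bar> \<le> 1" for x d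
  proof -
    have "d\<^sup>2 \<le> 1" using that by (simp add: abs_square_le_1)
    moreover have "0 \<le> ((x - d) - d)\<^sup>2" by simp
    ultimately have "1 + x\<^sup>2 \<le> 3 * (1 + (x - d)\<^sup>2)"
      using zero_le_power2[of "x - d"] by (simp add: power2_eq_square algebra_simps)
    then have "inverse (1 + (x - d)\<^sup>2) \<le> 3 * inverse (1 + x\<^sup>2)"
      by (simp add: field_simps add_pos_nonneg)
    then show ?thesis using window_sq_le[of "x - d"] by linarith
  qed
  define J where "J = (\<lambda>d. LINT x|lebesgue. \<bar>window_sq x - window_sq (x - d)\<bar>)"
  have int: "integrable lebesgue (\<lambda>x. of_real (window_sq (x - d)) * cis (s * x) :: complex)" if "\<bar>d\<bar> \<le> 1" for s d
    by (rule integrable_dominated_by_inverse_square[OF cont, where C = 432])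
       (use dom[OF that] in \<open>simp add: norm_mult window_sq_nonneg\<close>)
  have IJ: "cmod (I s) \<le> J (pi / s)" if s: "\<bar>s\<bar> \<ge> pi" for s
  proof -
    have s0: "s \<noteq> 0" using s pi_gt_zero by (metis abs_zero not_le)
    have d: "\<bar>pi / s\<bar> \<le> 1" using s s0 by (simp add: abs_divide)
    have "I s = (LINT x|lebesgue. of_real (window_sq (x - pi / s)) * cis (s * (x - pi / s)))"
      unfolding I_def
      by (subst lborel_integral_affine_lebesgue[where c = 1 and t = "- (pi / s)"])
         (use cont[of 0 s] in \<open>simp_all add: algebra_simps\<close>)
    also have "\<dots> = (LINT x|lebesgue. - (of_real (window_sq (x - pi / s)) * cis (s * x)))"
    proof (intro Bochner_Integration.integral_cong refl)
      fix x
      have "cis (s * (x - pi / s)) = cis (s * x) * cis (- pi)" using s0 by (simp add: cis_mult right_diff_distrib)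
      then show "of_real (window_sq (x - pi / s)) * cis (s * (x - pi / s)) = - (of_real (window_sq (x - pi / s)) * cis (s * x))"
        by (simp add: cis_cnj[symmetric])
    qed
    also have "\<dots> = - (LINT x|lebesgue. of_real (window_sq (x - pi / s)) * cis (s * x))" by simp
    finally have "2 * I s = I s - (LINT x|lebesgue. of_real (window_sq (x - pi / s)) * cis (s * x))" by simp
    also have "\<dots> = (LINT x|lebesgue. of_real (window_sq x) * cis (s * x) - of_real (window_sq (x - pi / s)) * cis (s * x))"
      unfolding I_def using int[of 0 s] int[OF d, of s] by (subst Bochner_Integration.integral_diff) auto
    also have "cmod \<dots> \<le> (LINT x|lebesgue. cmod (of_real (window_sq x) * cis (s * x) - of_real (window_sq (x - pi / s)) * cis (s * x)))"
      by (rule integral_norm_bound)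
    also have "\<dots> = J (pi / s)"
      unfolding J_def
      by (intro Bochner_Integration.integral_cong refl)
         (simp add: left_diff_distrib[symmetric] norm_mult del: left_diff_distrib flip: of_real_diff)
    finally have "2 * cmod (I s) \<le> J (pi / s)" by (simp add: norm_mult)
    then show ?thesis using norm_ge_zero[of "I s"] by linarith
  qed
  have J0: "(\<lambda>n. J (D n)) \<longlonglongrightarrow> 0" if D: "D \<longlonglongrightarrow> 0" "\<And>n. \<bar>D n\<bar> \<le> 1" for D
  proof -
    have "(\<lambda>n. J (D n)) \<longlonglongrightarrow> integral\<^sup>L (lebesgue :: real measure) (\<lambda>x. 0 :: real)"
      unfolding J_def
    proof (rule integral_dominated_convergence[where w = "\<lambda>x. 576 * inverse (1 + x\<^sup>2)"])
      show "(\<lambda>x. \<bar>window_sq x - window_sq (x - D n)\<bar>) \<in> borel_measurable lebesgue" for n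
        by (intro borel_measurable_lebesgue_continuous continuous_intros)
      show "integrable lebesgue (\<lambda>x::real. 576 * inverse (1 + x\<^sup>2))" using integrable_inverse_square by simp
      have "(\<lambda>n. \<bar>window_sq x - window_sq (x - D n)\<bar>) \<longlonglongrightarrow> 0" for x
      proof -
        have "continuous_on UNIV window_sq" by (intro continuous_on_window_sq continuous_on_id)
        then have "isCont window_sq (x - 0)" by (simp add: continuous_on_eq_continuous_at)
        then have "(\<lambda>n. window_sq (x - D n)) \<longlonglongrightarrow> window_sq (x - 0)"
          by (rule isCont_tendsto_compose) (intro tendsto_intros D)
        then have "(\<lambda>n. \<bar>window_sq x - window_sq (x - D n)\<bar>) \<longlonglongrightarrow> \<bar>window_sq x - window_sq (x - 0)\<bar>"
          by (intro tendsto_intros)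
        then show ?thesis by simp
      qed
      then show "AE x in lebesgue. (\<lambda>n. \<bar>window_sq x - window_sq (x - D n)\<bar>) \<longlonglongrightarrow> 0" by simp
      have "\<bar>window_sq x - window_sq (x - D n)\<bar> \<le> 576 * inverse (1 + x\<^sup>2)" for x n
        using dom[OF D(2), of x n] window_sq_le[of x] window_sq_nonneg[of x] window_sq_nonneg[of "x - D n"] by linarith
      then show "AE x in lebesgue. norm \<bar>window_sq x - window_sq (x - D n)\<bar> \<le> 576 * inverse (1 + x\<^sup>2)" for n by simp
    qed simp
    then show ?thesis by simp
  qed
  have ev: "\<forall>\<^sub>F n in sequentially. \<bar>X n\<bar> \<ge> pi" using X by (simp add: filterlim_at_top)
  \<comment> \<open>The shift is set to 0 while |X n| < \<pi>, so that |D n| \<le> 1 for all n and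
    the majorant applies from the first term on.\<close>
  define D where "D = (\<lambda>n. if \<bar>X n\<bar> \<ge> pi then pi / X n else 0)"
  have "D \<longlonglongrightarrow> 0"
  proof (rule Lim_null_comparison)
    show "\<forall>\<^sub>F n in sequentially. norm (D n) \<le> pi * inverse \<bar>X n\<bar>"
      by (intro always_eventually allI) (auto simp: D_def abs_mult divide_inverse)
    show "(\<lambda>n. pi * inverse \<bar>X n\<bar>) \<longlonglongrightarrow> 0"
      using tendsto_mult_left[OF filterlim_compose[OF tendsto_inverse_0_at_top[OF filterlim_ident] X], of pi] by simp
  qed
  moreover have "\<bar>D n\<bar> \<le> 1" for n
    using divide_le_eq_1[of pi "\<bar>X n\<bar>"] by (auto simp: D_def abs_divide)
  ultimately have "(\<lambda>n. J (D n)) \<longlonglongrightarrow> 0" by (rule J0)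
  moreover have "\<forall>\<^sub>F n in sequentially. cmod (I (X n)) \<le> J (D n)"
    using ev by eventually_elim (use IJ in \<open>auto simp: D_def\<close>)
  ultimately have "(\<lambda>n. I (X n)) \<longlonglongrightarrow> 0" by (rule Lim_null_comparison[rotated])
  then show ?thesis unfolding I_def .
qed

definition windowed :: "(real \<Rightarrow> complex) \<Rightarrow> real \<Rightarrow> real \<Rightarrow> complex" where
  "windowed c \<epsilon> = (\<lambda>t. tp c t * window (\<epsilon> * t))"

lemma windowed_continuous: "finsupp c \<Longrightarrow> continuous_on S (windowed c \<epsilon>)"
  unfolding windowed_def by (intro continuous_intros trig_poly_continuous tp_trig_poly)

lemma windowed_sq_integrable:
  assumes c: "finsupp c" and \<epsilon>: "\<epsilon> > 0"
  shows "integrable lebesgue (\<lambda>x. (cmod (tp c (x / \<epsilon>)))\<^sup>2 * window_sq x)"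
proof -
  obtain K where K: "\<And>t. cmod (tp c t) \<le> K" using trig_poly_bounded[OF tp_trig_poly[OF c]] by blast
  show ?thesis
  proof (rule integrable_dominated_by_inverse_square[where C = "K\<^sup>2 * 144"])
    show "continuous_on UNIV (\<lambda>x. (cmod (tp c (x / \<epsilon>)))\<^sup>2 * window_sq x)"
      by (intro continuous_intros continuous_on_compose2[OF trig_poly_continuous[OF tp_trig_poly[OF c]]]) (use \<epsilon> in auto)
    fix x
    have "(cmod (tp c (x / \<epsilon>)))\<^sup>2 * window_sq x \<le> K\<^sup>2 * (144 * inverse (1 + x\<^sup>2))"
      by (intro mult_mono power_mono K window_sq_le window_sq_nonneg) auto
    then show "norm ((cmod (tp c (x / \<epsilon>)))\<^sup>2 * window_sq x) \<le> K\<^sup>2 * 144 * inverse (1 + x\<^sup>2)"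
      by (simp add: window_sq_nonneg mult.assoc)
  qed
qed

lemma windowed_norm:
  assumes c: "finsupp c" and \<epsilon>: "\<epsilon> > 0"
  shows "windowed c \<epsilon> \<in> L2_fun"
    and "\<epsilon> * (L2_nrm (windowed c \<epsilon>))\<^sup>2 = (LINT x|lebesgue. (cmod (tp c (x / \<epsilon>)))\<^sup>2 * window_sq x)"
proof -
  define g where "g = (\<lambda>x. (cmod (tp c (x / \<epsilon>)))\<^sup>2 * window_sq x)"
  have g: "continuous_on UNIV g"
    unfolding g_def by (intro continuous_intros continuous_on_compose2[OF trig_poly_continuous[OF tp_trig_poly[OF c]]]) (use \<epsilon> in auto)
  have geq: "(cmod (windowed c \<epsilon> t))\<^sup>2 = g (0 + \<epsilon> * t)" for t
    using \<epsilon> by (simp add: g_def windowed_def norm_mult power_mult_distrib window_sq_def)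
  have "integrable lborel g"
    using windowed_sq_integrable[OF c \<epsilon>] g unfolding g_def[symmetric]
    by (simp add: integrable_completion borel_measurable_continuous_onI)
  then have "integrable lborel (\<lambda>t. g (0 + \<epsilon> * t))"
    using \<epsilon> by (subst lborel_integrable_real_affine_iff) auto
  then have i: "integrable lebesgue (\<lambda>t. (cmod (windowed c \<epsilon> t))\<^sup>2)"
    unfolding geq by (subst integrable_completion)
      (auto intro!: borel_measurable_continuous_onI continuous_on_compose2[OF g] continuous_intros)
  then show "windowed c \<epsilon> \<in> L2_fun"
    unfolding L2_fun_def by (simp add: borel_measurable_lebesgue_continuous windowed_continuous c)
  have "(L2_nrm (windowed c \<epsilon>))\<^sup>2 = (LINT t|lebesgue. g (0 + \<epsilon> * t))"
    unfolding L2_nrm_def geq by (simp add: g_def window_sq_nonneg)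
  then show "\<epsilon> * (L2_nrm (windowed c \<epsilon>))\<^sup>2 = (LINT x|lebesgue. (cmod (tp c (x / \<epsilon>)))\<^sup>2 * window_sq x)"
    using lborel_integral_affine_lebesgue[OF g, of \<epsilon> 0] \<epsilon> unfolding g_def by simp
qed

text \<open>After the substitution x = \<epsilon> t the cross terms carry cis ((\<mu> - \<nu>) x /
  \<epsilon>) and vanish in the limit by Riemann-Lebesgue; each diagonal term contributes
  \<open>window_energy\<close>.\<close>

lemma windowed_norm_limit:
  assumes c: "finsupp c"
  defines "\<epsilon> \<equiv> \<lambda>n. inverse (real (Suc n))"
  shows "(\<lambda>n. \<epsilon> n * (L2_nrm (windowed c (\<epsilon> n)))\<^sup>2) \<longlonglongrightarrow> window_energy * (\<Sum>\<mu> | c \<mu> \<noteq> 0. (cmod (c \<mu>))\<^sup>2)"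
proof -
  let ?M = "{\<mu>. c \<mu> \<noteq> 0}"
  have \<epsilon>: "\<epsilon> n > 0" for n by (simp add: \<epsilon>_def)
  define R where "R = (\<lambda>\<nu> n. LINT x|lebesgue. of_real (window_sq x) * cis (\<nu> / \<epsilon> n * x))"
  have Rlim: "R \<nu> \<longlonglongrightarrow> (if \<nu> = 0 then of_real window_energy else 0)" for \<nu>
  proof (cases "\<nu> = 0")
    case True
    then show ?thesis by (simp add: R_def window_energy_def)
  next
    case False
    have "filterlim (\<lambda>n. \<bar>\<nu>\<bar> * real (Suc n)) at_top sequentially"
      using False by (intro filterlim_tendsto_pos_mult_at_top[OF tendsto_const] filterlim_compose[OF filterlim_real_sequentially filterlim_Suc]) simp
    then have "filterlim (\<lambda>n. \<bar>\<nu> / \<epsilon> n\<bar>) at_top sequentially"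
      by (simp add: \<epsilon>_def abs_mult divide_inverse abs_of_nonneg del: of_nat_Suc)
    from window_riemann_lebesgue[OF this] show ?thesis using False by (simp add: R_def)
  qed
  have "of_real (\<epsilon> n * (L2_nrm (windowed c (\<epsilon> n)))\<^sup>2) = (\<Sum>\<mu>\<in>?M. \<Sum>\<nu>\<in>?M. c \<mu> * cnj (c \<nu>) * R (\<mu> - \<nu>) n)" for n
  proof -
    have eq: "complex_of_real ((cmod (tp c (x / \<epsilon> n)))\<^sup>2 * window_sq x)
        = (\<Sum>\<mu>\<in>?M. \<Sum>\<nu>\<in>?M. c \<mu> * cnj (c \<nu>) * (of_real (window_sq x) * cis ((\<mu> - \<nu>) / \<epsilon> n * x)))" for x
    proof -
      have "e_fun \<mu> (x / \<epsilon> n) * cnj (e_fun \<nu> (x / \<epsilon> n)) = cis ((\<mu> - \<nu>) / \<epsilon> n * x)" for \<mu> \<nu>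
        by (simp add: e_fun_def cis_cnj cis_mult diff_divide_distrib algebra_simps)
      then have "tp c (x / \<epsilon> n) * cnj (tp c (x / \<epsilon> n)) = (\<Sum>\<mu>\<in>?M. \<Sum>\<nu>\<in>?M. c \<mu> * cnj (c \<nu>) * cis ((\<mu> - \<nu>) / \<epsilon> n * x))"
        unfolding tp_def cnj_sum sum_product complex_cnj_mult by (intro sum.cong refl) (metis mult.assoc mult.left_commute)
      then show ?thesis
        by (simp only: of_real_mult complex_norm_square) (simp add: sum_distrib_left sum_distrib_right mult_ac)
    qed
    have int: "integrable lebesgue (\<lambda>x. of_real (window_sq x) * cis (s * x) :: complex)" for s
      by (rule integrable_dominated_by_inverse_square[where C = 144])
         (auto simp: cis_conv_exp norm_mult window_sq_nonneg window_sq_le intro!: continuous_intros)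
    have "of_real (\<epsilon> n * (L2_nrm (windowed c (\<epsilon> n)))\<^sup>2) = (LINT x|lebesgue. complex_of_real ((cmod (tp c (x / \<epsilon> n)))\<^sup>2 * window_sq x))"
      unfolding windowed_norm(2)[OF c \<epsilon>] by (rule integral_of_real[OF windowed_sq_integrable[OF c \<epsilon>], symmetric])
    also have "\<dots> = (\<Sum>\<mu>\<in>?M. \<Sum>\<nu>\<in>?M. c \<mu> * cnj (c \<nu>) * R (\<mu> - \<nu>) n)"
      unfolding eq R_def
      by (subst Bochner_Integration.integral_sum, intro Bochner_Integration.integrable_sum integrable_mult_right int)
         (intro sum.cong refl, rule trans[OF Bochner_Integration.integral_sum],
           intro integrable_mult_right int, simp only: integral_mult_right_zero)
    finally show ?thesis .
  qed
  moreover have "(\<lambda>n. \<Sum>\<mu>\<in>?M. \<Sum>\<nu>\<in>?M. c \<mu> * cnj (c \<nu>) * R (\<mu> - \<nu>) n) \<longlonglongrightarrow>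
      (\<Sum>\<mu>\<in>?M. \<Sum>\<nu>\<in>?M. c \<mu> * cnj (c \<nu>) * (if \<mu> - \<nu> = 0 then of_real window_energy else 0))"
    by (intro tendsto_sum tendsto_mult tendsto_const Rlim)
  moreover have "(\<Sum>\<mu>\<in>?M. \<Sum>\<nu>\<in>?M. c \<mu> * cnj (c \<nu>) * (if \<mu> - \<nu> = 0 then of_real window_energy else 0))
     = complex_of_real (window_energy * (\<Sum>\<mu>\<in>?M. (cmod (c \<mu>))\<^sup>2))"
  proof -
    have "(\<Sum>\<nu>\<in>?M. c \<mu> * cnj (c \<nu>) * (if \<mu> - \<nu> = 0 then of_real window_energy else 0)) = of_real window_energy * of_real ((cmod (c \<mu>))\<^sup>2)"
      if "\<mu> \<in> ?M" for \<mu>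
      using that c by (simp add: if_distrib[where f = "(*) _"] complex_norm_square mult.commute del: of_real_power cong: if_cong)
    then show ?thesis by (simp add: sum_distrib_left)
  qed
  ultimately have "(\<lambda>n. complex_of_real (\<epsilon> n * (L2_nrm (windowed c (\<epsilon> n)))\<^sup>2)) \<longlonglongrightarrow> of_real (window_energy * (\<Sum>\<mu>\<in>?M. (cmod (c \<mu>))\<^sup>2))"
    by simp
  then show ?thesis by (simp only: tendsto_of_real_iff)
qed

section \<open>Gabor coefficients of windowed trigonometric polynomials\<close>

lemma sigma_finite_lebesgue_real: "sigma_finite_measure (lebesgue :: real measure)"
proof
  show "\<exists>A::real set set. countable A \<and> A \<subseteq> sets lebesgue \<and> \<Union> A = space lebesgue \<and> (\<forall>a\<in>A. emeasure lebesgue a \<noteq> \<infinity>)"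
  proof (intro exI[of _ "range (\<lambda>n::nat. {- real n..real n})"] conjI)
    show "\<Union> (range (\<lambda>n::nat. {- real n..real n})) = space lebesgue"
    proof -
      have "x \<in> \<Union> (range (\<lambda>n::nat. {- real n..real n}))" for x
      proof -
        obtain n :: nat where "\<bar>x\<bar> < real n" using reals_Archimedean2 by blast
        then show ?thesis by (auto intro!: exI[of _ n] simp: abs_less_iff)
      qed
      then show ?thesis by auto
    qed
  qed auto
qed

lemma lebesgue_integral_translate:
  fixes f :: "real \<Rightarrow> complex"
  assumes f: "f \<in> borel_measurable lebesgue"
  shows "(LINT x|lebesgue. f x) = (LINT x|lebesgue. f (a + x))"
proof -
  have m: "(\<lambda>x. a + 1 * x) \<in> lebesgue \<rightarrow>\<^sub>M (lebesgue :: real measure)"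
    using lebesgue_affine_measurable[of "\<lambda>_. 1" a] by simp
  have "(LINT x|lebesgue. f x) = integral\<^sup>L (density (distr lebesgue lebesgue (\<lambda>x. a + 1 * x)) (\<lambda>_. ennreal \<bar>1\<bar>)) f"
    by (subst lebesgue_real_affine[of 1 a]) simp_all
  also have "\<dots> = integral\<^sup>L (distr lebesgue lebesgue (\<lambda>x. a + 1 * x)) (\<lambda>x. \<bar>1\<bar> *\<^sub>R f x)"
    using f by (intro integral_density) auto
  also have "\<dots> = (LINT x|lebesgue. f (a + x))"
    using m f by (subst integral_distr) auto
  finally show ?thesis .
qed

lemma integral_unit_interval_lborel:
  fixes f :: "real \<Rightarrow> complex"
  assumes "continuous_on {0..1} f"
  shows "integral {0..1} f = (LINT s|lborel. indicator {0..1} s *\<^sub>R f s)"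
proof -
  have "set_integrable lborel {0..1} f"
    unfolding set_integrable_def by (rule borel_integrable_compact[OF _ assms]) simp
  from set_borel_integral_eq_integral(2)[OF this] show ?thesis by (simp add: set_lebesgue_integral_def)
qed

text \<open>Fubini, applicable because \<psi> is integrable and the other factors are bounded with s
  in a compact interval.\<close>

lemma fourier_average:
  fixes \<phi> :: "real \<Rightarrow> complex"
  assumes \<psi>: "\<psi> \<in> L1_fun" and \<phi>: "continuous_on UNIV \<phi>"
  shows "(LINT t|lebesgue. \<psi> t * integral {0..1} (\<lambda>s. \<phi> s * cis (- ((a + \<epsilon> * s) * t))))
       = integral {0..1} (\<lambda>s. \<phi> s * fourier \<psi> (a + \<epsilon> * s))"
proof -
  interpret pair_sigma_finite "lebesgue :: real measure" "lborel :: real measure"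
    unfolding pair_sigma_finite_def by (intro conjI sigma_finite_lebesgue_real sigma_finite_lborel)
  define f where "f = (\<lambda>(t::real) (s::real). \<psi> t * (indicator {0..1::real} s *\<^sub>R (\<phi> s * cis (- ((a + \<epsilon> * s) * t)))))"
  have \<psi>m [measurable]: "\<psi> \<in> borel_measurable lebesgue" by (rule L1_measurable[OF \<psi>])
  have \<phi>m [measurable]: "\<phi> \<in> borel_measurable borel" by (rule borel_measurable_continuous_onI[OF \<phi>])
  have idm [measurable]: "(\<lambda>x::real. x) \<in> borel_measurable lebesgue"
    by (intro borel_measurable_lebesgue_continuous continuous_intros)
  have cism [measurable]: "cis \<in> borel_measurable borel"
    by (intro borel_measurable_continuous_onI) (auto simp: cis_conv_exp intro!: continuous_intros)
  have fstm [measurable]: "(\<lambda>x. fst x) \<in> borel_measurable ((lebesgue :: real measure) \<Otimes>\<^sub>M (lborel :: real measure))"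
    by (rule measurable_compose[OF measurable_fst idm])
  have meas: "case_prod f \<in> borel_measurable (lebesgue \<Otimes>\<^sub>M lborel)"
    unfolding f_def split_beta' by measurable
  have cont: "continuous_on S (\<lambda>s. \<phi> s * cis (- ((a + \<epsilon> * s) * t)))" for S t
    unfolding cis_conv_exp by (intro continuous_intros continuous_on_subset[OF \<phi>]) auto
  have norm_f: "norm (f t s) = cmod (\<psi> t) * (indicator {0..1} s * cmod (\<phi> s))" for t s
    by (simp add: f_def norm_mult)
  have int\<phi>: "integrable lborel (\<lambda>s. indicator {0..1} s * cmod (\<phi> s))"
    using borel_integrable_compact[of "{0..1}" "\<lambda>s. cmod (\<phi> s)"] \<phi> continuous_on_subset by (auto intro!: continuous_intros)
  have intf: "integrable lborel (f t)" for t
  proof -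
    have "integrable lborel (\<lambda>s. indicator {0..1} s *\<^sub>R (\<phi> s * cis (- ((a + \<epsilon> * s) * t))))"
      by (rule borel_integrable_compact[OF _ cont]) simp
    then show ?thesis unfolding f_def by (rule integrable_mult_right)
  qed
  have "integrable (lebesgue \<Otimes>\<^sub>M lborel) (case_prod f)"
  proof (rule Fubini_integrable[OF meas])
    have "integrable lebesgue (\<lambda>t. cmod (\<psi> t) * (LINT s|lborel. indicator {0..1} s * cmod (\<phi> s)))"
      using \<psi> unfolding L1_fun_def by (intro integrable_mult_left integrable_norm) simp
    then show "integrable lebesgue (\<lambda>t. LINT s|lborel. norm (case_prod f (t, s)))" by (simp add: norm_f)
    show "AE t in lebesgue. integrable lborel (\<lambda>s. case_prod f (t, s))" using intf by simp
  qed
  from Fubini_integral[OF this]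
  have swap: "(LINT s|lborel. LINT t|lebesgue. f t s) = (LINT t|lebesgue. LINT s|lborel. f t s)" .
  have "(LINT s|lborel. f t s) = \<psi> t * integral {0..1} (\<lambda>s. \<phi> s * cis (- ((a + \<epsilon> * s) * t)))" for t
    unfolding f_def integral_unit_interval_lborel[OF cont] mult_scaleR_right[symmetric]
    by (rule integral_mult_right_zero)
  moreover have "(LINT t|lebesgue. f t s) = indicator {0..1} s *\<^sub>R (\<phi> s * fourier \<psi> (a + \<epsilon> * s))" for s
  proof -
    have "(LINT t|lebesgue. f t s) = (LINT t|lebesgue. (indicator {0..1} s *\<^sub>R \<phi> s) * (\<psi> t * cis (- ((a + \<epsilon> * s) * t))))"
      by (intro Bochner_Integration.integral_cong refl) (simp add: f_def scaleR_conv_of_real mult_ac)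
    then show ?thesis by (simp add: fourier_def scaleR_conv_of_real)
  qed
  moreover have "integral {0..1} (\<lambda>s. \<phi> s * fourier \<psi> (a + \<epsilon> * s)) = (LINT s|lborel. indicator {0..1} s *\<^sub>R (\<phi> s * fourier \<psi> (a + \<epsilon> * s)))"
    by (intro integral_unit_interval_lborel continuous_intros continuous_on_subset[OF \<phi>]
        continuous_on_compose2[OF continuous_on_fourier[OF \<psi>]]) auto
  ultimately show ?thesis using swap by simp
qed

text \<open>The windowed polynomial is a superposition over s in [0, 1] of exponentials at \<mu> +
  \<epsilon> s with density \<open>bump s\<close>, so a Gabor atom reads the transform of \<psi> at
  \<mu> + \<epsilon> s - \<beta> l. The value \<epsilon> = 0 is included and later serves the
  polynomials without window.\<close>

lemma pairing_windowed_gabor: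
  assumes \<psi>: "\<psi> \<in> L1_fun" and c: "finsupp c"
  shows "pairing (windowed c \<epsilon>) (gabor \<psi> \<alpha> \<beta> (k, l)) =
    (\<Sum>\<mu> | c \<mu> \<noteq> 0. c \<mu> * integral {0..1} (\<lambda>s. of_real (bump s) *
       (cis ((\<mu> + \<epsilon> * s) * (\<alpha> * of_int k)) * cnj (fourier \<psi> (\<mu> - \<beta> * of_int l + \<epsilon> * s)))))"
proof -
  let ?M = "{\<mu>. c \<mu> \<noteq> 0}"
  define y where "y = \<alpha> * of_int k"
  define \<phi> where "\<phi> = (\<lambda>\<mu> s. of_real (bump s) * cis (- ((\<mu> + \<epsilon> * s) * y)))"
  have \<phi>: "continuous_on S (\<phi> \<mu>)" for \<mu> S
    unfolding \<phi>_def cis_conv_exp by (intro continuous_intros)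
  define X where "X = (\<lambda>\<mu> t. integral {0..1} (\<lambda>s. \<phi> \<mu> s * cis (- ((\<mu> - \<beta> * of_int l + \<epsilon> * s) * t))))"
  \<comment> \<open>The computation is carried out for the conjugate, since \<psi> enters
    \<open>pairing\<close> conjugated whereas \<open>fourier_average\<close> concerns \<psi>
    itself.\<close>
  have Xeq: "X \<mu> t = cnj (cis (\<mu> * (y + t)) * window (\<epsilon> * (y + t))) * cis (\<beta> * of_int l * t)" for \<mu> t
  proof -
    have "X \<mu> t = integral {0..1} (\<lambda>s. (cis (- (\<mu> * (y + t))) * cis (\<beta> * of_int l * t)) * cnj (of_real (bump s) * cis (\<epsilon> * (y + t) * s)))"
      unfolding X_def \<phi>_def by (intro integral_cong) (simp add: cis_cnj cis_mult algebra_simps)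
    also have "\<dots> = (cis (- (\<mu> * (y + t))) * cis (\<beta> * of_int l * t)) * cnj (window (\<epsilon> * (y + t)))"
      by (simp only: integral_mult_right window_def integral_cnj)
    finally show ?thesis by (simp add: cis_cnj mult_ac)
  qed
  have Xm: "X \<mu> \<in> borel_measurable lebesgue" for \<mu>
    unfolding Xeq cis_conv_exp by (intro borel_measurable_lebesgue_continuous continuous_intros)
  have X1: "cmod (X \<mu> t) \<le> 1" for \<mu> t by (simp add: Xeq norm_mult window_le_1)
  have int: "integrable lebesgue (\<lambda>t. \<psi> t * X \<mu> t)" for \<mu> by (rule L1_mult_bounded[OF \<psi> Xm X1])
  have gm: "gabor \<psi> \<alpha> \<beta> (k, l) \<in> borel_measurable lebesgue"
  proof -
    have m: "(\<lambda>x. - y + 1 * x) \<in> lebesgue \<rightarrow>\<^sub>M (lebesgue :: real measure)"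
      using lebesgue_affine_measurable[of "\<lambda>_. 1" "- y"] by simp
    have "(\<lambda>t. cis (\<beta> * of_int l * t) * \<psi> t) \<in> borel_measurable lebesgue"
      by (intro borel_measurable_times borel_measurable_cis L1_measurable \<psi>)
    from measurable_compose[OF m this] show ?thesis
      by (simp add: gabor_def translate_def modulate_def y_def)
  qed
  have "pairing (windowed c \<epsilon>) (gabor \<psi> \<alpha> \<beta> (k, l)) =
     (LINT t|lebesgue. windowed c \<epsilon> (y + t) * cnj (gabor \<psi> \<alpha> \<beta> (k, l) (y + t)))"
    unfolding pairing_def
    by (rule lebesgue_integral_translate)
       (intro borel_measurable_times borel_measurable_lebesgue_continuous windowed_continuous c
          measurable_compose[OF gm borel_measurable_continuous_onI] continuous_intros)
  also have "\<dots> = (LINT t|lebesgue. cnj (\<Sum>\<mu>\<in>?M. cnj (c \<mu>) * (\<psi> t * X \<mu> t)))"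
  proof (intro Bochner_Integration.integral_cong refl)
    fix t
    have "gabor \<psi> \<alpha> \<beta> (k, l) (y + t) = cis (\<beta> * of_int l * t) * \<psi> t"
      by (simp add: gabor_def translate_def modulate_def y_def)
    moreover have "windowed c \<epsilon> (y + t) = (\<Sum>\<mu>\<in>?M. c \<mu> * (cis (\<mu> * (y + t)) * window (\<epsilon> * (y + t))))"
      by (simp add: windowed_def tp_def e_fun_def sum_distrib_right mult.assoc)
    ultimately show "windowed c \<epsilon> (y + t) * cnj (gabor \<psi> \<alpha> \<beta> (k, l) (y + t)) = cnj (\<Sum>\<mu>\<in>?M. cnj (c \<mu>) * (\<psi> t * X \<mu> t))"
      by (simp add: Xeq sum_distrib_left mult_ac)
  qed
  also have "\<dots> = cnj (LINT t|lebesgue. (\<Sum>\<mu>\<in>?M. cnj (c \<mu>) * (\<psi> t * X \<mu> t)))"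
    by (rule Bochner_Integration.integral_cnj)
  also have "(LINT t|lebesgue. (\<Sum>\<mu>\<in>?M. cnj (c \<mu>) * (\<psi> t * X \<mu> t))) = (\<Sum>\<mu>\<in>?M. cnj (c \<mu>) * (LINT t|lebesgue. \<psi> t * X \<mu> t))"
    by (rule trans[OF Bochner_Integration.integral_sum]) (intro integrable_mult_right int, simp only: integral_mult_right_zero)
  also have "\<dots> = (\<Sum>\<mu>\<in>?M. cnj (c \<mu>) * integral {0..1} (\<lambda>s. \<phi> \<mu> s * fourier \<psi> (\<mu> - \<beta> * of_int l + \<epsilon> * s)))"
    unfolding X_def by (intro sum.cong refl arg_cong2[where f = "(*)"] fourier_average \<psi> \<phi>)
  also have "cnj \<dots> = (\<Sum>\<mu>\<in>?M. c \<mu> * integral {0..1} (\<lambda>s. cnj (\<phi> \<mu> s * fourier \<psi> (\<mu> - \<beta> * of_int l + \<epsilon> * s))))"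
    by (simp only: cnj_sum complex_cnj_mult complex_cnj_cnj integral_cnj)
  finally show ?thesis
    by (simp add: \<phi>_def cis_cnj y_def mult.assoc)
qed

text \<open>j = 1 serves the coefficients and j = 2 the energy. As j > 0 the integrand vanishes off
  [\<rho>, \<rho> + \<epsilon>], and \<rho> + \<epsilon> \<le> T keeps this interval inside one
  period.\<close>

lemma bump_substitution:
  fixes Y :: "real \<Rightarrow> 'a::{euclidean_space, real_normed_algebra}"
  assumes Y: "continuous_on UNIV Y" and \<epsilon>: "\<epsilon> > 0" and \<rho>: "0 \<le> \<rho>" "\<rho> + \<epsilon> \<le> T" and j: "j > 0"
  shows "integral {0..T} (\<lambda>\<xi>. bump ((\<xi> - \<rho>) / \<epsilon>) ^ j *\<^sub>R Y \<xi>) = \<epsilon> *\<^sub>R integral {0..1} (\<lambda>s. bump s ^ j *\<^sub>R Y (\<rho> + \<epsilon> * s))"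
proof -
  define f where "f = (\<lambda>s. bump s ^ j *\<^sub>R Y (\<rho> + \<epsilon> * s))"
  have "continuous_on {0..1} f"
    unfolding f_def by (intro continuous_intros continuous_on_compose2[OF Y]) auto
  then have "(f has_integral integral {0..1} f) (cbox 0 1)"
    by (simp add: integrable_integral integrable_continuous_real)
  from has_integral_affinity'[OF this, of "1 / \<epsilon>" "- \<rho> / \<epsilon>"]
  have "((\<lambda>x. f (x / \<epsilon> - \<rho> / \<epsilon>)) has_integral (\<epsilon> *\<^sub>R integral {0..1} f)) {\<rho>..\<epsilon> * (1 + \<rho> / \<epsilon>)}"
    using \<epsilon> by (simp add: mult.commute)
  moreover have "\<epsilon> * (1 + \<rho> / \<epsilon>) = \<rho> + \<epsilon>" using \<epsilon> by (simp add: distrib_left)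
  moreover have "f (x / \<epsilon> - \<rho> / \<epsilon>) = bump ((x - \<rho>) / \<epsilon>) ^ j *\<^sub>R Y x" for x
    using \<epsilon> by (simp add: f_def diff_divide_distrib right_diff_distrib)
  ultimately have "((\<lambda>x. bump ((x - \<rho>) / \<epsilon>) ^ j *\<^sub>R Y x) has_integral (\<epsilon> *\<^sub>R integral {0..1} f)) {\<rho>..\<rho> + \<epsilon>}" by simp
  then have "((\<lambda>x. bump ((x - \<rho>) / \<epsilon>) ^ j *\<^sub>R Y x) has_integral (\<epsilon> *\<^sub>R integral {0..1} f)) {0..T}"
  proof (rule has_integral_on_superset)
    fix x assume "x \<notin> {\<rho>..\<rho> + \<epsilon>}"
    then have "(x - \<rho>) / \<epsilon> \<le> 0 \<or> 1 \<le> (x - \<rho>) / \<epsilon>" using \<epsilon> by (auto simp: field_simps)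
    then show "bump ((x - \<rho>) / \<epsilon>) ^ j *\<^sub>R Y x = 0" using j by (simp add: bump_zero)
  qed (use \<rho> in auto)
  then show ?thesis by (simp add: integral_unique f_def)
qed

lemma cmod_sum_square_disjoint:
  fixes z :: "'i \<Rightarrow> complex"
  assumes R: "finite R" and "\<And>r r'. r \<in> R \<Longrightarrow> r' \<in> R \<Longrightarrow> r \<noteq> r' \<Longrightarrow> z r = 0 \<or> z r' = 0"
  shows "(cmod (\<Sum>r\<in>R. z r))\<^sup>2 = (\<Sum>r\<in>R. (cmod (z r))\<^sup>2)"
proof (cases "\<exists>r0\<in>R. z r0 \<noteq> 0")
  case True
  then obtain r0 where r0: "r0 \<in> R" "z r0 \<noteq> 0" by blast
  then have "z r = 0" if "r \<in> R - {r0}" for r using assms(2)[of r r0] that by auto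
  then have "(\<Sum>r\<in>R. z r) = z r0" "(\<Sum>r\<in>R. (cmod (z r))\<^sup>2) = (cmod (z r0))\<^sup>2"
    using R r0(1) by (simp_all add: sum.remove)
  then show ?thesis by simp
qed simp

definition residue_mod :: "real \<Rightarrow> real \<Rightarrow> real" where
  "residue_mod T \<mu> = \<mu> - T * of_int \<lfloor>\<mu> / T\<rfloor>"

lemma residue_mod_range: "T > 0 \<Longrightarrow> residue_mod T \<mu> \<in> {0..<T}"
proof -
  assume T: "T > 0"
  have "of_int \<lfloor>\<mu> / T\<rfloor> \<le> \<mu> / T" "\<mu> / T < of_int \<lfloor>\<mu> / T\<rfloor> + 1" by linarith+
  then have "T * of_int \<lfloor>\<mu> / T\<rfloor> \<le> T * (\<mu> / T)" "T * (\<mu> / T) < T * (of_int \<lfloor>\<mu> / T\<rfloor> + 1)"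
    using T by (simp_all only: mult_le_cancel_left_pos mult_less_cancel_left_pos)
  then have "T * of_int \<lfloor>\<mu> / T\<rfloor> \<le> \<mu>" "\<mu> < T * of_int \<lfloor>\<mu> / T\<rfloor> + T"
    using T by (simp_all add: distrib_left)
  then show ?thesis by (simp add: residue_mod_def)
qed

text \<open>At x = 0 and r in [0, T) this is the inner product of \<open>tp c\<close> with the
  element \<open>gabor_AP\<close> of residue r and index l; x records a common displacement
  \<epsilon> s of all frequencies of the fibre.\<close>

definition fiber :: "(real \<Rightarrow> complex) \<Rightarrow> real \<Rightarrow> real \<Rightarrow> (real \<Rightarrow> complex) \<Rightarrow> int \<Rightarrow> real \<Rightarrow> real \<Rightarrow> complex" where
  "fiber \<psi> \<beta> T c l r x = (\<Sum>\<mu> | c \<mu> \<noteq> 0 \<and> residue_mod T \<mu> = r. c \<mu> * cnj (fourier \<psi> (\<mu> - \<beta> * of_int l + x)))"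

lemma continuous_on_fourier_compose:
  assumes "\<psi> \<in> L1_fun" "continuous_on S f" shows "continuous_on S (\<lambda>x. fourier \<psi> (f x))"
  by (rule continuous_on_compose2[OF continuous_on_fourier[OF assms(1)] assms(2) subset_UNIV])

lemma continuous_on_fiber:
  assumes \<psi>: "\<psi> \<in> L1_fun" and "continuous_on S f" shows "continuous_on S (\<lambda>x. fiber \<psi> \<beta> T c l r (f x))"
  unfolding fiber_def by (intro continuous_intros continuous_on_fourier_compose assms)

lemma infsum_cmult_ennreal:
  fixes f :: "'i \<Rightarrow> ennreal"
  shows "(\<Sum>\<^sub>\<infinity>i\<in>A. c * f i) = c * infsum f A"
proof -
  have "sum (\<lambda>i. c * f i) = (\<lambda>F. c * sum f F)" by (simp add: fun_eq_iff sum_distrib_left)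
  then have "(\<Sum>\<^sub>\<infinity>i\<in>A. c * f i) = (SUP F\<in>{F. finite F \<and> F \<subseteq> A}. c * sum f F)"
    by (subst nonneg_infsum_complete) simp_all
  also have "\<dots> = c * (SUP F\<in>{F. finite F \<and> F \<subseteq> A}. sum f F)"
    by (rule SUP_mult_left_ennreal[symmetric])
  also have "\<dots> = c * infsum f A" by (subst nonneg_infsum_complete) simp_all
  finally show ?thesis .
qed

lemma gabor_energy:
  fixes \<alpha> \<beta> :: real
  assumes \<psi>: "\<psi> \<in> L1_fun" and c: "finsupp c" and \<alpha>: "\<alpha> > 0" and \<epsilon>: "\<epsilon> > 0"
  defines "T \<equiv> 2 * pi / \<alpha>"
  defines "R \<equiv> residue_mod T ` {\<mu>. c \<mu> \<noteq> 0}"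
  assumes sep: "\<And>r. r \<in> R \<Longrightarrow> r + \<epsilon> \<le> T" "\<And>r r'. r \<in> R \<Longrightarrow> r' \<in> R \<Longrightarrow> r \<noteq> r' \<Longrightarrow> \<epsilon> \<le> \<bar>r - r'\<bar>"
  shows "(\<Sum>\<^sub>\<infinity>k\<in>(UNIV::int set). ennreal ((cmod (pairing (windowed c \<epsilon>) (gabor \<psi> \<alpha> \<beta> (k, l))))\<^sup>2))
     = ennreal (T / \<epsilon> * (\<Sum>r\<in>R. integral {0..1} (\<lambda>s. (bump s)\<^sup>2 * (cmod (fiber \<psi> \<beta> T c l r (\<epsilon> * s)))\<^sup>2)))"
proof -
  let ?M = "{\<mu>. c \<mu> \<noteq> 0}"
  let ?\<rho> = "residue_mod T"
  have T: "T > 0" using \<alpha> by (simp add: T_def)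
  have \<alpha>T: "\<alpha> = 2 * pi / T" using \<alpha> by (simp add: T_def)
  have R: "finite R" "R \<subseteq> {0..<T}" using c residue_mod_range[OF T] by (auto simp: R_def)
  have \<rho>: "0 \<le> ?\<rho> \<mu>" "?\<rho> \<mu> + \<epsilon> \<le> T" if "\<mu> \<in> ?M" for \<mu>
    using residue_mod_range[OF T, of \<mu>] sep(1)[of "?\<rho> \<mu>"] that by (auto simp: R_def)
  define Y where "Y = (\<lambda>\<mu> \<xi>. cnj (fourier \<psi> (\<xi> - ?\<rho> \<mu> + \<mu> - \<beta> * of_int l)))"
  have Y: "continuous_on S (Y \<mu>)" for \<mu> S unfolding Y_def by (intro continuous_intros continuous_on_fourier_compose \<psi>)
  \<comment> \<open>Periodisation: the bump of \<mu> is moved to its residue, while \<open>Y\<close>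
    still reads the transform at the original frequency. G vanishes at 0 and at T, so the equal end
    values asked for by \<open>circle_parseval\<close> are available.\<close>
  define G where "G = (\<lambda>\<xi>. \<Sum>\<mu>\<in>?M. c \<mu> * (bump ((\<xi> - ?\<rho> \<mu>) / \<epsilon>) *\<^sub>R Y \<mu> \<xi>))"
  have G: "continuous_on S G" for S unfolding G_def by (intro continuous_intros Y) (use \<epsilon> in auto)
  have G0: "G 0 = 0" "G T = 0"
  proof -
    have "(0 - ?\<rho> \<mu>) / \<epsilon> \<le> 0" "1 \<le> (T - ?\<rho> \<mu>) / \<epsilon>" if "\<mu> \<in> ?M" for \<mu>
      using \<rho>[OF that] \<epsilon> by (auto simp: field_simps)
    then show "G 0 = 0" "G T = 0" unfolding G_def by (auto intro!: sum.neutral simp: bump_zero)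
  qed
  have coeff: "integral {0..T} (\<lambda>\<xi>. G \<xi> * cis (2 * pi / T * of_int k * \<xi>)) = of_real \<epsilon> * pairing (windowed c \<epsilon>) (gabor \<psi> \<alpha> \<beta> (k, l))" for k :: int
  proof -
    have bcont: "continuous_on S (\<lambda>\<xi>. bump ((\<xi> - r) / \<epsilon>) ^ j *\<^sub>R Z \<xi>)"
      if "continuous_on S Z" for S r j and Z :: "real \<Rightarrow> complex"
      by (intro continuous_intros that) (use \<epsilon> in auto)
    let ?e = "\<lambda>\<xi>. cis (2 * pi / T * of_int k * \<xi>)"
    have e: "continuous_on S ?e" for S unfolding cis_conv_exp by (intro continuous_intros)
    have "integral {0..T} (\<lambda>\<xi>. G \<xi> * ?e \<xi>) = integral {0..T} (\<lambda>\<xi>. \<Sum>\<mu>\<in>?M. c \<mu> * (bump ((\<xi> - ?\<rho> \<mu>) / \<epsilon>) ^ 1 *\<^sub>R (Y \<mu> \<xi> * ?e \<xi>)))"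
      by (simp add: G_def sum_distrib_left mult_ac)
    also have "\<dots> = (\<Sum>\<mu>\<in>?M. c \<mu> * integral {0..T} (\<lambda>\<xi>. bump ((\<xi> - ?\<rho> \<mu>) / \<epsilon>) ^ 1 *\<^sub>R (Y \<mu> \<xi> * ?e \<xi>)))"
      by (rule trans[OF integral_sum], intro c, intro integrable_continuous_real continuous_on_mult continuous_on_const bcont Y e)
         (simp only: integral_mult_right)
    also have "\<dots> = (\<Sum>\<mu>\<in>?M. c \<mu> * (\<epsilon> *\<^sub>R integral {0..1} (\<lambda>s. bump s ^ 1 *\<^sub>R (Y \<mu> (?\<rho> \<mu> + \<epsilon> * s) * ?e (?\<rho> \<mu> + \<epsilon> * s)))))"
      by (intro sum.cong refl arg_cong2[where f = "(*)"] bump_substitution continuous_intros Y e \<epsilon> \<rho>) auto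
    also have "\<dots> = (\<Sum>\<mu>\<in>?M. c \<mu> * (\<epsilon> *\<^sub>R integral {0..1} (\<lambda>s. of_real (bump s) *
       (cis ((\<mu> + \<epsilon> * s) * (\<alpha> * of_int k)) * cnj (fourier \<psi> (\<mu> - \<beta> * of_int l + \<epsilon> * s))))))"
    proof (intro sum.cong refl arg_cong2[where f = "(*)"] arg_cong2[where f = scaleR] integral_cong)
      fix \<mu> s
      \<comment> \<open>Since \<alpha> T = 2 \<pi>, changing \<mu> by a multiple of T does not
        change the character at the points \<alpha> k.\<close>
      have "(\<mu> + \<epsilon> * s) * (\<alpha> * of_int k) = 2 * pi / T * of_int k * (?\<rho> \<mu> + \<epsilon> * s) + 2 * pi * of_int (\<lfloor>\<mu> / T\<rfloor> * k)"
        using T by (simp add: \<alpha>T residue_mod_def field_simps)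
      then have "cis ((\<mu> + \<epsilon> * s) * (\<alpha> * of_int k)) = ?e (?\<rho> \<mu> + \<epsilon> * s)"
        by (simp add: cis_multiple_2pi flip: cis_mult del: of_int_mult)
      then show "bump s ^ 1 *\<^sub>R (Y \<mu> (?\<rho> \<mu> + \<epsilon> * s) * ?e (?\<rho> \<mu> + \<epsilon> * s)) = of_real (bump s) *
       (cis ((\<mu> + \<epsilon> * s) * (\<alpha> * of_int k)) * cnj (fourier \<psi> (\<mu> - \<beta> * of_int l + \<epsilon> * s)))"
        by (simp add: Y_def scaleR_conv_of_real algebra_simps)
    qed
    also have "\<dots> = of_real \<epsilon> * pairing (windowed c \<epsilon>) (gabor \<psi> \<alpha> \<beta> (k, l))"
      unfolding pairing_windowed_gabor[OF \<psi> c] by (simp add: sum_distrib_left scaleR_conv_of_real mult_ac)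
    finally show ?thesis .
  qed
  define F where "F = (\<lambda>r \<xi>. \<Sum>\<mu> | c \<mu> \<noteq> 0 \<and> ?\<rho> \<mu> = r. c \<mu> * Y \<mu> \<xi>)"
  have F: "continuous_on S (F r)" for r S unfolding F_def by (intro continuous_intros Y)
  \<comment> \<open>Frequencies with the same residue share one bump and are added up before
    squaring; between different residues the cross terms in |G|^2 vanish.\<close>
  have GF: "G \<xi> = (\<Sum>r\<in>R. of_real (bump ((\<xi> - r) / \<epsilon>)) * F r \<xi>)" for \<xi>
  proof -
    have "G \<xi> = (\<Sum>r\<in>R. \<Sum>\<mu> | \<mu> \<in> ?M \<and> ?\<rho> \<mu> = r. c \<mu> * (bump ((\<xi> - ?\<rho> \<mu>) / \<epsilon>) *\<^sub>R Y \<mu> \<xi>))"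
      unfolding G_def R_def by (rule sum.image_gen[OF c])
    also have "\<dots> = (\<Sum>r\<in>R. of_real (bump ((\<xi> - r) / \<epsilon>)) * F r \<xi>)"
      unfolding F_def sum_distrib_left
      by (intro sum.cong refl) (auto simp: scaleR_conv_of_real mult_ac)
    finally show ?thesis .
  qed
  have "integral {0..T} (\<lambda>\<xi>. (cmod (G \<xi>))\<^sup>2) = integral {0..T} (\<lambda>\<xi>. \<Sum>r\<in>R. (bump ((\<xi> - r) / \<epsilon>))\<^sup>2 *\<^sub>R (cmod (F r \<xi>))\<^sup>2)"
  proof (intro integral_cong)
    fix \<xi>
    have "of_real (bump ((\<xi> - r) / \<epsilon>)) * F r \<xi> = 0 \<or> of_real (bump ((\<xi> - r') / \<epsilon>)) * F r' \<xi> = 0"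
      if "r \<in> R" "r' \<in> R" "r \<noteq> r'" for r r'
    proof (rule ccontr)
      assume "\<not> ?thesis"
      then have "bump ((\<xi> - r) / \<epsilon>) \<noteq> 0" "bump ((\<xi> - r') / \<epsilon>) \<noteq> 0" by auto
      then have "0 < (\<xi> - r) / \<epsilon>" "(\<xi> - r) / \<epsilon> < 1" "0 < (\<xi> - r') / \<epsilon>" "(\<xi> - r') / \<epsilon> < 1"
        using bump_zero not_le by blast+
      then have "0 < \<xi> - r" "\<xi> - r < \<epsilon>" "0 < \<xi> - r'" "\<xi> - r' < \<epsilon>" using \<epsilon> by (auto simp: field_simps)
      with sep(2)[OF that] show False by linarith
    qed
    then show "(cmod (G \<xi>))\<^sup>2 = (\<Sum>r\<in>R. (bump ((\<xi> - r) / \<epsilon>))\<^sup>2 *\<^sub>R (cmod (F r \<xi>))\<^sup>2)"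
      unfolding GF by (subst cmod_sum_square_disjoint[OF R(1)]) (auto simp: norm_mult power_mult_distrib)
  qed
  also have "\<dots> = (\<Sum>r\<in>R. integral {0..T} (\<lambda>\<xi>. (bump ((\<xi> - r) / \<epsilon>))\<^sup>2 *\<^sub>R (cmod (F r \<xi>))\<^sup>2))"
    by (intro integral_sum R integrable_continuous_real continuous_intros F) (use \<epsilon> in auto)
  also have "\<dots> = (\<Sum>r\<in>R. \<epsilon> *\<^sub>R integral {0..1} (\<lambda>s. (bump s)\<^sup>2 *\<^sub>R (cmod (F r (r + \<epsilon> * s)))\<^sup>2))"
    by (intro sum.cong refl bump_substitution continuous_intros F \<epsilon> sep(1)) (use R in auto)
  also have "\<dots> = \<epsilon> * (\<Sum>r\<in>R. integral {0..1} (\<lambda>s. (bump s)\<^sup>2 * (cmod (fiber \<psi> \<beta> T c l r (\<epsilon> * s)))\<^sup>2))"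
  proof -
    have "F r (r + \<epsilon> * s) = fiber \<psi> \<beta> T c l r (\<epsilon> * s)" for r s
      unfolding F_def fiber_def Y_def by (intro sum.cong refl) (auto simp: algebra_simps)
    then show ?thesis by (simp add: sum_distrib_left)
  qed
  finally have energy: "integral {0..T} (\<lambda>\<xi>. (cmod (G \<xi>))\<^sup>2) = \<epsilon> * (\<Sum>r\<in>R. integral {0..1} (\<lambda>s. (bump s)\<^sup>2 * (cmod (fiber \<psi> \<beta> T c l r (\<epsilon> * s)))\<^sup>2))" .
  have "G 0 = G T" using G0 by simp
  from circle_parseval[OF T G this]
  have pars: "(\<Sum>\<^sub>\<infinity>k\<in>(UNIV::int set). ennreal ((cmod (of_real \<epsilon> * pairing (windowed c \<epsilon>) (gabor \<psi> \<alpha> \<beta> (k, l))))\<^sup>2))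
     = ennreal (T * (\<epsilon> * (\<Sum>r\<in>R. integral {0..1} (\<lambda>s. (bump s)\<^sup>2 * (cmod (fiber \<psi> \<beta> T c l r (\<epsilon> * s)))\<^sup>2))))"
    unfolding coeff energy .
  have "(\<Sum>\<^sub>\<infinity>k\<in>(UNIV::int set). ennreal ((cmod (pairing (windowed c \<epsilon>) (gabor \<psi> \<alpha> \<beta> (k, l))))\<^sup>2))
    = (\<Sum>\<^sub>\<infinity>k\<in>(UNIV::int set). ennreal (1 / \<epsilon>\<^sup>2) * ennreal ((cmod (of_real \<epsilon> * pairing (windowed c \<epsilon>) (gabor \<psi> \<alpha> \<beta> (k, l))))\<^sup>2))"
    using \<epsilon> by (simp add: norm_mult power_mult_distrib flip: ennreal_mult)
  also have "\<dots> = ennreal (1 / \<epsilon>\<^sup>2) * (\<Sum>\<^sub>\<infinity>k\<in>(UNIV::int set). ennreal ((cmod (of_real \<epsilon> * pairing (windowed c \<epsilon>) (gabor \<psi> \<alpha> \<beta> (k, l))))\<^sup>2))"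
    by (rule infsum_cmult_ennreal)
  also have "\<dots> = ennreal (1 / \<epsilon>\<^sup>2 * (T * (\<epsilon> * (\<Sum>r\<in>R. integral {0..1} (\<lambda>s. (bump s)\<^sup>2 * (cmod (fiber \<psi> \<beta> T c l r (\<epsilon> * s)))\<^sup>2)))))"
    unfolding pars by (rule ennreal_mult'[symmetric]) simp
  also have "1 / \<epsilon>\<^sup>2 * (T * (\<epsilon> * (\<Sum>r\<in>R. integral {0..1} (\<lambda>s. (bump s)\<^sup>2 * (cmod (fiber \<psi> \<beta> T c l r (\<epsilon> * s)))\<^sup>2))))
     = T / \<epsilon> * (\<Sum>r\<in>R. integral {0..1} (\<lambda>s. (bump s)\<^sup>2 * (cmod (fiber \<psi> \<beta> T c l r (\<epsilon> * s)))\<^sup>2))"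
    using \<epsilon> by (simp add: power2_eq_square)
  finally show ?thesis .
qed

section \<open>Transfer of the frame bounds\<close>

text \<open>The squared L2 norm of the bump, equal to 1 / 30; by Plancherel
  \<open>window_energy\<close> is 2 \<pi> times as large.\<close>

definition bump_energy :: real where "bump_energy = integral {0..1} (\<lambda>s. (bump s)\<^sup>2)"

lemma bump_energy_pos: "bump_energy > 0"
proof -
  have "((\<lambda>s::real. (s * (1 - s))\<^sup>2) has_integral (1^3/3 - 1^4/2 + 1^5/5) - (0^3/3 - 0^4/2 + 0^5/5)) {0..1}"
    by (rule fundamental_theorem_of_calculus)
       (auto intro!: derivative_eq_intros simp: algebra_simps eval_nat_numeral simp flip: has_real_derivative_iff_has_vector_derivative)
  then have "((\<lambda>s. (bump s)\<^sup>2) has_integral (1^3/3 - 1^4/2 + 1^5/5) - (0^3/3 - 0^4/2 + 0^5/5)) {0..1}"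
    by (rule has_integral_eq[rotated]) (simp add: bump_eq)
  then show ?thesis by (simp add: bump_energy_def integral_unique)
qed

lemma bump_average_limit:
  fixes g :: "real \<Rightarrow> real" and \<epsilon> :: "nat \<Rightarrow> real"
  assumes g: "continuous_on UNIV g" and \<epsilon>: "\<And>n. \<epsilon> n > 0" "\<epsilon> \<longlonglongrightarrow> 0"
  shows "(\<lambda>n. integral {0..1} (\<lambda>s. (bump s)\<^sup>2 * g (\<epsilon> n * s))) \<longlonglongrightarrow> bump_energy * g 0"
proof (rule LIMSEQ_I)
  fix e :: real assume e: "e > 0"
  obtain d where d: "d > 0" "\<And>y. \<bar>y\<bar> < d \<Longrightarrow> \<bar>g y - g 0\<bar> < e / 2"
    using g e unfolding continuous_on_iff dist_real_def by (metis UNIV_I diff_zero half_gt_zero)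
  obtain N where N: "\<And>n. n \<ge> N \<Longrightarrow> \<epsilon> n < d"
    using order_tendstoD(2)[OF \<epsilon>(2) d(1)] by (auto simp: eventually_sequentially)
  have cont: "continuous_on S (\<lambda>s. (bump s)\<^sup>2 * g (a * s))" for S a
    by (intro continuous_intros continuous_on_compose2[OF g]) auto
  have "norm (integral {0..1} (\<lambda>s. (bump s)\<^sup>2 * g (\<epsilon> n * s)) - bump_energy * g 0) < e" if n: "n \<ge> N" for n
  proof -
    have "integral {0..1} (\<lambda>s. (bump s)\<^sup>2 * g (\<epsilon> n * s)) - bump_energy * g 0
        = integral {0..1} (\<lambda>s. (bump s)\<^sup>2 * g (\<epsilon> n * s)) - integral {0..1} (\<lambda>s. (bump s)\<^sup>2 * g (0 * s))"
      by (simp add: bump_energy_def)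
    also have "\<dots> = integral {0..1} (\<lambda>s. (bump s)\<^sup>2 * g (\<epsilon> n * s) - (bump s)\<^sup>2 * g (0 * s))"
      by (intro integral_diff[symmetric] integrable_continuous_real cont)
    also have "norm \<dots> \<le> (e / 2) * (1 - 0)"
    proof (rule integral_bound)
      fix s :: real assume s: "s \<in> {0..1}"
      have "\<epsilon> n * s \<le> \<epsilon> n * 1" "0 \<le> \<epsilon> n * s" using s \<epsilon>(1)[of n] by (auto intro: mult_left_mono)
      then have "\<bar>\<epsilon> n * s\<bar> < d" using N[OF n] by linarith
      then have "(bump s)\<^sup>2 * \<bar>g (\<epsilon> n * s) - g 0\<bar> \<le> 1 * (e / 2)"
        using d(2) by (intro mult_mono power_le_one) (auto simp: bump_le_1 bump_nonneg less_imp_le)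
      then show "norm ((bump s)\<^sup>2 * g (\<epsilon> n * s) - (bump s)\<^sup>2 * g (0 * s)) \<le> e / 2"
        by (simp add: right_diff_distrib[symmetric] abs_mult del: right_diff_distrib)
    qed (intro continuous_on_diff cont | simp)+
    finally show ?thesis using e by simp
  qed
  then show "\<exists>no. \<forall>n\<ge>no. norm (integral {0..1} (\<lambda>s. (bump s)\<^sup>2 * g (\<epsilon> n * s)) - bump_energy * g 0) < e" by blast
qed

lemma cmod_sum_mult_square_le:
  "(cmod (\<Sum>i\<in>I. a i * b i))\<^sup>2 \<le> (\<Sum>i\<in>I. (cmod (a i))\<^sup>2) * (\<Sum>i\<in>I. (cmod (b i))\<^sup>2)"
proof -
  have "cmod (\<Sum>i\<in>I. a i * b i) \<le> (\<Sum>i\<in>I. cmod (a i) * cmod (b i))"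
    by (rule order_trans[OF norm_sum]) (simp add: norm_mult)
  then have "(cmod (\<Sum>i\<in>I. a i * b i))\<^sup>2 \<le> (\<Sum>i\<in>I. cmod (a i) * cmod (b i))\<^sup>2"
    by (intro power_mono) auto
  also have "\<dots> \<le> (\<Sum>i\<in>I. (cmod (a i))\<^sup>2) * (\<Sum>i\<in>I. (cmod (b i))\<^sup>2)" by (rule Cauchy_Schwarz_ineq_sum)
  finally show ?thesis .
qed

text \<open>The radius works for all finite \<open>L\<close> at once, which prevents mass from
  escaping to large l as \<epsilon> tends to 0. Cauchy-Schwarz within a fibre reduces the
  displacement to finitely many instances of the l2 continuity, one for each frequency of c.\<close>

lemma fiber_shift_bound:
  fixes \<beta> T :: real
  assumes c: "finsupp c" and cont: "fourier_l2_continuous \<psi> \<beta>" and \<eta>: "\<eta> > 0"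
    and X: "\<And>L::int set. finite L \<Longrightarrow> (\<Sum>l\<in>L. \<Sum>r\<in>residue_mod T ` {\<mu>. c \<mu> \<noteq> 0}. (cmod (fiber \<psi> \<beta> T c l r 0))\<^sup>2) \<le> X"
  shows "\<exists>\<delta>>0. \<forall>x. 0 \<le> x \<longrightarrow> x \<le> \<delta> \<longrightarrow> (\<forall>L::int set. finite L \<longrightarrow>
    (\<Sum>l\<in>L. \<Sum>r\<in>residue_mod T ` {\<mu>. c \<mu> \<noteq> 0}. (cmod (fiber \<psi> \<beta> T c l r x))\<^sup>2) \<le> 2 * X + \<eta>)"
proof -
  let ?M = "{\<mu>. c \<mu> \<noteq> 0}"
  let ?R = "residue_mod T ` ?M"
  define S where "S = (\<Sum>\<mu>\<in>?M. (cmod (c \<mu>))\<^sup>2)"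
  have S: "S \<ge> 0" unfolding S_def by (rule sum_nonneg) simp
  \<comment> \<open>After Cauchy-Schwarz the error is 2 \<eta>' times S times the number of
    frequencies; the summand 1 covers the empty support.\<close>
  define \<eta>' where "\<eta>' = \<eta> / (2 * (S * real (card ?M) + 1))"
  have \<eta>': "\<eta>' > 0" using \<eta> S by (simp add: \<eta>'_def add_nonneg_pos)
  define D where "D = (\<lambda>x \<mu> l. fourier \<psi> (\<mu> + x - \<beta> * of_int l) - fourier \<psi> (\<mu> - \<beta> * of_int l))"
  have "\<forall>\<mu>. \<exists>\<delta>. \<delta> > 0 \<and> (\<forall>x. 0 \<le> x \<longrightarrow> x \<le> \<delta> \<longrightarrow> (\<forall>L::int set. finite L \<longrightarrow> (\<Sum>l\<in>L. (cmod (D x \<mu> l))\<^sup>2) \<le> \<eta>'))"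
    using cont \<eta>' unfolding fourier_l2_continuous_def D_def by blast
  from choice[OF this] obtain \<delta> where \<delta>: "\<And>\<mu>. \<delta> \<mu> > (0::real)"
    "\<And>\<mu> x L. 0 \<le> x \<Longrightarrow> x \<le> \<delta> \<mu> \<Longrightarrow> finite (L :: int set) \<Longrightarrow> (\<Sum>l\<in>L. (cmod (D x \<mu> l))\<^sup>2) \<le> \<eta>'"
    by blast
  define d where "d = Min (insert 1 (\<delta> ` ?M))"
  have d: "d > 0" "\<And>\<mu>. \<mu> \<in> ?M \<Longrightarrow> d \<le> \<delta> \<mu>" using c \<delta>(1) by (auto simp: d_def)
  have "(\<Sum>l\<in>L. \<Sum>r\<in>?R. (cmod (fiber \<psi> \<beta> T c l r x))\<^sup>2) \<le> 2 * X + \<eta>"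
    if x: "0 \<le> x" "x \<le> d" and L: "finite L" for x and L :: "int set"
  proof -
    have fd: "(\<Sum>r\<in>?R. (cmod (fiber \<psi> \<beta> T c l r x - fiber \<psi> \<beta> T c l r 0))\<^sup>2) \<le> S * (\<Sum>\<mu>\<in>?M. (cmod (D x \<mu> l))\<^sup>2)" for l
    proof -
      let ?Mr = "\<lambda>r. {\<mu>. c \<mu> \<noteq> 0 \<and> residue_mod T \<mu> = r}"
      have "(cmod (fiber \<psi> \<beta> T c l r x - fiber \<psi> \<beta> T c l r 0))\<^sup>2 \<le> S * (\<Sum>\<mu>\<in>?Mr r. (cmod (D x \<mu> l))\<^sup>2)" for r
      proof -
        have "fiber \<psi> \<beta> T c l r x - fiber \<psi> \<beta> T c l r 0 = (\<Sum>\<mu>\<in>?Mr r. c \<mu> * cnj (D x \<mu> l))"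
          by (simp add: fiber_def D_def sum_subtractf[symmetric] right_diff_distrib algebra_simps)
        then have "(cmod (fiber \<psi> \<beta> T c l r x - fiber \<psi> \<beta> T c l r 0))\<^sup>2 \<le> (\<Sum>\<mu>\<in>?Mr r. (cmod (c \<mu>))\<^sup>2) * (\<Sum>\<mu>\<in>?Mr r. (cmod (D x \<mu> l))\<^sup>2)"
          using cmod_sum_mult_square_le[of c "\<lambda>\<mu>. cnj (D x \<mu> l)" "?Mr r"] by simp
        also have "\<dots> \<le> S * (\<Sum>\<mu>\<in>?Mr r. (cmod (D x \<mu> l))\<^sup>2)"
          unfolding S_def by (intro mult_right_mono sum_mono2 c sum_nonneg) auto
        finally show ?thesis .
      qed
      then have "(\<Sum>r\<in>?R. (cmod (fiber \<psi> \<beta> T c l r x - fiber \<psi> \<beta> T c l r 0))\<^sup>2) \<le> (\<Sum>r\<in>?R. S * (\<Sum>\<mu>\<in>?Mr r. (cmod (D x \<mu> l))\<^sup>2))"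
        by (intro sum_mono)
      also have "\<dots> = S * (\<Sum>\<mu>\<in>?M. (cmod (D x \<mu> l))\<^sup>2)"
        using sum.image_gen[OF c, of "\<lambda>\<mu>. (cmod (D x \<mu> l))\<^sup>2" "residue_mod T"] by (simp add: sum_distrib_left)
      finally show ?thesis .
    qed
    have "(\<Sum>l\<in>L. \<Sum>r\<in>?R. (cmod (fiber \<psi> \<beta> T c l r x))\<^sup>2)
       \<le> (\<Sum>l\<in>L. \<Sum>r\<in>?R. 2 * (cmod (fiber \<psi> \<beta> T c l r 0))\<^sup>2 + 2 * (cmod (fiber \<psi> \<beta> T c l r x - fiber \<psi> \<beta> T c l r 0))\<^sup>2)"
      by (intro sum_mono cmod_square_le_double)
    also have "\<dots> = 2 * (\<Sum>l\<in>L. \<Sum>r\<in>?R. (cmod (fiber \<psi> \<beta> T c l r 0))\<^sup>2)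
       + 2 * (\<Sum>l\<in>L. \<Sum>r\<in>?R. (cmod (fiber \<psi> \<beta> T c l r x - fiber \<psi> \<beta> T c l r 0))\<^sup>2)"
      by (simp add: sum.distrib sum_distrib_left)
    also have "\<dots> \<le> 2 * X + 2 * (\<Sum>l\<in>L. S * (\<Sum>\<mu>\<in>?M. (cmod (D x \<mu> l))\<^sup>2))"
      by (intro add_mono mult_left_mono X L sum_mono fd) auto
    also have "(\<Sum>l\<in>L. S * (\<Sum>\<mu>\<in>?M. (cmod (D x \<mu> l))\<^sup>2)) = S * (\<Sum>\<mu>\<in>?M. \<Sum>l\<in>L. (cmod (D x \<mu> l))\<^sup>2)"
      by (subst sum.swap) (simp add: sum_distrib_left)
    also have "\<dots> \<le> S * (\<Sum>\<mu>\<in>?M. \<eta>')"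
      using x d(2) L by (intro mult_left_mono sum_mono \<delta>(2) S) (auto intro: order_trans)
    also have "2 * (S * (\<Sum>\<mu>\<in>?M. \<eta>')) \<le> \<eta>"
    proof -
      have "2 * (S * (\<Sum>\<mu>\<in>?M. \<eta>')) = (S * real (card ?M)) * (2 * \<eta>')" by simp
      also have "\<dots> \<le> (S * real (card ?M) + 1) * (2 * \<eta>')" using \<eta>' by (intro mult_right_mono) auto
      also have "\<dots> = \<eta>"
      proof -
        have "V * (2 * (\<eta> / (2 * V))) = \<eta>" if "V > 0" for V :: real using that by simp
        from this[of "S * real (card ?M) + 1"] show ?thesis using S unfolding \<eta>'_def by (simp add: add_nonneg_pos)
      qed
      finally show ?thesis .
    qed
    finally show ?thesis by simp
  qed
  then show ?thesis using d(1) by blast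
qed

text \<open>The lower bound is phrased with an arbitrary bound X of the finite partial sums, so that
  no infinite sum over l enters. The new constants compare \<open>window_energy\<close> with T times
  \<open>bump_energy\<close>; by Plancherel this ratio is \<alpha>. The lower constant loses a
  factor 2 through \<open>fiber_shift_bound\<close>.\<close>

lemma frame_bounds_trig_poly:
  fixes \<alpha> \<beta> :: real
  assumes \<psi>: "\<psi> \<in> L1_fun" and \<alpha>: "\<alpha> > 0" and frame: "L2_frame (gabor \<psi> \<alpha> \<beta>)"
    and cont: "fourier_l2_continuous \<psi> \<beta>"
  defines "T \<equiv> 2 * pi / \<alpha>"
  obtains A B where "A > 0" "B > 0"
    "\<And>c X. finsupp c \<Longrightarrow> (\<And>L::int set. finite L \<Longrightarrow>
        (\<Sum>l\<in>L. \<Sum>r\<in>residue_mod T ` {\<mu>. c \<mu> \<noteq> 0}. (cmod (fiber \<psi> \<beta> T c l r 0))\<^sup>2) \<le> X) \<Longrightarrow> A * (\<Sum>\<mu> | c \<mu> \<noteq> 0. (cmod (c \<mu>))\<^sup>2) \<le> X"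
    "\<And>c (L::int set). finsupp c \<Longrightarrow> finite L \<Longrightarrow>
        (\<Sum>l\<in>L. \<Sum>r\<in>residue_mod T ` {\<mu>. c \<mu> \<noteq> 0}. (cmod (fiber \<psi> \<beta> T c l r 0))\<^sup>2) \<le> B * (\<Sum>\<mu> | c \<mu> \<noteq> 0. (cmod (c \<mu>))\<^sup>2)"
proof -
  obtain A B where AB: "A > 0" "B > 0" and fr: "\<And>f. f \<in> L2_fun \<Longrightarrow>
      ennreal (A * (L2_nrm f)\<^sup>2) \<le> (\<Sum>\<^sub>\<infinity>i\<in>UNIV. ennreal ((cmod (pairing f (gabor \<psi> \<alpha> \<beta> i)))\<^sup>2)) \<and>
      (\<Sum>\<^sub>\<infinity>i\<in>UNIV. ennreal ((cmod (pairing f (gabor \<psi> \<alpha> \<beta> i)))\<^sup>2)) \<le> ennreal (B * (L2_nrm f)\<^sup>2)"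
    using frame unfolding L2_frame_def by blast
  have T: "T > 0" using \<alpha> by (simp add: T_def)
  define b where "b = bump_energy"
  define \<kappa> where "\<kappa> = window_energy"
  have b: "b > 0" and \<kappa>: "\<kappa> > 0" by (simp_all add: b_def \<kappa>_def bump_energy_pos window_energy_pos)
  define \<epsilon> where "\<epsilon> = (\<lambda>n. inverse (real (Suc n)))"
  have \<epsilon>: "\<epsilon> n > 0" "\<epsilon> \<longlonglongrightarrow> 0" for n unfolding \<epsilon>_def using LIMSEQ_inverse_real_of_nat by auto
  define E where "E = (\<lambda>c n l. \<Sum>r\<in>residue_mod T ` {\<mu>. c \<mu> \<noteq> 0}. integral {0..1} (\<lambda>s. (bump s)\<^sup>2 * (cmod (fiber \<psi> \<beta> T c l r (\<epsilon> n * s)))\<^sup>2))"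
  have fcont: "continuous_on S (\<lambda>s. (bump s)\<^sup>2 * (cmod (fiber \<psi> \<beta> T c l r (a * s)))\<^sup>2)" for S c l r a
    by (intro continuous_intros continuous_on_fiber \<psi>)
  have E0: "E c n l \<ge> 0" for c n l
    unfolding E_def by (intro sum_nonneg integral_nonneg integrable_continuous_real fcont) auto
  define N2 where "N2 = (\<lambda>c n. \<epsilon> n * (L2_nrm (windowed c (\<epsilon> n)))\<^sup>2)"
  define S2 where "S2 = (\<lambda>c::real \<Rightarrow> complex. \<Sum>\<mu> | c \<mu> \<noteq> 0. (cmod (c \<mu>))\<^sup>2)"
  have N2: "N2 c \<longlonglongrightarrow> \<kappa> * S2 c" if "finsupp c" for c
    unfolding N2_def S2_def \<kappa>_def \<epsilon>_def by (rule windowed_norm_limit[OF that])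
  \<comment> \<open>There are finitely many residues, all in [0, T). From some n on the bumps of
    width \<epsilon> n are disjoint and end below T, and \<open>gabor_energy\<close> applies to
    every l with the same n.\<close>
  have ev: "\<forall>\<^sub>F n in sequentially. ennreal (A * (L2_nrm (windowed c (\<epsilon> n)))\<^sup>2) \<le> (\<Sum>\<^sub>\<infinity>l\<in>(UNIV::int set). ennreal (T / \<epsilon> n * E c n l)) \<and>
      (\<Sum>\<^sub>\<infinity>l\<in>(UNIV::int set). ennreal (T / \<epsilon> n * E c n l)) \<le> ennreal (B * (L2_nrm (windowed c (\<epsilon> n)))\<^sup>2)" if c: "finsupp c" for c
  proof -
    let ?R = "residue_mod T ` {\<mu>. c \<mu> \<noteq> 0}"
    have R: "finite ?R" using c by simp
    have "\<forall>\<^sub>F n in sequentially. \<forall>r\<in>?R. r + \<epsilon> n \<le> T"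
    proof (rule eventually_ball_finite[OF R], rule ballI)
      fix r assume "r \<in> ?R"
      then have "T - r > 0" using residue_mod_range[OF T] by auto
      from order_tendstoD(2)[OF \<epsilon>(2) this] show "\<forall>\<^sub>F n in sequentially. r + \<epsilon> n \<le> T"
        by eventually_elim simp
    qed
    moreover have "\<forall>\<^sub>F n in sequentially. \<forall>r\<in>?R. \<forall>r'\<in>?R. r \<noteq> r' \<longrightarrow> \<epsilon> n \<le> \<bar>r - r'\<bar>"
    proof (intro eventually_ball_finite[OF R] ballI)
      fix r r'
      show "\<forall>\<^sub>F n in sequentially. r \<noteq> r' \<longrightarrow> \<epsilon> n \<le> \<bar>r - r'\<bar>"
      proof (cases "r = r'")
        case False
        then have "\<bar>r - r'\<bar> > 0" by simp
        from order_tendstoD(2)[OF \<epsilon>(2) this] show ?thesis by eventually_elim simp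
      qed simp
    qed
    ultimately show ?thesis
    proof eventually_elim
      case (elim n)
      have "(\<Sum>\<^sub>\<infinity>i\<in>UNIV. ennreal ((cmod (pairing (windowed c (\<epsilon> n)) (gabor \<psi> \<alpha> \<beta> i)))\<^sup>2))
         = (\<Sum>\<^sub>\<infinity>l\<in>UNIV. \<Sum>\<^sub>\<infinity>k\<in>UNIV. ennreal ((cmod (pairing (windowed c (\<epsilon> n)) (gabor \<psi> \<alpha> \<beta> (k, l))))\<^sup>2))"
        using infsum_ennreal_swap[of "\<lambda>k l. ennreal ((cmod (pairing (windowed c (\<epsilon> n)) (gabor \<psi> \<alpha> \<beta> (k, l))))\<^sup>2)" UNIV UNIV]
        by (simp add: split_def)
      also have "\<dots> = (\<Sum>\<^sub>\<infinity>l\<in>(UNIV::int set). ennreal (T / \<epsilon> n * E c n l))"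
        unfolding E_def T_def
        by (intro infsum_cong gabor_energy \<psi> c \<alpha> \<epsilon>) (use elim in \<open>auto simp: T_def\<close>)
      finally show ?case using fr[OF windowed_norm(1)[OF c \<epsilon>(1)], of n] by simp
    qed
  qed
  \<comment> \<open>Only a fixed finite \<open>L\<close> is considered, so the limit in n can be
    taken term by term.\<close>
  have upper: "(\<Sum>l\<in>L. \<Sum>r\<in>residue_mod T ` {\<mu>. c \<mu> \<noteq> 0}. (cmod (fiber \<psi> \<beta> T c l r 0))\<^sup>2) \<le> B * \<kappa> / (T * b) * S2 c"
    if c: "finsupp c" and L: "finite L" for c and L :: "int set"
  proof -
    have "T * (\<Sum>l\<in>L. \<Sum>r\<in>residue_mod T ` {\<mu>. c \<mu> \<noteq> 0}. b * (cmod (fiber \<psi> \<beta> T c l r 0))\<^sup>2) \<le> B * (\<kappa> * S2 c)"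
    proof (rule tendsto_le[OF _ tendsto_mult_left[OF N2[OF c]]])
      show "(\<lambda>n. T * (\<Sum>l\<in>L. E c n l)) \<longlonglongrightarrow> T * (\<Sum>l\<in>L. \<Sum>r\<in>residue_mod T ` {\<mu>. c \<mu> \<noteq> 0}. b * (cmod (fiber \<psi> \<beta> T c l r 0))\<^sup>2)"
        unfolding E_def b_def
        by (intro tendsto_mult_left tendsto_sum bump_average_limit \<epsilon> continuous_intros continuous_on_fiber \<psi>)
      show "\<forall>\<^sub>F n in sequentially. T * (\<Sum>l\<in>L. E c n l) \<le> B * N2 c n"
        using ev[OF c]
      proof eventually_elim
        case (elim n)
        then have "(\<Sum>l\<in>L. T / \<epsilon> n * E c n l) \<le> B * (L2_nrm (windowed c (\<epsilon> n)))\<^sup>2"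
          using infsum_le_ennreal_real[of "\<lambda>l. T / \<epsilon> n * E c n l" "B * (L2_nrm (windowed c (\<epsilon> n)))\<^sup>2" UNIV] L T \<epsilon>(1)[of n] E0 AB
          by (simp add: less_imp_le)
        then have "T / \<epsilon> n * (\<Sum>l\<in>L. E c n l) \<le> B * (L2_nrm (windowed c (\<epsilon> n)))\<^sup>2" by (simp add: sum_distrib_left)
        from mult_left_mono[OF this less_imp_le[OF \<epsilon>(1)[of n]]]
        show ?case using \<epsilon>(1)[of n] by (simp add: N2_def mult.left_commute)
      qed
    qed simp
    then have "T * b * (\<Sum>l\<in>L. \<Sum>r\<in>residue_mod T ` {\<mu>. c \<mu> \<noteq> 0}. (cmod (fiber \<psi> \<beta> T c l r 0))\<^sup>2) \<le> B * \<kappa> * S2 c"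
      by (simp add: sum_distrib_left mult_ac)
    then show ?thesis using T b by (simp add: pos_le_divide_eq mult_ac)
  qed
  \<comment> \<open>Here the full sum over l has to be bounded for fixed n before the limit is
    taken. \<open>fiber_shift_bound\<close> does this pointwise in s, and integration against the
    squared bump gives b (2 X + \<eta>).\<close>
  have lower: "A * \<kappa> / (2 * T * b) * S2 c \<le> X"
    if c: "finsupp c" and X: "\<And>L::int set. finite L \<Longrightarrow> (\<Sum>l\<in>L. \<Sum>r\<in>residue_mod T ` {\<mu>. c \<mu> \<noteq> 0}. (cmod (fiber \<psi> \<beta> T c l r 0))\<^sup>2) \<le> X" for c X
  proof -
    let ?R = "residue_mod T ` {\<mu>. c \<mu> \<noteq> 0}"
    have R: "finite ?R" using c by simp
    have X0: "X \<ge> 0" using X[of "{}"] by simp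
    have eta: "A * (\<kappa> * S2 c) \<le> T * b * (2 * X + \<eta>)" if \<eta>: "\<eta> > 0" for \<eta>
    proof -
      obtain \<delta> where \<delta>: "\<delta> > 0" "\<And>x L. 0 \<le> x \<Longrightarrow> x \<le> \<delta> \<Longrightarrow> finite (L::int set) \<Longrightarrow>
          (\<Sum>l\<in>L. \<Sum>r\<in>?R. (cmod (fiber \<psi> \<beta> T c l r x))\<^sup>2) \<le> 2 * X + \<eta>"
        using fiber_shift_bound[OF c cont \<eta> X] by blast
      show ?thesis
      proof (rule tendsto_upperbound[OF tendsto_mult_left[OF N2[OF c]]])
        show "\<forall>\<^sub>F n in sequentially. A * N2 c n \<le> T * b * (2 * X + \<eta>)"
          using ev[OF c] order_tendstoD(2)[OF \<epsilon>(2) \<delta>(1)]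
        proof eventually_elim
          case (elim n)
          have EL: "(\<Sum>l\<in>L. E c n l) \<le> b * (2 * X + \<eta>)" if L: "finite L" for L
          proof -
            have "(\<Sum>l\<in>L. E c n l) = integral {0..1} (\<lambda>s. \<Sum>l\<in>L. \<Sum>r\<in>?R. (bump s)\<^sup>2 * (cmod (fiber \<psi> \<beta> T c l r (\<epsilon> n * s)))\<^sup>2)"
              unfolding E_def
              by (simp add: integral_sum L R integrable_sum integrable_continuous_real fcont)
            also have "\<dots> \<le> integral {0..1} (\<lambda>s. (bump s)\<^sup>2 * (2 * X + \<eta>))"
            proof (rule integral_le)
              show "(\<lambda>s. \<Sum>l\<in>L. \<Sum>r\<in>?R. (bump s)\<^sup>2 * (cmod (fiber \<psi> \<beta> T c l r (\<epsilon> n * s)))\<^sup>2) integrable_on {0..1}"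
                by (intro integrable_continuous_real continuous_on_sum fcont)
              show "(\<lambda>s. (bump s)\<^sup>2 * (2 * X + \<eta>)) integrable_on {0..1}"
                by (intro integrable_continuous_real continuous_intros)
              fix s :: real assume s: "s \<in> {0..1}"
              have "\<epsilon> n * s \<le> \<epsilon> n * 1" "0 \<le> \<epsilon> n * s" using s \<epsilon>(1)[of n] by (auto intro: mult_left_mono)
              then have "0 \<le> \<epsilon> n * s" "\<epsilon> n * s \<le> \<delta>" using elim(2) by linarith+
              then have "(bump s)\<^sup>2 * (\<Sum>l\<in>L. \<Sum>r\<in>?R. (cmod (fiber \<psi> \<beta> T c l r (\<epsilon> n * s)))\<^sup>2) \<le> (bump s)\<^sup>2 * (2 * X + \<eta>)"
                using L by (intro mult_left_mono \<delta>(2)) auto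
              then show "(\<Sum>l\<in>L. \<Sum>r\<in>?R. (bump s)\<^sup>2 * (cmod (fiber \<psi> \<beta> T c l r (\<epsilon> n * s)))\<^sup>2) \<le> (bump s)\<^sup>2 * (2 * X + \<eta>)"
                by (simp add: sum_distrib_left)
            qed
            also have "\<dots> = b * (2 * X + \<eta>)" by (simp add: b_def bump_energy_def)
            finally show ?thesis .
          qed
          have "(\<Sum>\<^sub>\<infinity>l\<in>(UNIV::int set). ennreal (T / \<epsilon> n * E c n l)) \<le> ennreal (T / \<epsilon> n * (b * (2 * X + \<eta>)))"
          proof (subst infsum_le_ennreal_real)
            show "\<forall>F. finite F \<longrightarrow> F \<subseteq> UNIV \<longrightarrow> (\<Sum>l\<in>F. T / \<epsilon> n * E c n l) \<le> T / \<epsilon> n * (b * (2 * X + \<eta>))"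
              unfolding sum_distrib_left[symmetric] using T \<epsilon>(1)[of n] by (intro allI impI mult_left_mono EL) auto
          qed (use T \<epsilon>(1)[of n] E0 b X0 \<eta> in auto)
          with elim(1) have "ennreal (A * (L2_nrm (windowed c (\<epsilon> n)))\<^sup>2) \<le> ennreal (T / \<epsilon> n * (b * (2 * X + \<eta>)))"
            using order_trans by blast
          then have "A * (L2_nrm (windowed c (\<epsilon> n)))\<^sup>2 \<le> T / \<epsilon> n * (b * (2 * X + \<eta>))"
            using T \<epsilon>(1)[of n] b X0 \<eta> by (subst (asm) ennreal_le_iff) auto
          from mult_left_mono[OF this less_imp_le[OF \<epsilon>(1)[of n]]]
          show ?case using \<epsilon>(1)[of n] by (simp add: N2_def mult.left_commute mult.assoc)
        qed
      qed simp
    qed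
    have "A * (\<kappa> * S2 c) \<le> T * b * (2 * X)"
    proof (rule field_le_epsilon)
      fix e :: real assume "e > 0"
      then have "e / (T * b) > 0" using T b by simp
      from eta[OF this] show "A * (\<kappa> * S2 c) \<le> T * b * (2 * X) + e" using T b by (simp add: distrib_left)
    qed
    then show ?thesis using T b by (simp add: pos_divide_le_eq mult_ac)
  qed
  show ?thesis
    by (rule that[of "A * \<kappa> / (2 * T * b)" "B * \<kappa> / (T * b)"])
       (use AB \<kappa> T b lower upper in \<open>auto simp: S2_def\<close>)
qed

section \<open>Passage from trigonometric polynomials to the completion\<close>

lemma residue_mod_eq_iff:
  assumes T: "T > 0" and \<xi>: "\<xi> \<in> {0..<T}"
  shows "residue_mod T \<mu> = \<xi> \<longleftrightarrow> (\<exists>p::int. \<mu> = \<xi> + T * of_int p)"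
proof
  assume "residue_mod T \<mu> = \<xi>"
  then show "\<exists>p::int. \<mu> = \<xi> + T * of_int p" unfolding residue_mod_def by (intro exI[of _ "\<lfloor>\<mu> / T\<rfloor>"]) simp
next
  assume "\<exists>p::int. \<mu> = \<xi> + T * of_int p"
  then obtain p :: int where p: "\<mu> = \<xi> + T * of_int p" by blast
  have "\<mu> / T = \<xi> / T + of_int p" using T by (simp add: p add_divide_distrib)
  moreover have "0 \<le> \<xi> / T" "\<xi> / T < 1" using T \<xi> by auto
  ultimately have "\<lfloor>\<mu> / T\<rfloor> = p" by linarith
  then show "residue_mod T \<mu> = \<xi>" by (simp add: residue_mod_def p)
qed

lemma fiber_eq_sum:
  assumes "finite M" "{\<mu>. c \<mu> \<noteq> 0} \<subseteq> M"
  shows "fiber \<psi> \<beta> T c l r x = (\<Sum>\<mu> | \<mu> \<in> M \<and> residue_mod T \<mu> = r. c \<mu> * cnj (fourier \<psi> (\<mu> - \<beta> * of_int l + x)))"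
  unfolding fiber_def using assms by (intro sum.mono_neutral_left) auto

lemma fiber_diff:
  assumes "finsupp c" "finsupp d"
  shows "fiber \<psi> \<beta> T (\<lambda>\<mu>. c \<mu> - d \<mu>) l r x = fiber \<psi> \<beta> T c l r x - fiber \<psi> \<beta> T d l r x"
proof -
  let ?M = "{\<mu>. c \<mu> \<noteq> 0} \<union> {\<mu>. d \<mu> \<noteq> 0}"
  have M: "finite ?M" using assms by simp
  show ?thesis
    by (subst (1 2 3) fiber_eq_sum[OF M]) (auto simp: sum_subtractf left_diff_distrib)
qed

lemma fiber_eq_0: "r \<notin> residue_mod T ` {\<mu>. c \<mu> \<noteq> 0} \<Longrightarrow> fiber \<psi> \<beta> T c l r x = 0"
  unfolding fiber_def by (intro sum.neutral) auto

lemma infsum_fiber: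
  assumes c: "finsupp c" and T: "T > 0"
  shows "(\<Sum>\<^sub>\<infinity>\<xi>\<in>{0..<T}. ennreal ((cmod (fiber \<psi> \<beta> T c l \<xi> 0))\<^sup>2))
     = ennreal (\<Sum>r\<in>residue_mod T ` {\<mu>. c \<mu> \<noteq> 0}. (cmod (fiber \<psi> \<beta> T c l r 0))\<^sup>2)"
proof -
  let ?R = "residue_mod T ` {\<mu>. c \<mu> \<noteq> 0}"
  have "(\<Sum>\<^sub>\<infinity>\<xi>\<in>{0..<T}. ennreal ((cmod (fiber \<psi> \<beta> T c l \<xi> 0))\<^sup>2)) = (\<Sum>\<^sub>\<infinity>\<xi>\<in>?R. ennreal ((cmod (fiber \<psi> \<beta> T c l \<xi> 0))\<^sup>2))"
    using residue_mod_range[OF T] by (intro infsum_cong_neutral) (auto simp: fiber_eq_0)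
  also have "\<dots> = ennreal (\<Sum>r\<in>?R. (cmod (fiber \<psi> \<beta> T c l r 0))\<^sup>2)"
    using c by (simp add: sum_ennreal)
  finally show ?thesis .
qed

text \<open>In a Cauchy estimate that is uniform over finite \<open>F\<close> the index m may tend
  to infinity inside the finite sum; a termwise limit is therefore also a limit in l2.\<close>

lemma l2_limit_near:
  fixes \<theta> :: "nat \<Rightarrow> 'i \<Rightarrow> complex"
  assumes lim: "\<And>i. i \<in> I \<Longrightarrow> (\<lambda>n. \<theta> n i) \<longlonglongrightarrow> \<theta>' i"
    and Cauchy: "\<And>\<eta>. \<eta> > 0 \<Longrightarrow> \<exists>N. \<forall>m\<ge>N. \<forall>n\<ge>N. \<forall>F. finite F \<longrightarrow> F \<subseteq> I \<longrightarrow> (\<Sum>i\<in>F. (cmod (\<theta> n i - \<theta> m i))\<^sup>2) \<le> \<eta>"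
    and \<eta>: "\<eta> > 0"
  shows "\<exists>N. \<forall>n\<ge>N. \<forall>F. finite F \<longrightarrow> F \<subseteq> I \<longrightarrow> (\<Sum>i\<in>F. (cmod (\<theta> n i - \<theta>' i))\<^sup>2) \<le> \<eta>"
proof -
  from Cauchy[OF \<eta>] obtain N where N: "\<forall>m\<ge>N. \<forall>n\<ge>N. \<forall>F. finite F \<longrightarrow> F \<subseteq> I \<longrightarrow> (\<Sum>i\<in>F. (cmod (\<theta> n i - \<theta> m i))\<^sup>2) \<le> \<eta>"
    by (rule exE)
  show ?thesis
  proof (intro exI allI impI)
    fix n F assume nF: "n \<ge> N" "finite F" "F \<subseteq> I"
    show "(\<Sum>i\<in>F. (cmod (\<theta> n i - \<theta>' i))\<^sup>2) \<le> \<eta>"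
    proof (rule sum_square_diff_limit[of F \<theta> \<theta>' N])
      show "(\<lambda>n. \<theta> n i) \<longlonglongrightarrow> \<theta>' i" if "i \<in> F" for i using lim that nF(3) by blast
      show "(\<Sum>i\<in>F. (cmod (\<theta> n i - \<theta> m i))\<^sup>2) \<le> \<eta>" if "m \<ge> N" for m
        by (rule N[rule_format, OF that nF])
    qed
  qed
qed

lemma l2_limit_upper:
  fixes \<theta> :: "nat \<Rightarrow> 'i \<Rightarrow> complex"
  assumes lim: "\<And>i. i \<in> I \<Longrightarrow> (\<lambda>n. \<theta> n i) \<longlonglongrightarrow> \<theta>' i"
    and Cauchy: "\<And>\<eta>. \<eta> > 0 \<Longrightarrow> \<exists>N. \<forall>m\<ge>N. \<forall>n\<ge>N. \<forall>F. finite F \<longrightarrow> F \<subseteq> I \<longrightarrow> (\<Sum>i\<in>F. (cmod (\<theta> n i - \<theta> m i))\<^sup>2) \<le> \<eta>"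
    and b: "\<And>n. (\<Sum>\<^sub>\<infinity>i\<in>I. ennreal ((cmod (\<theta> n i))\<^sup>2)) \<le> ennreal (b n)" "\<And>n. b n \<ge> 0" "b \<longlonglongrightarrow> b'"
  shows "(\<Sum>\<^sub>\<infinity>i\<in>I. ennreal ((cmod (\<theta>' i))\<^sup>2)) \<le> 2 * ennreal b'"
proof -
  have b': "b' \<ge> 0" using b(2,3) by (intro LIMSEQ_le_const[OF b(3)]) auto
  have "(\<Sum>\<^sub>\<infinity>i\<in>I. ennreal ((cmod (\<theta>' i))\<^sup>2)) \<le> 2 * ennreal b' + ennreal e" if e: "e > 0" for e
  proof -
    have "e / 4 > 0" using e by simp
    from l2_limit_near[OF lim Cauchy this] obtain N where N': "\<forall>n\<ge>N. \<forall>F. finite F \<longrightarrow> F \<subseteq> I \<longrightarrow> (\<Sum>i\<in>F. (cmod (\<theta> n i - \<theta>' i))\<^sup>2) \<le> e / 4"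
      by (rule exE)
    note N = N'[rule_format]
    have "\<forall>\<^sub>F n in sequentially. b n < b' + e / 4" using order_tendstoD(2)[OF b(3), of "b' + e / 4"] e by simp
    then obtain N' where N': "\<And>n. n \<ge> N' \<Longrightarrow> b n < b' + e / 4" by (auto simp: eventually_sequentially)
    define n where "n = max N N'"
    have "(\<Sum>\<^sub>\<infinity>i\<in>I. ennreal ((cmod (\<theta>' i))\<^sup>2)) \<le> 2 * (\<Sum>\<^sub>\<infinity>i\<in>I. ennreal ((cmod (\<theta> n i))\<^sup>2)) + ennreal (2 * (e / 4))"
      by (rule infsum_square_perturb) (use N[of n] in \<open>simp add: n_def norm_minus_commute\<close>)
    also have "\<dots> \<le> 2 * ennreal (b n) + ennreal (2 * (e / 4))" by (intro add_right_mono mult_left_mono b(1)) simp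
    also have "\<dots> = ennreal (2 * b n + 2 * (e / 4))" using b(2)[of n] e by (simp add: ennreal_plus ennreal_mult)
    also have "\<dots> \<le> ennreal (2 * b' + e)" using N'[of n] by (intro ennreal_leI) (simp add: n_def)
    also have "\<dots> = 2 * ennreal b' + ennreal e" using b' e by (simp add: ennreal_plus ennreal_mult)
    finally show ?thesis .
  qed
  then show "(\<Sum>\<^sub>\<infinity>i\<in>I. ennreal ((cmod (\<theta>' i))\<^sup>2)) \<le> 2 * ennreal b'" by (rule ennreal_le_epsilon)
qed

lemma l2_limit_lower:
  fixes \<theta> :: "nat \<Rightarrow> 'i \<Rightarrow> complex"
  assumes lim: "\<And>i. i \<in> I \<Longrightarrow> (\<lambda>n. \<theta> n i) \<longlonglongrightarrow> \<theta>' i"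
    and Cauchy: "\<And>\<eta>. \<eta> > 0 \<Longrightarrow> \<exists>N. \<forall>m\<ge>N. \<forall>n\<ge>N. \<forall>F. finite F \<longrightarrow> F \<subseteq> I \<longrightarrow> (\<Sum>i\<in>F. (cmod (\<theta> n i - \<theta> m i))\<^sup>2) \<le> \<eta>"
    and a: "\<And>n. ennreal (a n) \<le> (\<Sum>\<^sub>\<infinity>i\<in>I. ennreal ((cmod (\<theta> n i))\<^sup>2))" "\<And>n. a n \<ge> 0" "a \<longlonglongrightarrow> a'"
  shows "ennreal a' \<le> 2 * (\<Sum>\<^sub>\<infinity>i\<in>I. ennreal ((cmod (\<theta>' i))\<^sup>2))"
proof -
  have "ennreal a' \<le> 2 * (\<Sum>\<^sub>\<infinity>i\<in>I. ennreal ((cmod (\<theta>' i))\<^sup>2)) + ennreal e" if e: "e > 0" for e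
  proof -
    have "e / 4 > 0" using e by simp
    from l2_limit_near[OF lim Cauchy this] obtain N where N': "\<forall>n\<ge>N. \<forall>F. finite F \<longrightarrow> F \<subseteq> I \<longrightarrow> (\<Sum>i\<in>F. (cmod (\<theta> n i - \<theta>' i))\<^sup>2) \<le> e / 4"
      by (rule exE)
    note N = N'[rule_format]
    have "\<forall>\<^sub>F n in sequentially. a' - e / 2 < a n" using order_tendstoD(1)[OF a(3), of "a' - e / 2"] e by simp
    then obtain N' where N': "\<And>n. n \<ge> N' \<Longrightarrow> a' - e / 2 < a n" by (auto simp: eventually_sequentially)
    define n where "n = max N N'"
    have "ennreal a' \<le> ennreal (a n + e / 2)" using N'[of n] by (intro ennreal_leI) (simp add: n_def)
    also have "\<dots> = ennreal (a n) + ennreal (e / 2)" using a(2)[of n] e by (simp add: ennreal_plus)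
    also have "\<dots> \<le> (2 * (\<Sum>\<^sub>\<infinity>i\<in>I. ennreal ((cmod (\<theta>' i))\<^sup>2)) + ennreal (2 * (e / 4))) + ennreal (e / 2)"
      by (intro add_right_mono order_trans[OF a(1)] infsum_square_perturb) (use N[of n] in \<open>simp add: n_def\<close>)
    also have "\<dots> = 2 * (\<Sum>\<^sub>\<infinity>i\<in>I. ennreal ((cmod (\<theta>' i))\<^sup>2)) + ennreal e"
      using e by (simp add: add.assoc flip: ennreal_plus)
    finally show ?thesis .
  qed
  then show "ennreal a' \<le> 2 * (\<Sum>\<^sub>\<infinity>i\<in>I. ennreal ((cmod (\<theta>' i))\<^sup>2))" by (rule ennreal_le_epsilon)
qed

text \<open>Duality: the polynomial whose coefficients are the values of the transform itself has as
  its fibre the sum q in question, and the upper bound reads q^2 \<le> B q. This supplies the square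
  summability behind \<open>gabor_AP\<close>.\<close>

lemma fourier_fiber_bound:
  fixes \<beta> T :: real
  assumes T: "T > 0" and \<xi>: "\<xi> \<in> {0..<T}" and B: "B > 0"
    and upper: "\<And>c (L::int set). finsupp c \<Longrightarrow> finite L \<Longrightarrow>
        (\<Sum>l\<in>L. \<Sum>r\<in>residue_mod T ` {\<mu>. c \<mu> \<noteq> 0}. (cmod (fiber \<psi> \<beta> T c l r 0))\<^sup>2) \<le> B * (\<Sum>\<mu> | c \<mu> \<noteq> 0. (cmod (c \<mu>))\<^sup>2)"
    and M: "finite M" "\<And>\<mu>. \<mu> \<in> M \<Longrightarrow> residue_mod T \<mu> = \<xi>"
  shows "(\<Sum>\<mu>\<in>M. (cmod (fourier \<psi> (\<mu> - \<beta> * of_int l)))\<^sup>2) \<le> B"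
proof -
  define c where "c = (\<lambda>\<mu>. if \<mu> \<in> M then fourier \<psi> (\<mu> - \<beta> * of_int l) else 0)"
  define q where "q = (\<Sum>\<mu>\<in>M. (cmod (fourier \<psi> (\<mu> - \<beta> * of_int l)))\<^sup>2)"
  have q0: "q \<ge> 0" unfolding q_def by (rule sum_nonneg) simp
  have sub: "{\<mu>. c \<mu> \<noteq> 0} \<subseteq> M" by (auto simp: c_def)
  have c: "finsupp c" using finite_subset[OF sub M(1)] .
  have qc: "(\<Sum>\<mu> | c \<mu> \<noteq> 0. (cmod (c \<mu>))\<^sup>2) = q"
    unfolding q_def using sub M(1) by (intro sum.mono_neutral_cong_left) (auto simp: c_def)
  have fq: "fiber \<psi> \<beta> T c l \<xi> 0 = of_real q"
  proof -
    have "fiber \<psi> \<beta> T c l \<xi> 0 = (\<Sum>\<mu>\<in>M. c \<mu> * cnj (fourier \<psi> (\<mu> - \<beta> * of_int l)))"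
      unfolding fiber_eq_sum[OF M(1) sub] using M(2) by (intro sum.cong) auto
    also have "\<dots> = of_real q" by (simp add: q_def c_def complex_norm_square del: of_real_power)
    finally show ?thesis .
  qed
  show ?thesis
  proof (cases "q = 0")
    case False
    then have "\<xi> \<in> residue_mod T ` {\<mu>. c \<mu> \<noteq> 0}" using fiber_eq_0[of \<xi> T c \<psi> \<beta> l 0] fq by (metis of_real_eq_0_iff)
    then have "(cmod (fiber \<psi> \<beta> T c l \<xi> 0))\<^sup>2 \<le> (\<Sum>r\<in>residue_mod T ` {\<mu>. c \<mu> \<noteq> 0}. (cmod (fiber \<psi> \<beta> T c l r 0))\<^sup>2)"
      using c by (intro member_le_sum) auto
    also have "\<dots> \<le> B * q" using upper[OF c, of "{l}"] qc by simp
    finally have "q * q \<le> B * q" by (simp add: fq power2_eq_square)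
    then show ?thesis using False q0 unfolding q_def[symmetric] by simp
  qed (use B q_def in simp)
qed

text \<open>At displacement 0 the fibre is exactly the pairing of the coefficients of
  \<open>tp (c n)\<close> with those of \<open>gabor_AP\<close>. The finite sets \<open>M n\<close>
  exhaust the coset \<xi> + T \<int>, off which the latter vanish.\<close>

lemma fiber_tendsto_AP2_inner:
  fixes \<alpha> \<beta> :: real
  assumes \<alpha>: "\<alpha> > 0"
  defines "T \<equiv> 2 * pi / \<alpha>"
  assumes \<xi>: "\<xi> \<in> {0..<T}" and B: "B > 0"
    and upper: "\<And>c (L::int set). finsupp c \<Longrightarrow> finite L \<Longrightarrow>
        (\<Sum>l\<in>L. \<Sum>r\<in>residue_mod T ` {\<mu>. c \<mu> \<noteq> 0}. (cmod (fiber \<psi> \<beta> T c l r 0))\<^sup>2) \<le> B * (\<Sum>\<mu> | c \<mu> \<noteq> 0. (cmod (c \<mu>))\<^sup>2)"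
    and c: "\<And>n. finsupp (c n)" "(\<lambda>n. tp (c n)) \<in> AP_Cauchy"
  shows "(\<lambda>n. fiber \<psi> \<beta> T (c n) l \<xi> 0) \<longlonglongrightarrow> AP2_inner (AP_class (\<lambda>n. tp (c n))) (gabor_AP \<psi> \<alpha> \<beta> \<xi> l)"
proof -
  have T: "T > 0" using \<alpha> by (simp add: T_def)
  define a where "a = (\<lambda>\<mu>. if \<exists>p::int. \<mu> = \<xi> + T * of_int p then fourier \<psi> (\<mu> - \<beta> * of_int l) else 0)"
  have a: "a \<mu> = (if residue_mod T \<mu> = \<xi> then fourier \<psi> (\<mu> - \<beta> * of_int l) else 0)" for \<mu>
    unfolding a_def residue_mod_eq_iff[OF T \<xi>] ..
  define M where "M = (\<lambda>n::nat. (\<lambda>p::int. \<xi> + T * of_int p) ` {- int n..int n})"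
  have M1: "finite (M n)" for n by (simp add: M_def)
  have M2: "M m \<subseteq> M n" if "m \<le> n" for m n using that unfolding M_def by (intro image_mono) auto
  have M3: "{\<mu>. a \<mu> \<noteq> 0} \<subseteq> (\<Union>n. M n)"
  proof
    fix \<mu> assume "\<mu> \<in> {\<mu>. a \<mu> \<noteq> 0}"
    then obtain p :: int where "\<mu> = \<xi> + T * of_int p" by (auto simp: a_def split: if_splits)
    then have "\<mu> \<in> M (nat \<bar>p\<bar>)" unfolding M_def by (intro image_eqI[of _ _ p]) auto
    then show "\<mu> \<in> (\<Union>n. M n)" by blast
  qed
  have M4: "(\<Sum>\<mu>\<in>M n. (cmod (a \<mu>))\<^sup>2) \<le> B" for n
  proof -
    have res: "residue_mod T \<mu> = \<xi>" if "\<mu> \<in> M n" for \<mu>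
      using that unfolding M_def residue_mod_eq_iff[OF T \<xi>] by blast
    have "(\<Sum>\<mu>\<in>M n. (cmod (a \<mu>))\<^sup>2) = (\<Sum>\<mu>\<in>M n. (cmod (fourier \<psi> (\<mu> - \<beta> * of_int l)))\<^sup>2)"
      using res by (intro sum.cong) (auto simp: a)
    also have "\<dots> \<le> B" by (rule fourier_fiber_bound[OF T \<xi> B upper M1 res])
    finally show ?thesis .
  qed
  have "(\<Sum>\<mu> | c n \<mu> \<noteq> 0. c n \<mu> * cnj (a \<mu>)) = fiber \<psi> \<beta> T (c n) l \<xi> 0" for n
    unfolding fiber_def using c(1)[of n] by (intro sum.mono_neutral_cong_right) (auto simp: a)
  then show ?thesis
    using AP2_inner_with_coeffs[where M = M and a = a and B = B and c = c, OF M1 M2 M3 M4 c]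
    by (simp add: gabor_AP_def a_def T_def)
qed

text \<open>The fibre is additive in c, so the upper bound applies to the difference of c n and c m
  and carries the Cauchy property over to l2 on the pairs (l, \<xi>).\<close>

lemma fiber_Cauchy:
  fixes \<beta> T :: real
  assumes T: "T > 0" and B: "B > 0"
    and upper: "\<And>c (L::int set). finsupp c \<Longrightarrow> finite L \<Longrightarrow>
        (\<Sum>l\<in>L. \<Sum>r\<in>residue_mod T ` {\<mu>. c \<mu> \<noteq> 0}. (cmod (fiber \<psi> \<beta> T c l r 0))\<^sup>2) \<le> B * (\<Sum>\<mu> | c \<mu> \<noteq> 0. (cmod (c \<mu>))\<^sup>2)"
    and c: "\<And>n. finsupp (c n)" "(\<lambda>n. tp (c n)) \<in> AP_Cauchy" and \<eta>: "\<eta> > 0"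
  shows "\<exists>N. \<forall>m\<ge>N. \<forall>n\<ge>N. \<forall>F. finite F \<longrightarrow> F \<subseteq> UNIV \<times> {0..<T} \<longrightarrow>
     (\<Sum>(l, \<xi>)\<in>F. (cmod (fiber \<psi> \<beta> T (c n) l \<xi> 0 - fiber \<psi> \<beta> T (c m) l \<xi> 0))\<^sup>2) \<le> \<eta>"
proof -
  have "sqrt (\<eta> / B) > 0" using \<eta> B by simp
  then obtain N where N: "\<And>m n. m \<ge> N \<Longrightarrow> n \<ge> N \<Longrightarrow> AP_nrm (\<lambda>t. tp (c m) t - tp (c n) t) \<le> sqrt (\<eta> / B)"
    using AP_Cauchy_diff_le[OF c(2)] by blast
  have "(\<Sum>(l, \<xi>)\<in>F. (cmod (fiber \<psi> \<beta> T (c n) l \<xi> 0 - fiber \<psi> \<beta> T (c m) l \<xi> 0))\<^sup>2) \<le> \<eta>"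
    if mn: "m \<ge> N" "n \<ge> N" and F: "finite F" "F \<subseteq> UNIV \<times> {0..<T}" for m n and F :: "(int \<times> real) set"
  proof -
    define d where "d = (\<lambda>\<mu>. c n \<mu> - c m \<mu>)"
    have d: "finsupp d" unfolding d_def by (intro finsupp_diff c)
    let ?R = "residue_mod T ` {\<mu>. d \<mu> \<noteq> 0}"
    have R: "finite ?R" using d by simp
    have "(\<Sum>(l, \<xi>)\<in>F. (cmod (fiber \<psi> \<beta> T (c n) l \<xi> 0 - fiber \<psi> \<beta> T (c m) l \<xi> 0))\<^sup>2) = (\<Sum>(l, \<xi>)\<in>F. (cmod (fiber \<psi> \<beta> T d l \<xi> 0))\<^sup>2)"
      by (simp add: d_def fiber_diff c)
    \<comment> \<open>Only finitely many \<xi> are residues of frequencies of \<open>d\<close>;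
      pairs with other \<xi> contribute 0, and the remaining ones fit into a finite
      rectangle.\<close>
    also have "\<dots> = (\<Sum>(l, \<xi>)\<in>F \<inter> (fst ` F \<times> ?R). (cmod (fiber \<psi> \<beta> T d l \<xi> 0))\<^sup>2)"
    proof (rule sum.mono_neutral_right)
      have "fiber \<psi> \<beta> T d l \<xi> 0 = 0" if l\<xi>: "(l, \<xi>) \<in> F - F \<inter> (fst ` F \<times> ?R)" for l \<xi>
      proof (rule fiber_eq_0)
        have "l \<in> fst ` F" using image_eqI[of l fst "(l, \<xi>)" F] l\<xi> by simp
        with l\<xi> show "\<xi> \<notin> ?R" by (simp only: Diff_iff Int_iff mem_Times_iff fst_conv snd_conv) blast
      qed
      then show "\<forall>i\<in>F - F \<inter> (fst ` F \<times> ?R). (case i of (l, \<xi>) \<Rightarrow> (cmod (fiber \<psi> \<beta> T d l \<xi> 0))\<^sup>2) = 0"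
        by (intro ballI) (simp only: split_paired_all prod.case norm_zero power_zero_numeral)
    qed (use F in auto)
    also have "\<dots> \<le> (\<Sum>(l, \<xi>)\<in>fst ` F \<times> ?R. (cmod (fiber \<psi> \<beta> T d l \<xi> 0))\<^sup>2)"
      using F(1) R by (intro sum_mono2) auto
    also have "\<dots> = (\<Sum>l\<in>fst ` F. \<Sum>r\<in>?R. (cmod (fiber \<psi> \<beta> T d l r 0))\<^sup>2)" by (simp add: sum.cartesian_product)
    also have "\<dots> \<le> B * (\<Sum>\<mu> | d \<mu> \<noteq> 0. (cmod (d \<mu>))\<^sup>2)" using F(1) by (intro upper d) simp
    also have "(\<Sum>\<mu> | d \<mu> \<noteq> 0. (cmod (d \<mu>))\<^sup>2) = (AP_nrm (\<lambda>t. tp (c n) t - tp (c m) t))\<^sup>2"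
      using AP_nrm_tp[OF d order_refl] unfolding d_def tp_diff[OF c(1) c(1)] by simp
    also have "B * \<dots> \<le> B * (sqrt (\<eta> / B))\<^sup>2"
      using B N[OF mn(2,1)] by (intro mult_left_mono power_mono AP_nrm_nonneg UAP_diff tp_UAP c) auto
    also have "\<dots> = \<eta>" using B \<eta> by simp
    finally show ?thesis .
  qed
  then show ?thesis by blast
qed

lemma infsum_fiber_bounds:
  fixes \<beta> T :: real
  assumes T: "T > 0" and B: "B > 0"
    and lower: "\<And>c X. finsupp c \<Longrightarrow> (\<And>L::int set. finite L \<Longrightarrow>
        (\<Sum>l\<in>L. \<Sum>r\<in>residue_mod T ` {\<mu>. c \<mu> \<noteq> 0}. (cmod (fiber \<psi> \<beta> T c l r 0))\<^sup>2) \<le> X) \<Longrightarrow> A * (\<Sum>\<mu> | c \<mu> \<noteq> 0. (cmod (c \<mu>))\<^sup>2) \<le> X"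
    and upper: "\<And>c (L::int set). finsupp c \<Longrightarrow> finite L \<Longrightarrow>
        (\<Sum>l\<in>L. \<Sum>r\<in>residue_mod T ` {\<mu>. c \<mu> \<noteq> 0}. (cmod (fiber \<psi> \<beta> T c l r 0))\<^sup>2) \<le> B * (\<Sum>\<mu> | c \<mu> \<noteq> 0. (cmod (c \<mu>))\<^sup>2)"
    and c: "finsupp c"
  defines "\<Theta> \<equiv> (\<Sum>\<^sub>\<infinity>(l, \<xi>)\<in>(UNIV::int set) \<times> {0..<T}. ennreal ((cmod (fiber \<psi> \<beta> T c l \<xi> 0))\<^sup>2))"
  shows "ennreal (A * (AP_nrm (tp c))\<^sup>2) \<le> \<Theta>" "\<Theta> \<le> ennreal (B * (AP_nrm (tp c))\<^sup>2)"
proof -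
  let ?R = "residue_mod T ` {\<mu>. c \<mu> \<noteq> 0}"
  let ?q = "\<lambda>l. \<Sum>r\<in>?R. (cmod (fiber \<psi> \<beta> T c l r 0))\<^sup>2"
  have \<Theta>: "\<Theta> = (\<Sum>\<^sub>\<infinity>l\<in>(UNIV::int set). ennreal (?q l))"
    unfolding \<Theta>_def by (subst infsum_ennreal_Sigma) (simp only: infsum_fiber[OF c T])
  have S: "(\<Sum>\<mu> | c \<mu> \<noteq> 0. (cmod (c \<mu>))\<^sup>2) = (AP_nrm (tp c))\<^sup>2" using AP_nrm_tp[OF c order_refl] by simp
  show up: "\<Theta> \<le> ennreal (B * (AP_nrm (tp c))\<^sup>2)"
    unfolding \<Theta> using upper[OF c] B by (subst infsum_le_ennreal_real) (auto simp: sum_nonneg S)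
  \<comment> \<open>The upper bound makes the sum finite, so that it can serve as the real bound X
    required by \<open>lower\<close>.\<close>
  define X where "X = enn2real \<Theta>"
  have "\<Theta> < top" using up by (rule le_less_trans) simp
  then have X: "\<Theta> = ennreal X" "X \<ge> 0" by (simp_all add: X_def)
  have "A * (\<Sum>\<mu> | c \<mu> \<noteq> 0. (cmod (c \<mu>))\<^sup>2) \<le> X"
  proof (rule lower[OF c])
    fix L :: "int set" assume L: "finite L"
    have "(\<Sum>\<^sub>\<infinity>l\<in>(UNIV::int set). ennreal (?q l)) \<le> ennreal X" using X \<Theta> by simp
    then show "(\<Sum>l\<in>L. ?q l) \<le> X" using L X(2) by (subst (asm) infsum_le_ennreal_real) (auto simp: sum_nonneg)
  qed
  then show "ennreal (A * (AP_nrm (tp c))\<^sup>2) \<le> \<Theta>" unfolding X S by (rule ennreal_leI)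
qed

text \<open>Both inequalities for polynomials pass to the limit by the l2 lemmas on the pairs (l,
  \<xi>); each passage costs a factor 2.\<close>

lemma AP2_frame_bounds:
  fixes \<alpha> \<beta> :: real
  assumes \<alpha>: "\<alpha> > 0"
  defines "T \<equiv> 2 * pi / \<alpha>"
  assumes A: "A > 0" and B: "B > 0"
    and lower: "\<And>c X. finsupp c \<Longrightarrow> (\<And>L::int set. finite L \<Longrightarrow>
        (\<Sum>l\<in>L. \<Sum>r\<in>residue_mod T ` {\<mu>. c \<mu> \<noteq> 0}. (cmod (fiber \<psi> \<beta> T c l r 0))\<^sup>2) \<le> X) \<Longrightarrow> A * (\<Sum>\<mu> | c \<mu> \<noteq> 0. (cmod (c \<mu>))\<^sup>2) \<le> X"
    and upper: "\<And>c (L::int set). finsupp c \<Longrightarrow> finite L \<Longrightarrow>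
        (\<Sum>l\<in>L. \<Sum>r\<in>residue_mod T ` {\<mu>. c \<mu> \<noteq> 0}. (cmod (fiber \<psi> \<beta> T c l r 0))\<^sup>2) \<le> B * (\<Sum>\<mu> | c \<mu> \<noteq> 0. (cmod (c \<mu>))\<^sup>2)"
    and F: "F \<in> AP2"
  defines "\<Theta> \<equiv> (\<Sum>\<^sub>\<infinity>l\<in>(UNIV::int set). \<Sum>\<^sub>\<infinity>\<xi>\<in>{0..<T}. ennreal ((cmod (AP2_inner F (gabor_AP \<psi> \<alpha> \<beta> \<xi> l)))\<^sup>2))"
  shows "ennreal (A * (AP2_nrm F)\<^sup>2) \<le> 2 * \<Theta>" "\<Theta> \<le> 2 * ennreal (B * (AP2_nrm F)\<^sup>2)"
proof -
  have T: "T > 0" using \<alpha> by (simp add: T_def)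
  obtain c where c: "\<And>n. finsupp (c n)" "(\<lambda>n. tp (c n)) \<in> AP_Cauchy" "F = AP_class (\<lambda>n. tp (c n))"
    using AP2_trig_poly_rep[OF F] by blast
  define \<theta> where "\<theta> = (\<lambda>n (l, \<xi>). fiber \<psi> \<beta> T (c n) l \<xi> 0)"
  define \<theta>' where "\<theta>' = (\<lambda>(l, \<xi>). AP2_inner F (gabor_AP \<psi> \<alpha> \<beta> \<xi> l))"
  let ?I = "(UNIV :: int set) \<times> {0..<T}"
  have lim: "(\<lambda>n. \<theta> n i) \<longlonglongrightarrow> \<theta>' i" if "i \<in> ?I" for i
    using that fiber_tendsto_AP2_inner[OF \<alpha> _ B, of _ \<psi> \<beta> c] upper c(1,2) unfolding \<theta>_def \<theta>'_def T_def c(3) by auto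
  have Cauchy: "\<exists>N. \<forall>m\<ge>N. \<forall>n\<ge>N. \<forall>F. finite F \<longrightarrow> F \<subseteq> ?I \<longrightarrow> (\<Sum>i\<in>F. (cmod (\<theta> n i - \<theta> m i))\<^sup>2) \<le> \<eta>" if "\<eta> > 0" for \<eta>
    using fiber_Cauchy[OF T B upper c(1,2) that] unfolding \<theta>_def by (simp add: split_def)
  have \<Theta>: "\<Theta> = (\<Sum>\<^sub>\<infinity>i\<in>?I. ennreal ((cmod (\<theta>' i))\<^sup>2))"
    unfolding \<Theta>_def \<theta>'_def by (subst infsum_ennreal_Sigma[symmetric]) (simp add: split_def)
  have bounds: "ennreal (A * (AP_nrm (tp (c n)))\<^sup>2) \<le> (\<Sum>\<^sub>\<infinity>i\<in>?I. ennreal ((cmod (\<theta> n i))\<^sup>2))"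
    "(\<Sum>\<^sub>\<infinity>i\<in>?I. ennreal ((cmod (\<theta> n i))\<^sup>2)) \<le> ennreal (B * (AP_nrm (tp (c n)))\<^sup>2)" for n
    using infsum_fiber_bounds[OF T B lower upper c(1)[of n]] unfolding \<theta>_def by (simp_all add: split_def)
  have nrm: "(\<lambda>n. X * (AP_nrm (tp (c n)))\<^sup>2) \<longlonglongrightarrow> X * (AP2_nrm F)\<^sup>2" for X
    using AP2_nrm_class[OF c(2)] unfolding c(3) by (intro tendsto_intros)
  show "\<Theta> \<le> 2 * ennreal (B * (AP2_nrm F)\<^sup>2)"
    unfolding \<Theta> by (rule l2_limit_upper[OF lim Cauchy bounds(2) _ nrm]) (use B in auto)
  show "ennreal (A * (AP2_nrm F)\<^sup>2) \<le> 2 * \<Theta>"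
    unfolding \<Theta> by (rule l2_limit_lower[OF lim Cauchy bounds(1) _ nrm]) (use A in auto)
qed

section \<open>The Stepanov class\<close>

definition local_energy :: "(real \<Rightarrow> complex) \<Rightarrow> real \<Rightarrow> real" where
  "local_energy f t = (LINT s:{t..t+1}|lebesgue. (cmod (f s))\<^sup>2)"

lemma local_energy_nonneg: "0 \<le> local_energy f t"
  unfolding local_energy_def set_lebesgue_integral_def by (rule Bochner_Integration.integral_nonneg) auto

lemma amalgam_nrm_eq: "amalgam_nrm f = (SUP t. sqrt (local_energy f t))"
  by (simp add: amalgam_nrm_def local_energy_def)

lemma local_energy_le_amalgam:
  assumes "f \<in> amalgam"
  shows "local_energy f t \<le> (amalgam_nrm f)\<^sup>2" "0 \<le> amalgam_nrm f"
proof -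
  have "bdd_above (range (\<lambda>t. sqrt (local_energy f t)))"
    using assms unfolding amalgam_def local_energy_def by simp
  then have le: "sqrt (local_energy f t) \<le> amalgam_nrm f" for t
    unfolding amalgam_nrm_eq by (rule cSUP_upper[OF UNIV_I])
  show "0 \<le> amalgam_nrm f" using order_trans[OF _ le[of 0]] local_energy_nonneg by simp
  then show "local_energy f t \<le> (amalgam_nrm f)\<^sup>2"
    using le[of t] sqrt_le_D by blast
qed

lemma amalgam_nrm_leI: "(\<And>t. local_energy f t \<le> K\<^sup>2) \<Longrightarrow> 0 \<le> K \<Longrightarrow> amalgam_nrm f \<le> K"
  unfolding amalgam_nrm_eq by (intro cSUP_least) (auto intro: real_le_lsqrt local_energy_nonneg)

lemma amalgamI:
  assumes "f \<in> borel_measurable lebesgue" "\<And>t. set_integrable lebesgue {t..t+1} (\<lambda>s. (cmod (f s))\<^sup>2)"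
    "\<And>t. local_energy f t \<le> K"
  shows "f \<in> amalgam"
proof -
  have "bdd_above (range (\<lambda>t. sqrt (local_energy f t)))"
    using assms(3) by (intro bdd_aboveI2[of _ _ "sqrt K"]) simp
  then show ?thesis using assms unfolding amalgam_def local_energy_def by simp
qed

lemma UAP_amalgam:
  assumes f: "f \<in> UAP" shows "f \<in> amalgam"
proof -
  obtain K where K: "\<And>t. cmod (f t) \<le> K" "K > 0" using UAP_bounded[OF f] by blast
  have cont: "continuous_on S (\<lambda>s. (cmod (f s))\<^sup>2)" for S by (intro continuous_intros UAP_continuous f)
  have int: "set_integrable lebesgue {t..t+1} (\<lambda>s. (cmod (f s))\<^sup>2)" for t
    by (rule absolutely_integrable_continuous_real[OF cont])
  have "local_energy f t \<le> K\<^sup>2" for t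
  proof -
    have "local_energy f t = integral {t..t+1} (\<lambda>s. (cmod (f s))\<^sup>2)"
      unfolding local_energy_def by (rule set_lebesgue_integral_eq_integral(2)[OF int])
    also have "\<dots> \<le> integral {t..t+1} (\<lambda>s. K\<^sup>2)"
      by (intro integral_le integrable_continuous_real cont continuous_on_const power_mono K) auto
    finally show ?thesis by simp
  qed
  then show ?thesis by (intro amalgamI borel_measurable_lebesgue_continuous UAP_continuous f int)
qed

text \<open>|a - b|^2 \<le> 2 |a|^2 + 2 |b|^2 stands in for Minkowski's inequality; such factors do
  not affect convergence in \<open>amalgam_nrm\<close>.\<close>

lemma local_energy_diff:
  assumes f: "f \<in> amalgam" and g: "g \<in> amalgam"
  shows "(\<lambda>t. f t - g t) \<in> amalgam" "local_energy (\<lambda>t. f t - g t) t \<le> 2 * local_energy f t + 2 * local_energy g t"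
proof -
  have m: "(\<lambda>t. f t - g t) \<in> borel_measurable lebesgue" using f g unfolding amalgam_def by auto
  have fi: "set_integrable lebesgue {t..t+1} (\<lambda>s. (cmod (f s))\<^sup>2)" and gi: "set_integrable lebesgue {t..t+1} (\<lambda>s. (cmod (g s))\<^sup>2)" for t
    using f g unfolding amalgam_def by auto
  have si: "integrable lebesgue (\<lambda>s. 2 * (indicator {t..t+1} s *\<^sub>R (cmod (f s))\<^sup>2) + 2 * (indicator {t..t+1} s *\<^sub>R (cmod (g s))\<^sup>2))" for t
    using fi gi unfolding set_integrable_def by (intro Bochner_Integration.integrable_add integrable_mult_right)
  have le: "indicator {t..t+1} s *\<^sub>R (cmod (f s - g s))\<^sup>2 \<le> 2 * (indicator {t..t+1} s *\<^sub>R (cmod (f s))\<^sup>2) + 2 * (indicator {t..t+1} s *\<^sub>R (cmod (g s))\<^sup>2)" for s t :: real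
    using cmod_square_le_double[of "f s - g s" "f s"] by (simp add: indicator_def)
  have int: "set_integrable lebesgue {t..t+1} (\<lambda>s. (cmod (f s - g s))\<^sup>2)" for t
    unfolding set_integrable_def
  proof (rule Bochner_Integration.integrable_bound[OF si[of t]])
    show "(\<lambda>s. indicator {t..t+1} s *\<^sub>R (cmod (f s - g s))\<^sup>2) \<in> borel_measurable lebesgue"
      by (intro borel_measurable_scaleR borel_measurable_indicator borel_measurable_power norm_measurable m) simp
    have "norm (indicator {t..t+1} s *\<^sub>R (cmod (f s - g s))\<^sup>2) \<le> norm (2 * (indicator {t..t+1} s *\<^sub>R (cmod (f s))\<^sup>2) + 2 * (indicator {t..t+1} s *\<^sub>R (cmod (g s))\<^sup>2))" for s
      using order_trans[OF le abs_ge_self] by simp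
    then show "AE s in lebesgue. norm (indicator {t..t+1} s *\<^sub>R (cmod (f s - g s))\<^sup>2) \<le> norm (2 * (indicator {t..t+1} s *\<^sub>R (cmod (f s))\<^sup>2) + 2 * (indicator {t..t+1} s *\<^sub>R (cmod (g s))\<^sup>2))"
      by (intro always_eventually allI)
  qed
  show bound: "local_energy (\<lambda>t. f t - g t) t \<le> 2 * local_energy f t + 2 * local_energy g t" for t
  proof -
    have "local_energy (\<lambda>t. f t - g t) t \<le> (LINT s|lebesgue. 2 * (indicator {t..t+1} s *\<^sub>R (cmod (f s))\<^sup>2) + 2 * (indicator {t..t+1} s *\<^sub>R (cmod (g s))\<^sup>2))"
      unfolding local_energy_def set_lebesgue_integral_def
      by (intro integral_mono si le) (use int[of t] in \<open>simp add: set_integrable_def\<close>)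
    also have "\<dots> = 2 * local_energy f t + 2 * local_energy g t"
      unfolding local_energy_def set_lebesgue_integral_def
      by (rule trans[OF Bochner_Integration.integral_add])
         (use fi[of t] gi[of t] in \<open>simp_all only: set_integrable_def integrable_mult_right integral_mult_right_zero\<close>)
    finally show ?thesis .
  qed
  have "local_energy (\<lambda>t. f t - g t) t \<le> 2 * (amalgam_nrm f)\<^sup>2 + 2 * (amalgam_nrm g)\<^sup>2" for t
    using bound[of t] local_energy_le_amalgam(1)[OF f, of t] local_energy_le_amalgam(1)[OF g, of t] by linarith
  then show "(\<lambda>t. f t - g t) \<in> amalgam" by (intro amalgamI m int)
qed

text \<open>For the radius n + 1 the interval of averaging splits into 2 (n + 1) unit intervals,
  each of energy at most K^2. The limit over real radii exists, so it can be computed along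
  integers.\<close>

lemma AP_nrm_le_amalgam:
  assumes g: "g \<in> UAP" shows "AP_nrm g \<le> amalgam_nrm g"
proof -
  define K where "K = amalgam_nrm g"
  have K0: "K \<ge> 0" unfolding K_def by (rule local_energy_le_amalgam(2)[OF UAP_amalgam[OF g]])
  have cont: "continuous_on S (\<lambda>s. (cmod (g s))\<^sup>2)" for S by (intro continuous_intros UAP_continuous g)
  have unit: "integral {t..t+1} (\<lambda>s. (cmod (g s))\<^sup>2) \<le> K\<^sup>2" for t
    using local_energy_le_amalgam(1)[OF UAP_amalgam[OF g], of t]
    unfolding local_energy_def K_def set_lebesgue_integral_eq_integral(2)[OF absolutely_integrable_continuous_real[OF cont]] .
  have many: "integral {a..a + real m} (\<lambda>s. (cmod (g s))\<^sup>2) \<le> real m * K\<^sup>2" for a and m :: nat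
  proof (induction m)
    case (Suc m)
    have "integral {a..a + real (Suc m)} (\<lambda>s. (cmod (g s))\<^sup>2) = integral {a..a + real m} (\<lambda>s. (cmod (g s))\<^sup>2) + integral {a + real m..a + real m + 1} (\<lambda>s. (cmod (g s))\<^sup>2)"
      using Henstock_Kurzweil_Integration.integral_combine[of a "a + real m" "a + real (Suc m)" "\<lambda>s. (cmod (g s))\<^sup>2"]
      by (simp add: integrable_continuous_real cont algebra_simps)
    then show ?case using Suc unit[of "a + real m"] by (simp add: algebra_simps)
  qed simp
  have avg_le: "Re (avg (\<lambda>t. g t * cnj (g t)) (real (Suc n))) \<le> K\<^sup>2" for n
  proof -
    let ?T = "real (Suc n)"
    have c: "continuous_on S (\<lambda>t. g t * cnj (g t))" for S by (intro continuous_intros UAP_continuous g)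
    have "((\<lambda>t. complex_of_real ((cmod (g t))\<^sup>2)) has_integral of_real (integral {-?T..?T} (\<lambda>s. (cmod (g s))\<^sup>2))) {-?T..?T}"
      by (intro has_integral_of_real integrable_integral integrable_continuous_real cont)
    then have "integral {-?T..?T} (\<lambda>t. g t * cnj (g t)) = of_real (integral {-?T..?T} (\<lambda>s. (cmod (g s))\<^sup>2))"
      unfolding complex_norm_square by (rule integral_unique)
    then have "Re (avg (\<lambda>t. g t * cnj (g t)) ?T) = integral {-?T..?T} (\<lambda>s. (cmod (g s))\<^sup>2) / (2 * ?T)"
      by (subst avg_integral[OF c]) (simp_all add: Re_divide_of_real del: of_nat_Suc)
    moreover have "integral {-?T..?T} (\<lambda>s. (cmod (g s))\<^sup>2) \<le> (2 * ?T) * K\<^sup>2"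
      using many[of "-?T" "2 * Suc n"] by simp
    then have "integral {-?T..?T} (\<lambda>s. (cmod (g s))\<^sup>2) / (2 * ?T) \<le> (2 * ?T) * K\<^sup>2 / (2 * ?T)"
      by (rule divide_right_mono) simp
    ultimately show ?thesis by (simp del: of_nat_Suc)
  qed
  have "filterlim (\<lambda>n. real (Suc n)) at_top sequentially"
    by (rule filterlim_compose[OF filterlim_real_sequentially filterlim_Suc])
  from filterlim_compose[OF tendsto_mean[OF UAP_inner[OF g g]] this]
  have "(\<lambda>n. Re (avg (\<lambda>t. g t * cnj (g t)) (real (Suc n)))) \<longlonglongrightarrow> (AP_nrm g)\<^sup>2"
    unfolding AP_nrm_square[OF g] AP_inner_eq_mean by (rule tendsto_Re)
  then have "(AP_nrm g)\<^sup>2 \<le> K\<^sup>2"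
    by (rule tendsto_upperbound) (use avg_le in \<open>auto simp del: of_nat_Suc\<close>)
  then show ?thesis using K0 AP_nrm_nonneg[OF g] unfolding K_def by (simp add: power2_le_iff_abs_le)
qed

lemma AP_nrm_diff_le_amalgam:
  assumes f: "f \<in> amalgam" and u: "u \<in> UAP" and v: "v \<in> UAP"
  shows "AP_nrm (\<lambda>t. u t - v t) \<le> 2 * (amalgam_nrm (\<lambda>t. f t - u t) + amalgam_nrm (\<lambda>t. f t - v t))"
proof -
  note d = local_energy_diff(1)[OF f UAP_amalgam[OF u]] local_energy_diff(1)[OF f UAP_amalgam[OF v]]
  define x y where "x = amalgam_nrm (\<lambda>t. f t - u t)" "y = amalgam_nrm (\<lambda>t. f t - v t)"
  have xy: "x \<ge> 0" "y \<ge> 0" unfolding x_y_def by (rule local_energy_le_amalgam(2)[OF d(1)], rule local_energy_le_amalgam(2)[OF d(2)])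
  have "amalgam_nrm (\<lambda>t. (f t - v t) - (f t - u t)) \<le> 2 * (x + y)"
  proof (rule amalgam_nrm_leI)
    fix t
    have "local_energy (\<lambda>t. (f t - v t) - (f t - u t)) t \<le> 2 * y\<^sup>2 + 2 * x\<^sup>2"
      using local_energy_diff(2)[OF d(2,1), of t] local_energy_le_amalgam(1)[OF d(1), of t] local_energy_le_amalgam(1)[OF d(2), of t]
      unfolding x_y_def by linarith
    also have "\<dots> \<le> (2 * (x + y))\<^sup>2" using xy by (simp add: power2_eq_square algebra_simps)
    finally show "local_energy (\<lambda>t. (f t - v t) - (f t - u t)) t \<le> (2 * (x + y))\<^sup>2" .
  qed (use xy in simp)
  then have "amalgam_nrm (\<lambda>t. u t - v t) \<le> 2 * (x + y)" by simp
  then show ?thesis using AP_nrm_le_amalgam[OF UAP_diff[OF u v]] unfolding x_y_def by simp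
qed

lemma S2_approx_AP_Cauchy:
  assumes f: "f \<in> amalgam" and u: "\<And>n. u n \<in> AP" and lim: "(\<lambda>n. amalgam_nrm (\<lambda>t. f t - u n t)) \<longlonglongrightarrow> 0"
  shows "u \<in> AP_Cauchy"
  unfolding AP_Cauchy_def
proof (intro CollectI conjI allI impI u)
  fix e :: real assume e: "e > 0"
  obtain N where N: "\<And>n. n \<ge> N \<Longrightarrow> amalgam_nrm (\<lambda>t. f t - u n t) < e / 4"
    using order_tendstoD(2)[OF lim, of "e / 4"] e by (auto simp: eventually_sequentially)
  have U: "u n \<in> UAP" for n using u AP_subset_UAP by blast
  have "AP_nrm (\<lambda>t. u m t - u n t) < e" if "m \<ge> N" "n \<ge> N" for m n
    using AP_nrm_diff_le_amalgam[OF f U[of m] U[of n]] N[OF that(1)] N[OF that(2)] by simp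
  then show "\<exists>N. \<forall>m\<ge>N. \<forall>n\<ge>N. AP_nrm (\<lambda>t. u m t - u n t) < e" by blast
qed

text \<open>The definite description refers to all approximating sequences. Two of them are at null
  distance in \<open>AP_nrm\<close>, which \<open>amalgam_nrm\<close> dominates, so any single one
  determines the class.\<close>

lemma AP2_of_S2_class:
  assumes f: "f \<in> amalgam" and u: "\<And>n. u n \<in> AP" and lim: "(\<lambda>n. amalgam_nrm (\<lambda>t. f t - u n t)) \<longlonglongrightarrow> 0"
  shows "AP2_of_S2 f = AP_class u"
  unfolding AP2_of_S2_def
proof (rule the_equality)
  have uC: "u \<in> AP_Cauchy" by (rule S2_approx_AP_Cauchy[OF f u lim])
  show "AP_class u \<in> AP2 \<and> (\<forall>v. (\<forall>n. v n \<in> AP) \<and> (\<lambda>n. amalgam_nrm (\<lambda>t. f t - v n t)) \<longlonglongrightarrow> 0 \<longrightarrow> v \<in> AP_class u)"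
  proof (intro conjI AP_class_AP2 uC allI impI)
    fix v assume "(\<forall>n. v n \<in> AP) \<and> (\<lambda>n. amalgam_nrm (\<lambda>t. f t - v n t)) \<longlonglongrightarrow> 0"
    then have v: "\<And>n. v n \<in> AP" "(\<lambda>n. amalgam_nrm (\<lambda>t. f t - v n t)) \<longlonglongrightarrow> 0" by auto
    have U: "u n \<in> UAP" "v n \<in> UAP" for n using u v(1) AP_subset_UAP by blast+
    have "(\<lambda>n. AP_nrm (\<lambda>t. u n t - v n t)) \<longlonglongrightarrow> 0"
    proof (rule Lim_null_comparison)
      show "\<forall>\<^sub>F n in sequentially. norm (AP_nrm (\<lambda>t. u n t - v n t)) \<le> 2 * (amalgam_nrm (\<lambda>t. f t - u n t) + amalgam_nrm (\<lambda>t. f t - v n t))"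
        using AP_nrm_diff_le_amalgam[OF f U] by (auto simp: AP_nrm_nonneg UAP_diff U)
      show "(\<lambda>n. 2 * (amalgam_nrm (\<lambda>t. f t - u n t) + amalgam_nrm (\<lambda>t. f t - v n t))) \<longlonglongrightarrow> 0"
        using tendsto_mult_left[OF tendsto_add[OF lim v(2)], of 2] by simp
    qed
    then show "v \<in> AP_class u" using uC S2_approx_AP_Cauchy[OF f v] by (simp add: AP_null_rel_def)
  qed
  fix F assume "F \<in> AP2 \<and> (\<forall>v. (\<forall>n. v n \<in> AP) \<and> (\<lambda>n. amalgam_nrm (\<lambda>t. f t - v n t)) \<longlonglongrightarrow> 0 \<longrightarrow> v \<in> F)"
  then have "F \<in> AP2" "u \<in> F" using u lim by auto
  then show "F = AP_class u" using AP2_eq_class by blast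
qed

text \<open>|h| \<le> s / 2 + |h|^2 / (2 s) stands in for Cauchy-Schwarz. A strict upper bound s of
  the norm is taken because s has to be positive.\<close>

lemma nn_integral_unit_le:
  assumes h: "h \<in> amalgam" and s: "amalgam_nrm h < s"
  shows "(\<integral>\<^sup>+x. ennreal (cmod (h x)) * indicator {t..t+1} x \<partial>lebesgue) \<le> ennreal s"
proof -
  have s0: "s > 0" using local_energy_le_amalgam(2)[OF h] s by simp
  have hi: "integrable lebesgue (\<lambda>x. indicator {t..t+1} x *\<^sub>R (cmod (h x))\<^sup>2)"
    using h unfolding amalgam_def set_integrable_def by auto
  have ind: "integrable lebesgue (\<lambda>x. indicator {t..t+1} x :: real)" by (simp add: integrable_indicator_iff)
  have int: "integrable lebesgue (\<lambda>x. (s / 2) * indicator {t..t+1} x + (1 / (2 * s)) * (indicator {t..t+1} x *\<^sub>R (cmod (h x))\<^sup>2))"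
    using hi ind by (intro Bochner_Integration.integrable_add integrable_mult_right)
  have "(\<integral>\<^sup>+x. ennreal (cmod (h x)) * indicator {t..t+1} x \<partial>lebesgue)
     \<le> (\<integral>\<^sup>+x. ennreal ((s / 2) * indicator {t..t+1} x + (1 / (2 * s)) * (indicator {t..t+1} x *\<^sub>R (cmod (h x))\<^sup>2)) \<partial>lebesgue)"
  proof (intro nn_integral_mono)
    fix x
    have "0 \<le> (s - cmod (h x))\<^sup>2" by simp
    then have "cmod (h x) \<le> s / 2 + 1 / (2 * s) * (cmod (h x))\<^sup>2"
      using s0 by (simp add: field_simps power2_eq_square)
    then show "ennreal (cmod (h x)) * indicator {t..t+1} x \<le> ennreal ((s / 2) * indicator {t..t+1} x + (1 / (2 * s)) * (indicator {t..t+1} x *\<^sub>R (cmod (h x))\<^sup>2))"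
      by (auto simp: indicator_def intro!: ennreal_leI)
  qed
  also have "\<dots> = ennreal (LINT x|lebesgue. (s / 2) * indicator {t..t+1} x + (1 / (2 * s)) * (indicator {t..t+1} x *\<^sub>R (cmod (h x))\<^sup>2))"
    using s0 by (intro nn_integral_eq_integral int) simp
  also have "(LINT x|lebesgue. (s / 2) * indicator {t..t+1} x + (1 / (2 * s)) * (indicator {t..t+1} x *\<^sub>R (cmod (h x))\<^sup>2))
     = s / 2 + 1 / (2 * s) * local_energy h t"
  proof -
    have "(LINT x|lebesgue. (s / 2) * indicator {t..t+1} x + (1 / (2 * s)) * (indicator {t..t+1} x *\<^sub>R (cmod (h x))\<^sup>2))
      = (LINT x|lebesgue. (s / 2) * indicator {t..t+1} x) + (LINT x|lebesgue. (1 / (2 * s)) * (indicator {t..t+1} x *\<^sub>R (cmod (h x))\<^sup>2))"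
      using hi ind by (intro Bochner_Integration.integral_add integrable_mult_right)
    also have "(LINT x|lebesgue. (s / 2) * indicator {t..t+1} x) = s / 2" by simp
    also have "(LINT x|lebesgue. (1 / (2 * s)) * (indicator {t..t+1} x *\<^sub>R (cmod (h x))\<^sup>2)) = 1 / (2 * s) * local_energy h t"
      unfolding local_energy_def set_lebesgue_integral_def by (rule integral_mult_right_zero)
    finally show ?thesis .
  qed
  also have "s / 2 + 1 / (2 * s) * local_energy h t \<le> s"
  proof -
    have "local_energy h t \<le> s\<^sup>2"
      using local_energy_le_amalgam(1)[OF h, of t] power_mono[OF less_imp_le[OF s] local_energy_le_amalgam(2)[OF h], of 2] by linarith
    then have "1 / (2 * s) * local_energy h t \<le> 1 / (2 * s) * s\<^sup>2" using s0 by (intro mult_left_mono) auto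
    also have "\<dots> = s / 2" using s0 by (simp add: power2_eq_square)
    finally show ?thesis by simp
  qed
  finally show ?thesis by (simp add: ennreal_leI)
qed

text \<open>Moving the atom back to the origin translates h by \<alpha> k, and integrals over unit
  cells obey the same bound for every translate of h; modulation leaves moduli unchanged. Hence the
  bound is uniform in k and l.\<close>

lemma pairing_gabor_bound:
  fixes \<alpha> \<beta> :: real and k l :: int
  assumes \<psi>: "\<psi> \<in> wiener_space" and h: "h \<in> amalgam" and s: "amalgam_nrm h < s"
  shows "integrable lebesgue (\<lambda>t. h t * cnj (gabor \<psi> \<alpha> \<beta> (k, l) t))"
    and "cmod (pairing h (gabor \<psi> \<alpha> \<beta> (k, l))) \<le> enn2real (wiener_nrm \<psi>) * s"
proof -
  define y where "y = \<alpha> * of_int k"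
  have s0: "s > 0" using local_energy_le_amalgam(2)[OF h] s by simp
  have hm: "h \<in> borel_measurable lebesgue" using h unfolding amalgam_def by simp
  have \<psi>m: "\<psi> \<in> borel_measurable lebesgue" using \<psi> unfolding wiener_space_def by simp
  have aff: "(\<lambda>x. a + 1 * x) \<in> lebesgue \<rightarrow>\<^sub>M (lebesgue :: real measure)" for a
    using lebesgue_affine_measurable[of "\<lambda>_. 1" a] by simp
  have \<psi>y: "(\<lambda>t. \<psi> (- y + 1 * t)) \<in> borel_measurable lebesgue" by (rule measurable_compose[OF aff \<psi>m])
  have hy: "(\<lambda>t. h (y + 1 * t)) \<in> borel_measurable lebesgue" by (rule measurable_compose[OF aff hm])
  have g: "gabor \<psi> \<alpha> \<beta> (k, l) t = cis (\<beta> * of_int l * (- y + 1 * t)) * \<psi> (- y + 1 * t)" for t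
    by (simp add: gabor_def translate_def modulate_def y_def)
  have em: "(\<lambda>t. ennreal (cmod (u t))) \<in> borel_measurable lebesgue" if "u \<in> borel_measurable lebesgue" for u :: "real \<Rightarrow> complex"
    using that by (intro measurable_compose[OF _ measurable_ennreal] norm_measurable)
  have m: "(\<lambda>t. h t * cnj (gabor \<psi> \<alpha> \<beta> (k, l) t)) \<in> borel_measurable lebesgue"
  proof -
    have "(\<lambda>t. cis (\<beta> * of_int l * (- y + 1 * t)) * \<psi> (- y + 1 * t)) \<in> borel_measurable lebesgue"
      by (intro borel_measurable_times \<psi>y borel_measurable_lebesgue_continuous) (auto simp: cis_conv_exp intro!: continuous_intros)
    from measurable_compose[OF this borel_measurable_continuous_onI[of cnj]]
    show ?thesis unfolding g by (intro borel_measurable_times hm) (auto intro!: continuous_intros)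
  qed
  have cell: "(\<integral>\<^sup>+x. ennreal (cmod (h (y + 1 * x))) * indicator {of_int j..of_int j + 1} x \<partial>lebesgue) \<le> ennreal s" for j :: int
  proof -
    define H where "H = (\<lambda>x. ennreal (cmod (h x)) * indicator {y + of_int j..(y + of_int j) + 1} x)"
    have Hm: "H \<in> borel_measurable lebesgue"
      unfolding H_def by (intro borel_measurable_times_ennreal em hm borel_measurable_indicator) simp
    have "(\<integral>\<^sup>+x. ennreal (cmod (h (y + 1 * x))) * indicator {of_int j..of_int j + 1} x \<partial>lebesgue) = (\<integral>\<^sup>+x. H (y + 1 * x) \<partial>lebesgue)"
      by (intro nn_integral_cong) (auto simp: H_def indicator_def)
    also have "\<dots> = (\<integral>\<^sup>+x. H x \<partial>lebesgue)"
      using nn_integral_real_affine_lebesgue[OF Hm, of 1 y] by simp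
    also have "\<dots> \<le> ennreal s" unfolding H_def by (rule nn_integral_unit_le[OF h s])
    finally show ?thesis .
  qed
  have "(\<integral>\<^sup>+t. ennreal (cmod (h t * cnj (gabor \<psi> \<alpha> \<beta> (k, l) t))) \<partial>lebesgue)
      = (\<integral>\<^sup>+t. ennreal (cmod (\<psi> t)) * ennreal (cmod (h (y + 1 * t))) \<partial>lebesgue)"
    by (subst nn_integral_real_affine_lebesgue[OF em[OF m], of 1 y])
       (simp_all add: g norm_mult ennreal_mult[symmetric] mult.commute)
  also have "\<dots> \<le> wiener_nrm \<psi> * ennreal s"
    by (rule wiener_integral_bound[OF \<psi> em[OF hy] cell])
  also have "\<dots> = ennreal (enn2real (wiener_nrm \<psi>) * s)"
    using \<psi> s0 unfolding wiener_space_def by (simp add: ennreal_mult)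
  finally have le: "(\<integral>\<^sup>+t. ennreal (cmod (h t * cnj (gabor \<psi> \<alpha> \<beta> (k, l) t))) \<partial>lebesgue) \<le> ennreal (enn2real (wiener_nrm \<psi>) * s)" .
  show int: "integrable lebesgue (\<lambda>t. h t * cnj (gabor \<psi> \<alpha> \<beta> (k, l) t))"
    using m le_less_trans[OF le ennreal_less_top] by (simp add: integrable_iff_bounded)
  have "ennreal (cmod (pairing h (gabor \<psi> \<alpha> \<beta> (k, l)))) \<le> ennreal (enn2real (wiener_nrm \<psi>) * s)"
    unfolding pairing_def by (rule order_trans[OF integral_norm_bound_ennreal[OF int] le])
  then show "cmod (pairing h (gabor \<psi> \<alpha> \<beta> (k, l))) \<le> enn2real (wiener_nrm \<psi>) * s"
    using s0 by (subst (asm) ennreal_le_iff) auto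
qed

text \<open>Uniformity in k makes the Gabor coefficient sequence of f a uniform limit of the
  sequences of polynomials.\<close>

lemma pairing_gabor_diff_le:
  fixes \<alpha> \<beta> :: real and k l :: int
  assumes \<psi>: "\<psi> \<in> wiener_space" and f: "f \<in> amalgam" and p: "p \<in> amalgam" and s: "amalgam_nrm (\<lambda>t. f t - p t) < s"
  shows "cmod (pairing f (gabor \<psi> \<alpha> \<beta> (k, l)) - pairing p (gabor \<psi> \<alpha> \<beta> (k, l))) \<le> enn2real (wiener_nrm \<psi>) * s"
proof -
  have i: "integrable lebesgue (\<lambda>t. h t * cnj (gabor \<psi> \<alpha> \<beta> (k, l) t))" if "h \<in> amalgam" for h
    using pairing_gabor_bound(1)[OF \<psi> that, of "amalgam_nrm h + 1"] by simp
  have "pairing f (gabor \<psi> \<alpha> \<beta> (k, l)) - pairing p (gabor \<psi> \<alpha> \<beta> (k, l)) = pairing (\<lambda>t. f t - p t) (gabor \<psi> \<alpha> \<beta> (k, l))"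
    unfolding pairing_def left_diff_distrib by (rule Bochner_Integration.integral_diff[OF i[OF f] i[OF p], symmetric])
  then show ?thesis using pairing_gabor_bound(2)[OF \<psi> local_energy_diff(1)[OF f p] s] by simp
qed

text \<open>At \<open>\<epsilon> = 0\<close> the window is the constant \<open>window 0 = 1 / 6\<close>, which cancels.\<close>

lemma pairing_tp_gabor:
  fixes \<alpha> \<beta> :: real
  assumes \<psi>: "\<psi> \<in> L1_fun" and c: "finsupp c" and \<alpha>: "\<alpha> > 0"
  defines "T \<equiv> 2 * pi / \<alpha>"
  shows "pairing (tp c) (gabor \<psi> \<alpha> \<beta> (k, l)) =
    (\<Sum>r\<in>residue_mod T ` {\<mu>. c \<mu> \<noteq> 0}. fiber \<psi> \<beta> T c l r 0 * cis (r * \<alpha> * of_int k))"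
proof -
  let ?M = "{\<mu>. c \<mu> \<noteq> 0}"
  let ?K = "\<lambda>\<mu>. cis (\<mu> * (\<alpha> * of_int k)) * cnj (fourier \<psi> (\<mu> - \<beta> * of_int l))"
  have "pairing (windowed c 0) (gabor \<psi> \<alpha> \<beta> (k, l)) = window 0 * pairing (tp c) (gabor \<psi> \<alpha> \<beta> (k, l))"
    unfolding pairing_def windowed_def
    by (subst integral_mult_right_zero[symmetric]) (simp add: mult_ac)
  moreover have "pairing (windowed c 0) (gabor \<psi> \<alpha> \<beta> (k, l)) = window 0 * (\<Sum>\<mu>\<in>?M. c \<mu> * ?K \<mu>)"
  proof -
    have "integral {0..1} (\<lambda>s. of_real (bump s) * (cis ((\<mu> + 0 * s) * (\<alpha> * of_int k)) * cnj (fourier \<psi> (\<mu> - \<beta> * of_int l + 0 * s)))) = window 0 * ?K \<mu>" for \<mu>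
      unfolding window_def by (simp add: cis_zero del: integral_complex_of_real)
    then show ?thesis unfolding pairing_windowed_gabor[OF \<psi> c] by (simp only: sum_distrib_left mult_ac)
  qed
  ultimately have "pairing (tp c) (gabor \<psi> \<alpha> \<beta> (k, l)) = (\<Sum>\<mu>\<in>?M. c \<mu> * ?K \<mu>)" by (simp add: window_0)
  also have "\<dots> = (\<Sum>r\<in>residue_mod T ` ?M. \<Sum>\<mu> | \<mu> \<in> ?M \<and> residue_mod T \<mu> = r. c \<mu> * ?K \<mu>)"
    by (rule sum.image_gen[OF c])
  also have "\<dots> = (\<Sum>r\<in>residue_mod T ` ?M. fiber \<psi> \<beta> T c l r 0 * cis (r * \<alpha> * of_int k))"
    unfolding fiber_def sum_distrib_right
  proof (intro sum.cong refl)
    fix r \<mu> assume "\<mu> \<in> {\<mu>. c \<mu> \<noteq> 0 \<and> residue_mod T \<mu> = r}"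
    then have "r = \<mu> - T * of_int \<lfloor>\<mu> / T\<rfloor>" by (simp add: residue_mod_def)
    then have "\<mu> * (\<alpha> * of_int k) = r * \<alpha> * of_int k + 2 * pi * of_int (\<lfloor>\<mu> / T\<rfloor> * k)"
    proof -
      have "T * \<alpha> = 2 * pi" using \<alpha> by (simp add: T_def)
      moreover have "\<mu> * (\<alpha> * of_int k) = r * \<alpha> * of_int k + T * \<alpha> * of_int (\<lfloor>\<mu> / T\<rfloor> * k)"
        unfolding \<open>r = _\<close> of_int_mult by (simp only: algebra_simps)
      ultimately show ?thesis by (simp only:)
    qed
    then have "cis (\<mu> * (\<alpha> * of_int k)) = cis (r * \<alpha> * of_int k)"
      by (simp add: cis_multiple_2pi flip: cis_mult del: of_int_mult)
    then show "c \<mu> * ?K \<mu> = c \<mu> * cnj (fourier \<psi> (\<mu> - \<beta> * of_int l + 0)) * cis (r * \<alpha> * of_int k)" by simp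
  qed auto
  finally show ?thesis .
qed

section \<open>Means of sequences\<close>

text \<open>The quotient of 2 p + 1 terms by 2 p matches \<open>AP_seq_inner\<close>; the limit is
  the usual mean, and at p = 0 the value is 0.\<close>

definition seq_avg :: "(int \<Rightarrow> complex) \<Rightarrow> nat \<Rightarrow> complex" where
  "seq_avg a p = (\<Sum>n=-int p..int p. a n) / of_nat (2 * p)"

lemma sum_symmetric_Suc:
  fixes a :: "int \<Rightarrow> complex"
  shows "(\<Sum>n=-int (Suc p)..int (Suc p). a n) = a (- int (Suc p)) + (\<Sum>n=-int p..int p. a n) + a (int (Suc p))"
proof -
  have "{-int (Suc p)..int (Suc p)} = insert (- int (Suc p)) (insert (int (Suc p)) {-int p..int p})" by auto
  then show ?thesis by simp
qed

lemma seq_avg_cis: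
  "seq_avg (\<lambda>n. cis (\<theta> * of_int n)) \<longlonglongrightarrow> (if cis \<theta> = 1 then 1 else 0)"
proof (cases "cis \<theta> = 1")
  case True
  have one: "cis (\<theta> * of_int n) = 1" for n :: int
  proof -
    have "cis (\<theta> * of_int n) = cis \<theta> powi n" by (simp add: cis_power_int mult.commute)
    then show ?thesis by (simp add: True)
  qed
  have "seq_avg (\<lambda>n. cis (\<theta> * of_int n)) = (\<lambda>p. of_real (real (2 * p + 1) / real (2 * p)))"
    unfolding seq_avg_def one by (simp add: fun_eq_iff nat_add_distrib)
  moreover have "(\<lambda>p. real (2 * p + 1) / real (2 * p)) \<longlonglongrightarrow> 1" by real_asymp
  from tendsto_of_real[OF this, where 'a = complex] have "(\<lambda>p. complex_of_real (real (2 * p + 1) / real (2 * p))) \<longlonglongrightarrow> 1"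
    by (simp only: of_real_1)
  ultimately show ?thesis using True by (simp only: if_True simp_thms)
next
  case False
  \<comment> \<open>The geometric sum telescopes. As cis \<theta> is not 1, the sums stay bounded by
    2 / C while the divisor grows.\<close>
  have tele: "(1 - cis \<theta>) * (\<Sum>n=-int p..int p. cis (\<theta> * of_int n)) = cis (- (\<theta> * real p)) - cis (\<theta> * (real p + 1))" for p
  proof (induction p)
    case 0
    show ?case by simp
  next
    case (Suc p)
    have "(1 - cis \<theta>) * (\<Sum>n=-int (Suc p)..int (Suc p). cis (\<theta> * of_int n))
      = (1 - cis \<theta>) * cis (\<theta> * of_int (- int (Suc p))) + (cis (- (\<theta> * real p)) - cis (\<theta> * (real p + 1))) + (1 - cis \<theta>) * cis (\<theta> * of_int (int (Suc p)))"
      unfolding sum_symmetric_Suc distrib_left Suc.IH ..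
    also have "\<dots> = cis (- (\<theta> * real (Suc p))) - cis (\<theta> * (real (Suc p) + 1))"
      by (simp add: left_diff_distrib cis_mult algebra_simps)
    finally show ?case .
  qed
  define C where "C = cmod (1 - cis \<theta>)"
  have C: "C > 0" using False by (simp add: C_def)
  have "norm (seq_avg (\<lambda>n. cis (\<theta> * of_int n)) p) \<le> (2 / C) * inverse (real (2 * p))" for p
  proof -
    have "C * cmod (\<Sum>n=-int p..int p. cis (\<theta> * of_int n)) \<le> 2"
      unfolding C_def norm_mult[symmetric] tele
      using norm_triangle_ineq4[of "cis (- (\<theta> * real p))" "cis (\<theta> * (real p + 1))"] by simp
    then have "cmod (\<Sum>n=-int p..int p. cis (\<theta> * of_int n)) \<le> 2 / C" using C by (simp add: field_simps)
    then have "cmod (\<Sum>n=-int p..int p. cis (\<theta> * of_int n)) * inverse (real (2 * p)) \<le> (2 / C) * inverse (real (2 * p))"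
      by (intro mult_right_mono) auto
    then show ?thesis unfolding seq_avg_def norm_divide norm_of_nat by (simp only: divide_inverse)
  qed
  then have "seq_avg (\<lambda>n. cis (\<theta> * of_int n)) \<longlonglongrightarrow> 0"
    by (rule Lim_null_comparison[OF always_eventually[OF allI]]) real_asymp
  then show ?thesis using False by (simp only: if_False)
qed

lemma seq_avg_sum: "seq_avg (\<lambda>n. \<Sum>i\<in>I. c i * a i n) p = (\<Sum>i\<in>I. c i * seq_avg (a i) p)"
  unfolding seq_avg_def by (subst sum.swap) (simp add: sum_distrib_left sum_divide_distrib)

text \<open>By \<open>sep\<close> the off-diagonal products are nontrivial characters of the
  integers, whose means vanish.\<close>

lemma seq_avg_exponential_sum:
  fixes D :: "real \<Rightarrow> complex"
  assumes R: "finite R" and sep: "\<And>r r'. r \<in> R \<Longrightarrow> r' \<in> R \<Longrightarrow> cis ((r - r') * \<alpha>) = 1 \<Longrightarrow> r = r'"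
  defines "a \<equiv> \<lambda>k::int. \<Sum>r\<in>R. D r * cis (r * \<alpha> * of_int k)"
  shows "seq_avg (\<lambda>k. a k * cnj (a k)) \<longlonglongrightarrow> of_real (\<Sum>r\<in>R. (cmod (D r))\<^sup>2)"
proof -
  have eq: "(\<lambda>k. a k * cnj (a k)) = (\<lambda>k. \<Sum>(r, r')\<in>R \<times> R. (D r * cnj (D r')) * cis ((r - r') * \<alpha> * of_int k))"
  proof
    fix k
    have e: "cis (r * \<alpha> * of_int k) * cnj (cis (r' * \<alpha> * of_int k)) = cis ((r - r') * \<alpha> * of_int k)" for r r'
      by (simp add: cis_cnj cis_mult left_diff_distrib)
    have "(D r * cis (r * \<alpha> * of_int k)) * cnj (D r' * cis (r' * \<alpha> * of_int k)) = (D r * cnj (D r')) * cis ((r - r') * \<alpha> * of_int k)" for r r'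
      unfolding e[symmetric] by (simp only: complex_cnj_mult mult_ac)
    then show "a k * cnj (a k) = (\<Sum>(r, r')\<in>R \<times> R. (D r * cnj (D r')) * cis ((r - r') * \<alpha> * of_int k))"
      by (simp only: a_def cnj_sum sum_product sum.cartesian_product)
  qed
  have "seq_avg (\<lambda>k. a k * cnj (a k)) = (\<lambda>p. \<Sum>i\<in>R \<times> R. (D (fst i) * cnj (D (snd i))) * seq_avg (\<lambda>k. cis ((fst i - snd i) * \<alpha> * of_int k)) p)"
    unfolding eq split_def by (rule ext) (rule seq_avg_sum)
  moreover have "(\<lambda>p. \<Sum>i\<in>R \<times> R. (D (fst i) * cnj (D (snd i))) * seq_avg (\<lambda>k. cis ((fst i - snd i) * \<alpha> * of_int k)) p)
     \<longlonglongrightarrow> (\<Sum>i\<in>R \<times> R. (D (fst i) * cnj (D (snd i))) * (if cis ((fst i - snd i) * \<alpha>) = 1 then 1 else 0))"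
    by (intro tendsto_sum tendsto_mult_left seq_avg_cis)
  moreover have "(\<Sum>i\<in>R \<times> R. (D (fst i) * cnj (D (snd i))) * (if cis ((fst i - snd i) * \<alpha>) = 1 then 1 else 0)) = of_real (\<Sum>r\<in>R. (cmod (D r))\<^sup>2)"
  proof -
    have "(\<Sum>i\<in>R \<times> R. (D (fst i) * cnj (D (snd i))) * (if cis ((fst i - snd i) * \<alpha>) = 1 then 1 else 0))
       = (\<Sum>r\<in>R. \<Sum>r'\<in>R. (D r * cnj (D r')) * (if cis ((r - r') * \<alpha>) = 1 then 1 else 0))"
      by (simp add: sum.cartesian_product split_def)
    also have "\<dots> = (\<Sum>r\<in>R. \<Sum>r'\<in>R. if r = r' then D r * cnj (D r') else 0)"
      using sep by (intro sum.cong refl) auto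
    also have "\<dots> = of_real (\<Sum>r\<in>R. (cmod (D r))\<^sup>2)"
      using R by (simp add: complex_norm_square del: of_real_power)
    finally show ?thesis .
  qed
  ultimately show ?thesis by simp
qed

text \<open>For a uniform limit of the sequences b n the mean of |a|^2 exists by the Cauchy
  criterion and is the limit of the means q n. Its existence has to be shown because
  \<open>AP_seq_inner\<close> is defined by \<open>lim\<close>.\<close>

lemma AP_seq_nrm_limit:
  fixes a :: "int \<Rightarrow> complex" and b :: "nat \<Rightarrow> int \<Rightarrow> complex"
  assumes K: "\<And>k. cmod (a k) \<le> K" and near: "\<And>n k. cmod (a k - b n k) \<le> \<delta> n" and \<delta>: "\<delta> \<longlonglongrightarrow> 0"
    and b: "\<And>n. seq_avg (\<lambda>k. b n k * cnj (b n k)) \<longlonglongrightarrow> of_real (q n)" and q: "\<And>n. q n \<ge> 0"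
  shows "q \<longlonglongrightarrow> (AP_seq_nrm a)\<^sup>2"
proof -
  have K0: "K \<ge> 0" using K[of 0] norm_ge_zero order_trans by blast
  have \<delta>0: "\<delta> n \<ge> 0" for n using near[of 0 n] norm_ge_zero order_trans by blast
  define e where "e = (\<lambda>n. 2 * (\<delta> n * (2 * K + \<delta> n)))"
  have e: "e \<longlonglongrightarrow> 0"
    unfolding e_def using tendsto_mult_left[OF tendsto_mult[OF \<delta> tendsto_add[OF tendsto_const[of "2 * K"] \<delta>]], of 2] by simp
  have avg_near: "cmod (seq_avg (\<lambda>k. a k * cnj (a k)) p - seq_avg (\<lambda>k. b n k * cnj (b n k)) p) \<le> e n" if p: "p \<ge> 1" for n p
  proof -
    have pt: "cmod (a k * cnj (a k) - b n k * cnj (b n k)) \<le> \<delta> n * (2 * K + \<delta> n)" for k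
    proof -
      have bk: "cmod (b n k) \<le> K + \<delta> n"
        using norm_triangle_ineq4[of "a k" "a k - b n k"] K[of k] near[of k n] by simp
      have "a k * cnj (a k) - b n k * cnj (b n k) = (a k - b n k) * cnj (a k) + b n k * cnj (a k - b n k)" by (simp add: algebra_simps)
      also have "cmod \<dots> \<le> cmod (a k - b n k) * cmod (a k) + cmod (b n k) * cmod (a k - b n k)"
        by (rule order_trans[OF norm_triangle_ineq]) (simp only: norm_mult complex_mod_cnj order_refl)
      also have "\<dots> \<le> \<delta> n * K + (K + \<delta> n) * \<delta> n"
        by (intro add_mono mult_mono near K bk \<delta>0 K0 norm_ge_zero add_nonneg_nonneg)
      finally show ?thesis by (simp add: algebra_simps)
    qed
    have "cmod ((\<Sum>k=-int p..int p. a k * cnj (a k)) - (\<Sum>k=-int p..int p. b n k * cnj (b n k))) \<le> (\<Sum>k=-int p..int p. \<delta> n * (2 * K + \<delta> n))"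
      unfolding sum_subtractf[symmetric] by (intro sum_norm_le pt)
    also have "\<dots> = real (2 * p + 1) * (\<delta> n * (2 * K + \<delta> n))" by (simp add: nat_add_distrib)
    \<comment> \<open>2 p + 1 \<le> 4 p for p \<ge> 1, whence the factor 2 in
      \<open>e\<close>.\<close>
    also have "\<dots> \<le> real (4 * p) * (\<delta> n * (2 * K + \<delta> n))"
      using p K0 \<delta>0[of n] by (intro mult_right_mono) auto
    finally have "cmod ((\<Sum>k=-int p..int p. a k * cnj (a k)) - (\<Sum>k=-int p..int p. b n k * cnj (b n k))) / real (2 * p) \<le> real (4 * p) * (\<delta> n * (2 * K + \<delta> n)) / real (2 * p)"
      by (intro divide_right_mono) auto
    also have "\<dots> = e n" using p by (simp add: e_def)
    finally show ?thesis
      unfolding seq_avg_def diff_divide_distrib[symmetric] norm_divide by (simp add: norm_mult)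
  qed
  have "\<exists>L. (seq_avg (\<lambda>k. a k * cnj (a k)) \<longlongrightarrow> L) sequentially"
  proof (rule convergent_of_approximations)
    fix \<epsilon> :: real assume \<epsilon>: "\<epsilon> > 0"
    obtain n where n: "e n < \<epsilon> / 2"
      using order_tendstoD(2)[OF e, of "\<epsilon> / 2"] \<epsilon> by (auto simp: eventually_sequentially)
    have "\<forall>\<^sub>F p in sequentially. dist (seq_avg (\<lambda>k. b n k * cnj (b n k)) p) (of_real (q n)) < \<epsilon> / 2"
      using tendstoD[OF b[of n], of "\<epsilon> / 2"] \<epsilon> by simp
    then have "\<forall>\<^sub>F p in sequentially. cmod (seq_avg (\<lambda>k. a k * cnj (a k)) p - of_real (q n)) \<le> \<epsilon>"
      using eventually_ge_at_top[of 1]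
    proof eventually_elim
      case (elim p)
      then show ?case
        using avg_near[OF elim(2), of n] n
          norm_triangle_ineq[of "seq_avg (\<lambda>k. a k * cnj (a k)) p - seq_avg (\<lambda>k. b n k * cnj (b n k)) p" "seq_avg (\<lambda>k. b n k * cnj (b n k)) p - of_real (q n)"]
        by (simp add: dist_norm)
    qed
    then show "\<exists>z. \<forall>\<^sub>F p in sequentially. cmod (seq_avg (\<lambda>k. a k * cnj (a k)) p - z) \<le> \<epsilon>" by blast
  qed simp
  then obtain L where L: "seq_avg (\<lambda>k. a k * cnj (a k)) \<longlonglongrightarrow> L" by blast
  have Lq: "cmod (L - of_real (q n)) \<le> e n" for n
    by (rule tendsto_upperbound[OF tendsto_norm[OF tendsto_diff[OF L b]]])
       (auto intro!: eventually_sequentiallyI[of 1] avg_near)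
  have "q \<longlonglongrightarrow> Re L"
  proof (rule LIM_zero_cancel, rule Lim_null_comparison[OF _ e])
    have "norm (q n - Re L) \<le> e n" for n
      using abs_Re_le_cmod[of "L - of_real (q n)"] Lq[of n] by (simp add: abs_minus_commute)
    then show "\<forall>\<^sub>F n in sequentially. norm (q n - Re L) \<le> e n" by simp
  qed
  moreover from this have "Re L \<ge> 0" using q by (intro LIMSEQ_le_const[of q]) auto
  moreover have "AP_seq_inner a a = L"
    unfolding AP_seq_inner_def using L by (intro limI) (simp add: seq_avg_def[abs_def])
  ultimately show ?thesis by (simp add: AP_seq_nrm_def)
qed

text \<open>For polynomials approximating f the two quantities are the same number q n: the sum over
  residues of the squared fibres, and the mean square of the coefficient sequence. The first
  description passes to the limit by the l2 lemmas with factors 2, the second by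
  \<open>AP_seq_nrm_limit\<close>.\<close>

lemma S2_sequence_norm:
  fixes \<alpha> \<beta> :: real and l :: int
  assumes \<alpha>: "\<alpha> > 0"
  defines "T \<equiv> 2 * pi / \<alpha>"
  assumes B: "B > 0" and upper: "\<And>c (L::int set). finsupp c \<Longrightarrow> finite L \<Longrightarrow>
        (\<Sum>l\<in>L. \<Sum>r\<in>residue_mod T ` {\<mu>. c \<mu> \<noteq> 0}. (cmod (fiber \<psi> \<beta> T c l r 0))\<^sup>2) \<le> B * (\<Sum>\<mu> | c \<mu> \<noteq> 0. (cmod (c \<mu>))\<^sup>2)"
    and \<psi>: "\<psi> \<in> wiener_space" and f: "f \<in> S2"
  defines "\<Theta> \<equiv> (\<Sum>\<^sub>\<infinity>\<xi>\<in>{0..<T}. ennreal ((cmod (AP2_inner (AP2_of_S2 f) (gabor_AP \<psi> \<alpha> \<beta> \<xi> l)))\<^sup>2))"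
  defines "s \<equiv> (AP_seq_nrm (\<lambda>k. pairing f (gabor \<psi> \<alpha> \<beta> (k, l))))\<^sup>2"
  shows "AP2_of_S2 f \<in> AP2" "\<Theta> \<le> 2 * ennreal s" "ennreal s \<le> 2 * \<Theta>"
proof -
  have T: "T > 0" using \<alpha> by (simp add: T_def)
  have \<psi>1: "\<psi> \<in> L1_fun" using \<psi> wiener_space_subset_L1 by blast
  have fA: "f \<in> amalgam" using f unfolding S2_def by simp
  have "\<exists>c. finsupp c \<and> amalgam_nrm (\<lambda>t. f t - tp c t) < inverse (real (Suc n))" for n
  proof -
    have "inverse (real (Suc n)) > 0" by simp
    then obtain p where "p \<in> trig_poly" "amalgam_nrm (\<lambda>t. f t - p t) < inverse (real (Suc n))"
      using f unfolding S2_def by blast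
    then show ?thesis by (auto simp: trig_poly_iff_tp)
  qed
  then have "\<exists>c. \<forall>n. finsupp (c n) \<and> amalgam_nrm (\<lambda>t. f t - tp (c n) t) < inverse (real (Suc n))"
    by (intro choice allI)
  then obtain c where c: "\<And>n. finsupp (c n)" "\<And>n. amalgam_nrm (\<lambda>t. f t - tp (c n) t) < inverse (real (Suc n))" by blast
  have pA: "tp (c n) \<in> amalgam" for n by (intro UAP_amalgam tp_UAP c)
  have pAP: "tp (c n) \<in> AP" for n by (intro trig_poly_AP tp_trig_poly c)
  have lim0: "(\<lambda>n. amalgam_nrm (\<lambda>t. f t - tp (c n) t)) \<longlonglongrightarrow> 0"
  proof (rule Lim_null_comparison[OF _ LIMSEQ_inverse_real_of_nat])
    show "\<forall>\<^sub>F n in sequentially. norm (amalgam_nrm (\<lambda>t. f t - tp (c n) t)) \<le> inverse (real (Suc n))"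
      using c(2) local_energy_le_amalgam(2)[OF local_energy_diff(1)[OF fA pA]]
      by (intro always_eventually allI) (simp add: less_imp_le del: of_nat_Suc)
  qed
  have cC: "(\<lambda>n. tp (c n)) \<in> AP_Cauchy" by (rule S2_approx_AP_Cauchy[OF fA pAP lim0])
  have F: "AP2_of_S2 f = AP_class (\<lambda>n. tp (c n))" by (rule AP2_of_S2_class[OF fA pAP lim0])
  show "AP2_of_S2 f \<in> AP2" unfolding F by (rule AP_class_AP2[OF cC])
  define \<theta> where "\<theta> = (\<lambda>n \<xi>. fiber \<psi> \<beta> T (c n) l \<xi> 0)"
  define q where "q = (\<lambda>n. \<Sum>r\<in>residue_mod T ` {\<mu>. c n \<mu> \<noteq> 0}. (cmod (fiber \<psi> \<beta> T (c n) l r 0))\<^sup>2)"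
  have q0: "q n \<ge> 0" for n unfolding q_def by (rule sum_nonneg) simp
  have \<theta>q: "(\<Sum>\<^sub>\<infinity>\<xi>\<in>{0..<T}. ennreal ((cmod (\<theta> n \<xi>))\<^sup>2)) = ennreal (q n)" for n
    unfolding \<theta>_def q_def by (rule infsum_fiber[OF c(1) T])
  have lim: "(\<lambda>n. \<theta> n \<xi>) \<longlonglongrightarrow> AP2_inner (AP2_of_S2 f) (gabor_AP \<psi> \<alpha> \<beta> \<xi> l)" if "\<xi> \<in> {0..<T}" for \<xi>
    unfolding \<theta>_def F T_def
    by (rule fiber_tendsto_AP2_inner[OF \<alpha> that[unfolded T_def] B upper[unfolded T_def] c(1) cC])
  have Cauchy: "\<exists>N. \<forall>m\<ge>N. \<forall>n\<ge>N. \<forall>F. finite F \<longrightarrow> F \<subseteq> {0..<T} \<longrightarrow> (\<Sum>\<xi>\<in>F. (cmod (\<theta> n \<xi> - \<theta> m \<xi>))\<^sup>2) \<le> \<eta>" if \<eta>: "\<eta> > 0" for \<eta>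
  proof -
    from fiber_Cauchy[OF T B upper c(1) cC \<eta>] obtain N where N: "\<forall>m\<ge>N. \<forall>n\<ge>N. \<forall>F. finite F \<longrightarrow> F \<subseteq> UNIV \<times> {0..<T} \<longrightarrow>
       (\<Sum>(l, \<xi>)\<in>F. (cmod (fiber \<psi> \<beta> T (c n) l \<xi> 0 - fiber \<psi> \<beta> T (c m) l \<xi> 0))\<^sup>2) \<le> \<eta>"
      by (rule exE)
    show ?thesis
    proof (intro exI allI impI)
      fix m n F assume mn: "m \<ge> N" "n \<ge> N" and F: "finite F" "F \<subseteq> {0..<T}"
      have "finite (Pair l ` F)" "Pair l ` F \<subseteq> UNIV \<times> {0..<T}" using F by auto
      from N[rule_format, OF mn this] show "(\<Sum>\<xi>\<in>F. (cmod (\<theta> n \<xi> - \<theta> m \<xi>))\<^sup>2) \<le> \<eta>"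
        by (subst (asm) sum.reindex) (auto simp: inj_on_def \<theta>_def)
    qed
  qed
  define W where "W = enn2real (wiener_nrm \<psi>)"
  have "q \<longlonglongrightarrow> s"
    unfolding s_def
  proof (rule AP_seq_nrm_limit)
    show "cmod (pairing f (gabor \<psi> \<alpha> \<beta> (k, l))) \<le> W * (amalgam_nrm f + 1)" for k
      unfolding W_def by (rule pairing_gabor_bound(2)[OF \<psi> fA]) simp
    show "cmod (pairing f (gabor \<psi> \<alpha> \<beta> (k, l)) - pairing (tp (c n)) (gabor \<psi> \<alpha> \<beta> (k, l))) \<le> W * inverse (real (Suc n))" for k n
      unfolding W_def by (rule pairing_gabor_diff_le[OF \<psi> fA pA c(2)])
    show "(\<lambda>n. W * inverse (real (Suc n))) \<longlonglongrightarrow> 0"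
      using tendsto_mult_left[OF LIMSEQ_inverse_real_of_nat, of W] by simp
    show "seq_avg (\<lambda>k. pairing (tp (c n)) (gabor \<psi> \<alpha> \<beta> (k, l)) * cnj (pairing (tp (c n)) (gabor \<psi> \<alpha> \<beta> (k, l)))) \<longlonglongrightarrow> of_real (q n)" for n
      unfolding pairing_tp_gabor[OF \<psi>1 c(1) \<alpha>] q_def T_def[symmetric]
    proof (rule seq_avg_exponential_sum)
      show "finite (residue_mod T ` {\<mu>. c n \<mu> \<noteq> 0})" using c(1) by simp
      \<comment> \<open>Two residues in [0, T) differ by less than T, and \<alpha> T = 2 \<pi>; they
        induce the same character only if they are equal.\<close>
      fix r r' assume r: "r \<in> residue_mod T ` {\<mu>. c n \<mu> \<noteq> 0}" "r' \<in> residue_mod T ` {\<mu>. c n \<mu> \<noteq> 0}" and "cis ((r - r') * \<alpha>) = 1"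
      then obtain m :: int where m: "(r - r') * \<alpha> = of_int m * 2 * pi"
        by (auto simp: complex_eq_iff cos_one_2pi_int)
      have rr: "r \<in> {0..<T}" "r' \<in> {0..<T}" using r residue_mod_range[OF T] by auto
      have "\<bar>r - r'\<bar> * \<alpha> < T * \<alpha>" using rr \<alpha> by (intro mult_strict_right_mono) auto
      then have "\<bar>(r - r') * \<alpha>\<bar> < 2 * pi" using \<alpha> by (simp add: T_def abs_mult)
      then have "\<bar>real_of_int m\<bar> < 1" unfolding m by (simp add: abs_mult)
      then have "m = 0" by linarith
      then show "r = r'" using m \<alpha> by simp
    qed
  qed (rule q0)
  show "\<Theta> \<le> 2 * ennreal s"
    unfolding \<Theta>_def by (rule l2_limit_upper[OF lim Cauchy _ q0 \<open>q \<longlonglongrightarrow> s\<close>]) (simp_all add: \<theta>q)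
  show "ennreal s \<le> 2 * \<Theta>"
    unfolding \<Theta>_def by (rule l2_limit_lower[OF lim Cauchy _ q0 \<open>q \<longlonglongrightarrow> s\<close>]) (simp_all add: \<theta>q)
qed

lemma ennreal_le_twice_imp_half:
  assumes "ennreal a \<le> 2 * x" shows "ennreal (a / 2) \<le> x"
proof (cases x)
  case (real r)
  then have "ennreal a \<le> ennreal (2 * r)" using assms by (simp add: ennreal_mult)
  then have "a \<le> 2 * r" using real by (simp add: ennreal_le_iff)
  then show ?thesis using real by (simp add: ennreal_leI)
qed simp

theorem theorem18:
  fixes \<alpha> \<beta> :: real and \<psi> :: "real \<Rightarrow> complex"
  assumes "\<alpha> > 0" and "\<beta> > 0"
    and "\<psi> \<in> wiener_space \<or> (\<psi> \<in> L1_fun \<and> fourier \<psi> \<in> wiener_space)"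
    and "L2_frame (gabor \<psi> \<alpha> \<beta>)"
  shows "\<exists>A>0. \<exists>B>0.
    (\<forall>f\<in>AP2.
       ennreal (A * (AP2_nrm f)\<^sup>2)
         \<le> (\<Sum>\<^sub>\<infinity>l\<in>(UNIV :: int set). \<Sum>\<^sub>\<infinity>\<xi>\<in>{0..<2 * pi / \<alpha>}.
              ennreal ((cmod (AP2_inner f (gabor_AP \<psi> \<alpha> \<beta> \<xi> l)))\<^sup>2)) \<and>
       (\<Sum>\<^sub>\<infinity>l\<in>(UNIV :: int set). \<Sum>\<^sub>\<infinity>\<xi>\<in>{0..<2 * pi / \<alpha>}.
              ennreal ((cmod (AP2_inner f (gabor_AP \<psi> \<alpha> \<beta> \<xi> l)))\<^sup>2))
         \<le> ennreal (B * (AP2_nrm f)\<^sup>2)) \<and>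
    (\<psi> \<in> wiener_space \<longrightarrow> (\<forall>f\<in>S2.
       ennreal (A * (AP2_nrm (AP2_of_S2 f))\<^sup>2)
         \<le> (\<Sum>\<^sub>\<infinity>l\<in>(UNIV :: int set).
              ennreal ((AP_seq_nrm (\<lambda>k. pairing f (gabor \<psi> \<alpha> \<beta> (k, l))))\<^sup>2)) \<and>
       (\<Sum>\<^sub>\<infinity>l\<in>(UNIV :: int set).
              ennreal ((AP_seq_nrm (\<lambda>k. pairing f (gabor \<psi> \<alpha> \<beta> (k, l))))\<^sup>2))
         \<le> ennreal (B * (AP2_nrm (AP2_of_S2 f))\<^sup>2)))"
proof -
  note \<alpha> = assms(1) and \<beta> = assms(2)
  define T where "T = 2 * pi / \<alpha>"
  have \<psi>1: "\<psi> \<in> L1_fun" using assms(3) wiener_space_subset_L1 by blast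
  have cont: "fourier_l2_continuous \<psi> \<beta>"
    using assms(3) fourier_l2_continuous_wiener[OF _ \<beta>] fourier_l2_continuous_fourier_wiener[OF _ _ \<beta>] by blast
  obtain A B where A: "A > 0" and B: "B > 0"
    and lower: "\<And>c X. finsupp c \<Longrightarrow> (\<And>L::int set. finite L \<Longrightarrow>
        (\<Sum>l\<in>L. \<Sum>r\<in>residue_mod T ` {\<mu>. c \<mu> \<noteq> 0}. (cmod (fiber \<psi> \<beta> T c l r 0))\<^sup>2) \<le> X) \<Longrightarrow> A * (\<Sum>\<mu> | c \<mu> \<noteq> 0. (cmod (c \<mu>))\<^sup>2) \<le> X"
    and upper: "\<And>c (L::int set). finsupp c \<Longrightarrow> finite L \<Longrightarrow>
        (\<Sum>l\<in>L. \<Sum>r\<in>residue_mod T ` {\<mu>. c \<mu> \<noteq> 0}. (cmod (fiber \<psi> \<beta> T c l r 0))\<^sup>2) \<le> B * (\<Sum>\<mu> | c \<mu> \<noteq> 0. (cmod (c \<mu>))\<^sup>2)"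
    using frame_bounds_trig_poly[OF \<psi>1 \<alpha> assms(4) cont] unfolding T_def by blast
  define \<Theta> where "\<Theta> = (\<lambda>f. \<Sum>\<^sub>\<infinity>l\<in>(UNIV::int set). \<Sum>\<^sub>\<infinity>\<xi>\<in>{0..<2 * pi / \<alpha>}.
              ennreal ((cmod (AP2_inner f (gabor_AP \<psi> \<alpha> \<beta> \<xi> l)))\<^sup>2))"
  define S where "S = (\<lambda>f. \<Sum>\<^sub>\<infinity>l\<in>(UNIV :: int set). ennreal ((AP_seq_nrm (\<lambda>k. pairing f (gabor \<psi> \<alpha> \<beta> (k, l))))\<^sup>2))"
  have \<Theta>: "ennreal (A / 2 * (AP2_nrm f)\<^sup>2) \<le> \<Theta> f" "\<Theta> f \<le> ennreal (2 * B * (AP2_nrm f)\<^sup>2)" if f: "f \<in> AP2" for f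
  proof -
    note b = AP2_frame_bounds[OF \<alpha> A B lower[unfolded T_def] upper[unfolded T_def] f]
    show "ennreal (A / 2 * (AP2_nrm f)\<^sup>2) \<le> \<Theta> f"
      unfolding \<Theta>_def using ennreal_le_twice_imp_half[OF b(1)] by simp
    show "\<Theta> f \<le> ennreal (2 * B * (AP2_nrm f)\<^sup>2)"
    proof -
      have "2 * ennreal (B * (AP2_nrm f)\<^sup>2) = ennreal (2 * B * (AP2_nrm f)\<^sup>2)"
        using B by (simp add: ennreal_mult mult.assoc)
      with b(2) show ?thesis unfolding \<Theta>_def by (simp only:)
    qed
  qed
  have S: "\<Theta> (AP2_of_S2 f) \<le> 2 * S f" "S f \<le> 2 * \<Theta> (AP2_of_S2 f)" "AP2_of_S2 f \<in> AP2" if f: "f \<in> S2" and \<psi>: "\<psi> \<in> wiener_space" for f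
  proof -
    note b = S2_sequence_norm[OF \<alpha> B upper[unfolded T_def] \<psi> f]
    show "AP2_of_S2 f \<in> AP2" by (rule b(1))
    show "\<Theta> (AP2_of_S2 f) \<le> 2 * S f"
      unfolding \<Theta>_def S_def infsum_cmult_ennreal[symmetric] by (intro infsum_mono_ennreal b(2))
    show "S f \<le> 2 * \<Theta> (AP2_of_S2 f)"
      unfolding \<Theta>_def S_def by (subst infsum_cmult_ennreal[symmetric]) (intro infsum_mono_ennreal b(3))
  qed
  \<comment> \<open>A / 2 and 2 B serve the completion, and the version with sequences loses another
    factor 2; the constants A / 4 and 4 B are valid for both statements.\<close>
  have weaken: "ennreal (A / 4 * x) \<le> ennreal (A / 2 * x)" "ennreal (2 * B * x) \<le> ennreal (4 * B * x)" if "x \<ge> 0" for x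
    using A B that by (auto intro!: ennreal_leI)
  have "ennreal (A / 4 * (AP2_nrm f)\<^sup>2) \<le> \<Theta> f \<and> \<Theta> f \<le> ennreal (4 * B * (AP2_nrm f)\<^sup>2)" if "f \<in> AP2" for f
    using order_trans[OF weaken(1) \<Theta>(1)[OF that]] order_trans[OF \<Theta>(2)[OF that] weaken(2)] by simp
  moreover have "ennreal (A / 4 * (AP2_nrm (AP2_of_S2 f))\<^sup>2) \<le> S f \<and> S f \<le> ennreal (4 * B * (AP2_nrm (AP2_of_S2 f))\<^sup>2)"
    if "\<psi> \<in> wiener_space" "f \<in> S2" for f
  proof
    note b = S[OF that(2,1)]
    have "ennreal (A / 2 * (AP2_nrm (AP2_of_S2 f))\<^sup>2) \<le> 2 * S f" using \<Theta>(1)[OF b(3)] b(1) by (rule order_trans)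
    from ennreal_le_twice_imp_half[OF this]
    show "ennreal (A / 4 * (AP2_nrm (AP2_of_S2 f))\<^sup>2) \<le> S f" by simp
    have "S f \<le> 2 * ennreal (2 * B * (AP2_nrm (AP2_of_S2 f))\<^sup>2)"
      by (rule order_trans[OF b(2) mult_left_mono[OF \<Theta>(2)[OF b(3)]]]) simp
    also have "\<dots> = ennreal (2 * (2 * B * (AP2_nrm (AP2_of_S2 f))\<^sup>2))"
      using B by (subst ennreal_mult) simp_all
    finally show "S f \<le> ennreal (4 * B * (AP2_nrm (AP2_of_S2 f))\<^sup>2)" by (simp add: mult.assoc)
  qed
  moreover have "A / 4 > 0" "4 * B > 0" using A B by simp_all
  ultimately show ?thesis unfolding \<Theta>_def S_def by blast
qed

end
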